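(* Let $N\ge1$ be an integer and $\beta\in\mathbb C$ with $\beta^4=(-1)^N$. Then $Q(N,\beta)$ is a factorisable ribbon quasi-Hopf algebra.
   Context: $Q=Q(N,\beta)$ is the unital associative $\mathbb C$-algebra generated by $K$, $f_i^\pm$ ($1\le i\le N$) with relations $\{f_i^\pm,K\}=0$, $\{f_i^+,f_j^-\}=\delta_{ij}e_1$, $\{f_i^\pm,f_j^\pm\}=0$, $K^4=1$, where $\{x,y\}=xy+yx$, $e_0=\frac12(1+K^2)$, $e_1=\frac12(1-K^2)$. Put $\omega_\pm=(e_0\pm ie_1)K$. Its ribbon quasi-Hopf data are: - $\Delta(K)=K\otimes K-(1+(-1)^N)(e_1\otimes e_1)(K\otimes K)$, $\Delta(f_i^\pm)=f_i^\pm\otimes1+\omega_\pm\otimes f_i^\pm$, $\varepsilon(K)=1$, $\varepsilon(f_i^\pm)=0$; - coassociator $\Phi=1\otimes1\otimes1+e_1\otimes e_1\otimes\{(K^N-1)e_0+(\beta^2(iK)^N-1)e_1\}$ (acting as associator $U\otimes(V\otimes W)\to(U\otimes V)\otimes W$ on modules); - $S(K)=K^{(-1)^N}$, $S(f_k^\pm)=f_k^\pm(e_0\pm(-1)^Nie_1)K$, $\boldsymbol\alpha=1$, $\boldsymbol\beta=e_0+\beta^2(iK)^Ne_1$; - $R=\big(\sum_{n,m\in\{0,1\}}\beta^{nm}\rho_{n,m}\,e_n\otimes e_m\big)\prod_{k=1}^N(1\otimes1-2f_k^-\omega_-\otimes f_k^+)$, $\rho_{n,m}=\frac12\sum_{p,q=0}^1(-1)^{pq}i^{-pn+qm}K^p\otimes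 K^q$; the braiding of modules is the flip composed with the action of $R$; - ribbon element $v=(e_0-\beta iKe_1)\prod_{k=1}^N(1-2f_k^+f_k^-)$; the ribbon twist is the action of $v^{-1}$. A finite-dimensional quasi-triangular quasi-Hopf algebra $A$ is called factorisable if the finite braided tensor category $\mathcal C=\mathrm{Rep}\,A$ of finite-dimensional modules is factorisable. This means that the canonical Hopf pairing on the coend $L=\int^{U\in\mathcal C}U^*\otimes U$ (induced from the double braiding, $\omega_L\circ(\iota_X\otimes\iota_Y)=(\mathrm{ev}_X\otimes\mathrm{ev}_Y)\circ(\mathrm{id}\otimes(c_{Y^*,X}\circ c_{X,Y^*})\otimes\mathrm{id})$ with associators suppressed) is non-degenerate; equivalently (Shimizu), every transparent object $X$ (i.e. $c_{Y,X}\circ c_{X,Y}=\mathrm{id}$ for all $Y$) is isomorphic to a finite direct sum of copies of the tensor unit. *)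

theory Defs
  imports "HOL-Library.Poly_Mapping" "HOL-Library.Cardinality" "Jordan_Normal_Form.Matrix"
begin

section \<open>Complex vector spaces and unital associative complex algebras\<close>

class complex_vector = ab_group_add +
  fixes scaleC :: "complex \<Rightarrow> 'a \<Rightarrow> 'a"  (infixr \<open>*\<^sub>C\<close> 75)
  assumes scaleC_add_right: "c *\<^sub>C (x + y) = c *\<^sub>C x + c *\<^sub>C y"
    and scaleC_add_left: "(c + d) *\<^sub>C x = c *\<^sub>C x + d *\<^sub>C x"
    and scaleC_scaleC: "c *\<^sub>C (d *\<^sub>C x) = (c * d) *\<^sub>C x"
    and scaleC_one: "1 *\<^sub>C x = x"

global_interpretation complex_vector: vector_space "scaleC :: complex \<Rightarrow> 'a \<Rightarrow> 'a::complex_vector"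
  by unfold_locales (simp_all add: scaleC_add_right scaleC_add_left scaleC_scaleC scaleC_one)

text \<open>The zero algebra is admitted, so no \<^class>\<open>ring_1\<close> here.\<close>

class complex_algebra = complex_vector + ring + monoid_mult +
  assumes scaleC_mult_left: "(c *\<^sub>C x) * y = c *\<^sub>C (x * y)"
    and scaleC_mult_right: "x * (c *\<^sub>C y) = c *\<^sub>C (x * y)"

instantiation complex :: complex_algebra
begin
definition scaleC_complex :: "complex \<Rightarrow> complex \<Rightarrow> complex"
  where "scaleC_complex c x = c * x"
instance by standard (simp_all add: scaleC_complex_def algebra_simps)
end

definition linear_C :: "('a::complex_vector \<Rightarrow> 'b::complex_vector) \<Rightarrow> bool" where
  "linear_C f \<longleftrightarrow> (\<forall>x y. f (x + y) = f x + f y) \<and> (\<forall>c x. f (c *\<^sub>C x) = c *\<^sub>C f x)"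

definition algebra_hom :: "('a::complex_algebra \<Rightarrow> 'b::complex_algebra) \<Rightarrow> bool" where
  "algebra_hom f \<longleftrightarrow> linear_C f \<and> f 1 = 1 \<and> (\<forall>x y. f (x * y) = f x * f y)"

definition algebra_antihom :: "('a::complex_algebra \<Rightarrow> 'b::complex_algebra) \<Rightarrow> bool" where
  "algebra_antihom f \<longleftrightarrow> linear_C f \<and> f 1 = 1 \<and> (\<forall>x y. f (x * y) = f y * f x)"

definition finite_dim :: "'a::complex_vector itself \<Rightarrow> bool" where
  "finite_dim _ \<longleftrightarrow> (\<exists>B::'a set. finite B \<and> complex_vector.span B = UNIV)"

definition invertible_el :: "'a::monoid_mult \<Rightarrow> bool" where
  "invertible_el x \<longleftrightarrow> (\<exists>y. x * y = 1 \<and> y * x = 1)"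

definition inverse_el :: "'a::monoid_mult \<Rightarrow> 'a" where
  "inverse_el x = (THE y. x * y = 1 \<and> y * x = 1)"


section \<open>Free vector spaces and monoid algebras\<close>

instantiation poly_mapping :: (type, complex_vector) complex_vector
begin
lift_definition scaleC_poly_mapping :: "complex \<Rightarrow> ('a \<Rightarrow>\<^sub>0 'b) \<Rightarrow> ('a \<Rightarrow>\<^sub>0 'b)"
  is "\<lambda>c p x. c *\<^sub>C p x"
  by (rule finite_subset[rotated], assumption) (auto simp: complex_vector.scale_zero_right)
instance
  by standard (transfer, simp add: scaleC_add_right scaleC_add_left scaleC_scaleC scaleC_one)+
end

lemma lookup_scaleC: "Poly_Mapping.lookup (c *\<^sub>C p) x = c *\<^sub>C Poly_Mapping.lookup p x"
  by transfer simp

lemma poly_mapping_induct [case_names single sum]: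
  assumes single: "\<And>k v. P (Poly_Mapping.single k v)"
    and sum: "\<And>p q. P p \<Longrightarrow> P q \<Longrightarrow> P (p + q)"
  shows "P (p :: 'a \<Rightarrow>\<^sub>0 'b::monoid_add)"
proof (induction p rule: update_induct)
  case const
  show ?case using single[of undefined 0] by simp
next
  case (update p a b)
  have "Poly_Mapping.update a b p = p + Poly_Mapping.single a b"
    using update by (intro poly_mapping_eqI) (auto simp: lookup_update lookup_add lookup_single in_keys_iff)
  then show ?case using sum single update by simp
qed

lemma scaleC_conv_mult_left:
  fixes p :: "'a::monoid_add \<Rightarrow>\<^sub>0 'b::{complex_algebra,ring_1}"
  shows "c *\<^sub>C p = Poly_Mapping.single 0 (c *\<^sub>C 1) * p"
proof (induction p rule: poly_mapping_induct)
  case (single k v)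
  have "c *\<^sub>C Poly_Mapping.single k v = Poly_Mapping.single k (c *\<^sub>C v)"
    by (rule poly_mapping_eqI) (simp add: lookup_scaleC lookup_single when_def)
  then show ?case by (simp add: mult_single scaleC_mult_left)
next
  case (sum p q)
  then show ?case by (simp add: scaleC_add_right distrib_left)
qed

lemma scaleC_conv_mult_right:
  fixes p :: "'a::monoid_add \<Rightarrow>\<^sub>0 'b::{complex_algebra,ring_1}"
  shows "c *\<^sub>C p = p * Poly_Mapping.single 0 (c *\<^sub>C 1)"
proof (induction p rule: poly_mapping_induct)
  case (single k v)
  have "c *\<^sub>C Poly_Mapping.single k v = Poly_Mapping.single k (c *\<^sub>C v)"
    by (rule poly_mapping_eqI) (simp add: lookup_scaleC lookup_single when_def)
  then show ?case by (simp add: mult_single scaleC_mult_right)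
next
  case (sum p q)
  then show ?case by (simp add: scaleC_add_right distrib_right)
qed

instance poly_mapping :: (monoid_add, "{complex_algebra,ring_1}") complex_algebra
proof
  fix c :: complex and x y :: "'a \<Rightarrow>\<^sub>0 'b"
  show "(c *\<^sub>C x) * y = c *\<^sub>C (x * y)"
    by (simp add: scaleC_conv_mult_left mult.assoc)
  show "x * (c *\<^sub>C y) = c *\<^sub>C (x * y)"
    by (simp add: scaleC_conv_mult_right mult.assoc)
qed

definition linear_ext :: "('x \<Rightarrow> 'b::complex_vector) \<Rightarrow> ('x \<Rightarrow>\<^sub>0 complex) \<Rightarrow> 'b" where
  "linear_ext g p = (\<Sum>x\<in>Poly_Mapping.keys p. Poly_Mapping.lookup p x *\<^sub>C g x)"

lemma linear_ext_superset:
  assumes "finite A" "Poly_Mapping.keys p \<subseteq> A"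
  shows "linear_ext g p = (\<Sum>x\<in>A. Poly_Mapping.lookup p x *\<^sub>C g x)"
  unfolding linear_ext_def using assms
  by (intro sum.mono_neutral_left) (auto simp: in_keys_iff complex_vector.scale_zero_left)

lemma linear_ext_add: "linear_ext g (p + q) = linear_ext g p + linear_ext g q"
proof -
  let ?A = "Poly_Mapping.keys p \<union> Poly_Mapping.keys q"
  have "Poly_Mapping.keys (p + q) \<subseteq> ?A" by (rule keys_add)
  then show ?thesis
    by (simp add: linear_ext_superset[of ?A] lookup_add scaleC_add_left sum.distrib)
qed

lemma linear_ext_scaleC: "linear_ext g (c *\<^sub>C p) = c *\<^sub>C linear_ext g p"
proof -
  have "Poly_Mapping.keys (c *\<^sub>C p) \<subseteq> Poly_Mapping.keys p"
    by (auto simp: in_keys_iff lookup_scaleC scaleC_complex_def)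
  then show ?thesis
    by (simp add: linear_ext_superset[of "Poly_Mapping.keys p"] lookup_scaleC scaleC_complex_def
        scaleC_scaleC complex_vector.scale_sum_right)
qed

lemma linear_ext_single [simp]: "linear_ext g (Poly_Mapping.single x c) = c *\<^sub>C g x"
  by (simp add: linear_ext_def complex_vector.scale_zero_left)

lemma linear_ext_diff: "linear_ext g (p - q) = linear_ext g p - linear_ext g q"
  using linear_ext_add[of g "p - q" q] by simp

lemma linear_ext_zero [simp]: "linear_ext g 0 = 0"
  by (simp add: linear_ext_def)


section \<open>Tensor products\<close>

definition bilinear_C :: "('a::complex_vector \<Rightarrow> 'b::complex_vector \<Rightarrow> 'c::complex_vector) \<Rightarrow> bool" where
  "bilinear_C h \<longleftrightarrow> (\<forall>a. linear_C (h a)) \<and> (\<forall>b. linear_C (\<lambda>a. h a b))"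

definition tensor_relators :: "(('a::complex_vector \<times> 'b::complex_vector) \<Rightarrow>\<^sub>0 complex) set" where
  "tensor_relators =
     {Poly_Mapping.single (a + a', b) 1 - Poly_Mapping.single (a, b) 1
        - Poly_Mapping.single (a', b) 1 | a a' b. True} \<union>
     {Poly_Mapping.single (a, b + b') 1 - Poly_Mapping.single (a, b) 1
        - Poly_Mapping.single (a, b') 1 | a b b'. True} \<union>
     {Poly_Mapping.single (c *\<^sub>C a, b) 1 - c *\<^sub>C Poly_Mapping.single (a, b) 1 | c a b. True} \<union>
     {Poly_Mapping.single (a, c *\<^sub>C b) 1 - c *\<^sub>C Poly_Mapping.single (a, b) 1 | c a b. True}"

definition tensor_eq ::
  "(('a::complex_vector \<times> 'b::complex_vector) \<Rightarrow>\<^sub>0 complex) \<Rightarrow> ('a \<times> 'b \<Rightarrow>\<^sub>0 complex) \<Rightarrow> bool" where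
  "tensor_eq p q \<longleftrightarrow> p - q \<in> complex_vector.span tensor_relators"

lemma equivp_span_diff:
  "equivp (\<lambda>p q::'a::complex_vector. p - q \<in> complex_vector.span S)"
proof (intro equivpI reflpI sympI transpI)
  fix p q r :: 'a
  show "p - p \<in> complex_vector.span S" by (simp add: complex_vector.span_zero)
  show "q - p \<in> complex_vector.span S" if "p - q \<in> complex_vector.span S"
    using complex_vector.span_neg[OF that] by simp
  show "p - r \<in> complex_vector.span S"
    if "p - q \<in> complex_vector.span S" "q - r \<in> complex_vector.span S"
    using complex_vector.span_add[OF that] by simp
qed

quotient_type (overloaded) ('a, 'b) tensor (infixr \<open>\<otimes>\<^sub>C\<close> 71) =
  "('a::complex_vector \<times> 'b::complex_vector) \<Rightarrow>\<^sub>0 complex" / tensor_eq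
  unfolding tensor_eq_def[abs_def] by (rule equivp_span_diff)

lemma span_diff_add:
  assumes "p - p' \<in> complex_vector.span S" "q - q' \<in> complex_vector.span S"
  shows "(p + q) - (p' + q') \<in> complex_vector.span (S :: 'a::complex_vector set)"
  using complex_vector.span_add[OF assms] by (simp add: algebra_simps)

lemma span_diff_diff:
  assumes "p - p' \<in> complex_vector.span S" "q - q' \<in> complex_vector.span S"
  shows "(p - q) - (p' - q') \<in> complex_vector.span (S :: 'a::complex_vector set)"
  using complex_vector.span_diff[OF assms] by (simp add: algebra_simps)

lemma span_diff_neg:
  assumes "p - p' \<in> complex_vector.span S"
  shows "- p - - p' \<in> complex_vector.span (S :: 'a::complex_vector set)"
  using complex_vector.span_neg[OF assms] by (simp add: algebra_simps)

lemma span_diff_scale: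
  assumes "p - p' \<in> complex_vector.span S"
  shows "c *\<^sub>C p - c *\<^sub>C p' \<in> complex_vector.span (S :: 'a::complex_vector set)"
  using complex_vector.span_scale[OF assms, of c] by (simp add: complex_vector.scale_right_diff_distrib)

instantiation tensor :: (complex_vector, complex_vector) complex_vector
begin
lift_definition zero_tensor :: "'a \<otimes>\<^sub>C 'b" is 0 .
lift_definition plus_tensor :: "'a \<otimes>\<^sub>C 'b \<Rightarrow> 'a \<otimes>\<^sub>C 'b \<Rightarrow> 'a \<otimes>\<^sub>C 'b" is "(+)"
  unfolding tensor_eq_def by (rule span_diff_add)
lift_definition minus_tensor :: "'a \<otimes>\<^sub>C 'b \<Rightarrow> 'a \<otimes>\<^sub>C 'b \<Rightarrow> 'a \<otimes>\<^sub>C 'b" is "(-)"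
  unfolding tensor_eq_def by (rule span_diff_diff)
lift_definition uminus_tensor :: "'a \<otimes>\<^sub>C 'b \<Rightarrow> 'a \<otimes>\<^sub>C 'b" is "uminus"
  unfolding tensor_eq_def by (rule span_diff_neg)
lift_definition scaleC_tensor :: "complex \<Rightarrow> 'a \<otimes>\<^sub>C 'b \<Rightarrow> 'a \<otimes>\<^sub>C 'b" is scaleC
  unfolding tensor_eq_def by (rule span_diff_scale)
instance
  by standard (transfer, simp add: tensor_eq_def complex_vector.span_zero algebra_simps
      scaleC_add_right scaleC_add_left scaleC_scaleC scaleC_one)+
end

lift_definition tens :: "'a::complex_vector \<Rightarrow> 'b::complex_vector \<Rightarrow> 'a \<otimes>\<^sub>C 'b" (infixr \<open>\<otimes>\<^sub>C\<close> 71)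
  is "\<lambda>a b. Poly_Mapping.single (a, b) 1" .

text \<open>
  The linear map on a tensor product induced by a bilinear map \<open>h\<close>; it does not depend on the
  representative chosen by \<^term>\<open>rep_tensor\<close> (lemmas \<open>tlift_tens\<close> and \<open>linear_C_tlift\<close> below).
\<close>

definition tlift :: "('a::complex_vector \<Rightarrow> 'b::complex_vector \<Rightarrow> 'c::complex_vector) \<Rightarrow> 'a \<otimes>\<^sub>C 'b \<Rightarrow> 'c" where
  "tlift h t = linear_ext (\<lambda>(a, b). h a b) (rep_tensor t)"

lemma linear_ext_relators:
  assumes h: "bilinear_C h" and p: "p \<in> complex_vector.span tensor_relators"
  shows "linear_ext (\<lambda>(a, b). h a b) p = 0"
  using p
proof (induction p rule: complex_vector.span_induct_alt)
  case base
  show ?case by simp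
next
  case (step c x y)
  have "linear_ext (\<lambda>(a, b). h a b) x = 0"
    using step(1) h unfolding tensor_relators_def bilinear_C_def linear_C_def
    by (auto simp: linear_ext_diff linear_ext_scaleC scaleC_one)
  then show ?case
    using step(2) by (simp add: linear_ext_add linear_ext_scaleC complex_vector.scale_zero_right)
qed

lemma tlift_abs:
  assumes "bilinear_C h"
  shows "tlift h (abs_tensor p) = linear_ext (\<lambda>(a, b). h a b) p"
proof -
  have "tensor_eq (rep_tensor (abs_tensor p)) p"
    by (rule Quotient3_rep_abs[OF Quotient3_tensor])
       (simp add: tensor_eq_def complex_vector.span_zero)
  then have "linear_ext (\<lambda>(a, b). h a b) (rep_tensor (abs_tensor p) - p) = 0"
    unfolding tensor_eq_def by (rule linear_ext_relators[OF assms])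
  then show ?thesis by (simp add: tlift_def linear_ext_diff)
qed

lemma tlift_tens:
  assumes "bilinear_C h"
  shows "tlift h (a \<otimes>\<^sub>C b) = h a b"
  using tlift_abs[OF assms] by (simp add: tens.abs_eq scaleC_one)

lemma tlift_add:
  assumes "bilinear_C h"
  shows "tlift h (x + y) = tlift h x + tlift h y"
  by (induct x, induct y) (simp add: plus_tensor.abs_eq tlift_abs[OF assms] linear_ext_add)

lemma tlift_scaleC:
  assumes "bilinear_C h"
  shows "tlift h (c *\<^sub>C x) = c *\<^sub>C tlift h x"
  by (induct x) (simp add: scaleC_tensor.abs_eq tlift_abs[OF assms] linear_ext_scaleC)

lemma linear_C_tlift: "bilinear_C h \<Longrightarrow> linear_C (tlift h)"
  by (simp add: linear_C_def tlift_add tlift_scaleC)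

lemma tens_add_left: "(a + a') \<otimes>\<^sub>C b = a \<otimes>\<^sub>C b + a' \<otimes>\<^sub>C b"
  by transfer (simp only: tensor_eq_def diff_diff_eq[symmetric],
      rule complex_vector.span_base, unfold tensor_relators_def, blast)

lemma tens_add_right: "a \<otimes>\<^sub>C (b + b') = a \<otimes>\<^sub>C b + a \<otimes>\<^sub>C b'"
  by transfer (simp only: tensor_eq_def diff_diff_eq[symmetric],
      rule complex_vector.span_base, unfold tensor_relators_def, blast)

lemma tens_scaleC_left: "(c *\<^sub>C a) \<otimes>\<^sub>C b = c *\<^sub>C (a \<otimes>\<^sub>C b)"
  by transfer (simp only: tensor_eq_def,
      rule complex_vector.span_base, unfold tensor_relators_def, blast)

lemma tens_scaleC_right: "a \<otimes>\<^sub>C (c *\<^sub>C b) = c *\<^sub>C (a \<otimes>\<^sub>C b)"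
  by transfer (simp only: tensor_eq_def,
      rule complex_vector.span_base, unfold tensor_relators_def, blast)

lemma bilinear_C_tens: "bilinear_C (\<otimes>\<^sub>C)"
  by (simp add: bilinear_C_def linear_C_def tens_add_left tens_add_right
      tens_scaleC_left tens_scaleC_right)

lemma tensor_induct [case_names tens add]:
  assumes "\<And>a b. P (a \<otimes>\<^sub>C b)" and add: "\<And>x y. P x \<Longrightarrow> P y \<Longrightarrow> P (x + y)"
  shows "P t"
proof (induct t rule: tensor.abs_induct)
  fix p :: "'a \<times> 'b \<Rightarrow>\<^sub>0 complex"
  show "P (abs_tensor p)"
  proof (induction p rule: poly_mapping_induct)
    case (single k v)
    obtain a b where k: "k = (a, b)" by force
    have "Poly_Mapping.single (a, b) v = v *\<^sub>C Poly_Mapping.single (a, b) 1"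
      by (rule poly_mapping_eqI) (simp add: lookup_scaleC lookup_single when_def scaleC_complex_def)
    then have "abs_tensor (Poly_Mapping.single k v) = v *\<^sub>C (a \<otimes>\<^sub>C b)"
      by (simp only: k tens.abs_eq scaleC_tensor.abs_eq)
    then have "abs_tensor (Poly_Mapping.single k v) = (v *\<^sub>C a) \<otimes>\<^sub>C b"
      by (simp only: tens_scaleC_left)
    then show ?case using assms(1) by simp
  next
    case (sum p q)
    then show ?case using add by (metis plus_tensor.abs_eq)
  qed
qed

lemma linear_C_compose_bilinear:
  "bilinear_C h \<Longrightarrow> linear_C f \<Longrightarrow> linear_C g \<Longrightarrow> bilinear_C (\<lambda>a b. h (f a) (g b))"
  by (simp add: bilinear_C_def linear_C_def)

lemma bilinear_tensor_mult_inner: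
  "bilinear_C (\<lambda>(c::'a::complex_algebra) (d::'b::complex_algebra). (a * c) \<otimes>\<^sub>C (b * d))"
  by (rule linear_C_compose_bilinear[OF bilinear_C_tens])
     (simp_all add: linear_C_def distrib_left scaleC_mult_right)

lemma bilinear_tensor_mult_outer:
  "bilinear_C (\<lambda>(a::'a::complex_algebra) (b::'b::complex_algebra).
     tlift (\<lambda>c d. (a * c) \<otimes>\<^sub>C (b * d)) u)"
proof (induction u rule: tensor_induct)
  case (tens c d)
  show ?case
    unfolding tlift_tens[OF bilinear_tensor_mult_inner]
    by (rule linear_C_compose_bilinear[OF bilinear_C_tens])
       (simp_all add: linear_C_def distrib_right scaleC_mult_left)
next
  case (add x y)
  then show ?case
    by (simp add: tlift_add[OF bilinear_tensor_mult_inner] bilinear_C_def linear_C_def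
        scaleC_add_right)
qed

instantiation tensor :: (complex_algebra, complex_algebra) complex_algebra
begin

definition one_tensor :: "'a \<otimes>\<^sub>C 'b" where
  "one_tensor = 1 \<otimes>\<^sub>C 1"

definition times_tensor :: "'a \<otimes>\<^sub>C 'b \<Rightarrow> 'a \<otimes>\<^sub>C 'b \<Rightarrow> 'a \<otimes>\<^sub>C 'b" where
  "times_tensor t u = tlift (\<lambda>a b. tlift (\<lambda>c d. (a * c) \<otimes>\<^sub>C (b * d)) u) t"

lemma times_tens: "(a \<otimes>\<^sub>C b) * u = tlift (\<lambda>c d. (a * c) \<otimes>\<^sub>C ((b::'b) * d)) u" for a :: 'a
  unfolding times_tensor_def by (rule tlift_tens[OF bilinear_tensor_mult_outer])

lemma tens_mult: "(a \<otimes>\<^sub>C b) * (c \<otimes>\<^sub>C d) = (a * c) \<otimes>\<^sub>C ((b::'b) * d)" for a c :: 'a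
  by (simp only: times_tens tlift_tens[OF bilinear_tensor_mult_inner])

lemma tensor_mult_add_left: "(x + y) * z = x * z + y * (z :: 'a \<otimes>\<^sub>C 'b)"
  by (simp add: times_tensor_def tlift_add bilinear_tensor_mult_outer)

lemma tensor_mult_add_right: "z * (x + y) = z * x + z * (y :: 'a \<otimes>\<^sub>C 'b)"
proof (induction z rule: tensor_induct)
  case (tens a b)
  show ?case
    by (simp only: times_tens tlift_add[OF bilinear_tensor_mult_inner])
next
  case (add z w)
  then show ?case by (simp add: tensor_mult_add_left)
qed

instance
proof
  fix x y z :: "'a \<otimes>\<^sub>C 'b" and c :: complex
  show "(x + y) * z = x * z + y * z" by (rule tensor_mult_add_left)
  show "z * (x + y) = z * x + z * y" for z by (rule tensor_mult_add_right)
  show "(x * y) * z = x * (y * z)"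
  proof (induction x rule: tensor_induct)
    case (tens a b)
    show ?case
    proof (induction y rule: tensor_induct)
      case (tens c d)
      show ?case
        by (induction z rule: tensor_induct) (simp_all add: tens_mult mult.assoc tensor_mult_add_right)
    qed (simp add: tensor_mult_add_left tensor_mult_add_right)
  qed (simp add: tensor_mult_add_left)
  show "1 * x = x"
    by (induction x rule: tensor_induct) (simp_all add: one_tensor_def tens_mult tensor_mult_add_right)
  show "x * 1 = x"
    by (induction x rule: tensor_induct) (simp_all add: one_tensor_def tens_mult tensor_mult_add_left)
  show "(c *\<^sub>C x) * y = c *\<^sub>C (x * y)"
    by (simp add: times_tensor_def tlift_scaleC bilinear_tensor_mult_outer)
  show "x * (c *\<^sub>C y) = c *\<^sub>C (x * y)"
  proof (induction x rule: tensor_induct)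
    case (tens a b)
    show ?case
      by (simp only: times_tens tlift_scaleC[OF bilinear_tensor_mult_inner])
  qed (simp add: tensor_mult_add_left scaleC_add_right)
qed

end

definition tmap :: "('a::complex_vector \<Rightarrow> 'c::complex_vector) \<Rightarrow> ('b::complex_vector \<Rightarrow> 'd::complex_vector)
    \<Rightarrow> 'a \<otimes>\<^sub>C 'b \<Rightarrow> 'c \<otimes>\<^sub>C 'd" where
  "tmap f g = tlift (\<lambda>a b. f a \<otimes>\<^sub>C g b)"

definition tflip :: "'a::complex_vector \<otimes>\<^sub>C 'b::complex_vector \<Rightarrow> 'b \<otimes>\<^sub>C 'a" where
  "tflip = tlift (\<lambda>a b. b \<otimes>\<^sub>C a)"

definition tassoc :: "('a::complex_vector \<otimes>\<^sub>C 'b::complex_vector) \<otimes>\<^sub>C 'c::complex_vector \<Rightarrow> 'a \<otimes>\<^sub>C 'b \<otimes>\<^sub>C 'c" where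
  "tassoc = tlift (\<lambda>x c. tlift (\<lambda>a b. a \<otimes>\<^sub>C b \<otimes>\<^sub>C c) x)"

definition tlift3 :: "('a::complex_vector \<Rightarrow> 'b::complex_vector \<Rightarrow> 'c::complex_vector \<Rightarrow> 'd::complex_vector)
    \<Rightarrow> 'a \<otimes>\<^sub>C 'b \<otimes>\<^sub>C 'c \<Rightarrow> 'd" where
  "tlift3 h = tlift (\<lambda>a. tlift (h a))"


section \<open>Quasi-Hopf algebras\<close>

record (overloaded) 'a quasi_hopf =
  comult :: "'a \<Rightarrow> ('a, 'a) tensor"
  counit :: "'a \<Rightarrow> complex"
  coassoc :: "('a, ('a, 'a) tensor) tensor"
  antipode :: "'a \<Rightarrow> 'a"
  alpha_el :: 'a
  beta_el :: 'a

record (overloaded) 'a quasi_triangular_quasi_hopf = "'a quasi_hopf" +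
  R_matrix :: "('a, 'a) tensor"

record (overloaded) 'a ribbon_quasi_hopf = "'a quasi_triangular_quasi_hopf" +
  ribbon_el :: 'a

text \<open>
  All elements of threefold and fourfold tensor powers are written in right-nested form, using
  \<^const>\<open>tassoc\<close>. The coassociator acts as associator
  \<open>U \<otimes> (V \<otimes> W) \<rightarrow> (U \<otimes> V) \<otimes> W\<close>; this is the inverse of Drinfeld's convention and fixes
  on which side the coassociator and its inverse appear in the axioms below.
\<close>

locale quasi_hopf_algebra =
  fixes H :: "('a::complex_algebra, 'z) quasi_hopf_scheme"
  assumes comult_hom: "algebra_hom (comult H)"
    and counit_hom: "algebra_hom (counit H)"
    and counit_left: "tlift (\<lambda>x y. counit H x *\<^sub>C y) (comult H a) = a"
    and counit_right: "tlift (\<lambda>x y. counit H y *\<^sub>C x) (comult H a) = a"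
    and coassoc_invertible: "invertible_el (coassoc H)"
    and quasi_coassociative:
      "coassoc H * tmap id (comult H) (comult H a) = tassoc (tmap (comult H) id (comult H a)) * coassoc H"
    and pentagon:
      "tassoc (tmap (comult H) id (coassoc H)) * tmap id (tmap id (comult H)) (coassoc H)
       = tmap id tassoc (tassoc (coassoc H \<otimes>\<^sub>C 1))
         * tmap id (\<lambda>x. tassoc (tmap (comult H) id x)) (coassoc H)
         * (1 \<otimes>\<^sub>C coassoc H)"
    and coassoc_counit: "tlift3 (\<lambda>x y z. counit H y *\<^sub>C (x \<otimes>\<^sub>C z)) (coassoc H) = 1"
    and antipode_antihom: "algebra_antihom (antipode H)"
    and antipode_bij: "bij (antipode H)"
    and antipode_alpha:
      "tlift (\<lambda>x y. antipode H x * alpha_el H * y) (comult H a) = counit H a *\<^sub>C alpha_el H"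
    and antipode_beta:
      "tlift (\<lambda>x y. x * beta_el H * antipode H y) (comult H a) = counit H a *\<^sub>C beta_el H"
    and antipode_coassoc:
      "tlift3 (\<lambda>x y z. antipode H x * alpha_el H * y * beta_el H * antipode H z) (coassoc H) = 1"
    and antipode_coassoc_inverse:
      "tlift3 (\<lambda>x y z. x * beta_el H * antipode H y * alpha_el H * z) (inverse_el (coassoc H)) = 1"

text \<open>
  The braiding is \<open>c = flip \<circ> R\<close>. The last two axioms are the two hexagons; a permuted
  coassociator such as \<open>\<lambda>x y z. z \<otimes> x \<otimes> y\<close> is the associator of the
  correspondingly permuted modules, transported back to \<open>U \<otimes> V \<otimes> W\<close>.
\<close>

locale quasi_triangular_quasi_hopf_algebra = quasi_hopf_algebra H
  for H :: "('a::complex_algebra, 'z) quasi_triangular_quasi_hopf_scheme" +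
  assumes R_invertible: "invertible_el (R_matrix H)"
    and R_comult: "R_matrix H * comult H a = tflip (comult H a) * R_matrix H"
    and hexagon_right:
      "tmap id (comult H) (R_matrix H)
       = tlift3 (\<lambda>x y z. z \<otimes>\<^sub>C x \<otimes>\<^sub>C y) (coassoc H)
         * tlift (\<lambda>x y. x \<otimes>\<^sub>C 1 \<otimes>\<^sub>C y) (R_matrix H)
         * tlift3 (\<lambda>x y z. y \<otimes>\<^sub>C x \<otimes>\<^sub>C z) (inverse_el (coassoc H))
         * tassoc (R_matrix H \<otimes>\<^sub>C 1)
         * coassoc H"
    and hexagon_left:
      "tassoc (tmap (comult H) id (R_matrix H))
       = tlift3 (\<lambda>x y z. y \<otimes>\<^sub>C z \<otimes>\<^sub>C x) (inverse_el (coassoc H))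
         * tlift (\<lambda>x y. x \<otimes>\<^sub>C 1 \<otimes>\<^sub>C y) (R_matrix H)
         * tlift3 (\<lambda>x y z. x \<otimes>\<^sub>C z \<otimes>\<^sub>C y) (coassoc H)
         * (1 \<otimes>\<^sub>C R_matrix H)
         * inverse_el (coassoc H)"

text \<open>The ribbon twist is the action of the inverse of the ribbon element.\<close>

locale ribbon_quasi_hopf_algebra = quasi_triangular_quasi_hopf_algebra H
  for H :: "('a::complex_algebra, 'z) ribbon_quasi_hopf_scheme" +
  assumes ribbon_central: "ribbon_el H * a = a * ribbon_el H"
    and ribbon_invertible: "invertible_el (ribbon_el H)"
    and ribbon_comult:
      "tflip (R_matrix H) * R_matrix H * comult H (ribbon_el H) = ribbon_el H \<otimes>\<^sub>C ribbon_el H"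
    and ribbon_antipode: "antipode H (ribbon_el H) = ribbon_el H"


section \<open>The category of finite-dimensional modules\<close>

text \<open>
  A finite-dimensional module is taken to be \<open>\<complex>\<^sup>n\<close> with a matrix representation, and
  morphisms are intertwining matrices acting on column vectors. Up to isomorphism
  every finite-dimensional module is of this form. Tensor products of vector spaces are
  identified with \<open>\<complex>\<^sup>n\<^sup>m\<close> by the lexicographically ordered product basis, so that the
  identification \<open>(U \<otimes> V) \<otimes> W = U \<otimes> (V \<otimes> W)\<close> of underlying spaces is strict.
\<close>

datatype 'a matrep = MatRep (rdim: nat) (act: "'a \<Rightarrow> complex mat")

definition is_module :: "'a::complex_algebra matrep \<Rightarrow> bool" where
  "is_module X \<longleftrightarrow>
     (\<forall>a. act X a \<in> carrier_mat (rdim X) (rdim X)) \<and>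
     (\<forall>a b. act X (a + b) = act X a + act X b) \<and>
     (\<forall>c a. act X (c *\<^sub>C a) = c \<cdot>\<^sub>m act X a) \<and>
     act X 1 = 1\<^sub>m (rdim X) \<and>
     (\<forall>a b. act X (a * b) = act X a * act X b)"

definition is_hom :: "'a matrep \<Rightarrow> 'a matrep \<Rightarrow> complex mat \<Rightarrow> bool" where
  "is_hom X Y f \<longleftrightarrow>
     f \<in> carrier_mat (rdim Y) (rdim X) \<and> (\<forall>a. f * act X a = act Y a * f)"

definition is_iso :: "'a matrep \<Rightarrow> 'a matrep \<Rightarrow> complex mat \<Rightarrow> bool" where
  "is_iso X Y f \<longleftrightarrow> is_hom X Y f \<and>
     (\<exists>g. is_hom Y X g \<and> g * f = 1\<^sub>m (rdim X) \<and> f * g = 1\<^sub>m (rdim Y))"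

definition kron :: "complex mat \<Rightarrow> complex mat \<Rightarrow> complex mat" where
  "kron A B = mat (dim_row A * dim_row B) (dim_col A * dim_col B)
     (\<lambda>(i, j). A $$ (i div dim_row B, j div dim_col B) * B $$ (i mod dim_row B, j mod dim_col B))"

text \<open>The action of \<open>A \<otimes> B\<close> on \<open>X \<otimes> Y\<close>, determined by \<open>a \<otimes> b \<mapsto> kron (act X a) (act Y b)\<close>.\<close>

definition ext_tensor :: "'a::complex_vector matrep \<Rightarrow> 'b::complex_vector matrep \<Rightarrow> ('a \<otimes>\<^sub>C 'b) matrep" where
  "ext_tensor X Y = MatRep (rdim X * rdim Y)
     (\<lambda>t. mat (rdim X * rdim Y) (rdim X * rdim Y)
        (\<lambda>ij. tlift (\<lambda>a b. kron (act X a) (act Y b) $$ ij) t))"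

definition flip_mat :: "nat \<Rightarrow> nat \<Rightarrow> complex mat" where
  "flip_mat n m = mat (m * n) (n * m)
     (\<lambda>(i, j). if i = (j mod m) * n + j div m then 1 else 0)"

definition unit_mod :: "('a::complex_algebra, 'z) quasi_hopf_scheme \<Rightarrow> 'a matrep" where
  "unit_mod H = MatRep 1 (\<lambda>a. mat 1 1 (\<lambda>_. counit H a))"

definition tensor_mod ::
  "('a::complex_algebra, 'z) quasi_hopf_scheme \<Rightarrow> 'a matrep \<Rightarrow> 'a matrep \<Rightarrow> 'a matrep" where
  "tensor_mod H X Y = MatRep (rdim X * rdim Y) (\<lambda>a. act (ext_tensor X Y) (comult H a))"

text \<open>
  The dual module carries the dual basis; correspondingly the dual of a morphism \<open>f\<close> is its
  transpose.
\<close>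

definition dual_mod :: "('a::complex_algebra, 'z) quasi_hopf_scheme \<Rightarrow> 'a matrep \<Rightarrow> 'a matrep" where
  "dual_mod H X = MatRep (rdim X) (\<lambda>a. transpose_mat (act X (antipode H a)))"

text \<open>\<open>\<phi> \<otimes> x \<mapsto> \<phi>(\<alpha> x)\<close>, as a morphism \<open>X\<^sup>* \<otimes> X \<rightarrow> 1\<close>.\<close>

definition ev_mod :: "('a::complex_algebra, 'z) quasi_hopf_scheme \<Rightarrow> 'a matrep \<Rightarrow> complex mat" where
  "ev_mod H X = mat 1 (rdim X * rdim X)
     (\<lambda>(_, k). act X (alpha_el H) $$ (k div rdim X, k mod rdim X))"

definition assoc_mod ::
  "('a::complex_algebra, 'z) quasi_hopf_scheme \<Rightarrow> 'a matrep \<Rightarrow> 'a matrep \<Rightarrow> 'a matrep \<Rightarrow> complex mat" where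
  "assoc_mod H X Y Z = act (ext_tensor X (ext_tensor Y Z)) (coassoc H)"

definition assoc_inv_mod ::
  "('a::complex_algebra, 'z) quasi_hopf_scheme \<Rightarrow> 'a matrep \<Rightarrow> 'a matrep \<Rightarrow> 'a matrep \<Rightarrow> complex mat" where
  "assoc_inv_mod H X Y Z = act (ext_tensor X (ext_tensor Y Z)) (inverse_el (coassoc H))"

definition braiding_mod ::
  "('a::complex_algebra, 'z) quasi_triangular_quasi_hopf_scheme \<Rightarrow> 'a matrep \<Rightarrow> 'a matrep \<Rightarrow> complex mat" where
  "braiding_mod H X Y = flip_mat (rdim X) (rdim Y) * act (ext_tensor X Y) (R_matrix H)"


section \<open>The coend, its Hopf pairing, and factorisability\<close>

definition dinatural_to ::
  "('a::complex_algebra, 'z) quasi_hopf_scheme \<Rightarrow> 'a matrep \<Rightarrow> ('a matrep \<Rightarrow> complex mat) \<Rightarrow> bool" where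
  "dinatural_to H Z j \<longleftrightarrow>
     (\<forall>X. is_module X \<longrightarrow> is_hom (tensor_mod H (dual_mod H X) X) Z (j X)) \<and>
     (\<forall>X Y f. is_module X \<and> is_module Y \<and> is_hom X Y f \<longrightarrow>
        j Y * kron (1\<^sub>m (rdim Y)) f = j X * kron (transpose_mat f) (1\<^sub>m (rdim X)))"

text \<open>\<open>(L, \<iota>)\<close> is a coend of \<open>(U, V) \<mapsto> U\<^sup>* \<otimes> V\<close>.\<close>

definition is_coend ::
  "('a::complex_algebra, 'z) quasi_hopf_scheme \<Rightarrow> 'a matrep \<Rightarrow> ('a matrep \<Rightarrow> complex mat) \<Rightarrow> bool" where
  "is_coend H L \<iota> \<longleftrightarrow> is_module L \<and> dinatural_to H L \<iota> \<and>
     (\<forall>Z j. is_module Z \<and> dinatural_to H Z j \<longrightarrow>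
        (\<exists>!u. is_hom L Z u \<and> (\<forall>X. is_module X \<longrightarrow> u * \<iota> X = j X)))"

text \<open>
  \<open>(X\<^sup>* \<otimes> X) \<otimes> (Y\<^sup>* \<otimes> Y) \<rightarrow> X\<^sup>* \<otimes> (X \<otimes> (Y\<^sup>* \<otimes> Y)) \<rightarrow> X\<^sup>* \<otimes> ((X \<otimes> Y\<^sup>*) \<otimes> Y)\<close>,
  then the double braiding of \<open>X\<close> and \<open>Y\<^sup>*\<close>, then back to
  \<open>(X\<^sup>* \<otimes> X) \<otimes> (Y\<^sup>* \<otimes> Y)\<close> and evaluation.
\<close>

definition double_braiding_pairing ::
  "('a::complex_algebra, 'z) quasi_triangular_quasi_hopf_scheme \<Rightarrow> 'a matrep \<Rightarrow> 'a matrep \<Rightarrow> complex mat" where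
  "double_braiding_pairing H X Y =
     (let Xd = dual_mod H X; Yd = dual_mod H Y; YY = tensor_mod H Yd Y;
          idX = 1\<^sub>m (rdim X); idY = 1\<^sub>m (rdim Y)
      in kron (ev_mod H X) (ev_mod H Y)
         * assoc_mod H Xd X YY
         * kron idX (assoc_inv_mod H X Yd Y)
         * kron idX (kron (braiding_mod H Yd X * braiding_mod H X Yd) idY)
         * kron idX (assoc_mod H X Yd Y)
         * assoc_inv_mod H Xd X YY)"

definition is_hopf_pairing ::
  "('a::complex_algebra, 'z) quasi_triangular_quasi_hopf_scheme \<Rightarrow> 'a matrep \<Rightarrow>
   ('a matrep \<Rightarrow> complex mat) \<Rightarrow> complex mat \<Rightarrow> bool" where
  "is_hopf_pairing H L \<iota> \<omega> \<longleftrightarrow>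
     is_hom (tensor_mod H L L) (unit_mod H) \<omega> \<and>
     (\<forall>X Y. is_module X \<and> is_module Y \<longrightarrow>
        \<omega> * kron (\<iota> X) (\<iota> Y) = double_braiding_pairing H X Y)"

text \<open>A pairing \<open>L \<otimes> L \<rightarrow> 1\<close> is non-degenerate if the induced morphism \<open>L \<rightarrow> L\<^sup>*\<close> is invertible.\<close>

definition nondegenerate_pairing ::
  "('a::complex_algebra, 'z) quasi_hopf_scheme \<Rightarrow> 'a matrep \<Rightarrow> complex mat \<Rightarrow> bool" where
  "nondegenerate_pairing H L \<omega> \<longleftrightarrow>
     (\<exists>f. is_iso L (dual_mod H L) f \<and> \<omega> = ev_mod H L * kron f (1\<^sub>m (rdim L)))"

text \<open>
  The coend is unique up to unique isomorphism, and it determines \<open>\<omega>\<close>, so the existential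
  quantifier speaks about the coend and its Hopf pairing.
\<close>

definition factorisable :: "('a::complex_algebra, 'z) quasi_triangular_quasi_hopf_scheme \<Rightarrow> bool" where
  "factorisable H \<longleftrightarrow>
     quasi_triangular_quasi_hopf_algebra H \<and> finite_dim TYPE('a) \<and>
     (\<exists>L \<iota> \<omega>. is_coend H L \<iota> \<and> is_hopf_pairing H L \<iota> \<omega> \<and> nondegenerate_pairing H L \<omega>)"


section \<open>The algebra \<open>Q\<close> by generators and relations\<close>

datatype 'n letter = Letter_K | Letter_fp 'n | Letter_fm 'n

datatype 'n word = Word (letters: "'n letter list")

text \<open>
  Words form the free monoid, written additively so that the monoid algebra
  \<^typ>\<open>'n word \<Rightarrow>\<^sub>0 complex\<close> (with the convolution product) is the free algebra.
\<close>

instantiation word :: (type) monoid_add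
begin
definition zero_word :: "'a word" where "zero_word = Word []"
definition plus_word :: "'a word \<Rightarrow> 'a word \<Rightarrow> 'a word"
  where "plus_word u w = Word (letters u @ letters w)"
instance by standard (simp_all add: zero_word_def plus_word_def)
end

definition e0_of :: "'a::complex_algebra \<Rightarrow> 'a" where
  "e0_of K = (1/2) *\<^sub>C (1 + K^2)"

definition e1_of :: "'a::complex_algebra \<Rightarrow> 'a" where
  "e1_of K = (1/2) *\<^sub>C (1 - K^2)"

definition gen :: "'n letter \<Rightarrow> 'n word \<Rightarrow>\<^sub>0 complex" where
  "gen x = Poly_Mapping.single (Word [x]) 1"

definition anticomm :: "'a::ring \<Rightarrow> 'a \<Rightarrow> 'a" where
  "anticomm x y = x * y + y * x"

text \<open>The elements which are set to zero in \<open>Q\<close>.\<close>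

definition Q_relators :: "('n word \<Rightarrow>\<^sub>0 complex) set" where
  "Q_relators =
     {anticomm (gen (Letter_fp i)) (gen Letter_K) | i. True} \<union>
     {anticomm (gen (Letter_fm i)) (gen Letter_K) | i. True} \<union>
     {anticomm (gen (Letter_fp i)) (gen (Letter_fm j))
        - (if i = j then e1_of (gen Letter_K) else 0) | i j. True} \<union>
     {anticomm (gen (Letter_fp i)) (gen (Letter_fp j)) | i j. True} \<union>
     {anticomm (gen (Letter_fm i)) (gen (Letter_fm j)) | i j. True} \<union>
     {gen Letter_K ^ 4 - 1}"

definition two_sided_ideal :: "'a::complex_algebra set \<Rightarrow> 'a set" where
  "two_sided_ideal S = complex_vector.span {x * s * y | x s y. s \<in> S}"

lemma two_sided_ideal_mult_left: "p \<in> two_sided_ideal S \<Longrightarrow> x * p \<in> two_sided_ideal S"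
  unfolding two_sided_ideal_def
proof (induction p rule: complex_vector.span_induct_alt)
  case base
  show ?case by (simp add: complex_vector.span_zero)
next
  case (step c z y)
  then obtain a s b where z: "z = a * s * b" "s \<in> S" by blast
  have "x * z = (x * a) * s * b" by (simp add: z(1) mult.assoc)
  then have "x * z \<in> complex_vector.span {x * s * y | x s y. s \<in> S}"
    using z(2) by (blast intro: complex_vector.span_base)
  then show ?case
    using step(2) by (simp add: distrib_left scaleC_mult_right complex_vector.span_add complex_vector.span_scale)
qed

lemma two_sided_ideal_mult_right: "p \<in> two_sided_ideal S \<Longrightarrow> p * x \<in> two_sided_ideal S"
  unfolding two_sided_ideal_def
proof (induction p rule: complex_vector.span_induct_alt)
  case base
  show ?case by (simp add: complex_vector.span_zero)
next
  case (step c z y)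
  then obtain a s b where z: "z = a * s * b" "s \<in> S" by blast
  have "z * x = a * s * (b * x)" by (simp add: z(1) mult.assoc)
  then have "z * x \<in> complex_vector.span {x * s * y | x s y. s \<in> S}"
    using z(2) by (blast intro: complex_vector.span_base)
  then show ?case
    using step(2) by (simp add: distrib_right scaleC_mult_left complex_vector.span_add complex_vector.span_scale)
qed

definition Q_eq :: "('n word \<Rightarrow>\<^sub>0 complex) \<Rightarrow> ('n word \<Rightarrow>\<^sub>0 complex) \<Rightarrow> bool" where
  "Q_eq p q \<longleftrightarrow> p - q \<in> two_sided_ideal Q_relators"

text \<open>
  The index type \<open>'n\<close> plays the role of \<open>{1..N}\<close>, \<open>N = CARD('n)\<close>. The underlying algebra does
  not depend on \<open>\<beta>\<close>.
\<close>

quotient_type 'n Q = "'n word \<Rightarrow>\<^sub>0 complex" / Q_eq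
  unfolding Q_eq_def[abs_def] two_sided_ideal_def by (rule equivp_span_diff)

instantiation Q :: (type) complex_algebra
begin
lift_definition zero_Q :: "'a Q" is 0 .
lift_definition one_Q :: "'a Q" is 1 .
lift_definition plus_Q :: "'a Q \<Rightarrow> 'a Q \<Rightarrow> 'a Q" is "(+)"
  unfolding Q_eq_def two_sided_ideal_def by (rule span_diff_add)
lift_definition minus_Q :: "'a Q \<Rightarrow> 'a Q \<Rightarrow> 'a Q" is "(-)"
  unfolding Q_eq_def two_sided_ideal_def by (rule span_diff_diff)
lift_definition uminus_Q :: "'a Q \<Rightarrow> 'a Q" is "uminus"
  unfolding Q_eq_def two_sided_ideal_def by (rule span_diff_neg)
lift_definition scaleC_Q :: "complex \<Rightarrow> 'a Q \<Rightarrow> 'a Q" is scaleC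
  unfolding Q_eq_def two_sided_ideal_def by (rule span_diff_scale)
lift_definition times_Q :: "'a Q \<Rightarrow> 'a Q \<Rightarrow> 'a Q" is "(*)"
proof -
  fix p p' q q' :: "'a word \<Rightarrow>\<^sub>0 complex"
  assume "Q_eq p p'" "Q_eq q q'"
  then have "p * (q - q') \<in> two_sided_ideal Q_relators" "(p - p') * q' \<in> two_sided_ideal Q_relators"
    by (simp_all add: Q_eq_def two_sided_ideal_mult_left two_sided_ideal_mult_right)
  then have "p * (q - q') + (p - p') * q' \<in> two_sided_ideal Q_relators"
    unfolding two_sided_ideal_def by (rule complex_vector.span_add)
  then show "Q_eq (p * q) (p' * q')"
    by (simp add: Q_eq_def algebra_simps)
qed
instance
  by standard (transfer, simp add: Q_eq_def two_sided_ideal_def complex_vector.span_zero algebra_simps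
      scaleC_add_right scaleC_add_left scaleC_scaleC scaleC_one scaleC_mult_left scaleC_mult_right)+
end

definition QK :: "'n Q" where "QK = abs_Q (gen Letter_K)"
definition Qfp :: "'n \<Rightarrow> 'n Q" where "Qfp i = abs_Q (gen (Letter_fp i))"
definition Qfm :: "'n \<Rightarrow> 'n Q" where "Qfm i = abs_Q (gen (Letter_fm i))"

text \<open>
  Extensions of an assignment on generators to an algebra homomorphism, resp. antihomomorphism,
  \<open>Q \<rightarrow> B\<close>. They are evaluated on a representative in the free algebra, hence are
  meaningful only if the assigned values satisfy the (opposite) relations of \<open>Q\<close>; this is part
  of the content of \<^const>\<open>algebra_hom\<close> and \<^const>\<open>algebra_antihom\<close> for the maps below.
\<close>

definition Q_hom_ext :: "('n letter \<Rightarrow> 'b::complex_algebra) \<Rightarrow> 'n Q \<Rightarrow> 'b" where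
  "Q_hom_ext g x = linear_ext (\<lambda>w. prod_list (map g (letters w))) (rep_Q x)"

definition Q_antihom_ext :: "('n letter \<Rightarrow> 'b::complex_algebra) \<Rightarrow> 'n Q \<Rightarrow> 'b" where
  "Q_antihom_ext g x = linear_ext (\<lambda>w. prod_list (map g (rev (letters w)))) (rep_Q x)"

definition ordered_prod :: "('n::{finite,linorder} \<Rightarrow> 'b::monoid_mult) \<Rightarrow> 'b" where
  "ordered_prod g = prod_list (map g (sorted_list_of_set UNIV))"


section \<open>The ribbon quasi-Hopf data of \<open>Q(N, \<beta>)\<close>\<close>

definition e0 :: "'n Q" where "e0 = e0_of QK"
definition e1 :: "'n Q" where "e1 = e1_of QK"
definition idem :: "nat \<Rightarrow> 'n Q" where "idem n = (if n = 0 then e0 else e1)"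

definition omega_p :: "'n Q" where "omega_p = (e0 + \<i> *\<^sub>C e1) * QK"
definition omega_m :: "'n Q" where "omega_m = (e0 - \<i> *\<^sub>C e1) * QK"

fun Q_comult_gen :: "'n::finite letter \<Rightarrow> 'n Q \<otimes>\<^sub>C 'n Q" where
  "Q_comult_gen Letter_K =
     QK \<otimes>\<^sub>C QK - (1 + (-1) ^ CARD('n)) *\<^sub>C ((e1 \<otimes>\<^sub>C e1) * (QK \<otimes>\<^sub>C QK))"
| "Q_comult_gen (Letter_fp i) = Qfp i \<otimes>\<^sub>C 1 + omega_p \<otimes>\<^sub>C Qfp i"
| "Q_comult_gen (Letter_fm i) = Qfm i \<otimes>\<^sub>C 1 + omega_m \<otimes>\<^sub>C Qfm i"

fun Q_counit_gen :: "'n letter \<Rightarrow> complex" where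
  "Q_counit_gen Letter_K = 1"
| "Q_counit_gen (Letter_fp i) = 0"
| "Q_counit_gen (Letter_fm i) = 0"

fun Q_antipode_gen :: "'n::finite letter \<Rightarrow> 'n Q" where
  "Q_antipode_gen Letter_K = (if even CARD('n) then QK else inverse_el QK)"
| "Q_antipode_gen (Letter_fp k) = Qfp k * (e0 + ((-1) ^ CARD('n) * \<i>) *\<^sub>C e1) * QK"
| "Q_antipode_gen (Letter_fm k) = Qfm k * (e0 - ((-1) ^ CARD('n) * \<i>) *\<^sub>C e1) * QK"

definition Q_coassoc :: "complex \<Rightarrow> 'n::finite Q \<otimes>\<^sub>C 'n Q \<otimes>\<^sub>C 'n Q" where
  "Q_coassoc \<beta> = 1 \<otimes>\<^sub>C 1 \<otimes>\<^sub>C 1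
     + e1 \<otimes>\<^sub>C e1 \<otimes>\<^sub>C
         ((QK ^ CARD('n) - 1) * e0 + (\<beta>^2 *\<^sub>C (\<i> *\<^sub>C QK) ^ CARD('n) - 1) * e1)"

definition Q_beta :: "complex \<Rightarrow> 'n::finite Q" where
  "Q_beta \<beta> = e0 + \<beta>^2 *\<^sub>C (\<i> *\<^sub>C QK) ^ CARD('n) * e1"

definition Q_rho :: "nat \<Rightarrow> nat \<Rightarrow> 'n Q \<otimes>\<^sub>C 'n Q" where
  "Q_rho n m = (1/2) *\<^sub>C (\<Sum>p\<in>{0,1}. \<Sum>q\<in>{0,1}.
     ((-1) ^ (p * q) * \<i> powi (- int p * int n + int q * int m)) *\<^sub>C (QK ^ p \<otimes>\<^sub>C QK ^ q))"

definition Q_R :: "complex \<Rightarrow> 'n::{finite,linorder} Q \<otimes>\<^sub>C 'n Q" where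
  "Q_R \<beta> = (\<Sum>n\<in>{0,1}. \<Sum>m\<in>{0,1}. \<beta> ^ (n * m) *\<^sub>C (Q_rho n m * (idem n \<otimes>\<^sub>C idem m)))
     * ordered_prod (\<lambda>k. 1 \<otimes>\<^sub>C 1 - 2 *\<^sub>C ((Qfm k * omega_m) \<otimes>\<^sub>C Qfp k))"

definition Q_ribbon :: "complex \<Rightarrow> 'n::{finite,linorder} Q" where
  "Q_ribbon \<beta> = (e0 - (\<beta> * \<i>) *\<^sub>C (QK * e1)) * ordered_prod (\<lambda>k. 1 - 2 *\<^sub>C (Qfp k * Qfm k))"

definition Q_data :: "complex \<Rightarrow> 'n::{finite,linorder} Q ribbon_quasi_hopf" where
  "Q_data \<beta> =
     \<lparr> comult = Q_hom_ext Q_comult_gen,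
       counit = Q_hom_ext Q_counit_gen,
       coassoc = Q_coassoc \<beta>,
       antipode = Q_antihom_ext Q_antipode_gen,
       alpha_el = 1,
       beta_el = Q_beta \<beta>,
       R_matrix = Q_R \<beta>,
       ribbon_el = Q_ribbon \<beta> \<rparr>"

end

theory Submission
  imports Defs "HOL-Library.Countable" "Jordan_Normal_Form.Determinant"
begin

text \<open>
  Every element of \<open>Q\<close> built from \<open>K\<close> alone is a function on the four weights of \<open>K\<close>, and moving it past a
  generator \<open>f\<^sub>k\<^sup>\<plusminus>\<close> shifts the weights. The axioms therefore reduce to identities between functions on weights
  and to checks on generators, where the products over \<open>k\<close> in \<open>R\<close> and \<open>v\<close> are treated one factor at a time.

  The coend \<open>L\<close> is realised on the dual of \<open>Q\<close> with the coadjoint action. Its Hopf pairing is then an element of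
  \<open>Q \<otimes> Q\<close>, namely the double braiding \<open>R\<^sub>2\<^sub>1 R\<close> contracted with the antipode and two coassociators, and
  non-degeneracy means that its second legs span \<open>Q\<close> when its first legs are written in a basis. In a PBW basis,
  whose independence is seen in a Fock representation, \<open>R\<^sub>2\<^sub>1 R\<close> couples each monomial in the \<open>f\<^sub>k\<^sup>\<plusminus>\<close> with the
  monomial obtained by exchanging \<open>+\<close> and \<open>-\<close>, with non-zero coefficients; what is left is an
  invertible \<open>4 \<times> 4\<close> matrix on weights, built from the character table of \<open>\<int>\<^sub>2 \<times> \<int>\<^sub>2\<close>.
\<close>


section \<open>Algebra homomorphisms on tensor products\<close>

text \<open>The weights multiply under the comultiplication, as \<open>\<int>_2 x \<int>_2\<close>
  for even N and as \<open>\<int>_4\<close> for odd N. The coassociator is a function of three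
  weights, and the pentagon says that it is a 3-cocycle; \<open>\<beta>^4 = (-1)^N\<close> is what
  four weights in the sector \<open>e1\<close> demand. The dual of Q is the coend because every
  vector of a module is the image of 1 under a module map from the regular module: a dinatural
  family is thus determined by its values at \<open>phi \<otimes> 1\<close> on the regular module.
  The obstacle in the pairing is the four associators around the double braiding. As
  \<open>e1\<close> is central, the two inner ones commute with the double braiding and cancel. The
  left outer one dies in the evaluation, and the right outer one multiplies each PBW monomial by a
  sign. The antipode left on the second leg is bijective and does not affect spanning.
  Non-degeneracy asks for an isomorphism of modules from L to its dual. Its linear part is a
  spanning statement, but its compatibility with the action is a separate fact, which is derived
  from the invariance of the pairing on generators.\<close>

lemma linear_CI:
  "(\<And>x y. f (x + y) = f x + f y) \<Longrightarrow> (\<And>c x. f (c *\<^sub>C x) = c *\<^sub>C f x) \<Longrightarrow> linear_C f"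
  by (simp add: linear_C_def)

lemma linear_C_add: "linear_C f \<Longrightarrow> f (x + y) = f x + f y"
  by (simp add: linear_C_def)

lemma linear_C_scale: "linear_C f \<Longrightarrow> f (c *\<^sub>C x) = c *\<^sub>C f x"
  by (simp add: linear_C_def)

lemma linear_C_zero: "linear_C f \<Longrightarrow> f 0 = 0"
  using linear_C_add[of f 0 0] by simp

lemma linear_C_diff: "linear_C f \<Longrightarrow> f (x - y) = f x - f y"
  using linear_C_add[of f "x - y" y] by (simp add: algebra_simps)

lemma linear_C_minus: "linear_C f \<Longrightarrow> f (- x) = - f x"
  using linear_C_diff[of f 0 x] by (simp add: linear_C_zero)

lemma linear_C_sum: "linear_C f \<Longrightarrow> f (\<Sum>i\<in>I. g i) = (\<Sum>i\<in>I. f (g i))"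
  by (induction I rule: infinite_finite_induct) (simp_all add: linear_C_zero linear_C_add)

lemmas linear_C_simps = linear_C_add linear_C_scale linear_C_zero linear_C_diff linear_C_minus linear_C_sum

lemma linear_C_id: "linear_C id" "linear_C (\<lambda>x. x)"
  by (simp_all add: linear_C_def)

lemma linear_C_mult: "linear_C (\<lambda>x. a * x * b)" "linear_C (\<lambda>x. a * x)" "linear_C (\<lambda>x. x * b)"
  for a :: "'a::complex_algebra"
  by (simp_all add: linear_C_def algebra_simps scaleC_mult_left scaleC_mult_right)

lemma linear_C_comp: "linear_C f \<Longrightarrow> linear_C g \<Longrightarrow> linear_C (\<lambda>x. f (g x))"
  by (simp add: linear_C_def)

lemma linear_C_scale_const: "linear_C f \<Longrightarrow> linear_C (\<lambda>x. f x *\<^sub>C v)"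
  by (simp add: linear_C_def scaleC_add_left scaleC_complex_def scaleC_scaleC)

lemma linear_C_tens: "linear_C (\<lambda>x. x \<otimes>\<^sub>C y)" "linear_C (\<lambda>y. x \<otimes>\<^sub>C y)"
  using bilinear_C_tens by (auto simp: bilinear_C_def)

lemma bilinear_CI: "(\<And>a. linear_C (h a)) \<Longrightarrow> (\<And>b. linear_C (\<lambda>a. h a b)) \<Longrightarrow> bilinear_C h"
  by (simp add: bilinear_C_def)

lemma tensor_linear_eq:
  assumes "linear_C f" "linear_C g" "\<And>a b. f (a \<otimes>\<^sub>C b) = g (a \<otimes>\<^sub>C b)"
  shows "f t = g t"
  by (induction t rule: tensor_induct) (simp_all add: assms linear_C_add)

lemma tensor_linear_eq3:
  assumes "linear_C f" "linear_C g" "\<And>a b c. f (a \<otimes>\<^sub>C b \<otimes>\<^sub>C c) = g (a \<otimes>\<^sub>C b \<otimes>\<^sub>C c)"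
  shows "f t = g t"
proof (rule tensor_linear_eq[OF assms(1,2)])
  fix a t
  show "f (a \<otimes>\<^sub>C t) = g (a \<otimes>\<^sub>C t)"
    by (rule tensor_linear_eq[where f="\<lambda>t. f (a \<otimes>\<^sub>C t)" and g="\<lambda>t. g (a \<otimes>\<^sub>C t)"])
       (auto intro: linear_C_comp[OF assms(1)] linear_C_comp[OF assms(2)] linear_C_tens assms(3))
qed

lemma algebra_homD:
  assumes "algebra_hom f"
  shows "linear_C f" "f 1 = 1" "f (x * y) = f x * f y"
  using assms by (simp_all add: algebra_hom_def)

lemma algebra_hom_power: "algebra_hom f \<Longrightarrow> f (x ^ n) = f x ^ n"
  by (induction n) (simp_all add: algebra_homD)

lemma algebra_hom_id: "algebra_hom id"
  by (simp add: algebra_hom_def linear_C_id)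

lemma algebra_hom_comp: "algebra_hom f \<Longrightarrow> algebra_hom g \<Longrightarrow> algebra_hom (\<lambda>x. f (g x))"
  by (simp add: algebra_hom_def linear_C_comp)

lemma algebra_hom_tlift:
  assumes h: "bilinear_C h" and one: "h 1 1 = 1"
    and mult: "\<And>a b a' b'. h (a * a') (b * b') = h a b * h a' b'"
  shows "algebra_hom (tlift h)"
  unfolding algebra_hom_def
proof (intro conjI allI)
  show "linear_C (tlift h)" by (rule linear_C_tlift[OF h])
  show "tlift h 1 = 1" by (simp add: one_tensor_def tlift_tens[OF h] one)
  fix x y
  show "tlift h (x * y) = tlift h x * tlift h y"
  proof (induction x rule: tensor_induct)
    case (tens a b)
    show ?case
      by (induction y rule: tensor_induct)
         (simp_all add: tens_mult tlift_tens[OF h] mult tlift_add[OF h] distrib_left)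
  qed (simp add: tlift_add[OF h] distrib_right)
qed

lemma tens_one: "1 \<otimes>\<^sub>C 1 = 1"
  by (simp add: one_tensor_def)

lemma tens_zero: "0 \<otimes>\<^sub>C y = 0" "x \<otimes>\<^sub>C 0 = 0"
  using linear_C_zero[OF linear_C_tens(1)] linear_C_zero[OF linear_C_tens(2)] by blast+

lemma tens_diff: "(a - b) \<otimes>\<^sub>C c = a \<otimes>\<^sub>C c - b \<otimes>\<^sub>C c" "c \<otimes>\<^sub>C (a - b) = c \<otimes>\<^sub>C a - c \<otimes>\<^sub>C b"
  using linear_C_diff[OF linear_C_tens(1)] linear_C_diff[OF linear_C_tens(2)] by blast+

lemma tens_sum: "(\<Sum>i\<in>I. g i) \<otimes>\<^sub>C c = (\<Sum>i\<in>I. g i \<otimes>\<^sub>C c)" "c \<otimes>\<^sub>C (\<Sum>i\<in>I. g i) = (\<Sum>i\<in>I. c \<otimes>\<^sub>C g i)"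
  using linear_C_sum[OF linear_C_tens(1)] linear_C_sum[OF linear_C_tens(2)] by blast+

lemma algebra_hom_tens: "algebra_hom (\<lambda>x. x \<otimes>\<^sub>C 1)" "algebra_hom (\<lambda>x. 1 \<otimes>\<^sub>C x)"
  by (simp_all add: algebra_hom_def linear_C_tens tens_one tens_mult)

lemma bilinear_C_tmap: "linear_C f \<Longrightarrow> linear_C g \<Longrightarrow> bilinear_C (\<lambda>a b. f a \<otimes>\<^sub>C g b)"
  by (rule linear_C_compose_bilinear[OF bilinear_C_tens])

lemma tmap_tens: "linear_C f \<Longrightarrow> linear_C g \<Longrightarrow> tmap f g (a \<otimes>\<^sub>C b) = f a \<otimes>\<^sub>C g b"
  unfolding tmap_def by (rule tlift_tens[OF bilinear_C_tmap])

lemma linear_C_tmap: "linear_C f \<Longrightarrow> linear_C g \<Longrightarrow> linear_C (tmap f g)"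
  unfolding tmap_def by (intro linear_C_tlift bilinear_C_tmap)

lemma algebra_hom_tmap:
  assumes "algebra_hom f" "algebra_hom g"
  shows "algebra_hom (tmap f g)"
  unfolding tmap_def using assms
  by (intro algebra_hom_tlift bilinear_C_tmap)
     (simp_all add: algebra_homD tens_one tens_mult)

lemma bilinear_C_tflip: "bilinear_C (\<lambda>a b. b \<otimes>\<^sub>C a)"
  by (intro bilinear_CI linear_C_tens)

lemma tflip_tens: "tflip (a \<otimes>\<^sub>C b) = b \<otimes>\<^sub>C a"
  unfolding tflip_def by (rule tlift_tens[OF bilinear_C_tflip])

lemma algebra_hom_tflip: "algebra_hom tflip"
  unfolding tflip_def by (intro algebra_hom_tlift bilinear_C_tflip) (simp_all add: tens_one tens_mult)

lemma bilinear_C_tassoc_inner: "bilinear_C (\<lambda>a b. a \<otimes>\<^sub>C b \<otimes>\<^sub>C c)"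
  by (intro bilinear_CI linear_C_comp[OF linear_C_tens(2) linear_C_tens(1)] linear_C_tens)

lemma bilinear_C_tassoc: "bilinear_C (\<lambda>x c. tlift (\<lambda>a b. a \<otimes>\<^sub>C b \<otimes>\<^sub>C c) x)"
proof (rule bilinear_CI)
  show "linear_C (\<lambda>x. tlift (\<lambda>a b. a \<otimes>\<^sub>C b \<otimes>\<^sub>C c) x)" for c :: 'c
    by (rule linear_C_tlift[OF bilinear_C_tassoc_inner])
  show "linear_C (\<lambda>c. tlift (\<lambda>a b. a \<otimes>\<^sub>C b \<otimes>\<^sub>C c) x)" for x :: "'a \<otimes>\<^sub>C 'b"
  proof (induction x rule: tensor_induct)
    case (tens a b)
    show ?case
      by (simp add: tlift_tens[OF bilinear_C_tassoc_inner]) (intro linear_C_comp[OF linear_C_tens(2)] linear_C_tens)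
  next
    case (add x y)
    then show ?case
      by (simp add: tlift_add[OF bilinear_C_tassoc_inner] linear_C_def scaleC_add_right)
  qed
qed

lemma tassoc_tens': "tassoc (x \<otimes>\<^sub>C c) = tlift (\<lambda>a b. a \<otimes>\<^sub>C b \<otimes>\<^sub>C c) x"
  unfolding tassoc_def by (rule tlift_tens[OF bilinear_C_tassoc])

lemma tassoc_tens: "tassoc ((a \<otimes>\<^sub>C b) \<otimes>\<^sub>C c) = a \<otimes>\<^sub>C b \<otimes>\<^sub>C c"
  unfolding tassoc_tens' by (rule tlift_tens[OF bilinear_C_tassoc_inner])

lemma linear_C_tassoc: "linear_C tassoc"
  unfolding tassoc_def by (rule linear_C_tlift[OF bilinear_C_tassoc])

lemma algebra_hom_tassoc: "algebra_hom (tassoc :: ('a::complex_algebra \<otimes>\<^sub>C 'b::complex_algebra) \<otimes>\<^sub>C 'c::complex_algebra \<Rightarrow> _)"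
  unfolding algebra_hom_def
proof (intro conjI allI)
  show "linear_C (tassoc :: ('a \<otimes>\<^sub>C 'b) \<otimes>\<^sub>C 'c \<Rightarrow> _)" by (rule linear_C_tassoc)
  show "tassoc 1 = (1 :: 'a \<otimes>\<^sub>C 'b \<otimes>\<^sub>C 'c)" by (simp add: one_tensor_def tassoc_tens)
  fix x y :: "('a \<otimes>\<^sub>C 'b) \<otimes>\<^sub>C 'c"
  have *: "tassoc ((u \<otimes>\<^sub>C c) * (u' \<otimes>\<^sub>C c')) = tassoc (u \<otimes>\<^sub>C c) * tassoc (u' \<otimes>\<^sub>C c')"
    for u u' :: "'a \<otimes>\<^sub>C 'b" and c c' :: 'c
  proof (induction u rule: tensor_induct)
    case (tens a b)
    show ?case
      by (induction u' rule: tensor_induct)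
         (simp_all add: tens_mult tassoc_tens distrib_left tens_add_left linear_C_add[OF linear_C_tassoc])
  next
    case (add u v)
    then show ?case
      by (simp add: tens_mult distrib_right tens_add_left linear_C_add[OF linear_C_tassoc])
  qed
  show "tassoc (x * y) = tassoc x * tassoc y"
  proof (induction x rule: tensor_induct)
    case (tens u c)
    show ?case
      by (induction y rule: tensor_induct) (simp_all add: * distrib_left linear_C_add[OF linear_C_tassoc])
  qed (simp add: distrib_right linear_C_add[OF linear_C_tassoc])
qed

section \<open>Trilinear maps and permutations of three tensor legs\<close>

definition trilinear_C :: "('a::complex_vector \<Rightarrow> 'b::complex_vector \<Rightarrow> 'c::complex_vector \<Rightarrow> 'd::complex_vector) \<Rightarrow> bool" where
  "trilinear_C h \<longleftrightarrow> (\<forall>a. bilinear_C (h a)) \<and> (\<forall>b c. linear_C (\<lambda>a. h a b c))"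

lemma trilinear_CI:
  "(\<And>a b. linear_C (h a b)) \<Longrightarrow> (\<And>a c. linear_C (\<lambda>b. h a b c)) \<Longrightarrow> (\<And>b c. linear_C (\<lambda>a. h a b c))
    \<Longrightarrow> trilinear_C h"
  by (simp add: trilinear_C_def bilinear_CI)

lemma bilinear_C_tlift3:
  assumes "trilinear_C h"
  shows "bilinear_C (\<lambda>a. tlift (h a))"
proof (rule bilinear_CI)
  show "linear_C (tlift (h a))" for a
    using assms by (simp add: trilinear_C_def linear_C_tlift)
  have b: "bilinear_C (h a)" for a using assms by (simp add: trilinear_C_def)
  show "linear_C (\<lambda>a. tlift (h a) x)" for x
  proof (induction x rule: tensor_induct)
    case (tens a b)
    show ?case using assms by (simp add: tlift_tens[OF b] trilinear_C_def)
  next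
    case (add x y)
    then show ?case by (simp add: tlift_add[OF b] linear_C_def scaleC_add_right)
  qed
qed

lemma tlift3_tens: "trilinear_C h \<Longrightarrow> tlift3 h (a \<otimes>\<^sub>C b \<otimes>\<^sub>C c) = h a b c"
  by (simp add: tlift3_def tlift_tens bilinear_C_tlift3) (simp add: tlift_tens trilinear_C_def)

lemma linear_C_tlift3: "trilinear_C h \<Longrightarrow> linear_C (tlift3 h)"
  by (simp add: tlift3_def linear_C_tlift bilinear_C_tlift3)

lemma algebra_hom_tlift3:
  assumes h: "trilinear_C h" and one: "h 1 1 1 = 1"
    and mult: "\<And>a b c a' b' c'. h (a * a') (b * b') (c * c') = h a b c * h a' b' c'"
  shows "algebra_hom (tlift3 h)"
  unfolding tlift3_def
proof (rule algebra_hom_tlift[OF bilinear_C_tlift3[OF h]])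
  have b: "bilinear_C (h a)" for a using h by (simp add: trilinear_C_def)
  show "tlift (h 1) 1 = 1" by (simp add: one_tensor_def tlift_tens[OF b] one)
  show "tlift (h (a * a')) (x * y) = tlift (h a) x * tlift (h a') y" for a a' x y
  proof (induction x rule: tensor_induct)
    case (tens c d)
    show ?case
      by (induction y rule: tensor_induct)
         (simp_all add: tens_mult tlift_tens[OF b] mult tlift_add[OF b] distrib_left)
  qed (simp add: tlift_add[OF b] distrib_right)
qed

lemma trilinear_C_perm:
  "trilinear_C (\<lambda>x y z. z \<otimes>\<^sub>C x \<otimes>\<^sub>C y)" "trilinear_C (\<lambda>x y z. y \<otimes>\<^sub>C x \<otimes>\<^sub>C z)"
  "trilinear_C (\<lambda>x y z. y \<otimes>\<^sub>C z \<otimes>\<^sub>C x)" "trilinear_C (\<lambda>x y z. x \<otimes>\<^sub>C z \<otimes>\<^sub>C y)"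
  by (rule trilinear_CI; simp add: linear_C_def tens_add_left tens_add_right tens_scaleC_left tens_scaleC_right)+

lemmas tlift3_perm = tlift3_tens[OF trilinear_C_perm(1)] tlift3_tens[OF trilinear_C_perm(2)]
  tlift3_tens[OF trilinear_C_perm(3)] tlift3_tens[OF trilinear_C_perm(4)]

lemma bilinear_C_mid: "bilinear_C (\<lambda>x y. x \<otimes>\<^sub>C 1 \<otimes>\<^sub>C y)"
  by (rule bilinear_CI; simp add: linear_C_def tens_add_left tens_add_right tens_scaleC_left tens_scaleC_right)

lemma algebra_hom_mid: "algebra_hom (tlift (\<lambda>x y. x \<otimes>\<^sub>C 1 \<otimes>\<^sub>C y))"
  by (rule algebra_hom_tlift[OF bilinear_C_mid]) (simp_all add: tens_one tens_mult)

lemma tlift_mid: "tlift (\<lambda>x y. x \<otimes>\<^sub>C 1 \<otimes>\<^sub>C y) (a \<otimes>\<^sub>C b) = a \<otimes>\<^sub>C 1 \<otimes>\<^sub>C b"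
  by (rule tlift_tens[OF bilinear_C_mid])

section \<open>Inverses in a monoid\<close>

lemma inverse_el_eq: "x * y = 1 \<Longrightarrow> y * x = 1 \<Longrightarrow> inverse_el x = y"
  unfolding inverse_el_def by (rule the_equality, simp) (metis mult.assoc mult_1_left mult_1_right)

lemma invertible_elI: "x * y = 1 \<Longrightarrow> y * x = 1 \<Longrightarrow> invertible_el x"
  unfolding invertible_el_def by blast

lemma invertible_el_inverse:
  assumes "invertible_el x" shows "x * inverse_el x = 1" "inverse_el x * x = 1"
  using assms inverse_el_eq unfolding invertible_el_def by metis+

lemma invertible_el_mult:
  assumes "invertible_el x" "invertible_el y" shows "invertible_el (x * y)"
proof -
  have "(x * y) * (inverse_el y * inverse_el x) = x * (y * inverse_el y) * inverse_el x"
       "(inverse_el y * inverse_el x) * (x * y) = inverse_el y * (inverse_el x * x) * y"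
    by (simp_all only: mult.assoc)
  then show ?thesis using assms by (auto simp: invertible_el_inverse intro: invertible_elI)
qed


section \<open>Homomorphisms and antihomomorphisms out of \<open>Q\<close>\<close>

text \<open>The relations involve only anticommutators and powers of \<open>K\<close>, so they read
  the same in the opposite algebra. One predicate therefore serves for homomorphisms and for
  antihomomorphisms.\<close>

definition Q_rels :: "('n letter \<Rightarrow> 'b::complex_algebra) \<Rightarrow> bool" where
  "Q_rels g \<longleftrightarrow>
     (\<forall>i. anticomm (g (Letter_fp i)) (g Letter_K) = 0) \<and>
     (\<forall>i. anticomm (g (Letter_fm i)) (g Letter_K) = 0) \<and>
     (\<forall>i j. anticomm (g (Letter_fp i)) (g (Letter_fm j)) = (if i = j then e1_of (g Letter_K) else 0)) \<and>
     (\<forall>i j. anticomm (g (Letter_fp i)) (g (Letter_fp j)) = 0) \<and>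
     (\<forall>i j. anticomm (g (Letter_fm i)) (g (Letter_fm j)) = 0) \<and>
     g Letter_K ^ 4 = 1"

text \<open>The flag \<open>rv\<close> reverses words, so that both kinds of extension are treated
  at once on the free algebra.\<close>

definition free_ext :: "bool \<Rightarrow> ('n letter \<Rightarrow> 'b::complex_algebra) \<Rightarrow> ('n word \<Rightarrow>\<^sub>0 complex) \<Rightarrow> 'b" where
  "free_ext rv g = linear_ext (\<lambda>w. prod_list (map g ((if rv then rev else id) (letters w))))"

lemma linear_C_free_ext: "linear_C (free_ext rv g)"
  by (simp add: free_ext_def linear_C_def linear_ext_add linear_ext_scaleC)

lemma free_ext_mult:
  "free_ext rv g (p * q) = (if rv then free_ext rv g q * free_ext rv g p else free_ext rv g p * free_ext rv g q)"
proof (induction p rule: poly_mapping_induct)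
  case (single k v)
  show ?case
    by (induction q rule: poly_mapping_induct)
       (simp_all add: free_ext_def mult_single plus_word_def linear_ext_add distrib_left distrib_right
          scaleC_add_right scaleC_mult_left scaleC_mult_right scaleC_scaleC mult.commute)
next
  case (sum p q)
  then show ?case by (simp add: distrib_left distrib_right linear_C_add[OF linear_C_free_ext])
qed

lemma free_ext_one: "free_ext rv g 1 = 1"
  unfolding free_ext_def single_one[symmetric] zero_word_def by (simp add: scaleC_one)

lemma free_ext_gen: "free_ext rv g (gen x) = g x"
  by (simp add: free_ext_def gen_def scaleC_one)

lemma free_ext_gen_power: "free_ext rv g (gen x ^ n) = g x ^ n"
  by (cases rv; induction n) (simp_all add: free_ext_one free_ext_mult free_ext_gen power_commutes)

lemma free_ext_relator:
  assumes "Q_rels g" "r \<in> Q_relators"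
  shows "free_ext rv g r = 0"
  using assms unfolding Q_relators_def Q_rels_def
  by (auto simp: anticomm_def e1_of_def linear_C_simps[OF linear_C_free_ext] free_ext_mult free_ext_gen
      free_ext_one free_ext_gen_power add.commute)

lemma free_ext_ideal:
  assumes "Q_rels g" "p \<in> two_sided_ideal Q_relators"
  shows "free_ext rv g p = 0"
  using assms(2) unfolding two_sided_ideal_def
proof (induction p rule: complex_vector.span_induct_alt)
  case base
  show ?case by (rule linear_C_zero[OF linear_C_free_ext])
next
  case (step c x y)
  then obtain u s v where x: "x = u * s * v" "s \<in> Q_relators" by blast
  have "free_ext rv g x = 0"
    by (simp add: x(1) free_ext_mult free_ext_relator[OF assms(1) x(2)])
  then show ?case using step(2)
    by (simp add: linear_C_simps[OF linear_C_free_ext] complex_vector.scale_zero_right)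
qed

text \<open>The extension kills the ideal, hence its value does not depend on the representative
  that \<open>rep_Q\<close> picks.\<close>

lemma free_ext_rep_Q:
  assumes "Q_rels g"
  shows "free_ext rv g (rep_Q (abs_Q p)) = free_ext rv g p"
proof -
  have "Q_eq (rep_Q (abs_Q p)) p"
    by (rule Quotient3_rep_abs[OF Quotient3_Q])
       (simp add: Q_eq_def two_sided_ideal_def complex_vector.span_zero)
  then show ?thesis
    using free_ext_ideal[OF assms, of "rep_Q (abs_Q p) - p" rv]
    by (simp add: Q_eq_def linear_C_diff[OF linear_C_free_ext])
qed

lemma Q_ext_conv:
  "Q_hom_ext g x = free_ext False g (rep_Q x)" "Q_antihom_ext g x = free_ext True g (rep_Q x)"
  by (simp_all add: Q_hom_ext_def Q_antihom_ext_def free_ext_def)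

lemma free_ext_descends:
  fixes rv :: bool and g :: "'n letter \<Rightarrow> 'b::complex_algebra"
  assumes "Q_rels g"
  defines "F \<equiv> \<lambda>x. free_ext rv g (rep_Q x)"
  shows "linear_C F" "F 1 = 1" "F (x * y) = (if rv then F y * F x else F x * F y)"
proof -
  have F: "F (abs_Q p) = free_ext rv g p" for p
    by (simp add: F_def free_ext_rep_Q[OF assms(1)])
  show "linear_C F"
  proof (rule linear_CI)
    show "F (a + b) = F a + F b" for a b
      by (induct a, induct b) (simp add: plus_Q.abs_eq F linear_C_add[OF linear_C_free_ext])
    show "F (c *\<^sub>C a) = c *\<^sub>C F a" for c a
      by (induct a) (simp add: scaleC_Q.abs_eq F linear_C_scale[OF linear_C_free_ext])
  qed
  show "F 1 = 1" by (simp add: one_Q_def F free_ext_one)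
  show "F (x * y) = (if rv then F y * F x else F x * F y)"
    by (induct x, induct y) (simp add: times_Q.abs_eq F free_ext_mult)
qed

lemma algebra_hom_Q_hom_ext: "Q_rels g \<Longrightarrow> algebra_hom (Q_hom_ext g)"
  using free_ext_descends[of g False] unfolding algebra_hom_def Q_ext_conv[abs_def] by simp

lemma algebra_antihom_Q_antihom_ext: "Q_rels g \<Longrightarrow> algebra_antihom (Q_antihom_ext g)"
  using free_ext_descends[of g True] unfolding algebra_antihom_def Q_ext_conv[abs_def] by simp

lemma Q_ext_gens:
  assumes "Q_rels g"
  shows "Q_hom_ext g QK = g Letter_K" "Q_hom_ext g (Qfp i) = g (Letter_fp i)" "Q_hom_ext g (Qfm i) = g (Letter_fm i)"
    "Q_antihom_ext g QK = g Letter_K" "Q_antihom_ext g (Qfp i) = g (Letter_fp i)" "Q_antihom_ext g (Qfm i) = g (Letter_fm i)"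
  by (simp_all add: Q_ext_conv QK_def Qfp_def Qfm_def free_ext_rep_Q[OF assms] free_ext_gen)

lemma Q_eqI: "p - q \<in> Q_relators \<Longrightarrow> abs_Q p = abs_Q q"
  unfolding Q.abs_eq_iff Q_eq_def two_sided_ideal_def
  by (rule complex_vector.span_base) (metis (mono_tags, lifting) mem_Collect_eq mult_1_left mult_1_right)

lemma Q_rels_gens: "Q_rels (\<lambda>l. case l of Letter_K \<Rightarrow> QK | Letter_fp i \<Rightarrow> Qfp i | Letter_fm i \<Rightarrow> Qfm i)"
proof -
  have e: "e1_of QK = (abs_Q (e1_of (gen Letter_K)) :: 'a Q)"
    by (simp add: e1_of_def QK_def one_Q_def minus_Q.abs_eq scaleC_Q.abs_eq times_Q.abs_eq power2_eq_square)
  have a: "anticomm (abs_Q p) (abs_Q q) = (abs_Q (anticomm p q) :: 'a Q)" for p q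
    by (simp add: anticomm_def times_Q.abs_eq plus_Q.abs_eq)
  have k: "(QK :: 'a Q) ^ 4 = abs_Q (gen Letter_K ^ 4)"
    by (simp add: QK_def times_Q.abs_eq power4_eq_xxxx)
  show ?thesis
    unfolding Q_rels_def
    by (simp add: k) (simp add: Qfp_def Qfm_def a e, simp add: QK_def a zero_Q_def one_Q_def,
        intro conjI allI impI Q_eqI; unfold Q_relators_def; simp; metis)
qed

lemma Q_relations:
  fixes i j :: 'n
  shows "Qfp i * QK = - (QK * Qfp i)" "Qfm i * QK = - (QK * Qfm i)"
  "Qfp i * Qfp j = - (Qfp j * Qfp i)" "Qfm i * Qfm j = - (Qfm j * Qfm i)"
  "Qfm i * Qfp j = (if i = j then e1 else 0) - Qfp j * Qfm i"
  "QK ^ 4 = (1 :: 'n Q)"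
proof -
  define g where "g = (\<lambda>l :: 'n letter. case l of Letter_K \<Rightarrow> QK | Letter_fp i \<Rightarrow> Qfp i | Letter_fm i \<Rightarrow> Qfm i)"
  have g: "g Letter_K = QK" "g (Letter_fp i) = Qfp i" "g (Letter_fm i) = Qfm i" for i
    by (simp_all add: g_def)
  have "Q_rels g" unfolding g_def by (rule Q_rels_gens)
  note r = this[unfolded Q_rels_def anticomm_def g]
  show "Qfp i * QK = - (QK * Qfp i)" "Qfm i * QK = - (QK * Qfm i)"
    "Qfp i * Qfp j = - (Qfp j * Qfp i)" "Qfm i * Qfm j = - (Qfm j * Qfm i)"
    using r by (simp_all add: eq_neg_iff_add_eq_0)
  have "Qfp j * Qfm i + Qfm i * Qfp j = (if j = i then e1_of QK else 0)"
    using r by blast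
  then show "Qfm i * Qfp j = (if i = j then e1 else 0) - Qfp j * Qfm i"
    by (auto simp: e1_def algebra_simps split: if_splits)
  show "QK ^ 4 = (1 :: 'n Q)" using r by blast
qed

text \<open>Words span the free algebra, and each word arises from 1 by multiplying with letters on
  the left.\<close>

lemma Q_induct [case_names one add scale K fp fm]:
  fixes P :: "'n Q \<Rightarrow> bool"
  assumes one: "P 1" and add: "\<And>x y. P x \<Longrightarrow> P y \<Longrightarrow> P (x + y)" and scale: "\<And>c x. P x \<Longrightarrow> P (c *\<^sub>C x)"
    and K: "\<And>x. P x \<Longrightarrow> P (QK * x)" and fp: "\<And>i x. P x \<Longrightarrow> P (Qfp i * x)" and fm: "\<And>i x. P x \<Longrightarrow> P (Qfm i * x)"
  shows "P x"
proof (induct x)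
  fix p :: "'n word \<Rightarrow>\<^sub>0 complex"
  show "P (abs_Q p)"
  proof (induction p rule: poly_mapping_induct)
    case (single w c)
    have s: "Poly_Mapping.single w c = c *\<^sub>C Poly_Mapping.single w 1"
      by (rule poly_mapping_eqI) (simp add: lookup_scaleC lookup_single when_def scaleC_complex_def)
    have "P (abs_Q (Poly_Mapping.single (Word ls) 1))" for ls
    proof (induction ls)
      case Nil
      show ?case using one by (simp add: one_Q_def zero_word_def[symmetric] single_one)
    next
      case (Cons l ls)
      have "Poly_Mapping.single (Word (l # ls)) 1 = gen l * (Poly_Mapping.single (Word ls) 1 :: 'n word \<Rightarrow>\<^sub>0 complex)"
        by (simp add: gen_def mult_single plus_word_def)
      then have "abs_Q (Poly_Mapping.single (Word (l # ls)) 1) = abs_Q (gen l) * abs_Q (Poly_Mapping.single (Word ls) 1)"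
        by (simp add: times_Q.abs_eq)
      then show ?case using Cons K fp fm by (cases l) (simp_all add: QK_def Qfp_def Qfm_def)
    qed
    then show ?case using scale by (cases w) (metis s scaleC_Q.abs_eq)
  next
    case (sum p q)
    then show ?case using add by (simp add: plus_Q.abs_eq[symmetric])
  qed
qed


section \<open>Kronecker products\<close>

text \<open>The quotient and the remainder modulo \<open>m\<close> are the two coordinates of a
  lexicographic index; this is the bridge between matrix products of Kronecker products and double
  sums.\<close>

lemma sum_prod_index:
  fixes f :: "nat \<Rightarrow> nat \<Rightarrow> 'b::comm_monoid_add"
  shows "(\<Sum>k<n * m. f (k div m) (k mod m)) = (\<Sum>i<n. \<Sum>j<m. f i j)"
proof -
  have "(\<Sum>k<n * m. f (k div m) (k mod m)) = (\<Sum>i<n. \<Sum>k=i * m..<i * m + m. f (k div m) (k mod m))"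
    by (rule sum.nat_group[symmetric])
  also have "\<dots> = (\<Sum>i<n. \<Sum>j<m. f i j)"
  proof (rule sum.cong[OF refl])
    fix i
    have "(\<Sum>k=0 + i * m..<m + i * m. f (k div m) (k mod m)) = (\<Sum>k=0..<m. f ((k + i * m) div m) ((k + i * m) mod m))"
      by (rule sum.shift_bounds_nat_ivl)
    also have "\<dots> = (\<Sum>j<m. f i j)"
      by (intro sum.cong) auto
    finally show "(\<Sum>k=i * m..<i * m + m. f (k div m) (k mod m)) = (\<Sum>j<m. f i j)"
      by (simp add: add.commute)
  qed
  finally show ?thesis .
qed

lemma mat_mult_entry:
  assumes "A \<in> carrier_mat r n" "B \<in> carrier_mat n c" "i < r" "j < c"
  shows "(A * B) $$ (i, j) = (\<Sum>k<n. A $$ (i, k) * B $$ (k, j))"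
  using assms by (simp add: scalar_prod_def lessThan_atLeast0)

lemma kron_carrier: "A \<in> carrier_mat r c \<Longrightarrow> B \<in> carrier_mat r' c' \<Longrightarrow> kron A B \<in> carrier_mat (r * r') (c * c')"
  by (simp add: kron_def)

lemma kron_entry:
  assumes "A \<in> carrier_mat r c" "B \<in> carrier_mat r' c'" "i < r * r'" "j < c * c'"
  shows "kron A B $$ (i, j) = A $$ (i div r', j div c') * B $$ (i mod r', j mod c')"
  using assms by (simp add: kron_def)

lemma index_less:
  fixes i :: nat assumes "i < n * m" shows "i div m < n" "i mod m < m"
  using assms by (simp_all add: less_mult_imp_div_less) (metis mod_less_divisor mult_0_right not_less_zero gr0I)

lemma kron_mult:
  assumes "A \<in> carrier_mat r n" "A' \<in> carrier_mat n c" "B \<in> carrier_mat r' n'" "B' \<in> carrier_mat n' c'"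
  shows "kron A B * kron A' B' = kron (A * A') (B * B')"
proof (rule eq_matI)
  note AA = mult_carrier_mat[OF assms(1,2)] and BB = mult_carrier_mat[OF assms(3,4)]
  note K = kron_carrier[OF assms(1,3)] kron_carrier[OF assms(2,4)]
  fix i j assume "i < dim_row (kron (A * A') (B * B'))" "j < dim_col (kron (A * A') (B * B'))"
  then have ij: "i < r * r'" "j < c * c'" using kron_carrier[OF AA BB] by auto
  note i = index_less[OF ij(1)] and j = index_less[OF ij(2)]
  have "(kron A B * kron A' B') $$ (i, j) =
      (\<Sum>k<n * n'. (A $$ (i div r', k div n') * B $$ (i mod r', k mod n')) * (A' $$ (k div n', j div c') * B' $$ (k mod n', j mod c')))"
    unfolding mat_mult_entry[OF K ij]
    by (intro sum.cong refl arg_cong2[where f="(*)"] kron_entry[OF assms(1,3)] kron_entry[OF assms(2,4)] ij) auto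
  also have "\<dots> = (\<Sum>k<n. \<Sum>l<n'. (A $$ (i div r', k) * B $$ (i mod r', l)) * (A' $$ (k, j div c') * B' $$ (l, j mod c')))"
    by (rule sum_prod_index)
  also have "\<dots> = (\<Sum>k<n. A $$ (i div r', k) * A' $$ (k, j div c')) * (\<Sum>l<n'. B $$ (i mod r', l) * B' $$ (l, j mod c'))"
    by (simp add: sum_product mult_ac)
  also have "\<dots> = kron (A * A') (B * B') $$ (i, j)"
    by (simp only: kron_entry[OF AA BB ij] mat_mult_entry[OF assms(1,2) i(1) j(1)] mat_mult_entry[OF assms(3,4) i(2) j(2)])
  finally show "(kron A B * kron A' B') $$ (i, j) = kron (A * A') (B * B') $$ (i, j)" .
qed (use assms in \<open>auto simp: kron_def\<close>)

lemma kron_add: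
  assumes "A \<in> carrier_mat r c" "A' \<in> carrier_mat r c" "B \<in> carrier_mat r' c'" "B' \<in> carrier_mat r' c'"
  shows "kron (A + A') B = kron A B + kron A' B" "kron A (B + B') = kron A B + kron A B'"
    "kron (x \<cdot>\<^sub>m A) B = x \<cdot>\<^sub>m kron A B" "kron A (x \<cdot>\<^sub>m B) = x \<cdot>\<^sub>m kron A B"
proof -
  note d = carrier_matD[OF assms(1)] carrier_matD[OF assms(2)] carrier_matD[OF assms(3)] carrier_matD[OF assms(4)]
  have idx: "i < r * r' \<Longrightarrow> j < c * c' \<Longrightarrow>
      (i div r' < r \<Longrightarrow> i mod r' < r' \<Longrightarrow> j div c' < c \<Longrightarrow> j mod c' < c' \<Longrightarrow> R) \<Longrightarrow> R" for i j R
    using index_less by blast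
  show "kron (A + A') B = kron A B + kron A' B" "kron A (B + B') = kron A B + kron A B'"
    "kron (x \<cdot>\<^sub>m A) B = x \<cdot>\<^sub>m kron A B" "kron A (x \<cdot>\<^sub>m B) = x \<cdot>\<^sub>m kron A B"
    by (rule eq_matI; simp add: kron_def d; erule (1) idx; simp add: d algebra_simps)+
qed

lemma kron_assoc: "kron (kron A B) C = kron A (kron B C)"
proof (rule eq_matI)
  have d: "(i mod (n * m)) div m = i div m mod n" "(i mod (n * m)) mod m = i mod m" "i div (n * m) = i div m div n" for i n m :: nat
    by (simp_all add: mult.commute[of n] mod_mult2_eq div_mult2_eq) (cases "m = 0"; simp)+
  have A: "A \<in> carrier_mat (dim_row A) (dim_col A)" and B: "B \<in> carrier_mat (dim_row B) (dim_col B)"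
    and C: "C \<in> carrier_mat (dim_row C) (dim_col C)" by simp_all
  fix i j assume "i < dim_row (kron A (kron B C))" "j < dim_col (kron A (kron B C))"
  then have ij: "i < dim_row A * dim_row B * dim_row C" "j < dim_col A * dim_col B * dim_col C"
    "i < dim_row A * (dim_row B * dim_row C)" "j < dim_col A * (dim_col B * dim_col C)"
    by (simp_all add: kron_def mult.assoc)
  show "kron (kron A B) C $$ (i, j) = kron A (kron B C) $$ (i, j)"
    unfolding kron_entry[OF kron_carrier[OF A B] C ij(1,2)] kron_entry[OF A kron_carrier[OF B C] ij(3,4)]
      kron_entry[OF A B index_less(1)[OF ij(1)] index_less(1)[OF ij(2)]]
      kron_entry[OF B C index_less(2)[OF ij(3)] index_less(2)[OF ij(4)]] d
    by (simp only: mult.assoc)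
qed (simp_all add: kron_def mult.assoc)

lemma kron_one: "kron (1\<^sub>m n) (1\<^sub>m m) = 1\<^sub>m (n * m)"
proof (rule eq_matI)
  fix i j assume "i < dim_row (1\<^sub>m (n * m))" "j < dim_col (1\<^sub>m (n * m))"
  then have ij: "i < n * m" "j < n * m" by simp_all
  then show "kron (1\<^sub>m n) (1\<^sub>m m) $$ (i, j) = 1\<^sub>m (n * m) $$ (i, j)"
    using index_less[OF ij(1)] index_less[OF ij(2)]
    by (auto simp: kron_def) (metis div_mult_mod_eq)
qed (simp_all add: kron_def)


lemma kron_one_1: "kron A (1\<^sub>m 1) = A" "kron (1\<^sub>m 1) A = A"
  by (rule eq_matI; simp add: kron_def)+


section \<open>Matrix-valued linear maps\<close>

text \<open>Matrices of all sizes share one type, which is not a vector space, so linearity of a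
  matrix-valued map has to be stated for a fixed format.\<close>

definition lin_mat :: "nat \<Rightarrow> nat \<Rightarrow> ('a::complex_vector \<Rightarrow> complex mat) \<Rightarrow> bool" where
  "lin_mat r c f \<longleftrightarrow> (\<forall>a. f a \<in> carrier_mat r c) \<and> (\<forall>a b. f (a + b) = f a + f b) \<and> (\<forall>x a. f (x *\<^sub>C a) = x \<cdot>\<^sub>m f a)"

lemma lin_matD:
  assumes "lin_mat r c f"
  shows "f a \<in> carrier_mat r c" "f (a + b) = f a + f b" "f (x *\<^sub>C a) = x \<cdot>\<^sub>m f a"
  using assms by (simp_all add: lin_mat_def)

lemma lin_mat_entry:
  assumes "lin_mat r c f" "i < r" "j < c"
  shows "linear_C (\<lambda>a. f a $$ (i, j))"
  using assms(2,3) carrier_matD[OF lin_matD(1)[OF assms(1)]]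
  by (intro linear_CI) (simp_all add: lin_matD(2,3)[OF assms(1)] scaleC_complex_def)

lemma lin_mat_comp: "lin_mat r c f \<Longrightarrow> linear_C g \<Longrightarrow> lin_mat r c (\<lambda>x. f (g x))"
  by (simp add: lin_mat_def linear_C_def)

lemma lin_mat_mult_right:
  assumes f: "lin_mat r n f" and C: "C \<in> carrier_mat n c"
  shows "lin_mat r c (\<lambda>x. f x * C)"
  unfolding lin_mat_def
  by (simp add: lin_matD(2,3)[OF f] add_mult_distrib_mat[OF lin_matD(1)[OF f] lin_matD(1)[OF f] C]
      mult_smult_assoc_mat[OF lin_matD(1)[OF f] C] mult_carrier_mat[OF lin_matD(1)[OF f] C])

lemma lin_mat_mult_left:
  assumes f: "lin_mat n c f" and C: "C \<in> carrier_mat r n"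
  shows "lin_mat r c (\<lambda>x. C * f x)"
  unfolding lin_mat_def
  by (simp add: lin_matD(2,3)[OF f] mult_add_distrib_mat[OF C lin_matD(1)[OF f] lin_matD(1)[OF f]]
      mult_smult_distrib[OF C lin_matD(1)[OF f]] mult_carrier_mat[OF C lin_matD(1)[OF f]])

lemma lin_mat_tensor_eq:
  assumes "lin_mat r c f" "lin_mat r c g" "\<And>a b. f (a \<otimes>\<^sub>C b) = g (a \<otimes>\<^sub>C b)"
  shows "f t = g t"
  by (induction t rule: tensor_induct) (simp_all add: assms lin_matD(2)[OF assms(1)] lin_matD(2)[OF assms(2)])

text \<open>The linear extension of \<open>a \<otimes> b \<mapsto> kron (f a) (g b)\<close>; the action of \<open>ext_tensor X Y\<close> is of this form.\<close>

definition kext :: "nat \<Rightarrow> nat \<Rightarrow> ('a::complex_vector \<Rightarrow> complex mat) \<Rightarrow> ('b::complex_vector \<Rightarrow> complex mat) \<Rightarrow> 'a \<otimes>\<^sub>C 'b \<Rightarrow> complex mat" where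
  "kext r c f g t = mat r c (\<lambda>ij. tlift (\<lambda>a b. kron (f a) (g b) $$ ij) t)"

lemma bilinear_kron:
  assumes "lin_mat r c f" "lin_mat r' c' g" "i < r * r'" "j < c * c'"
  shows "bilinear_C (\<lambda>a b. kron (f a) (g b) $$ (i, j))"
proof -
  note K = kron_carrier[OF lin_matD(1)[OF assms(1)] lin_matD(1)[OF assms(2)]]
  note A = kron_add[OF lin_matD(1)[OF assms(1)] lin_matD(1)[OF assms(1)] lin_matD(1)[OF assms(2)] lin_matD(1)[OF assms(2)]]
  have d: "dim_row (kron (f a) (g b)) = r * r'" "dim_col (kron (f a) (g b)) = c * c'" for a b
    using K by auto
  show ?thesis
    by (intro bilinear_CI linear_CI)
       (simp_all add: lin_matD(2,3)[OF assms(1)] lin_matD(2,3)[OF assms(2)] A d assms(3,4) scaleC_complex_def)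
qed

lemma kext_tens:
  assumes "lin_mat r c f" "lin_mat r' c' g"
  shows "kext (r * r') (c * c') f g (a \<otimes>\<^sub>C b) = kron (f a) (g b)"
  using kron_carrier[OF lin_matD(1)[OF assms(1)] lin_matD(1)[OF assms(2)], of a b]
  by (intro eq_matI) (auto simp: kext_def tlift_tens[OF bilinear_kron[OF assms]])

lemma lin_mat_kext:
  assumes "lin_mat r c f" "lin_mat r' c' g"
  shows "lin_mat (r * r') (c * c') (kext (r * r') (c * c') f g)"
  unfolding lin_mat_def kext_def
  by (auto intro!: eq_matI simp: tlift_add[OF bilinear_kron[OF assms]] tlift_scaleC[OF bilinear_kron[OF assms]] scaleC_complex_def)

lemma kext_comp:
  assumes f: "lin_mat r c f" and g: "lin_mat r' c' g" and u: "linear_C u" and v: "linear_C v"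
  shows "kext (r * r') (c * c') (\<lambda>a. f (u a)) (\<lambda>b. g (v b)) t = kext (r * r') (c * c') f g (tmap u v t)"
proof (rule lin_mat_tensor_eq[where g="\<lambda>t. kext (r * r') (c * c') f g (tmap u v t)"])
  note fu = lin_mat_comp[OF f u] and gv = lin_mat_comp[OF g v]
  show "lin_mat (r * r') (c * c') (kext (r * r') (c * c') (\<lambda>a. f (u a)) (\<lambda>b. g (v b)))"
    by (rule lin_mat_kext[OF fu gv])
  show "lin_mat (r * r') (c * c') (\<lambda>t. kext (r * r') (c * c') f g (tmap u v t))"
    by (rule lin_mat_comp[OF lin_mat_kext[OF f g] linear_C_tmap[OF u v]])
  show "kext (r * r') (c * c') (\<lambda>a. f (u a)) (\<lambda>b. g (v b)) (a \<otimes>\<^sub>C b) = kext (r * r') (c * c') f g (tmap u v (a \<otimes>\<^sub>C b))" for a b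
    by (simp only: kext_tens[OF fu gv] tmap_tens[OF u v] kext_tens[OF f g])
qed

lemma kext_mult_right:
  assumes f: "lin_mat r n f" and g: "lin_mat r' n' g" and C: "C \<in> carrier_mat n c" and D: "D \<in> carrier_mat n' c'"
  shows "kext (r * r') (n * n') f g t * kron C D = kext (r * r') (c * c') (\<lambda>a. f a * C) (\<lambda>b. g b * D) t"
proof (rule lin_mat_tensor_eq[where f="\<lambda>t. kext (r * r') (n * n') f g t * kron C D"])
  note fC = lin_mat_mult_right[OF f C] and gD = lin_mat_mult_right[OF g D]
  show "lin_mat (r * r') (c * c') (\<lambda>t. kext (r * r') (n * n') f g t * kron C D)"
    by (rule lin_mat_mult_right[OF lin_mat_kext[OF f g] kron_carrier[OF C D]])
  show "lin_mat (r * r') (c * c') (kext (r * r') (c * c') (\<lambda>a. f a * C) (\<lambda>b. g b * D))"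
    by (rule lin_mat_kext[OF fC gD])
  show "kext (r * r') (n * n') f g (a \<otimes>\<^sub>C b) * kron C D = kext (r * r') (c * c') (\<lambda>a. f a * C) (\<lambda>b. g b * D) (a \<otimes>\<^sub>C b)" for a b
    unfolding kext_tens[OF f g] kext_tens[OF fC gD]
    by (rule kron_mult[OF lin_matD(1)[OF f] C lin_matD(1)[OF g] D])
qed

lemma kext_mult_left:
  assumes f: "lin_mat n c f" and g: "lin_mat n' c' g" and C: "C \<in> carrier_mat r n" and D: "D \<in> carrier_mat r' n'"
  shows "kron C D * kext (n * n') (c * c') f g t = kext (r * r') (c * c') (\<lambda>a. C * f a) (\<lambda>b. D * g b) t"
proof (rule lin_mat_tensor_eq[where f="\<lambda>t. kron C D * kext (n * n') (c * c') f g t"])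
  note fC = lin_mat_mult_left[OF f C] and gD = lin_mat_mult_left[OF g D]
  show "lin_mat (r * r') (c * c') (\<lambda>t. kron C D * kext (n * n') (c * c') f g t)"
    by (rule lin_mat_mult_left[OF lin_mat_kext[OF f g] kron_carrier[OF C D]])
  show "lin_mat (r * r') (c * c') (kext (r * r') (c * c') (\<lambda>a. C * f a) (\<lambda>b. D * g b))"
    by (rule lin_mat_kext[OF fC gD])
  show "kron C D * kext (n * n') (c * c') f g (a \<otimes>\<^sub>C b) = kext (r * r') (c * c') (\<lambda>a. C * f a) (\<lambda>b. D * g b) (a \<otimes>\<^sub>C b)" for a b
    unfolding kext_tens[OF f g] kext_tens[OF fC gD]
    by (rule kron_mult[OF C lin_matD(1)[OF f] D lin_matD(1)[OF g]])
qed

definition vrow :: "nat \<Rightarrow> nat \<Rightarrow> complex mat \<Rightarrow> complex mat" where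
  "vrow n n' B = mat 1 (n * n') (\<lambda>(_, k). B $$ (k div n', k mod n'))"

lemma lin_mat_vrow:
  assumes "lin_mat n n' f" shows "lin_mat 1 (n * n') (\<lambda>a. vrow n n' (f a))"
  using carrier_matD[OF lin_matD(1)[OF assms]] lin_matD(2,3)[OF assms] unfolding lin_mat_def vrow_def
  by (auto intro!: eq_matI simp: index_less)

text \<open>
  The row \<open>vrow B\<close> is the functional \<open>\<phi> \<otimes> x \<mapsto> \<phi>(B x)\<close>; precomposing it with the tensor product of
  a dual map and a map multiplies \<open>B\<close> from both sides.
\<close>

lemma vrow_mult_kron:
  assumes B: "B \<in> carrier_mat n n'" and U: "U \<in> carrier_mat n m" and W: "W \<in> carrier_mat n' m'"
  shows "vrow n n' B * kron U W = vrow m m' (transpose_mat U * B * W)"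
proof (rule eq_matI)
  have V: "vrow n n' B \<in> carrier_mat 1 (n * n')" by (simp add: vrow_def)
  note K = kron_carrier[OF U W]
  have UB: "transpose_mat U * B \<in> carrier_mat m n'" using U B by auto
  fix i j assume "i < dim_row (vrow m m' (transpose_mat U * B * W))" "j < dim_col (vrow m m' (transpose_mat U * B * W))"
  then have i: "i < 1" and j: "j < m * m'" by (simp_all add: vrow_def)
  note jj = index_less[OF j]
  have "(vrow n n' B * kron U W) $$ (i, j) = (\<Sum>k<n * n'. B $$ (k div n', k mod n') * (U $$ (k div n', j div m') * W $$ (k mod n', j mod m')))"
    unfolding mat_mult_entry[OF V K i j] using i
    by (intro sum.cong refl) (simp add: vrow_def kron_entry[OF U W _ j])
  also have "\<dots> = (\<Sum>k<n. \<Sum>l<n'. B $$ (k, l) * (U $$ (k, j div m') * W $$ (l, j mod m')))"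
    by (rule sum_prod_index)
  also have "\<dots> = (\<Sum>l<n'. \<Sum>k<n. B $$ (k, l) * (U $$ (k, j div m') * W $$ (l, j mod m')))"
    by (rule sum.swap)
  also have "\<dots> = (\<Sum>l<n'. (\<Sum>k<n. transpose_mat U $$ (j div m', k) * B $$ (k, l)) * W $$ (l, j mod m'))"
    unfolding sum_distrib_right using U jj by (intro sum.cong refl) simp
  also have "\<dots> = (\<Sum>l<n'. (transpose_mat U * B) $$ (j div m', l) * W $$ (l, j mod m'))"
  proof (intro sum.cong refl arg_cong2[where f="(*)"])
    fix l assume "l \<in> {..<n'}"
    then have l: "l < n'" by simp
    have "transpose_mat U \<in> carrier_mat m n" using U by simp
    from mat_mult_entry[OF this B jj(1) l]
    show "(\<Sum>k<n. transpose_mat U $$ (j div m', k) * B $$ (k, l)) = (transpose_mat U * B) $$ (j div m', l)" by simp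
  qed
  also have "\<dots> = (transpose_mat U * B * W) $$ (j div m', j mod m')"
    using jj by (simp only: mat_mult_entry[OF UB W])
  finally show "(vrow n n' B * kron U W) $$ (i, j) = vrow m m' (transpose_mat U * B * W) $$ (i, j)"
    using i j by (simp add: vrow_def)
qed (use assms in \<open>auto simp: vrow_def kron_def\<close>)


section \<open>Modules\<close>

lemma is_moduleD:
  assumes "is_module X"
  shows "lin_mat (rdim X) (rdim X) (act X)" "act X a \<in> carrier_mat (rdim X) (rdim X)"
    "act X 1 = 1\<^sub>m (rdim X)" "act X (a * b) = act X a * act X b"
  using assms by (simp_all add: is_module_def lin_mat_def)

lemma is_moduleI:
  assumes "lin_mat (rdim X) (rdim X) (act X)" "act X 1 = 1\<^sub>m (rdim X)" "\<And>a b. act X (a * b) = act X a * act X b"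
  shows "is_module X"
  using assms by (simp add: is_module_def lin_mat_def)

lemma rdim_ext: "rdim (ext_tensor X Y) = rdim X * rdim Y"
  by (simp add: ext_tensor_def)

lemma rdim_simps: "rdim (tensor_mod H X Y) = rdim X * rdim Y"
  "rdim (dual_mod H X) = rdim X" "act (dual_mod H X) a = transpose_mat (act X (antipode H a))"
  "act (tensor_mod H X Y) a = act (ext_tensor X Y) (comult H a)"
  by (simp_all add: tensor_mod_def dual_mod_def)

lemma act_ext: "act (ext_tensor X Y) = kext (rdim X * rdim Y) (rdim X * rdim Y) (act X) (act Y)"
  by (simp add: ext_tensor_def kext_def fun_eq_iff)

lemma act_ext_tens:
  assumes "is_module X" "is_module Y"
  shows "act (ext_tensor X Y) (a \<otimes>\<^sub>C b) = kron (act X a) (act Y b)"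
  unfolding act_ext by (rule kext_tens[OF is_moduleD(1)[OF assms(1)] is_moduleD(1)[OF assms(2)]])

lemma lin_mat_ext:
  assumes "is_module X" "is_module Y"
  shows "lin_mat (rdim X * rdim Y) (rdim X * rdim Y) (act (ext_tensor X Y))"
  unfolding act_ext by (rule lin_mat_kext[OF is_moduleD(1)[OF assms(1)] is_moduleD(1)[OF assms(2)]])

lemma is_module_ext:
  assumes X: "is_module X" and Y: "is_module Y"
  shows "is_module (ext_tensor X Y)"
proof (rule is_moduleI, unfold rdim_ext)
  note L = lin_mat_ext[OF X Y] and x = is_moduleD[OF X] and y = is_moduleD[OF Y]
  show "lin_mat (rdim X * rdim Y) (rdim X * rdim Y) (act (ext_tensor X Y))" by (rule L)
  show "act (ext_tensor X Y) 1 = 1\<^sub>m (rdim X * rdim Y)"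
    by (simp add: one_tensor_def act_ext_tens[OF X Y] x y kron_one)
  fix s t
  show "act (ext_tensor X Y) (s * t) = act (ext_tensor X Y) s * act (ext_tensor X Y) t"
  proof (induction s rule: tensor_induct)
    case (tens a b)
    show ?case
    proof (rule lin_mat_tensor_eq[where f="\<lambda>t. act (ext_tensor X Y) ((a \<otimes>\<^sub>C b) * t)" and g="\<lambda>t. act (ext_tensor X Y) (a \<otimes>\<^sub>C b) * act (ext_tensor X Y) t"])
      show "lin_mat (rdim X * rdim Y) (rdim X * rdim Y) (\<lambda>t. act (ext_tensor X Y) ((a \<otimes>\<^sub>C b) * t))"
        by (rule lin_mat_comp[OF L linear_C_mult(2)])
      show "lin_mat (rdim X * rdim Y) (rdim X * rdim Y) (\<lambda>t. act (ext_tensor X Y) (a \<otimes>\<^sub>C b) * act (ext_tensor X Y) t)"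
        by (rule lin_mat_mult_left[OF L lin_matD(1)[OF L]])
      show "act (ext_tensor X Y) ((a \<otimes>\<^sub>C b) * (c \<otimes>\<^sub>C e)) = act (ext_tensor X Y) (a \<otimes>\<^sub>C b) * act (ext_tensor X Y) (c \<otimes>\<^sub>C e)" for c e
        by (simp add: tens_mult act_ext_tens[OF X Y] x(4) y(4) kron_mult[OF x(2) x(2) y(2) y(2)])
    qed
  next
    case (add s s')
    then show ?case
      by (simp add: distrib_right lin_matD(2)[OF L] add_mult_distrib_mat[OF lin_matD(1)[OF L] lin_matD(1)[OF L] lin_matD(1)[OF L]])
  qed
qed

lemma is_module_pullback:
  assumes "is_module Z" "algebra_hom f" "rdim X = rdim Z" "\<And>a. act X a = act Z (f a)"
  shows "is_module X"
proof (rule is_moduleI)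
  have a: "act X = (\<lambda>a. act Z (f a))" using assms(4) by auto
  show "lin_mat (rdim X) (rdim X) (act X)"
    unfolding a assms(3) by (rule lin_mat_comp[OF is_moduleD(1)[OF assms(1)] algebra_homD(1)[OF assms(2)]])
qed (simp_all add: assms(3,4) algebra_homD(2,3)[OF assms(2)] is_moduleD(3,4)[OF assms(1)])

text \<open>Restriction along \<open>f\<close> is moved from the module into the algebra. With a
  comultiplication for \<open>f\<close> this handles associators in which one argument is itself a
  tensor product.\<close>

lemma act_ext_pullback:
  assumes X: "is_module X" and Z: "is_module Z" and f: "linear_C f" and d: "rdim Z' = rdim Z" "\<And>a. act Z' a = act Z (f a)"
  shows "act (ext_tensor X Z') t = act (ext_tensor X Z) (tmap id f t)"
proof -
  have "act Z' = (\<lambda>a. act Z (f a))" using d(2) by auto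
  then show ?thesis
    using kext_comp[OF is_moduleD(1)[OF X] is_moduleD(1)[OF Z] linear_C_id(1) f, of t] by (simp add: act_ext d(1))
qed

lemma act_ext_one_tens:
  assumes "is_module X" "is_module Z"
  shows "kron (1\<^sub>m (rdim X)) (act Z t) = act (ext_tensor X Z) (1 \<otimes>\<^sub>C t)"
    "kron (act X s) (1\<^sub>m (rdim Z)) = act (ext_tensor X Z) (s \<otimes>\<^sub>C 1)"
  by (simp_all add: act_ext_tens[OF assms] is_moduleD[OF assms(1)] is_moduleD[OF assms(2)])

text \<open>\<open>kron\<close> is strictly associative, so both bracketings act by the same
  matrices on the same space.\<close>

lemma act_ext_assoc:
  assumes X: "is_module X" and Y: "is_module Y" and Z: "is_module Z"
  shows "act (ext_tensor (ext_tensor X Y) Z) t = act (ext_tensor X (ext_tensor Y Z)) (tassoc t)"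
proof (rule lin_mat_tensor_eq[where f="act (ext_tensor (ext_tensor X Y) Z)" and g="\<lambda>t. act (ext_tensor X (ext_tensor Y Z)) (tassoc t)"])
  note XY = is_module_ext[OF X Y] and YZ = is_module_ext[OF Y Z]
  let ?d = "rdim X * rdim Y * rdim Z"
  show L: "lin_mat ?d ?d (act (ext_tensor (ext_tensor X Y) Z))"
    using lin_mat_ext[OF XY Z] by (simp add: rdim_ext)
  show R: "lin_mat ?d ?d (\<lambda>t. act (ext_tensor X (ext_tensor Y Z)) (tassoc t))"
    using lin_mat_comp[OF lin_mat_ext[OF X YZ] linear_C_tassoc] by (simp add: rdim_ext mult.assoc)
  show "act (ext_tensor (ext_tensor X Y) Z) (s \<otimes>\<^sub>C c) = act (ext_tensor X (ext_tensor Y Z)) (tassoc (s \<otimes>\<^sub>C c))" for s c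
  proof (rule lin_mat_tensor_eq[where f="\<lambda>s. act (ext_tensor (ext_tensor X Y) Z) (s \<otimes>\<^sub>C c)" and g="\<lambda>s. act (ext_tensor X (ext_tensor Y Z)) (tassoc (s \<otimes>\<^sub>C c))"])
    show "lin_mat ?d ?d (\<lambda>s. act (ext_tensor (ext_tensor X Y) Z) (s \<otimes>\<^sub>C c))"
      by (rule lin_mat_comp[OF L linear_C_tens(1)])
    show "lin_mat ?d ?d (\<lambda>s. act (ext_tensor X (ext_tensor Y Z)) (tassoc (s \<otimes>\<^sub>C c)))"
      by (rule lin_mat_comp[OF R linear_C_tens(1)])
    show "act (ext_tensor (ext_tensor X Y) Z) ((a \<otimes>\<^sub>C b) \<otimes>\<^sub>C c) = act (ext_tensor X (ext_tensor Y Z)) (tassoc ((a \<otimes>\<^sub>C b) \<otimes>\<^sub>C c))" for a b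
      by (simp add: act_ext_tens X Y Z XY YZ tassoc_tens kron_assoc)
  qed
qed

lemma flip_mat_conj:
  assumes A: "A \<in> carrier_mat m m" and B: "B \<in> carrier_mat n n"
  shows "flip_mat m n * kron A B * flip_mat n m = kron B A"
proof -
  have F: "flip_mat m n \<in> carrier_mat (n * m) (m * n)" for m n by (simp add: flip_mat_def)
  note K = kron_carrier[OF A B] kron_carrier[OF B A]
  have lt: "i mod n * m + i div n < n * m" if "i < m * n" for i m n :: nat
  proof -
    have "i mod n < n" "i div n < m" using index_less[OF that] by auto
    then have "i mod n * m + i div n < i mod n * m + m" by simp
    also have "\<dots> = (i mod n + 1) * m" by simp
    also have "\<dots> \<le> n * m" using \<open>i mod n < n\<close> by (intro mult_le_mono1) simp
    finally show ?thesis .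
  qed
  \<comment> \<open>The exchanges of coordinates for the formats \<open>n * m\<close> and
    \<open>m * n\<close> are inverse to each other, so a row of \<open>flip_mat\<close> selects
    exactly one summand.\<close>
  have inv: "i = j mod n * m + j div n \<longleftrightarrow> j = i mod m * n + i div m" if "i < n * m" "j < m * n" for i j m n :: nat
    using index_less[OF that(1)] index_less[OF that(2)] by (auto simp: div_mult_mod_eq mult.commute)
  have 1: "flip_mat m n * C = mat (n * m) c (\<lambda>(i, j). C $$ (i mod m * n + i div m, j))" if C: "C \<in> carrier_mat (m * n) c" for C c
  proof (rule eq_matI)
    fix i j assume "i < dim_row (mat (n * m) c (\<lambda>(i, j). C $$ (i mod m * n + i div m, j)))" "j < dim_col (mat (n * m) c (\<lambda>(i, j). C $$ (i mod m * n + i div m, j)))"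
    then have ij: "i < n * m" "j < c" by simp_all
    have "(flip_mat m n * C) $$ (i, j) = (\<Sum>k<m * n. if k = i mod m * n + i div m then C $$ (k, j) else 0)"
      unfolding mat_mult_entry[OF F C ij] using ij by (intro sum.cong refl) (auto simp: flip_mat_def inv[OF ij(1)])
    then show "(flip_mat m n * C) $$ (i, j) = mat (n * m) c (\<lambda>(i, j). C $$ (i mod m * n + i div m, j)) $$ (i, j)"
      using ij lt[OF ij(1)] by simp
  qed (use C F in auto)
  have 2: "C * flip_mat n m = mat r (n * m) (\<lambda>(i, j). C $$ (i, j mod m * n + j div m))" if C: "C \<in> carrier_mat r (m * n)" for C r
  proof (rule eq_matI)
    fix i j assume "i < dim_row (mat r (n * m) (\<lambda>(i, j). C $$ (i, j mod m * n + j div m)))" "j < dim_col (mat r (n * m) (\<lambda>(i, j). C $$ (i, j mod m * n + j div m)))"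
    then have ij: "i < r" "j < n * m" by simp_all
    have "(C * flip_mat n m) $$ (i, j) = (\<Sum>k<m * n. if k = j mod m * n + j div m then C $$ (i, k) else 0)"
      unfolding mat_mult_entry[OF C F ij] using ij by (intro sum.cong refl) (auto simp: flip_mat_def)
    then show "(C * flip_mat n m) $$ (i, j) = mat r (n * m) (\<lambda>(i, j). C $$ (i, j mod m * n + j div m)) $$ (i, j)"
      using ij lt[OF ij(2)] by simp
  qed (use C F in auto)
  show ?thesis
  proof (rule eq_matI)
    fix i j assume "i < dim_row (kron B A)" "j < dim_col (kron B A)"
    then have ij: "i < n * m" "j < n * m" using K by auto
    note i = index_less[OF ij(1)] and j = index_less[OF ij(2)]
    have "(flip_mat m n * kron A B * flip_mat n m) $$ (i, j) = kron A B $$ (i mod m * n + i div m, j mod m * n + j div m)"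
      using ij lt[OF ij(2)] by (simp add: 1[OF K(1)] 2[of _ "n * m"])
    also have "\<dots> = kron B A $$ (i, j)"
      unfolding kron_entry[OF A B lt[OF ij(1)] lt[OF ij(2)]] kron_entry[OF B A ij] using i j by simp
    finally show "(flip_mat m n * kron A B * flip_mat n m) $$ (i, j) = kron B A $$ (i, j)" .
  qed (use K F in \<open>auto simp: flip_mat_def\<close>)
qed

lemma act_ext_flip:
  assumes X: "is_module X" and Y: "is_module Y"
  shows "flip_mat (rdim Y) (rdim X) * act (ext_tensor Y X) t * flip_mat (rdim X) (rdim Y) = act (ext_tensor X Y) (tflip t)"
proof (rule lin_mat_tensor_eq[where f="\<lambda>t. flip_mat (rdim Y) (rdim X) * act (ext_tensor Y X) t * flip_mat (rdim X) (rdim Y)" and g="\<lambda>t. act (ext_tensor X Y) (tflip t)"])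
  have F: "flip_mat m n \<in> carrier_mat (n * m) (m * n)" for m n by (simp add: flip_mat_def)
  show "lin_mat (rdim X * rdim Y) (rdim X * rdim Y) (\<lambda>t. flip_mat (rdim Y) (rdim X) * act (ext_tensor Y X) t * flip_mat (rdim X) (rdim Y))"
    by (rule lin_mat_mult_right[OF lin_mat_mult_left[OF lin_mat_ext[OF Y X] F] F])
  show "lin_mat (rdim X * rdim Y) (rdim X * rdim Y) (\<lambda>t. act (ext_tensor X Y) (tflip t))"
    by (rule lin_mat_comp[OF lin_mat_ext[OF X Y] algebra_homD(1)[OF algebra_hom_tflip]])
  show "flip_mat (rdim Y) (rdim X) * act (ext_tensor Y X) (a \<otimes>\<^sub>C b) * flip_mat (rdim X) (rdim Y) = act (ext_tensor X Y) (tflip (a \<otimes>\<^sub>C b))" for a b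
    by (simp add: act_ext_tens X Y tflip_tens flip_mat_conj is_moduleD(2)[OF X] is_moduleD(2)[OF Y])
qed


section \<open>The coend and its Hopf pairing\<close>

lemma intertwine_mult: "x * a = b * x \<Longrightarrow> y * b = c * y \<Longrightarrow> (y * x) * a = c * (y * x)"
  for x :: "'b::semigroup_mult"
  by (metis mult.assoc)

lemma intertwine_inverse: "x * a = b * x \<Longrightarrow> x * y = 1 \<Longrightarrow> y * x = 1 \<Longrightarrow> y * b = a * y"
  for x :: "'b::monoid_mult"
  by (metis mult.assoc mult_1_left mult_1_right)

lemma tens_one_intertwine:
  assumes L: "linear_C L" and R: "linear_C R" and c: "\<And>b. c * L b = R b * c"
  shows "(1 \<otimes>\<^sub>C c) * tmap id L s = tmap id R s * (1 \<otimes>\<^sub>C (c :: 'b::complex_algebra))"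
proof (induction s rule: tensor_induct)
  case (tens a b)
  show ?case
    by (simp only: tmap_tens[OF linear_C_id(1) L] tmap_tens[OF linear_C_id(1) R] tens_mult c mult_1_left mult_1_right)
next
  case (add s t)
  then show ?case
    by (simp only: linear_C_add[OF linear_C_tmap[OF linear_C_id(1) L]] linear_C_add[OF linear_C_tmap[OF linear_C_id(1) R]]
        distrib_left distrib_right)
qed

lemma lin_mat_transpose:
  assumes "lin_mat r c f" shows "lin_mat c r (\<lambda>a. transpose_mat (f a))"
  using carrier_matD[OF lin_matD(1)[OF assms]] lin_matD[OF assms] unfolding lin_mat_def
  by (auto intro!: eq_matI)

section \<open>The adjoint action and contraction with the antipode\<close>

context quasi_hopf_algebra
begin

text \<open>\<open>contract t a = S(t\<^sub>1) a t\<^sub>2\<close>; the adjoint action is \<open>a \<mapsto> contract (comult H h) a\<close>.\<close>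

definition contract :: "'a \<otimes>\<^sub>C 'a \<Rightarrow> 'a \<Rightarrow> 'a" where
  "contract t a = tlift (\<lambda>x y. antipode H x * a * y) t"

definition adj :: "'a \<Rightarrow> 'a \<Rightarrow> 'a" where
  "adj h = contract (comult H h)"

lemma antipode_simps: "linear_C (antipode H)" "antipode H 1 = 1" "antipode H (x * y) = antipode H y * antipode H x"
  using antipode_antihom by (simp_all add: algebra_antihom_def)

lemma bilinear_C_contract_ant: "bilinear_C (\<lambda>x y. antipode H x * a * y)"
  by (intro bilinear_CI linear_CI)
     (simp_all add: linear_C_simps[OF antipode_simps(1)] distrib_left distrib_right scaleC_mult_left scaleC_mult_right)

lemma contract_tens: "contract (x \<otimes>\<^sub>C y) a = antipode H x * a * y"
  unfolding contract_def by (rule tlift_tens[OF bilinear_C_contract_ant])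

lemma linear_C_contract: "linear_C (\<lambda>t. contract t a)"
  unfolding contract_def by (rule linear_C_tlift[OF bilinear_C_contract_ant])

lemma linear_C_contract2: "linear_C (contract t)"
proof (induction t rule: tensor_induct)
  case (tens x y)
  show ?case by (simp add: contract_tens[abs_def] linear_C_mult)
next
  case (add s t)
  then show ?case by (simp add: linear_C_def linear_C_add[OF linear_C_contract] scaleC_add_right)
qed

lemma contract_mult: "contract (s * t) a = contract t (contract s a)"
proof (induction s rule: tensor_induct)
  case (tens x y)
  show ?case
    by (rule tensor_linear_eq[where f="\<lambda>t. contract ((x \<otimes>\<^sub>C y) * t) a"])
       (simp_all add: linear_C_comp[OF linear_C_contract linear_C_mult(2)] linear_C_contract tens_mult contract_tens
         antipode_simps mult.assoc)
next
  case (add s s')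
  then show ?case by (simp add: distrib_right linear_C_add[OF linear_C_contract] linear_C_add[OF linear_C_contract2])
qed

lemma linear_C_adj: "linear_C (adj h)" "linear_C (\<lambda>h. adj h a)"
  unfolding adj_def
  by (rule linear_C_contract2, rule linear_C_comp[OF linear_C_contract algebra_homD(1)[OF comult_hom]])

text \<open>The antipode reverses products, so this is a right action of H on itself. Its transpose
  is a left action on the dual of H, which becomes the module structure of the coend.\<close>

lemma adj_mult: "adj (h * k) a = adj k (adj h a)"
  by (simp add: adj_def algebra_homD(3)[OF comult_hom] contract_mult)

lemma adj_one: "adj 1 a = a"
  by (simp add: adj_def algebra_homD(2)[OF comult_hom] one_tensor_def contract_tens antipode_simps)

text \<open>The left factor is contracted first, directly against \<open>alpha_el\<close>, where the
  antipode axiom reduces a coproduct to its counit.\<close>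

lemma contract_comult_left: "contract (comult H x * t) (alpha_el H) = counit H x *\<^sub>C contract t (alpha_el H)"
  using antipode_alpha[of x]
  by (simp add: contract_mult contract_def[of "comult H x"] linear_C_scale[OF linear_C_contract2])

definition ad2 :: "'a \<otimes>\<^sub>C 'a \<Rightarrow> 'a \<otimes>\<^sub>C 'a \<Rightarrow> 'a \<otimes>\<^sub>C 'a" where
  "ad2 s t = tlift (\<lambda>x y. tmap (adj x) (adj y) t) s"

lemma bilinear_C_ad2: "bilinear_C (\<lambda>x y. tmap (adj x) (adj y) t)"
proof (induction t rule: tensor_induct)
  case (tens a b)
  show ?case
    by (simp add: tmap_tens linear_C_adj bilinear_C_tmap)
next
  case (add s t)
  then show ?case
    by (simp add: linear_C_add[OF linear_C_tmap[OF linear_C_adj(1) linear_C_adj(1)]] bilinear_C_def linear_C_def scaleC_add_right)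
qed

text \<open>The two evaluations, applied after an element has acted on the tensor product of the
  dual of X, X, the dual of Y and Y, written on the level of the algebra.\<close>

definition trace2 :: "('a \<otimes>\<^sub>C 'a) \<otimes>\<^sub>C ('a \<otimes>\<^sub>C 'a) \<Rightarrow> 'a \<otimes>\<^sub>C 'a" where
  "trace2 = tmap (\<lambda>t. contract t (alpha_el H)) (\<lambda>t. contract t (alpha_el H))"

lemma linear_C_trace2: "linear_C trace2"
  unfolding trace2_def by (intro linear_C_tmap linear_C_contract)

lemma trace2_tens: "trace2 (s \<otimes>\<^sub>C t) = contract s (alpha_el H) \<otimes>\<^sub>C contract t (alpha_el H)"
  unfolding trace2_def by (intro tmap_tens linear_C_contract)

lemma algebra_hom_comult2: "algebra_hom (tmap (comult H) (comult H))"
  by (intro algebra_hom_tmap comult_hom)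

text \<open>\<open>S (a x) \<alpha> (b y) = S x (S a \<alpha> b) y\<close>: a factor on the right
  acts from outside on what has been contracted already.\<close>

lemma trace2_mult_right: "trace2 (g * tmap (comult H) (comult H) s) = ad2 s (trace2 g)"
proof (rule tensor_linear_eq[where f="\<lambda>s. trace2 (g * tmap (comult H) (comult H) s)"])
  show "linear_C (\<lambda>s. trace2 (g * tmap (comult H) (comult H) s))"
    by (intro linear_C_comp[OF linear_C_trace2] linear_C_comp[OF linear_C_mult(2)] algebra_homD(1)[OF algebra_hom_comult2])
  show "linear_C (\<lambda>s. ad2 s (trace2 g))"
    unfolding ad2_def by (rule linear_C_tlift[OF bilinear_C_ad2])
  fix x y
  show "trace2 (g * tmap (comult H) (comult H) (x \<otimes>\<^sub>C y)) = ad2 (x \<otimes>\<^sub>C y) (trace2 g)"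
    unfolding ad2_def tlift_tens[OF bilinear_C_ad2]
      tmap_tens[OF algebra_homD(1)[OF comult_hom] algebra_homD(1)[OF comult_hom]]
  proof (induction g rule: tensor_induct)
    case (tens a b)
    show ?case by (simp add: tens_mult trace2_tens contract_mult tmap_tens linear_C_adj) (simp add: adj_def)
  next
    case (add g g')
    then show ?case by (simp add: distrib_right linear_C_add[OF linear_C_trace2] linear_C_add[OF linear_C_tmap] linear_C_adj)
  qed
qed

text \<open>A factor on the left meets \<open>alpha_el\<close> in both pairs and leaves two counits,
  which collapse to one because \<open>comult H h\<close> has been comultiplied in both
  legs.\<close>

lemma trace2_mult_left: "trace2 (tmap (comult H) (comult H) (comult H h) * g) = counit H h *\<^sub>C trace2 g"
proof -
  have "trace2 (tmap (comult H) (comult H) s * g) = counit H (tlift (\<lambda>x y. counit H x *\<^sub>C y) s) *\<^sub>C trace2 g" for s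
  proof (rule tensor_linear_eq[where f="\<lambda>s. trace2 (tmap (comult H) (comult H) s * g)"])
    note e = algebra_homD(1)[OF counit_hom]
    have b: "bilinear_C (\<lambda>x y. counit H x *\<^sub>C (y :: 'a))"
      by (intro bilinear_CI linear_CI) (simp_all add: linear_C_simps[OF e] scaleC_add_left scaleC_add_right scaleC_scaleC scaleC_complex_def mult.commute)
    show "linear_C (\<lambda>s. trace2 (tmap (comult H) (comult H) s * g))"
      by (intro linear_C_comp[OF linear_C_trace2] linear_C_comp[OF linear_C_mult(3)] algebra_homD(1)[OF algebra_hom_comult2])
    show "linear_C (\<lambda>s. counit H (tlift (\<lambda>x y. counit H x *\<^sub>C y) s) *\<^sub>C trace2 g)"
      by (rule linear_C_scale_const[OF linear_C_comp[OF e linear_C_tlift[OF b]]])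
    fix x y
    show "trace2 (tmap (comult H) (comult H) (x \<otimes>\<^sub>C y) * g) = counit H (tlift (\<lambda>x y. counit H x *\<^sub>C y) (x \<otimes>\<^sub>C y)) *\<^sub>C trace2 g"
      unfolding tlift_tens[OF b] tmap_tens[OF algebra_homD(1)[OF comult_hom] algebra_homD(1)[OF comult_hom]] linear_C_scale[OF e]
    proof (induction g rule: tensor_induct)
      case (tens a b)
      show ?case
        by (simp add: tens_mult trace2_tens contract_comult_left tens_scaleC_left tens_scaleC_right scaleC_scaleC scaleC_complex_def)
    next
      case (add g g')
      then show ?case by (simp add: distrib_left linear_C_add[OF linear_C_trace2] scaleC_add_right)
    qed
  qed
  then show ?thesis by (simp add: counit_left)
qed

text \<open>Turns an element acting on three modules into the one that acts when the third module is
  itself a tensor product, as for the outer associators of the pairing.\<close>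

definition cocycle4 :: "'a \<otimes>\<^sub>C 'a \<otimes>\<^sub>C 'a \<Rightarrow> 'a \<otimes>\<^sub>C 'a \<otimes>\<^sub>C 'a \<otimes>\<^sub>C 'a" where
  "cocycle4 = tmap id (tmap id (comult H))"

lemma algebra_hom_cocycle4: "algebra_hom cocycle4"
  unfolding cocycle4_def by (intro algebra_hom_tmap algebra_hom_id comult_hom)

lemma is_module_dual:
  assumes "is_module X" shows "is_module (dual_mod H X)"
proof (rule is_moduleI, unfold rdim_simps)
  note x = is_moduleD[OF assms]
  have l: "lin_mat (rdim X) (rdim X) (\<lambda>a. act X (antipode H a))" by (rule lin_mat_comp[OF x(1) antipode_simps(1)])
  show "lin_mat (rdim X) (rdim X) (\<lambda>a. transpose_mat (act X (antipode H a)))"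
    by (rule lin_mat_transpose[OF l])
  show "transpose_mat (act X (antipode H 1)) = 1\<^sub>m (rdim X)" by (simp add: antipode_simps x)
  show "transpose_mat (act X (antipode H (a * b))) = transpose_mat (act X (antipode H a)) * transpose_mat (act X (antipode H b))" for a b
    by (simp add: antipode_simps x(4) transpose_mult[OF x(2) x(2)])
qed

lemma is_module_tensor: "is_module X \<Longrightarrow> is_module Y \<Longrightarrow> is_module (tensor_mod H X Y)"
  by (rule is_module_pullback[OF is_module_ext comult_hom]) (simp_all add: rdim_simps rdim_ext)

text \<open>The dual module acts by transposed antipodes, so composing a functional on the tensor
  product of the dual of X with X with the action is a contraction inside the algebra.\<close>

lemma vrow_act:
  assumes X: "is_module X"
  shows "vrow (rdim X) (rdim X) (act X a) * act (ext_tensor (dual_mod H X) X) t = vrow (rdim X) (rdim X) (act X (contract t a))"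
proof (rule lin_mat_tensor_eq[where f="\<lambda>t. vrow (rdim X) (rdim X) (act X a) * act (ext_tensor (dual_mod H X) X) t"])
  let ?n = "rdim X"
  note x = is_moduleD[OF X] and D = is_module_dual[OF X]
  have V: "vrow ?n ?n (act X a) \<in> carrier_mat 1 (?n * ?n)" by (simp add: vrow_def)
  show "lin_mat 1 (?n * ?n) (\<lambda>t. vrow ?n ?n (act X a) * act (ext_tensor (dual_mod H X) X) t)"
    by (rule lin_mat_mult_left[OF _ V]) (use lin_mat_ext[OF D X] in \<open>simp add: rdim_simps\<close>)
  show "lin_mat 1 (?n * ?n) (\<lambda>t. vrow ?n ?n (act X (contract t a)))"
    by (rule lin_mat_vrow[OF lin_mat_comp[OF x(1) linear_C_contract]])
  fix b c
  have "transpose_mat (act X (antipode H b)) \<in> carrier_mat ?n ?n" using x(2) by simp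
  from vrow_mult_kron[OF x(2) this x(2)]
  show "vrow ?n ?n (act X a) * act (ext_tensor (dual_mod H X) X) (b \<otimes>\<^sub>C c) = vrow ?n ?n (act X (contract (b \<otimes>\<^sub>C c) a))"
    by (simp add: act_ext_tens[OF D X] rdim_simps contract_tens x(4))
qed

end

section \<open>The double braiding pairing as an element of the tensor square\<close>

context quasi_triangular_quasi_hopf_algebra
begin

abbreviation "coassoc_inv \<equiv> inverse_el (coassoc H)"
abbreviation "monodromy \<equiv> tflip (R_matrix H) * R_matrix H"

definition dbp_el :: "'a \<otimes>\<^sub>C 'a \<otimes>\<^sub>C 'a \<otimes>\<^sub>C 'a" where
  "dbp_el = cocycle4 (coassoc H) * (1 \<otimes>\<^sub>C coassoc_inv) * (1 \<otimes>\<^sub>C tassoc (monodromy \<otimes>\<^sub>C 1)) * (1 \<otimes>\<^sub>C coassoc H) * cocycle4 coassoc_inv"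

definition tunassoc :: "'a \<otimes>\<^sub>C 'a \<otimes>\<^sub>C 'a \<otimes>\<^sub>C 'a \<Rightarrow> ('a \<otimes>\<^sub>C 'a) \<otimes>\<^sub>C ('a \<otimes>\<^sub>C 'a)" where
  "tunassoc = tlift3 (\<lambda>a b z. (a \<otimes>\<^sub>C b) \<otimes>\<^sub>C z)"

definition pairing_el :: "'a \<otimes>\<^sub>C 'a" where
  "pairing_el = trace2 (tunassoc dbp_el)"

lemma trilinear_C_tunassoc: "trilinear_C (\<lambda>a b z. (a \<otimes>\<^sub>C b) \<otimes>\<^sub>C z)"
  by (rule trilinear_CI; simp add: linear_C_def tens_add_left tens_add_right tens_scaleC_left tens_scaleC_right)

lemma algebra_hom_tunassoc: "algebra_hom tunassoc"
  unfolding tunassoc_def by (rule algebra_hom_tlift3[OF trilinear_C_tunassoc]) (simp_all add: tens_one tens_mult)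

lemma tassoc_tunassoc: "tassoc (tunassoc x) = x"
proof (rule tensor_linear_eq3[where f="\<lambda>x. tassoc (tunassoc x)"])
  show "linear_C (\<lambda>x. tassoc (tunassoc x))"
    by (rule linear_C_comp[OF linear_C_tassoc algebra_homD(1)[OF algebra_hom_tunassoc]])
qed (simp_all add: linear_C_id tunassoc_def tlift3_tens[OF trilinear_C_tunassoc] tassoc_tens)

lemma tunassoc_tassoc: "tunassoc (tassoc x) = x"
proof (rule tensor_linear_eq[where f="\<lambda>x. tunassoc (tassoc x)"])
  show l: "linear_C (\<lambda>x. tunassoc (tassoc x))"
    by (rule linear_C_comp[OF algebra_homD(1)[OF algebra_hom_tunassoc] linear_C_tassoc])
  show "linear_C (\<lambda>x :: ('a \<otimes>\<^sub>C 'a) \<otimes>\<^sub>C ('a \<otimes>\<^sub>C 'a). x)" by (rule linear_C_id)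
  fix s z
  show "tunassoc (tassoc (s \<otimes>\<^sub>C z)) = s \<otimes>\<^sub>C z"
    by (induction s rule: tensor_induct)
       (simp_all add: tassoc_tens tunassoc_def tlift3_tens[OF trilinear_C_tunassoc] tens_add_left
         linear_C_add[OF linear_C_tassoc] linear_C_add[OF linear_C_tlift3[OF trilinear_C_tunassoc]])
qed

lemma R_monodromy_comult: "monodromy * comult H a = comult H a * monodromy"
proof -
  have "tflip (R_matrix H) * tflip (comult H a) = tflip (tflip (comult H a)) * tflip (R_matrix H)"
    using arg_cong[OF R_comult, of tflip a] by (simp add: algebra_homD[OF algebra_hom_tflip])
  moreover have "tflip (tflip x) = x" for x :: "'a \<otimes>\<^sub>C 'a"
    by (induction x rule: tensor_induct) (simp_all add: tflip_tens linear_C_add[OF algebra_homD(1)[OF algebra_hom_tflip]])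
  ultimately have "tflip (R_matrix H) * tflip (comult H a) = comult H a * tflip (R_matrix H)" by simp
  then show ?thesis by (rule intertwine_mult[OF R_comult])
qed

text \<open>Each factor of \<open>dbp_el\<close> intertwines two bracketings of the fourfold
  comultiplication, and the chain starts and ends at the bracketing
  \<open>(\<Delta> \<otimes> \<Delta>) \<Delta>\<close>.\<close>

lemma dbp_el_commute: "dbp_el * tassoc (tmap (comult H) (comult H) (comult H h)) = tassoc (tmap (comult H) (comult H) (comult H h)) * dbp_el"
proof -
  note cl = algebra_homD(1)[OF comult_hom]
  let ?L = "\<lambda>x. tmap id (comult H) (comult H x)" and ?R = "\<lambda>x. tassoc (tmap (comult H) id (comult H x))"
  have lL: "linear_C ?L" by (intro linear_C_comp[OF linear_C_tmap] cl linear_C_id)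
  have lR: "linear_C ?R" by (intro linear_C_comp[OF linear_C_tassoc] linear_C_comp[OF linear_C_tmap] cl linear_C_id)
  note i = invertible_el_inverse[OF coassoc_invertible]
  have a: "cocycle4 (?L h) = tmap id ?L (comult H h)"
  proof -
    have "tmap id (tmap id (comult H)) (tmap id (comult H) s) = tmap id ?L s" for s
    proof (induction s rule: tensor_induct)
      case (tens x y)
      show ?case
        unfolding tmap_tens[OF linear_C_id(1) cl] tmap_tens[OF linear_C_id(1) linear_C_tmap[OF linear_C_id(1) cl]]
          tmap_tens[OF linear_C_id(1) lL] by (simp only: id_def)
    next
      case (add s t)
      then show ?case
        by (simp only: linear_C_add[OF linear_C_tmap[OF linear_C_id(1) cl]] linear_C_add[OF linear_C_tmap[OF linear_C_id(1) lL]]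
            linear_C_add[OF linear_C_tmap[OF linear_C_id(1) linear_C_tmap[OF linear_C_id(1) cl]]])
    qed
    then show ?thesis by (simp only: cocycle4_def)
  qed
  have b: "cocycle4 (?R h) = tassoc (tmap (comult H) (comult H) (comult H h))"
  proof -
    have 1: "tmap id (tmap id (comult H)) (tassoc (t \<otimes>\<^sub>C y)) = tassoc (t \<otimes>\<^sub>C comult H y)" for t :: "'a \<otimes>\<^sub>C 'a" and y
      by (induction t rule: tensor_induct)
         (simp_all add: tassoc_tens tmap_tens linear_C_tmap linear_C_id cl tens_add_left linear_C_add[OF linear_C_tassoc] linear_C_add[OF linear_C_tmap])
    have "tmap id (tmap id (comult H)) (tassoc (tmap (comult H) id s)) = tassoc (tmap (comult H) (comult H) s)" for s
    proof (induction s rule: tensor_induct)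
      case (tens x y)
      show ?case
        unfolding tmap_tens[OF cl linear_C_id(1)] tmap_tens[OF cl cl] 1 by (simp only: id_def)
    next
      case (add s t)
      then show ?case
        by (simp only: linear_C_add[OF linear_C_tmap[OF cl linear_C_id(1)]] linear_C_add[OF linear_C_tmap[OF cl cl]]
            linear_C_add[OF linear_C_tassoc] linear_C_add[OF linear_C_tmap[OF linear_C_id(1) linear_C_tmap[OF linear_C_id(1) cl]]])
    qed
    then show ?thesis by (simp only: cocycle4_def)
  qed
  have "cocycle4 (coassoc H) * cocycle4 (?L h) = cocycle4 (?R h) * cocycle4 (coassoc H)"
    using arg_cong[OF quasi_coassociative, of cocycle4 h] by (simp add: algebra_homD[OF algebra_hom_cocycle4])
  then have 1: "cocycle4 (coassoc H) * tmap id ?L (comult H h) = tassoc (tmap (comult H) (comult H) (comult H h)) * cocycle4 (coassoc H)"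
    unfolding a b .
  have ci: "cocycle4 (coassoc H) * cocycle4 coassoc_inv = 1" "cocycle4 coassoc_inv * cocycle4 (coassoc H) = 1"
    by (simp_all add: algebra_homD(3)[OF algebra_hom_cocycle4, symmetric] i algebra_homD(2)[OF algebra_hom_cocycle4])
  note 5 = intertwine_inverse[OF 1 ci]
  have 2: "(1 \<otimes>\<^sub>C coassoc H) * tmap id ?L s = tmap id ?R s * (1 \<otimes>\<^sub>C coassoc H)" for s
    by (rule tens_one_intertwine[OF lL lR quasi_coassociative])
  have "(1 \<otimes>\<^sub>C coassoc H) * (1 \<otimes>\<^sub>C coassoc_inv) = 1" "(1 \<otimes>\<^sub>C coassoc_inv) * (1 \<otimes>\<^sub>C coassoc H) = (1 :: 'a \<otimes>\<^sub>C 'a \<otimes>\<^sub>C 'a \<otimes>\<^sub>C 'a)"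
    by (simp_all add: tens_mult i tens_one)
  note 4 = intertwine_inverse[OF 2 this]
  have M: "tassoc (monodromy \<otimes>\<^sub>C 1) * ?R x = ?R x * tassoc (monodromy \<otimes>\<^sub>C 1)" for x
  proof -
    have "(monodromy \<otimes>\<^sub>C 1) * tmap (comult H) id s = tmap (comult H) id s * (monodromy \<otimes>\<^sub>C 1)" for s :: "'a \<otimes>\<^sub>C 'a"
      by (induction s rule: tensor_induct)
         (simp_all add: tmap_tens cl linear_C_id tens_mult R_monodromy_comult distrib_left distrib_right linear_C_add[OF linear_C_tmap])
    then show ?thesis by (simp only: algebra_homD(3)[OF algebra_hom_tassoc, symmetric])
  qed
  have 3: "(1 \<otimes>\<^sub>C tassoc (monodromy \<otimes>\<^sub>C 1)) * tmap id ?R s = tmap id ?R s * (1 \<otimes>\<^sub>C tassoc (monodromy \<otimes>\<^sub>C 1))" for s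
    by (rule tens_one_intertwine[OF lR lR M])
  \<comment> \<open>The facts 5, 2, 3, 4, 1 belong to the five factors of \<open>dbp_el\<close> read
    from right to left.\<close>
  note 34 = intertwine_mult[OF intertwine_mult[OF intertwine_mult[OF intertwine_mult[OF 5 2] 3] 4] 1]
  show ?thesis using 34 by (simp only: dbp_el_def mult.assoc)
qed

text \<open>An iterated coproduct is moved through \<open>dbp_el\<close>: on its right it becomes
  the adjoint action on both legs, on its left it becomes a counit.\<close>

lemma pairing_el_invariant: "ad2 (comult H h) pairing_el = counit H h *\<^sub>C pairing_el"
proof -
  have "tunassoc dbp_el * tmap (comult H) (comult H) (comult H h) = tmap (comult H) (comult H) (comult H h) * tunassoc dbp_el"
    using arg_cong[OF dbp_el_commute, of tunassoc h] by (simp add: algebra_homD[OF algebra_hom_tunassoc] tunassoc_tassoc)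
  then show ?thesis
    unfolding pairing_el_def trace2_mult_right[symmetric] trace2_mult_left[symmetric] by simp
qed

text \<open>The modules enter only through their matrix coefficients, so the pairings of all modules
  come from one universal element. This is what lets them factor through the coend.\<close>

lemma double_braiding_pairing_eq:
  assumes X: "is_module X" and Y: "is_module Y"
  defines "n \<equiv> rdim X" and "m \<equiv> rdim Y"
  shows "double_braiding_pairing H X Y =
    kext (1 * 1) ((n * n) * (m * m)) (\<lambda>a. vrow n n (act X a)) (\<lambda>b. vrow m m (act Y b)) pairing_el"
proof -
  let ?Xd = "dual_mod H X" and ?Yd = "dual_mod H Y"
  note Xd = is_module_dual[OF X] and Yd = is_module_dual[OF Y] and cl = algebra_homD(1)[OF comult_hom]
  let ?YY = "ext_tensor ?Yd Y" and ?XYY = "ext_tensor X (ext_tensor ?Yd Y)"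
  note YY = is_module_ext[OF Yd Y] and XX = is_module_ext[OF Xd X]
  note XYY = is_module_ext[OF X YY]
  let ?E = "ext_tensor ?Xd ?XYY"
  note E = is_module_ext[OF Xd XYY]
  note dims = rdim_simps(1-3) rdim_ext n_def[symmetric] m_def[symmetric]
  have assoc4: "act (ext_tensor ?Xd (ext_tensor X (tensor_mod H ?Yd Y))) t = act ?E (cocycle4 t)" for t
  proof -
    have "act (ext_tensor X (tensor_mod H ?Yd Y)) t = act ?XYY (tmap id (comult H) t)" for t
      by (rule act_ext_pullback[OF X YY cl]) (simp_all add: dims rdim_simps)
    then show ?thesis unfolding cocycle4_def
      by (intro act_ext_pullback[OF Xd XYY linear_C_tmap[OF linear_C_id(1) cl]]) (simp_all add: dims)
  qed
  have idX: "kron (1\<^sub>m n) (act ?XYY t) = act ?E (1 \<otimes>\<^sub>C t)" for t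
    using act_ext_one_tens(1)[OF Xd XYY, of t] by (simp add: dims)
  have braid: "braiding_mod H ?Yd X * braiding_mod H X ?Yd = act (ext_tensor X ?Yd) monodromy"
  proof -
    have F: "flip_mat m n \<in> carrier_mat (n * m) (m * n)" for m n by (simp add: flip_mat_def)
    have A: "act (ext_tensor ?Yd X) (R_matrix H) \<in> carrier_mat (m * n) (m * n)" "act (ext_tensor X ?Yd) t \<in> carrier_mat (n * m) (n * m)" for t
      using is_moduleD(2)[OF is_module_ext[OF Yd X]] is_moduleD(2)[OF is_module_ext[OF X Yd]] by (simp_all add: dims)
    have "braiding_mod H ?Yd X * braiding_mod H X ?Yd = (flip_mat m n * act (ext_tensor ?Yd X) (R_matrix H)) * (flip_mat n m * act (ext_tensor X ?Yd) (R_matrix H))"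
      by (simp add: braiding_mod_def dims)
    also have "\<dots> = (flip_mat m n * act (ext_tensor ?Yd X) (R_matrix H) * flip_mat n m) * act (ext_tensor X ?Yd) (R_matrix H)"
      by (rule assoc_mult_mat[symmetric, OF mult_carrier_mat[OF F A(1)] F A(2)])
    also have "flip_mat m n * act (ext_tensor ?Yd X) (R_matrix H) * flip_mat n m = act (ext_tensor X ?Yd) (tflip (R_matrix H))"
      using act_ext_flip[OF X Yd, of "R_matrix H"] by (simp add: dims)
    finally show ?thesis by (simp add: is_moduleD(4)[OF is_module_ext[OF X Yd]])
  qed
  have mon: "kron (act (ext_tensor X ?Yd) monodromy) (1\<^sub>m m) = act ?XYY (tassoc (monodromy \<otimes>\<^sub>C 1))"
    using act_ext_one_tens(2)[OF is_module_ext[OF X Yd] Y, of monodromy] act_ext_assoc[OF X Yd Y, of "monodromy \<otimes>\<^sub>C 1"]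
    by (simp add: dims)
  let ?V = "kron (vrow n n (act X (alpha_el H))) (vrow m m (act Y (alpha_el H)))"
  have ev: "ev_mod H X = vrow n n (act X (alpha_el H))" "ev_mod H Y = vrow m m (act Y (alpha_el H))"
    by (simp_all add: ev_mod_def vrow_def n_def m_def)
  have Vc: "?V \<in> carrier_mat 1 (rdim ?E)"
    using kron_carrier[of "vrow n n (act X (alpha_el H))" 1 "n * n" "vrow m m (act Y (alpha_el H))" 1 "m * m"]
    by (simp add: vrow_def dims mult.assoc)
  have step: "?V * act ?E s * act ?E t = ?V * act ?E (s * t)" for s t
    unfolding is_moduleD(4)[OF E] by (rule assoc_mult_mat[OF Vc is_moduleD(2)[OF E] is_moduleD(2)[OF E]])
  have "double_braiding_pairing H X Y = ?V * act ?E dbp_el"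
    unfolding double_braiding_pairing_def Let_def assoc_mod_def assoc_inv_mod_def ev braid dims mon assoc4 idX step dbp_el_def ..
  also have "act ?E dbp_el = act (ext_tensor (ext_tensor ?Xd X) ?YY) (tunassoc dbp_el)"
    using act_ext_assoc[OF Xd X YY, of "tunassoc dbp_el"] by (simp add: tassoc_tunassoc)
  also have "\<dots> = kext ((n * n) * (m * m)) ((n * n) * (m * m)) (act (ext_tensor ?Xd X)) (act ?YY) (tunassoc dbp_el)"
    by (simp add: act_ext[of "ext_tensor ?Xd X"] dims)
  also have "?V * \<dots> = kext (1 * 1) ((n * n) * (m * m)) (\<lambda>g. vrow n n (act X (contract g (alpha_el H)))) (\<lambda>g. vrow m m (act Y (contract g (alpha_el H)))) (tunassoc dbp_el)"
  proof -
    have l: "lin_mat (n * n) (n * n) (act (ext_tensor ?Xd X))" "lin_mat (m * m) (m * m) (act ?YY)"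
      using lin_mat_ext[OF Xd X] lin_mat_ext[OF Yd Y] by (simp_all add: dims)
    have v: "vrow n n A \<in> carrier_mat 1 (n * n)" for n A by (simp add: vrow_def)
    show ?thesis
      unfolding kext_mult_left[OF l v v] vrow_act[OF X, folded n_def] vrow_act[OF Y, folded m_def] ..
  qed
  also have "\<dots> = kext (1 * 1) ((n * n) * (m * m)) (\<lambda>a. vrow n n (act X a)) (\<lambda>b. vrow m m (act Y b)) pairing_el"
    unfolding pairing_el_def trace2_def n_def m_def
    by (rule kext_comp[OF lin_mat_vrow[OF is_moduleD(1)[OF X]] lin_mat_vrow[OF is_moduleD(1)[OF Y]] linear_C_contract linear_C_contract])
  finally show ?thesis .
qed

end

text \<open>Separates the categorical part from the computation in Q. A concrete algebra has to
  supply a basis with coordinates, the pairing element written with basis elements in the first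
  legs, and the spanning property of the second legs. The assumption \<open>pairing_adj\<close>
  makes the matrix of the pairing a module map into the dual of the coend.\<close>

locale factorisability_data = quasi_triangular_quasi_hopf_algebra H
  for H :: "('a::complex_algebra, 'z) quasi_triangular_quasi_hopf_scheme" +
  fixes d :: nat and bs :: "nat \<Rightarrow> 'a" and co :: "nat \<Rightarrow> 'a \<Rightarrow> complex" and dual_bs :: "nat \<Rightarrow> 'a"
  assumes alpha_one: "alpha_el H = 1"
    and co_linear: "linear_C (co i)"
    and co_bs: "i < d \<Longrightarrow> j < d \<Longrightarrow> co i (bs j) = (if i = j then 1 else 0)"
    and expand: "a = (\<Sum>i<d. co i a *\<^sub>C bs i)"
    and pairing_adj: "tmap (adj h) id pairing_el = tmap id (adj (antipode H h)) pairing_el"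
    and pairing_el_expand: "pairing_el = (\<Sum>i<d. bs i \<otimes>\<^sub>C dual_bs i)"
    and dual_bs_span: "\<exists>c. a = (\<Sum>i<d. c i *\<^sub>C dual_bs i)"
begin

section \<open>The coend on the dual of H\<close>

lemma expand_linear:
  assumes "linear_C (f :: 'a \<Rightarrow> complex)" shows "f a = (\<Sum>i<d. co i a * f (bs i))"
proof -
  have "f a = f (\<Sum>i<d. co i a *\<^sub>C bs i)" using expand[of a] by simp
  then show ?thesis by (simp add: linear_C_simps[OF assms] scaleC_complex_def)
qed

definition rco :: "'a \<Rightarrow> complex mat" where
  "rco a = mat 1 d (\<lambda>(_, i). co i a)"

definition cco :: "'a \<Rightarrow> complex mat" where
  "cco a = mat d 1 (\<lambda>(i, _). co i a)"

text \<open>Rows are coordinates of elements of H and columns are functionals on H. The right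
  adjoint action on rows is the left coadjoint action on columns.\<close>

definition Lmod :: "'a matrep" where
  "Lmod = MatRep d (\<lambda>h. mat d d (\<lambda>(i, j). co j (adj h (bs i))))"

text \<open>The matrix coefficient map: \<open>phi \<otimes> x\<close> goes to the functional
  \<open>a |-> phi (a x)\<close>.\<close>

definition iota :: "'a matrep \<Rightarrow> complex mat" where
  "iota X = mat d (rdim X * rdim X) (\<lambda>(i, k). act X (bs i) $$ (k div rdim X, k mod rdim X))"

definition Reg :: "'a matrep" where
  "Reg = MatRep d (\<lambda>a. mat d d (\<lambda>(i, j). co i (a * bs j)))"

lemma lin_mat_rco: "lin_mat 1 d rco"
  unfolding lin_mat_def rco_def by (auto intro!: eq_matI simp: linear_C_simps[OF co_linear] scaleC_complex_def)

lemma lin_mat_cco: "lin_mat d 1 cco"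
  unfolding lin_mat_def cco_def by (auto intro!: eq_matI simp: linear_C_simps[OF co_linear] scaleC_complex_def)

lemma rco_mult:
  assumes "M \<in> carrier_mat d c" "j < c"
  shows "(rco a * M) $$ (0, j) = (\<Sum>k<d. co k a * M $$ (k, j))"
  using mat_mult_entry[OF lin_matD(1)[OF lin_mat_rco] assms(1) _ assms(2), of 0 a] by (simp add: rco_def)

lemma rco_eqI:
  assumes M: "M \<in> carrier_mat d c" and N: "N \<in> carrier_mat d c" and e: "\<And>a. rco a * M = rco a * N"
  shows "M = N"
proof (rule eq_matI)
  fix i j assume "i < dim_row N" "j < dim_col N"
  then have ij: "i < d" "j < c" using N by auto
  have "(rco (bs i) * K) $$ (0, j) = K $$ (i, j)" if K: "K \<in> carrier_mat d c" for K
  proof -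
    have "(rco (bs i) * K) $$ (0, j) = (\<Sum>k<d. if k = i then K $$ (k, j) else 0)"
      unfolding rco_mult[OF K ij(2)] using ij by (intro sum.cong refl) (simp add: co_bs)
    then show ?thesis using ij by simp
  qed
  then show "M $$ (i, j) = N $$ (i, j)" using e[of "bs i"] M N by metis
qed (use M N in auto)

lemma rdim_L [simp]: "rdim Lmod = d" and act_L_carrier: "act Lmod h \<in> carrier_mat d d"
  and act_L_entry: "i < d \<Longrightarrow> j < d \<Longrightarrow> act Lmod h $$ (i, j) = co j (adj h (bs i))"
  by (simp_all add: Lmod_def)

lemma rco_L: "rco a * act Lmod h = rco (adj h a)"
proof (rule eq_matI)
  fix i j assume "i < dim_row (rco (adj h a))" "j < dim_col (rco (adj h a))"
  then have ij: "i = 0" "j < d" by (simp_all add: rco_def)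
  have "(rco a * act Lmod h) $$ (0, j) = co j (adj h a)"
    unfolding rco_mult[OF act_L_carrier ij(2)]
    using expand_linear[OF linear_C_comp[OF co_linear linear_C_adj(1)], of j h a] ij by (simp add: act_L_entry)
  then show "(rco a * act Lmod h) $$ (i, j) = rco (adj h a) $$ (i, j)" using ij by (simp add: rco_def)
qed (simp_all add: rco_def Lmod_def)

lemma is_module_L: "is_module Lmod"
proof (rule is_moduleI)
  show "lin_mat (rdim Lmod) (rdim Lmod) (act Lmod)"
    unfolding lin_mat_def
    by (auto intro!: eq_matI simp: Lmod_def linear_C_simps[OF co_linear] linear_C_simps[OF linear_C_adj(2)] scaleC_complex_def)
  show "act Lmod 1 = 1\<^sub>m (rdim Lmod)"
    by (auto intro!: eq_matI simp: Lmod_def adj_one co_bs)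
  fix h k
  show "act Lmod (h * k) = act Lmod h * act Lmod k"
  proof (rule rco_eqI[OF act_L_carrier mult_carrier_mat[OF act_L_carrier act_L_carrier]])
    show "rco a * act Lmod (h * k) = rco a * (act Lmod h * act Lmod k)" for a
      unfolding assoc_mult_mat[OF lin_matD(1)[OF lin_mat_rco] act_L_carrier act_L_carrier, symmetric]
      by (simp only: rco_L adj_mult)
  qed
qed

lemma iota_carrier: "iota X \<in> carrier_mat d (rdim X * rdim X)"
  by (simp add: iota_def)

lemma rco_iota:
  assumes X: "is_module X" shows "rco a * iota X = vrow (rdim X) (rdim X) (act X a)"
proof (rule eq_matI)
  let ?n = "rdim X"
  fix i j assume "i < dim_row (vrow ?n ?n (act X a))" "j < dim_col (vrow ?n ?n (act X a))"
  then have ij: "i = 0" "j < ?n * ?n" by (simp_all add: vrow_def)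
  note j = index_less[OF ij(2)]
  have "(rco a * iota X) $$ (0, j) = act X a $$ (j div ?n, j mod ?n)"
    unfolding rco_mult[OF iota_carrier ij(2)]
    using expand_linear[OF lin_mat_entry[OF is_moduleD(1)[OF X] j], of a] ij by (simp add: iota_def)
  then show "(rco a * iota X) $$ (i, j) = vrow ?n ?n (act X a) $$ (i, j)" using ij by (simp add: vrow_def)
qed (simp_all add: rco_def iota_def vrow_def)

text \<open>For a module map \<open>f\<close>, the coefficients \<open>phi (f (a x))\<close> and
  \<open>phi (a (f x))\<close> agree. The module property is \<open>vrow_act\<close> read on
  rows.\<close>

lemma dinatural_iota: "dinatural_to H Lmod iota"
  unfolding dinatural_to_def
proof (intro conjI allI impI; (elim conjE)?)
  fix X :: "'a matrep" assume X: "is_module X"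
  let ?n = "rdim X"
  have A: "act (tensor_mod H (dual_mod H X) X) h \<in> carrier_mat (?n * ?n) (?n * ?n)" for h
    using is_moduleD(2)[OF is_module_tensor[OF is_module_dual[OF X] X]] by (simp add: rdim_simps)
  show "is_hom (tensor_mod H (dual_mod H X) X) Lmod (iota X)"
    unfolding is_hom_def
  proof (intro conjI allI)
    show "iota X \<in> carrier_mat (rdim Lmod) (rdim (tensor_mod H (dual_mod H X) X))"
      by (simp add: rdim_simps iota_carrier)
    fix h
    show "iota X * act (tensor_mod H (dual_mod H X) X) h = act Lmod h * iota X"
    proof (rule rco_eqI[OF mult_carrier_mat[OF iota_carrier A] mult_carrier_mat[OF act_L_carrier iota_carrier]])
      fix a
      show "rco a * (iota X * act (tensor_mod H (dual_mod H X) X) h) = rco a * (act Lmod h * iota X)"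
        unfolding assoc_mult_mat[OF lin_matD(1)[OF lin_mat_rco] iota_carrier A, symmetric]
          assoc_mult_mat[OF lin_matD(1)[OF lin_mat_rco] act_L_carrier iota_carrier, symmetric]
          rco_L rco_iota[OF X] by (simp add: rdim_simps vrow_act[OF X] adj_def)
    qed
  qed
next
  fix X Y :: "'a matrep" and f assume X: "is_module X" and Y: "is_module Y" and f: "is_hom X Y f"
  let ?n = "rdim X" and ?m = "rdim Y"
  have fc: "f \<in> carrier_mat ?m ?n" and fh: "f * act X a = act Y a * f" for a using f by (simp_all add: is_hom_def)
  have ft: "transpose_mat f \<in> carrier_mat ?n ?m" using fc by simp
  note K = kron_carrier[OF one_carrier_mat[of ?m] fc] kron_carrier[OF ft one_carrier_mat[of ?n]]
  show "iota Y * kron (1\<^sub>m ?m) f = iota X * kron (transpose_mat f) (1\<^sub>m ?n)"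
  proof (rule rco_eqI[OF mult_carrier_mat[OF iota_carrier K(1)] mult_carrier_mat[OF iota_carrier K(2)]])
    fix a
    note x = is_moduleD(2)[OF X, of a] and y = is_moduleD(2)[OF Y, of a]
    have "vrow ?m ?m (act Y a) * kron (1\<^sub>m ?m) f = vrow ?m ?n (f * act X a)"
      unfolding vrow_mult_kron[OF y one_carrier_mat fc] using y fc by (simp add: fh)
    moreover have "vrow ?n ?n (act X a) * kron (transpose_mat f) (1\<^sub>m ?n) = vrow ?m ?n (f * act X a)"
      unfolding vrow_mult_kron[OF x ft one_carrier_mat] using x fc by simp
    ultimately show "rco a * (iota Y * kron (1\<^sub>m ?m) f) = rco a * (iota X * kron (transpose_mat f) (1\<^sub>m ?n))"
      unfolding assoc_mult_mat[OF lin_matD(1)[OF lin_mat_rco] iota_carrier K(1), symmetric]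
        assoc_mult_mat[OF lin_matD(1)[OF lin_mat_rco] iota_carrier K(2), symmetric] rco_iota[OF X] rco_iota[OF Y] by simp
  qed
qed

lemma rdim_Reg [simp]: "rdim Reg = d" and act_Reg_carrier: "act Reg a \<in> carrier_mat d d"
  by (simp_all add: Reg_def)

lemma Reg_cco: "act Reg a * cco b = cco (a * b)"
proof (rule eq_matI)
  fix i j assume "i < dim_row (cco (a * b))" "j < dim_col (cco (a * b))"
  then have ij: "i < d" "j < 1" by (simp_all add: cco_def)
  have "(act Reg a * cco b) $$ (i, j) = (\<Sum>k<d. co i (a * bs k) * co k b)"
    unfolding mat_mult_entry[OF act_Reg_carrier lin_matD(1)[OF lin_mat_cco] ij] using ij
    by (intro sum.cong refl) (simp add: Reg_def cco_def)
  also have "\<dots> = co i (a * b)"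
    using expand_linear[OF linear_C_comp[OF co_linear linear_C_mult(2)], of i a b] by (simp add: mult.commute)
  finally show "(act Reg a * cco b) $$ (i, j) = cco (a * b) $$ (i, j)" using ij by (simp add: cco_def)
qed (simp_all add: cco_def Reg_def)

lemma cco_eqI:
  assumes M: "M \<in> carrier_mat r d" and N: "N \<in> carrier_mat r d" and e: "\<And>a. M * cco a = N * cco a"
  shows "M = N"
proof (rule eq_matI)
  fix i j assume "i < dim_row N" "j < dim_col N"
  then have ij: "i < r" "j < d" using N by auto
  have z: "(0::nat) < 1" by simp
  have "(K * cco (bs j)) $$ (i, 0) = K $$ (i, j)" if K: "K \<in> carrier_mat r d" for K
  proof -
    have "(K * cco (bs j)) $$ (i, 0) = (\<Sum>k<d. if k = j then K $$ (i, k) else 0)"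
      unfolding mat_mult_entry[OF K lin_matD(1)[OF lin_mat_cco] ij(1) z] using ij
      by (intro sum.cong refl) (simp add: co_bs cco_def)
    then show ?thesis using ij by simp
  qed
  then show "M $$ (i, j) = N $$ (i, j)" using e[of "bs j"] M N by metis
qed (use M N in auto)

lemma is_module_Reg: "is_module Reg"
proof (rule is_moduleI)
  show "lin_mat (rdim Reg) (rdim Reg) (act Reg)"
    unfolding lin_mat_def
    by (auto intro!: eq_matI simp: Reg_def linear_C_simps[OF co_linear] distrib_right scaleC_mult_left scaleC_complex_def)
  show "act Reg 1 = 1\<^sub>m (rdim Reg)"
    by (auto intro!: eq_matI simp: Reg_def co_bs)
  fix a b
  show "act Reg (a * b) = act Reg a * act Reg b"
  proof (rule cco_eqI[OF act_Reg_carrier mult_carrier_mat[OF act_Reg_carrier act_Reg_carrier]])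
    show "act Reg (a * b) * cco c = act Reg a * act Reg b * cco c" for c
      unfolding assoc_mult_mat[OF act_Reg_carrier act_Reg_carrier lin_matD(1)[OF lin_mat_cco]]
      by (simp only: Reg_cco mult.assoc)
  qed
qed

text \<open>The module map from the regular module to \<open>X\<close> which sends \<open>1\<close> to the basis vector \<open>q\<close>.\<close>

definition orbit :: "'a matrep \<Rightarrow> nat \<Rightarrow> complex mat" where
  "orbit X q = mat (rdim X) d (\<lambda>(i, j). act X (bs j) $$ (i, q))"

lemma orbit_carrier: "orbit X q \<in> carrier_mat (rdim X) d"
  by (simp add: orbit_def)

lemma orbit_cco:
  assumes X: "is_module X" and q: "q < rdim X"
  shows "orbit X q * cco a = mat (rdim X) 1 (\<lambda>(i, _). act X a $$ (i, q))"
proof (rule eq_matI)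
  fix i j assume "i < dim_row (mat (rdim X) 1 (\<lambda>(i, _). act X a $$ (i, q)))" "j < dim_col (mat (rdim X) 1 (\<lambda>(i, _). act X a $$ (i, q)))"
  then have ij: "i < rdim X" "j < 1" by simp_all
  have "(orbit X q * cco a) $$ (i, j) = (\<Sum>k<d. act X (bs k) $$ (i, q) * co k a)"
    unfolding mat_mult_entry[OF orbit_carrier lin_matD(1)[OF lin_mat_cco] ij] using ij
    by (intro sum.cong refl) (simp add: orbit_def cco_def)
  also have "\<dots> = act X a $$ (i, q)"
    using expand_linear[OF lin_mat_entry[OF is_moduleD(1)[OF X] ij(1) q], of a] by (simp add: mult.commute)
  finally show "(orbit X q * cco a) $$ (i, j) = mat (rdim X) 1 (\<lambda>(i, _). act X a $$ (i, q)) $$ (i, j)" using ij by simp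
qed (simp_all add: orbit_def cco_def)

lemma is_hom_orbit:
  assumes X: "is_module X" and q: "q < rdim X"
  shows "is_hom Reg X (orbit X q)"
  unfolding is_hom_def
proof (intro conjI allI)
  show "orbit X q \<in> carrier_mat (rdim X) (rdim Reg)" by (simp add: orbit_carrier)
  fix a
  note x = is_moduleD(2)[OF X]
  show "orbit X q * act Reg a = act X a * orbit X q"
  proof (rule cco_eqI[OF mult_carrier_mat[OF orbit_carrier act_Reg_carrier] mult_carrier_mat[OF x orbit_carrier]])
    fix b
    have "act X a * mat (rdim X) 1 (\<lambda>(i, _). act X b $$ (i, q)) = mat (rdim X) 1 (\<lambda>(i, _). act X (a * b) $$ (i, q))"
    proof (rule eq_matI)
      fix i j assume "i < dim_row (mat (rdim X) 1 (\<lambda>(i, _). act X (a * b) $$ (i, q)))" "j < dim_col (mat (rdim X) 1 (\<lambda>(i, _). act X (a * b) $$ (i, q)))"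
      then have ij: "i < rdim X" "j < 1" by simp_all
      show "(act X a * mat (rdim X) 1 (\<lambda>(i, _). act X b $$ (i, q))) $$ (i, j) = mat (rdim X) 1 (\<lambda>(i, _). act X (a * b) $$ (i, q)) $$ (i, j)"
        unfolding mat_mult_entry[OF x mat_carrier ij] is_moduleD(4)[OF X] using ij by (simp add: mat_mult_entry[OF x x ij(1) q] del: index_mult_mat)
    qed (use carrier_matD[OF x] in simp_all)
    then show "orbit X q * act Reg a * cco b = act X a * orbit X q * cco b"
      unfolding assoc_mult_mat[OF orbit_carrier act_Reg_carrier lin_matD(1)[OF lin_mat_cco]]
        assoc_mult_mat[OF x orbit_carrier lin_matD(1)[OF lin_mat_cco]] Reg_cco orbit_cco[OF X q] by simp
  qed
qed

text \<open>The linear map \<open>phi |-> phi \<otimes> 1\<close> for the regular module. It is a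
  section of \<open>iota Reg\<close>, since \<open>phi (a 1) = phi a\<close>.\<close>

definition unit_col :: "complex mat" where
  "unit_col = kron (1\<^sub>m d) (cco 1)"

lemma unit_col_carrier: "unit_col \<in> carrier_mat (d * d) d"
  using kron_carrier[OF one_carrier_mat lin_matD(1)[OF lin_mat_cco], of d 1] by (simp add: unit_col_def)

lemma iota_Reg_unit_col: "iota Reg * unit_col = 1\<^sub>m d"
proof (rule rco_eqI[OF mult_carrier_mat[OF _ unit_col_carrier] one_carrier_mat])
  show ic: "iota Reg \<in> carrier_mat d (d * d)" using iota_carrier[of Reg] by simp
  fix a
  note c1 = lin_matD(1)[OF lin_mat_cco, of 1]
  have "rco a * (iota Reg * unit_col) = vrow d d (act Reg a) * unit_col"
    using assoc_mult_mat[OF lin_matD(1)[OF lin_mat_rco] ic unit_col_carrier, of a] rco_iota[OF is_module_Reg, of a] by simp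
  also have "\<dots> = vrow d 1 (act Reg a * cco 1)"
    unfolding unit_col_def vrow_mult_kron[OF act_Reg_carrier one_carrier_mat c1] using act_Reg_carrier[of a] by simp
  also have "\<dots> = rco a * 1\<^sub>m d"
    unfolding Reg_cco by (auto intro!: eq_matI simp: vrow_def rco_def cco_def)
  finally show "rco a * (iota Reg * unit_col) = rco a * 1\<^sub>m d" .
qed

text \<open>A basis vector of X is the image of 1 under an orbit map. Dinaturality along this map
  carries \<open>j X\<close> at that vector to \<open>j Reg\<close> at a tensor of the form
  \<open>psi \<otimes> 1\<close>.\<close>

lemma dinatural_factors:
  assumes Z: "is_module Z" and j: "dinatural_to H Z j" and X: "is_module X"
  shows "j Reg * unit_col * iota X = j X"
proof -
  let ?n = "rdim X" and ?z = "rdim Z"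
  have jc: "j X \<in> carrier_mat ?z (rdim X * rdim X)" if "is_module X" for X
    using j that unfolding dinatural_to_def is_hom_def by (simp add: rdim_simps)
  have jX: "j X \<in> carrier_mat ?z (?n * ?n)" by (rule jc[OF X])
  have jR: "j Reg \<in> carrier_mat ?z (d * d)" using jc[OF is_module_Reg] by simp
  note c1 = lin_matD(1)[OF lin_mat_cco, of 1]
  have U: "j Reg * unit_col \<in> carrier_mat ?z d" by (rule mult_carrier_mat[OF jR unit_col_carrier])
  show ?thesis
  proof (rule eq_matI)
    fix z k assume "z < dim_row (j X)" "k < dim_col (j X)"
    then have zk: "z < ?z" "k < ?n * ?n" using jX by auto
    let ?p = "k div ?n" and ?q = "k mod ?n"
    note pq = index_less[OF zk(2)]
    let ?r = "orbit X ?q"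
    note r = orbit_carrier[of X ?q]
    have rt: "transpose_mat ?r \<in> carrier_mat d ?n" using r by simp
    have "j X * kron (1\<^sub>m ?n) ?r = j Reg * kron (transpose_mat ?r) (1\<^sub>m d)"
      using j X is_module_Reg is_hom_orbit[OF X pq(2)] unfolding dinatural_to_def by (metis rdim_Reg)
    \<comment> \<open>The factor \<open>cco 1\<close> inserts the unit of the algebra, which the
      orbit map sends to the basis vector \<open>?q\<close>.\<close>
    then have "j X * kron (1\<^sub>m ?n) ?r * kron (1\<^sub>m ?n) (cco 1) = j Reg * kron (transpose_mat ?r) (1\<^sub>m d) * kron (1\<^sub>m ?n) (cco 1)"
      by simp
    moreover have "j X * kron (1\<^sub>m ?n) ?r * kron (1\<^sub>m ?n) (cco 1) = j X * kron (1\<^sub>m ?n) (?r * cco 1)"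
      unfolding assoc_mult_mat[OF jX kron_carrier[OF one_carrier_mat r] kron_carrier[OF one_carrier_mat c1]]
        kron_mult[OF one_carrier_mat one_carrier_mat r c1] by simp
    moreover have "j Reg * kron (transpose_mat ?r) (1\<^sub>m d) * kron (1\<^sub>m ?n) (cco 1) = j Reg * unit_col * transpose_mat ?r"
    proof -
      have "kron (transpose_mat ?r) (1\<^sub>m d) * kron (1\<^sub>m ?n) (cco 1) = kron (1\<^sub>m d) (cco 1) * kron (transpose_mat ?r) (1\<^sub>m 1)"
        unfolding kron_mult[OF rt one_carrier_mat one_carrier_mat c1] kron_mult[OF one_carrier_mat rt c1 one_carrier_mat]
        using rt c1 by simp
      then have "kron (transpose_mat ?r) (1\<^sub>m d) * kron (1\<^sub>m ?n) (cco 1) = unit_col * transpose_mat ?r"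
        by (simp only: unit_col_def kron_one_1)
      then show ?thesis
        unfolding assoc_mult_mat[OF jR kron_carrier[OF rt one_carrier_mat] kron_carrier[OF one_carrier_mat c1]]
          assoc_mult_mat[OF jR unit_col_carrier rt] by simp
    qed
    ultimately have e: "j X * kron (1\<^sub>m ?n) (?r * cco 1) = j Reg * unit_col * transpose_mat ?r" by simp
    have rc: "?r * cco 1 \<in> carrier_mat ?n 1" by (rule mult_carrier_mat[OF r c1])
    have rv: "(?r * cco 1) $$ (i, 0) = (if i = ?q then 1 else 0)" if "i < ?n" for i
      unfolding orbit_cco[OF X pq(2)] is_moduleD(3)[OF X] using that pq by simp
    \<comment> \<open>The index \<open>l\<close> is written through its quotient and remainder so
      that \<open>sum_prod_index\<close> applies.\<close>
    have "(j X * kron (1\<^sub>m ?n) (?r * cco 1)) $$ (z, ?p) = (\<Sum>l<?n * ?n. j X $$ (z, (l div ?n) * ?n + l mod ?n) * ((if l div ?n = ?p then 1 else 0) * (if l mod ?n = ?q then 1 else 0)))"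
    proof -
      have p1: "?p < ?n * 1" using pq by simp
      have "(j X * kron (1\<^sub>m ?n) (?r * cco 1)) $$ (z, ?p) = (\<Sum>l<?n * ?n. j X $$ (z, l) * kron (1\<^sub>m ?n) (?r * cco 1) $$ (l, ?p))"
        using mat_mult_entry[OF jX kron_carrier[OF one_carrier_mat rc] zk(1) p1] .
      also have "\<dots> = (\<Sum>l<?n * ?n. j X $$ (z, (l div ?n) * ?n + l mod ?n) * ((if l div ?n = ?p then 1 else 0) * (if l mod ?n = ?q then 1 else 0)))"
      proof (intro sum.cong refl)
        fix l assume "l \<in> {..<?n * ?n}"
        then have l: "l < ?n * ?n" by simp
        show "j X $$ (z, l) * kron (1\<^sub>m ?n) (?r * cco 1) $$ (l, ?p) = j X $$ (z, (l div ?n) * ?n + l mod ?n) * ((if l div ?n = ?p then 1 else 0) * (if l mod ?n = ?q then 1 else 0))"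
          unfolding kron_entry[OF one_carrier_mat rc l p1] using index_less[OF l] pq by (simp add: rv del: index_mult_mat)
      qed
      finally show ?thesis .
    qed
    also have "\<dots> = (\<Sum>a<?n. \<Sum>b<?n. j X $$ (z, a * ?n + b) * ((if a = ?p then 1 else 0) * (if b = ?q then 1 else 0)))"
      by (rule sum_prod_index)
    also have "\<dots> = (\<Sum>a<?n. if a = ?p then j X $$ (z, a * ?n + ?q) else 0)"
      using pq(2) by (intro sum.cong refl) (simp add: if_distrib[of "(*) _"] cong: if_cong)
    also have "\<dots> = j X $$ (z, k)" using pq(1) by simp
    finally have 1: "(j X * kron (1\<^sub>m ?n) (?r * cco 1)) $$ (z, ?p) = j X $$ (z, k)" .
    have "(j Reg * unit_col * transpose_mat ?r) $$ (z, ?p) = (\<Sum>i<d. (j Reg * unit_col) $$ (z, i) * transpose_mat ?r $$ (i, ?p))"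
      by (rule mat_mult_entry[OF U rt zk(1) pq(1)])
    also have "\<dots> = (\<Sum>i<d. (j Reg * unit_col) $$ (z, i) * iota X $$ (i, k))"
      using pq zk by (intro sum.cong refl) (simp add: orbit_def iota_def del: index_mult_mat)
    also have "\<dots> = (j Reg * unit_col * iota X) $$ (z, k)"
      by (rule mat_mult_entry[OF U iota_carrier zk, symmetric])
    finally show "(j Reg * unit_col * iota X) $$ (z, k) = j X $$ (z, k)" using 1 e by simp
  qed (use jX U in \<open>auto simp: iota_def\<close>)
qed

text \<open>\<open>iota Reg\<close> has a right inverse as a matrix, so a factorisation through it
  has no choice, and it inherits compatibility with the action from \<open>j Reg\<close>.\<close>

lemma is_coend_L: "is_coend H Lmod iota"
  unfolding is_coend_def
proof (intro conjI allI impI; (elim conjE)?)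
  show "is_module Lmod" by (rule is_module_L)
  show "dinatural_to H Lmod iota" by (rule dinatural_iota)
  fix Z j assume Z: "is_module Z" and j: "dinatural_to H Z j"
  let ?T = "\<lambda>h. act (tensor_mod H (dual_mod H Reg) Reg) h"
  have jR: "j Reg \<in> carrier_mat (rdim Z) (d * d)" and jh: "j Reg * ?T h = act Z h * j Reg" for h
    using j is_module_Reg unfolding dinatural_to_def is_hom_def by (auto simp: rdim_simps)
  have ic: "iota Reg \<in> carrier_mat d (d * d)" and ih: "iota Reg * ?T h = act Lmod h * iota Reg" for h
    using dinatural_iota is_module_Reg unfolding dinatural_to_def is_hom_def by (auto simp: rdim_simps)
  have Tc: "?T h \<in> carrier_mat (d * d) (d * d)" for h
    using is_moduleD(2)[OF is_module_tensor[OF is_module_dual[OF is_module_Reg] is_module_Reg]] by (simp add: rdim_simps)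
  let ?u = "j Reg * unit_col"
  note K = unit_col_carrier and zc = is_moduleD(2)[OF Z]
  have uc: "?u \<in> carrier_mat (rdim Z) d" by (rule mult_carrier_mat[OF jR K])
  show "\<exists>!u. is_hom Lmod Z u \<and> (\<forall>X. is_module X \<longrightarrow> u * iota X = j X)"
  proof (rule ex1I)
    have "?u * act Lmod h = act Z h * ?u" for h
    proof -
      have "?u * act Lmod h = ?u * act Lmod h * (iota Reg * unit_col)"
        using right_mult_one_mat[OF mult_carrier_mat[OF uc act_L_carrier[of h]]] by (simp add: iota_Reg_unit_col)
      also have "\<dots> = ?u * (act Lmod h * iota Reg) * unit_col"
        using assoc_mult_mat[OF mult_carrier_mat[OF uc act_L_carrier[of h]] ic K] assoc_mult_mat[OF uc act_L_carrier[of h] ic] by simp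
      also have "?u * (act Lmod h * iota Reg) = j Reg * ?T h"
        unfolding ih[symmetric] assoc_mult_mat[OF uc ic Tc, symmetric] dinatural_factors[OF Z j is_module_Reg] ..
      also have "j Reg * ?T h * unit_col = act Z h * ?u"
        unfolding jh by (rule assoc_mult_mat[OF zc jR K])
      finally show ?thesis .
    qed
    then show "is_hom Lmod Z ?u \<and> (\<forall>X. is_module X \<longrightarrow> ?u * iota X = j X)"
      using uc dinatural_factors[OF Z j] by (simp add: is_hom_def)
    fix v assume v: "is_hom Lmod Z v \<and> (\<forall>X. is_module X \<longrightarrow> v * iota X = j X)"
    then have vc: "v \<in> carrier_mat (rdim Z) d" and vi: "v * iota Reg = j Reg"
      using is_module_Reg by (simp_all add: is_hom_def)
    have "v = v * (iota Reg * unit_col)" using vc by (simp add: iota_Reg_unit_col)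
    also have "\<dots> = ?u" using assoc_mult_mat[OF vc ic K] vi by simp
    finally show "v = ?u" .
  qed
qed

section \<open>The Hopf pairing on the dual of H and its non-degeneracy\<close>

definition omega :: "complex mat" where
  "omega = kext (1 * 1) (d * d) rco rco pairing_el"

lemma omega_carrier: "omega \<in> carrier_mat 1 (d * d)"
  using lin_matD(1)[OF lin_mat_kext[OF lin_mat_rco lin_mat_rco]] by (simp add: omega_def)

lemma omega_hom: "is_hom (tensor_mod H Lmod Lmod) (unit_mod H) omega"
  unfolding is_hom_def
proof (intro conjI allI)
  show "omega \<in> carrier_mat (rdim (unit_mod H)) (rdim (tensor_mod H Lmod Lmod))"
    using omega_carrier by (simp add: rdim_simps unit_mod_def)
  fix h
  let ?W = "kext (1 * 1) (d * d) rco rco"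
  have L: "lin_mat d d (act Lmod)" using is_moduleD(1)[OF is_module_L] by simp
  have "omega * act (ext_tensor Lmod Lmod) s = ?W (ad2 s pairing_el)" for s
  proof (rule lin_mat_tensor_eq[where f="\<lambda>s. omega * act (ext_tensor Lmod Lmod) s"])
    show "lin_mat 1 (d * d) (\<lambda>s. omega * act (ext_tensor Lmod Lmod) s)"
      by (rule lin_mat_mult_left[OF lin_mat_ext[OF is_module_L is_module_L, unfolded rdim_L] omega_carrier])
    have "linear_C (\<lambda>s. ad2 s pairing_el)" unfolding ad2_def by (rule linear_C_tlift[OF bilinear_C_ad2])
    then show "lin_mat 1 (d * d) (\<lambda>s. ?W (ad2 s pairing_el))"
      using lin_mat_comp[OF lin_mat_kext[OF lin_mat_rco lin_mat_rco]] by simp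
    fix x y
    have "omega * act (ext_tensor Lmod Lmod) (x \<otimes>\<^sub>C y) = kext (1 * 1) (d * d) (\<lambda>a. rco (adj x a)) (\<lambda>b. rco (adj y b)) pairing_el"
      unfolding act_ext_tens[OF is_module_L is_module_L] omega_def
        kext_mult_right[OF lin_mat_rco lin_mat_rco act_L_carrier act_L_carrier] rco_L ..
    also have "\<dots> = ?W (ad2 (x \<otimes>\<^sub>C y) pairing_el)"
      unfolding ad2_def tlift_tens[OF bilinear_C_ad2] by (rule kext_comp[OF lin_mat_rco lin_mat_rco linear_C_adj(1) linear_C_adj(1)])
    finally show "omega * act (ext_tensor Lmod Lmod) (x \<otimes>\<^sub>C y) = ?W (ad2 (x \<otimes>\<^sub>C y) pairing_el)" .
  qed
  then have "omega * act (tensor_mod H Lmod Lmod) h = counit H h \<cdot>\<^sub>m omega"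
    by (simp add: rdim_simps pairing_el_invariant lin_matD(3)[OF lin_mat_kext[OF lin_mat_rco lin_mat_rco], simplified] omega_def)
  also have "\<dots> = act (unit_mod H) h * omega"
    using omega_carrier by (auto intro!: eq_matI simp: unit_mod_def scalar_prod_def)
  finally show "omega * act (tensor_mod H Lmod Lmod) h = act (unit_mod H) h * omega" .
qed

lemma is_hopf_pairing_omega: "is_hopf_pairing H Lmod iota omega"
  unfolding is_hopf_pairing_def
proof (intro conjI allI impI; (elim conjE)?)
  show "is_hom (tensor_mod H Lmod Lmod) (unit_mod H) omega" by (rule omega_hom)
  fix X Y :: "'a matrep" assume X: "is_module X" and Y: "is_module Y"
  show "omega * kron (iota X) (iota Y) = double_braiding_pairing H X Y"
    unfolding double_braiding_pairing_eq[OF X Y] omega_def kext_mult_right[OF lin_mat_rco lin_mat_rco iota_carrier iota_carrier]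
      rco_iota[OF X] rco_iota[OF Y] ..
qed

text \<open>The map \<open>phi |-> (phi \<otimes> id) pairing_el\<close> from functionals on H, the
  columns of \<open>Lmod\<close>, to H, which carries the dual of \<open>Lmod\<close>.\<close>

definition fmat :: "complex mat" where
  "fmat = kext (1 * d) (d * 1) rco cco pairing_el"

lemma fmat_carrier: "fmat \<in> carrier_mat d d"
  using lin_matD(1)[OF lin_mat_kext[OF lin_mat_rco lin_mat_cco]] by (simp add: fmat_def)

lemma cco_L: "transpose_mat (act Lmod h) * cco b = cco (adj h b)"
proof -
  have t: "cco c = transpose_mat (rco c)" for c by (auto intro!: eq_matI simp: rco_def cco_def)
  show ?thesis unfolding t transpose_mult[OF lin_matD(1)[OF lin_mat_rco] act_L_carrier, symmetric] rco_L ..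
qed

text \<open>Moving the adjoint action from the first leg to the second costs an antipode, and this
  antipode is the one in the action on a dual module.\<close>

lemma fmat_hom: "is_hom Lmod (dual_mod H Lmod) fmat"
  unfolding is_hom_def
proof (intro conjI allI)
  show "fmat \<in> carrier_mat (rdim (dual_mod H Lmod)) (rdim Lmod)" by (simp add: rdim_simps fmat_carrier)
  fix h
  have Lt: "transpose_mat (act Lmod (antipode H h)) \<in> carrier_mat d d" using act_L_carrier by simp
  have c1: "cco b * 1\<^sub>m 1 = cco b" "1\<^sub>m 1 * rco b = rco b" for b
    using right_mult_one_mat[OF lin_matD(1)[OF lin_mat_cco]] left_mult_one_mat[OF lin_matD(1)[OF lin_mat_rco]] by simp_all
  have "fmat * kron (act Lmod h) (1\<^sub>m 1) = kext (1 * d) (d * 1) (\<lambda>a. rco (adj h a)) (\<lambda>b. cco (id b)) pairing_el"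
    unfolding fmat_def kext_mult_right[OF lin_mat_rco lin_mat_cco act_L_carrier one_carrier_mat] rco_L c1 id_def ..
  also have "\<dots> = kext (1 * d) (d * 1) (\<lambda>a. rco (id a)) (\<lambda>b. cco (adj (antipode H h) b)) pairing_el"
    unfolding kext_comp[OF lin_mat_rco lin_mat_cco linear_C_adj(1) linear_C_id(1)] pairing_adj
      kext_comp[OF lin_mat_rco lin_mat_cco linear_C_id(1) linear_C_adj(1)] ..
  also have "\<dots> = kron (1\<^sub>m 1) (transpose_mat (act Lmod (antipode H h))) * fmat"
    unfolding fmat_def kext_mult_left[OF lin_mat_rco lin_mat_cco one_carrier_mat Lt] cco_L c1 id_def ..
  finally show "fmat * act Lmod h = act (dual_mod H Lmod) h * fmat"
    by (simp only: kron_one_1 rdim_simps)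
qed

lemma fmat_entry:
  assumes ij: "i < d" "j < d" shows "fmat $$ (j, i) = co j (dual_bs i)"
proof -
  have lt: "j < 1 * d" "i < d * 1" using ij by simp_all
  have b: "bilinear_C (\<lambda>a b. kron (rco a) (cco b) $$ (j, i))" by (rule bilinear_kron[OF lin_mat_rco lin_mat_cco lt])
  have k: "kron (rco a) (cco b) $$ (j, i) = co i a * co j b" for a b
    using kron_entry[OF lin_matD(1)[OF lin_mat_rco] lin_matD(1)[OF lin_mat_cco] lt, of a b] ij by (simp add: rco_def cco_def)
  have "fmat $$ (j, i) = tlift (\<lambda>a b. kron (rco a) (cco b) $$ (j, i)) (\<Sum>k<d. bs k \<otimes>\<^sub>C dual_bs k)"
    using ij by (simp add: fmat_def kext_def pairing_el_expand)
  also have "\<dots> = (\<Sum>k<d. co i (bs k) * co j (dual_bs k))"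
    unfolding linear_C_sum[OF linear_C_tlift[OF b]] tlift_tens[OF b] unfolding k ..
  also have "\<dots> = (\<Sum>k<d. if k = i then co j (dual_bs k) else 0)"
    using ij by (intro sum.cong refl) (simp add: co_bs)
  finally show ?thesis using ij by simp
qed

text \<open>Spanning of the second legs provides a right inverse of a square matrix, which is then
  two-sided. As \<open>alpha_el\<close> is 1, evaluation is the plain pairing of a space with its
  dual, so the map belonging to \<open>omega\<close> is its own matrix \<open>fmat\<close>.\<close>

lemma nondegenerate_omega: "nondegenerate_pairing H Lmod omega"
proof -
  have "\<forall>m. \<exists>c. bs m = (\<Sum>i<d. c i *\<^sub>C dual_bs i)" by (intro allI dual_bs_span)
  from choice[OF this] obtain c where c: "\<And>m. bs m = (\<Sum>i<d. c m i *\<^sub>C dual_bs i)" by blast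
  define g where "g = mat d d (\<lambda>(i, m). c m i)"
  have gc: "g \<in> carrier_mat d d" by (simp add: g_def)
  have fg: "fmat * g = 1\<^sub>m d"
  proof (rule eq_matI)
    fix j m assume "j < dim_row (1\<^sub>m d :: complex mat)" "m < dim_col (1\<^sub>m d :: complex mat)"
    then have jm: "j < d" "m < d" by simp_all
    have "(fmat * g) $$ (j, m) = (\<Sum>i<d. co j (dual_bs i) * c m i)"
      unfolding mat_mult_entry[OF fmat_carrier gc jm] using jm by (intro sum.cong refl) (simp add: fmat_entry g_def)
    also have "\<dots> = co j (bs m)"
      by (simp add: c[of m] linear_C_simps[OF co_linear] scaleC_complex_def mult.commute)
    finally show "(fmat * g) $$ (j, m) = 1\<^sub>m d $$ (j, m)" using jm by (simp add: co_bs)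
  qed (use fmat_carrier gc in auto)
  have gf: "g * fmat = 1\<^sub>m d" by (rule mat_mult_left_right_inverse[OF fmat_carrier gc fg])
  let ?D = "\<lambda>h. act (dual_mod H Lmod) h"
  have Dc: "?D h \<in> carrier_mat d d" for h using is_moduleD(2)[OF is_module_dual[OF is_module_L]] by (simp add: rdim_simps)
  have fh: "fmat * act Lmod h = ?D h * fmat" for h using fmat_hom by (simp add: is_hom_def)
  have "g * ?D h = act Lmod h * g" for h
  proof -
    note L = act_L_carrier[of h] and f = fmat_carrier
    have "g * ?D h = g * ?D h * (fmat * g)" unfolding fg right_mult_one_mat[OF mult_carrier_mat[OF gc Dc[of h]]] ..
    also have "\<dots> = g * (?D h * fmat) * g"
      using assoc_mult_mat[OF mult_carrier_mat[OF gc Dc[of h]] f gc] assoc_mult_mat[OF gc Dc[of h] f] by simp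
    also have "\<dots> = (g * fmat) * act Lmod h * g"
      unfolding fh[symmetric] using assoc_mult_mat[OF gc f L] by simp
    finally show ?thesis unfolding gf left_mult_one_mat[OF L] .
  qed
  then have iso: "is_iso Lmod (dual_mod H Lmod) fmat"
    using fmat_hom gc fg gf unfolding is_iso_def is_hom_def by (auto simp: rdim_simps)
  have ev: "ev_mod H Lmod = vrow d d (1\<^sub>m d)"
    using is_moduleD(3)[OF is_module_L] by (simp add: ev_mod_def vrow_def alpha_one)
  have "omega = vrow d d (transpose_mat fmat)"
    unfolding omega_def fmat_def
  proof (rule lin_mat_tensor_eq[where f="kext (1 * 1) (d * d) rco rco" and g="\<lambda>t. vrow d d (transpose_mat (kext (1 * d) (d * 1) rco cco t))"])
    show "lin_mat (1 * 1) (d * d) (kext (1 * 1) (d * d) rco rco)" by (rule lin_mat_kext[OF lin_mat_rco lin_mat_rco])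
    have f: "lin_mat d d (kext (1 * d) (d * 1) rco cco)" using lin_mat_kext[OF lin_mat_rco lin_mat_cco] by simp
    have "lin_mat d d (\<lambda>t. transpose_mat (kext (1 * d) (d * 1) rco cco t))"
      by (rule lin_mat_transpose[OF f])
    from lin_mat_vrow[OF this]
    show "lin_mat (1 * 1) (d * d) (\<lambda>t. vrow d d (transpose_mat (kext (1 * d) (d * 1) rco cco t)))" by simp
    fix a b
    show "kext (1 * 1) (d * d) rco rco (a \<otimes>\<^sub>C b) = vrow d d (transpose_mat (kext (1 * d) (d * 1) rco cco (a \<otimes>\<^sub>C b)))"
      unfolding kext_tens[OF lin_mat_rco lin_mat_rco] kext_tens[OF lin_mat_rco lin_mat_cco]
      by (rule eq_matI) (auto simp: vrow_def kron_def rco_def cco_def index_less)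
  qed
  also have "\<dots> = ev_mod H Lmod * kron fmat (1\<^sub>m (rdim Lmod))"
    unfolding ev rdim_L vrow_mult_kron[OF one_carrier_mat fmat_carrier one_carrier_mat] using fmat_carrier by simp
  finally show ?thesis using iso unfolding nondegenerate_pairing_def by blast
qed

theorem factorisable_H: "factorisable H"
  unfolding factorisable_def
proof (intro conjI exI)
  show "quasi_triangular_quasi_hopf_algebra H" by unfold_locales
  show "is_coend H Lmod iota" "is_hopf_pairing H Lmod iota omega" "nondegenerate_pairing H Lmod omega"
    by (rule is_coend_L is_hopf_pairing_omega nondegenerate_omega)+
  have "a \<in> complex_vector.span (bs ` {..<d})" for a
    by (subst expand) (intro complex_vector.span_sum complex_vector.span_scale complex_vector.span_base imageI)
  then show "finite_dim TYPE('a)" unfolding finite_dim_def by (intro exI[of _ "bs ` {..<d}"]) auto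
qed

end


section \<open>Weights of \<open>K\<close>\<close>

text \<open>
  The weight \<open>(s, p)\<close> stands for the eigenvalue \<open>\<i>\<^sup>s (-1)\<^sup>p\<close> of \<open>K\<close>; thus \<open>s\<close> is the sector
  (\<open>e\<^sub>0\<close> or \<open>e\<^sub>1\<close>) and \<open>p\<close> the parity, which is flipped by the generators \<open>f\<^sub>i\<^sup>\<plusminus>\<close>.
\<close>

type_synonym wt = "bool \<times> bool"

definition chi :: "wt \<Rightarrow> complex" where
  "chi a = (if fst a then \<i> else 1) * (if snd a then -1 else 1)"

definition sh :: "wt \<Rightarrow> wt" where
  "sh a = (fst a, \<not> snd a)"

lemma sum_wt: "(\<Sum>a\<in>UNIV. f a) = f (False, False) + f (False, True) + f (True, False) + f (True, True)"
  for f :: "wt \<Rightarrow> 'b::comm_monoid_add"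
  by (simp add: UNIV_Times_UNIV[symmetric] UNIV_bool sum.cartesian_product[symmetric] add.assoc del: UNIV_Times_UNIV)

lemma sum_delta_scaleC:
  "finite A \<Longrightarrow> (\<Sum>a\<in>A. (if a = b then 1 else (0::complex)) *\<^sub>C f a) = (if b \<in> A then f b else 0)"
  "finite A \<Longrightarrow> (\<Sum>a\<in>A. (if b = a then 1 else (0::complex)) *\<^sub>C f a) = (if b \<in> A then f b else 0)"
  by (simp_all add: if_distrib[of "\<lambda>c. c *\<^sub>C _"] complex_vector.scale_zero_left scaleC_one cong: if_cong)

text \<open>The spectral projector of an element with fourth power 1, as a discrete Fourier sum. It
  is kept generic in the algebra so that a homomorphism sends it to the projector of the image of
  \<open>K\<close>; weight projectors are evaluated in this way under each structure map.\<close>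

definition wt_proj :: "'a::complex_algebra \<Rightarrow> wt \<Rightarrow> 'a" where
  "wt_proj K a = (1/4) *\<^sub>C (1 + cnj (chi a) *\<^sub>C K + cnj (chi a) ^ 2 *\<^sub>C K ^ 2 + cnj (chi a) ^ 3 *\<^sub>C K ^ 3)"

lemma chi_simps:
  "chi a ^ 4 = 1" "cnj (chi a) * chi a = 1" "chi a * cnj (chi a) = 1" "chi (sh a) = - chi a" "chi a \<noteq> 0"
  by (auto simp: chi_def sh_def power4_eq_xxxx)

lemma sh_sh [simp]: "sh (sh a) = a" "fst (sh a) = fst a" "snd (sh a) = (\<not> snd a)" "sh a = sh b \<longleftrightarrow> a = b"
  by (auto simp: sh_def prod_eq_iff)

text \<open>Orthogonality of the fourth roots of unity: the four powers of a root sum to 0 unless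
  the root is 1.\<close>

lemma wt_proj_mult_eigen:
  assumes "K * v = chi b *\<^sub>C v"
  shows "wt_proj K a * v = (if a = b then v else 0)"
proof -
  have "K ^ n * v = chi b ^ n *\<^sub>C v" for n
    by (induction n) (simp_all add: scaleC_one mult.assoc scaleC_mult_right assms scaleC_scaleC mult.commute)
  from this[of 2] this[of 3] have "wt_proj K a * v =
      ((1/4) * (1 + cnj (chi a) * chi b + (cnj (chi a) * chi b) ^ 2 + (cnj (chi a) * chi b) ^ 3)) *\<^sub>C v"
    by (simp add: wt_proj_def scaleC_mult_left distrib_right assms scaleC_scaleC scaleC_add_left
        scaleC_one power_mult_distrib scaleC_add_right distrib_left)
  also have "(1/4) * (1 + cnj (chi a) * chi b + (cnj (chi a) * chi b) ^ 2 + (cnj (chi a) * chi b) ^ 3) =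
      (if a = b then 1 else 0)"
    by (cases a; cases b) (auto simp: chi_def power2_eq_square power3_eq_cube)
  finally show ?thesis by (simp add: scaleC_one complex_vector.scale_zero_left)
qed

definition P :: "wt \<Rightarrow> 'n Q" where
  "P a = wt_proj QK a"

lemma QK_P: "QK * P a = (chi a *\<^sub>C P a :: 'n Q)"
proof -
  let ?z = "cnj (chi a)"
  have p: "QK * QK ^ 2 = (QK ^ 3 :: 'n Q)" "QK * QK ^ 3 = (1 :: 'n Q)"
    using Q_relations(6) by (simp_all add: power2_eq_square power3_eq_cube power4_eq_xxxx mult.assoc)
  have z: "chi a * ?z ^ 2 = ?z" "chi a * ?z ^ 3 = ?z ^ 2" "?z ^ 3 = chi a"
    by (cases a; simp add: chi_def power2_eq_square power3_eq_cube)+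
  have "(QK * P a :: 'n Q) = (1/4) *\<^sub>C (QK + ?z *\<^sub>C QK ^ 2 + ?z ^ 2 *\<^sub>C QK ^ 3 + ?z ^ 3 *\<^sub>C 1)"
    unfolding P_def wt_proj_def
    by (simp only: scaleC_mult_right distrib_left p mult_1_right power2_eq_square[of QK, symmetric])
  also have "\<dots> = (1/4) *\<^sub>C chi a *\<^sub>C (1 + ?z *\<^sub>C QK + ?z ^ 2 *\<^sub>C QK ^ 2 + ?z ^ 3 *\<^sub>C QK ^ 3)"
    unfolding scaleC_add_right[of "chi a"] scaleC_scaleC[of "chi a"] chi_simps z(1,2)
    by (simp add: scaleC_one z(3) add_ac)
  also have "\<dots> = chi a *\<^sub>C P a"
    unfolding P_def wt_proj_def by (simp only: scaleC_scaleC mult.commute[of "chi a"])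
  finally show ?thesis .
qed

lemma P_P: "P a * P b = (if a = b then P b else 0)"
  unfolding P_def by (rule wt_proj_mult_eigen) (rule QK_P[unfolded P_def])

lemma sum_P: "(\<Sum>a\<in>UNIV. P a) = 1"
proof -
  have four: "4 *\<^sub>C x = x + x + x + x" for x :: "'a Q"
    using scaleC_add_left[of 2 2 x] scaleC_add_left[of 1 1 x] by (simp add: scaleC_one add.assoc)
  have "4 *\<^sub>C (\<Sum>a\<in>UNIV. P a) = (4 *\<^sub>C 1 :: 'a Q)"
    unfolding sum_wt P_def wt_proj_def scaleC_add_right scaleC_scaleC
    by (simp add: chi_def scaleC_scaleC scaleC_one complex_vector.scale_minus_left
        power2_eq_square power3_eq_cube four)
  then have "(1/4) *\<^sub>C 4 *\<^sub>C (\<Sum>a\<in>UNIV. P a) = (1/4) *\<^sub>C (4 *\<^sub>C 1 :: 'a Q)" by simp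
  then show ?thesis by (simp add: scaleC_scaleC scaleC_one)
qed

definition F :: "bool \<Rightarrow> 'n \<Rightarrow> 'n Q" where
  "F b i = (if b then Qfp i else Qfm i)"

lemma F_anticomm: "F b i * F c j + F c j * F b i = (if i = j \<and> b \<noteq> c then e1 else 0)"
  using Q_relations(3)[of i j] Q_relations(4)[of i j] Q_relations(5)[of i j] Q_relations(5)[of j i]
  by (auto simp: F_def eq_neg_iff_add_eq_0)

lemma F_swap: "i \<noteq> j \<or> b = c \<Longrightarrow> F b i * F c j = - (F c j * F b i)"
  using F_anticomm[of b i c j] by (auto simp: eq_neg_iff_add_eq_0)

lemma scaleC_2_eq_0: "x + x = 0 \<Longrightarrow> x = (0::'a::complex_vector)"
proof -
  assume "x + x = 0"
  then have "2 *\<^sub>C x = 0" using scaleC_add_left[of 1 1 x] by (simp only: scaleC_one one_add_one)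
  then have "(1/2) *\<^sub>C 2 *\<^sub>C x = 0" by (simp only: complex_vector.scale_zero_right)
  then show "x = 0" unfolding scaleC_scaleC by (simp add: scaleC_one)
qed

lemma F_F_same: "F b i * F b i = 0"
  by (rule scaleC_2_eq_0) (simp add: F_anticomm)

lemma F_Not: "F (\<not> b) i * F b i = e1 - F b i * F (\<not> b) i"
  using F_anticomm[of "\<not> b" i b i] by (simp add: algebra_simps)

lemma F_K: "QK * F b i = - (F b i * QK)"
  by (simp add: F_def Q_relations(1,2))

lemma P_F: "P a * F b i = F b i * P (sh a)"
proof -
  have k: "QK ^ n * F b i = (-1) ^ n *\<^sub>C (F b i * QK ^ n)" for n
  proof (induction n)
    case (Suc n)
    have "QK ^ Suc n * F b i = QK * (QK ^ n * F b i)" by (simp add: mult.assoc)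
    also have "\<dots> = (-1) ^ n *\<^sub>C ((QK * F b i) * QK ^ n)"
      by (simp only: Suc scaleC_mult_right mult.assoc)
    also have "\<dots> = (-1) ^ Suc n *\<^sub>C (F b i * QK ^ Suc n)"
      by (simp add: F_K complex_vector.scale_minus_left complex_vector.scale_minus_right mult.assoc)
    finally show ?case .
  qed (simp add: scaleC_one)
  show ?thesis
    unfolding P_def wt_proj_def using k[of 1] k[of 2] k[of 3]
    by (simp add: distrib_left distrib_right right_diff_distrib scaleC_mult_left scaleC_mult_right chi_simps scaleC_scaleC
        power2_eq_square power3_eq_cube complex_vector.scale_minus_left complex_vector.scale_minus_right scaleC_one)
qed


section \<open>Diagonal elements\<close>

text \<open>Diagonal in the first leg only, with values in an arbitrary space. Nesting it gives
  \<open>D2\<close>, \<open>D3\<close> and \<open>D4\<close>, so each rule for several legs follows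
  from the rule for one leg fewer.\<close>

definition dg :: "(wt \<Rightarrow> 'b) \<Rightarrow> 'n Q \<otimes>\<^sub>C 'b::complex_vector" where
  "dg G = (\<Sum>a\<in>UNIV. P a \<otimes>\<^sub>C G a)"

definition D1 :: "(wt \<Rightarrow> complex) \<Rightarrow> 'n Q" where
  "D1 g = (\<Sum>a\<in>UNIV. g a *\<^sub>C P a)"

definition D2 :: "(wt \<Rightarrow> wt \<Rightarrow> complex) \<Rightarrow> 'n Q \<otimes>\<^sub>C 'n Q" where
  "D2 g = dg (\<lambda>a. D1 (g a))"

definition D3 :: "(wt \<Rightarrow> wt \<Rightarrow> wt \<Rightarrow> complex) \<Rightarrow> 'n Q \<otimes>\<^sub>C 'n Q \<otimes>\<^sub>C 'n Q" where
  "D3 g = dg (\<lambda>a. D2 (g a))"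

definition D4 :: "(wt \<Rightarrow> wt \<Rightarrow> wt \<Rightarrow> wt \<Rightarrow> complex) \<Rightarrow> 'n Q \<otimes>\<^sub>C 'n Q \<otimes>\<^sub>C 'n Q \<otimes>\<^sub>C 'n Q" where
  "D4 g = dg (\<lambda>a. D3 (g a))"

lemma D1_mult: "D1 g * D1 h = D1 (\<lambda>a. g a * h a)"
  by (simp add: D1_def sum_distrib_left sum_distrib_right scaleC_mult_left scaleC_mult_right P_P
      scaleC_scaleC if_distrib[of "scaleC _"] complex_vector.scale_zero_right mult.commute cong: if_cong)

lemma D1_add: "D1 g + D1 h = D1 (\<lambda>a. g a + h a)"
  by (simp add: D1_def sum.distrib scaleC_add_left)

lemma D1_scale: "c *\<^sub>C D1 g = D1 (\<lambda>a. c * g a)"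
  by (simp add: D1_def complex_vector.scale_sum_right scaleC_scaleC)

lemma D1_diff: "D1 g - D1 h = D1 (\<lambda>a. g a - h a)"
  by (simp add: D1_def sum_subtractf complex_vector.scale_left_diff_distrib)

lemma D1_minus: "- D1 g = D1 (\<lambda>a. - g a)"
  by (simp add: D1_def sum_negf complex_vector.scale_minus_left)

lemma one_D1: "1 = D1 (\<lambda>a. 1)"
  by (simp add: D1_def scaleC_one sum_P)

lemma zero_D1: "0 = D1 (\<lambda>a. 0)"
  by (simp add: D1_def complex_vector.scale_zero_left)

lemma P_D1: "P b = D1 (\<lambda>a. if a = b then 1 else 0)"
  by (simp add: D1_def sum_delta_scaleC)

lemma QK_D1: "QK = D1 chi"
proof -
  have "QK = QK * (\<Sum>a\<in>UNIV. P a)" by (simp add: sum_P)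
  then show ?thesis by (simp only: sum_distrib_left QK_P D1_def)
qed

lemma D1_power: "D1 g ^ n = D1 (\<lambda>a. g a ^ n)"
  by (induction n) (simp_all add: D1_mult one_D1)

lemma D1_F: "D1 g * F b i = F b i * D1 (\<lambda>a. g (sh a))"
proof -
  have "D1 g * F b i = (\<Sum>a\<in>UNIV. g a *\<^sub>C (F b i * P (sh a)))"
    by (simp add: D1_def sum_distrib_right scaleC_mult_left P_F)
  also have "\<dots> = (\<Sum>a\<in>UNIV. g (sh a) *\<^sub>C (F b i * P a))"
    by (rule sum.reindex_bij_witness[of _ sh sh]) simp_all
  finally show ?thesis by (simp add: D1_def sum_distrib_left scaleC_mult_right)
qed

lemma D1_sum: "(\<Sum>i\<in>I. D1 (g i)) = D1 (\<lambda>a. \<Sum>i\<in>I. g i a)"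
  by (simp add: D1_def complex_vector.scale_sum_left) (rule sum.swap)

lemma dg_mult: "dg G * dg H = dg (\<lambda>a. G a * H a)" for G :: "wt \<Rightarrow> 'b::complex_algebra"
proof -
  have "dg G * dg H = (\<Sum>a\<in>UNIV. \<Sum>b\<in>UNIV. (P a * P b) \<otimes>\<^sub>C (G a * H b))"
    by (simp add: dg_def sum_distrib_left sum_distrib_right tens_mult) (rule sum.swap)
  then show ?thesis
    by (simp add: P_P dg_def if_distrib[of "\<lambda>x. x \<otimes>\<^sub>C _"] tens_zero cong: if_cong)
qed

lemma dg_add: "dg G + dg H = dg (\<lambda>a. G a + H a)"
  by (simp add: dg_def sum.distrib tens_add_right)

lemma dg_diff: "dg G - dg H = dg (\<lambda>a. G a - H a)"
  by (simp add: dg_def sum_subtractf tens_diff)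

lemma dg_scale: "c *\<^sub>C dg G = dg (\<lambda>a. c *\<^sub>C G a)"
  by (simp add: dg_def complex_vector.scale_sum_right tens_scaleC_right)

lemma dg_sum: "(\<Sum>i\<in>I. dg (G i)) = dg (\<lambda>a. \<Sum>i\<in>I. G i a)"
  by (simp add: dg_def tens_sum) (rule sum.swap)

lemma dg_const: "dg (\<lambda>a. y) = 1 \<otimes>\<^sub>C y"
  by (simp add: dg_def tens_sum[symmetric] sum_P)

lemma D1_tens: "D1 g \<otimes>\<^sub>C y = dg (\<lambda>a. g a *\<^sub>C y)"
  by (simp add: D1_def dg_def tens_sum tens_scaleC_left tens_scaleC_right)

lemma one_dg: "1 = dg (\<lambda>a. 1)"
  by (simp add: dg_const tens_one)

lemma dg_F1: "dg G * (F b i \<otimes>\<^sub>C 1) = (F b i \<otimes>\<^sub>C 1) * dg (\<lambda>a. G (sh a))" for G :: "wt \<Rightarrow> 'b::complex_algebra"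
proof -
  have "dg G * (F b i \<otimes>\<^sub>C 1) = (\<Sum>a\<in>UNIV. (F b i * P (sh a)) \<otimes>\<^sub>C G a)"
    by (simp add: dg_def sum_distrib_right tens_mult P_F)
  also have "\<dots> = (\<Sum>a\<in>UNIV. (F b i * P a) \<otimes>\<^sub>C G (sh a))"
    by (rule sum.reindex_bij_witness[of _ sh sh]) simp_all
  finally show ?thesis by (simp add: dg_def sum_distrib_left tens_mult)
qed

lemma dg_tens_right:
  "dg G * (1 \<otimes>\<^sub>C y) = dg (\<lambda>a. G a * y)" "(1 \<otimes>\<^sub>C y) * dg G = dg (\<lambda>a. y * G a)"
  for G :: "wt \<Rightarrow> 'b::complex_algebra"
  by (simp_all add: dg_def sum_distrib_right sum_distrib_left tens_mult)

lemma D2_mult: "D2 g * D2 h = D2 (\<lambda>a b. g a b * h a b)"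
  by (simp add: D2_def dg_mult D1_mult)
lemma D2_add: "D2 g + D2 h = D2 (\<lambda>a b. g a b + h a b)"
  by (simp add: D2_def dg_add D1_add)
lemma D2_diff: "D2 g - D2 h = D2 (\<lambda>a b. g a b - h a b)"
  by (simp add: D2_def dg_diff D1_diff)
lemma D2_scale: "c *\<^sub>C D2 g = D2 (\<lambda>a b. c * g a b)"
  by (simp add: D2_def dg_scale D1_scale)
lemma D2_sum: "(\<Sum>i\<in>I. D2 (g i)) = D2 (\<lambda>a b. \<Sum>i\<in>I. g i a b)"
  by (simp add: D2_def dg_sum D1_sum)
lemma one_D2: "1 = D2 (\<lambda>a b. 1)"
  by (simp add: D2_def one_D1[symmetric] one_dg[symmetric])
lemma D1_tens_D1: "D1 g \<otimes>\<^sub>C D1 h = D2 (\<lambda>a b. g a * h b)"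
  by (simp add: D1_tens D2_def D1_scale)
lemma D2_power: "D2 g ^ n = D2 (\<lambda>a b. g a b ^ n)"
  by (induction n) (simp_all add: D2_mult one_D2)

lemma D3_mult: "D3 g * D3 h = D3 (\<lambda>a b c. g a b c * h a b c)"
  by (simp add: D3_def dg_mult D2_mult)
lemma D3_add: "D3 g + D3 h = D3 (\<lambda>a b c. g a b c + h a b c)"
  by (simp add: D3_def dg_add D2_add)
lemma D3_diff: "D3 g - D3 h = D3 (\<lambda>a b c. g a b c - h a b c)"
  by (simp add: D3_def dg_diff D2_diff)
lemma D3_scale: "x *\<^sub>C D3 g = D3 (\<lambda>a b c. x * g a b c)"
  by (simp add: D3_def dg_scale D2_scale)
lemma one_D3: "1 = D3 (\<lambda>a b c. 1)"
  by (simp add: D3_def one_D2[symmetric] one_dg[symmetric])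
lemma D1_tens_D2: "D1 g \<otimes>\<^sub>C D2 h = D3 (\<lambda>a b c. g a * h b c)"
  by (simp add: D1_tens D3_def D2_scale)

lemma D4_mult: "D4 g * D4 h = D4 (\<lambda>a b c d. g a b c d * h a b c d)"
  by (simp add: D4_def dg_mult D3_mult)
lemma D1_tens_D3: "D1 g \<otimes>\<^sub>C D3 h = D4 (\<lambda>a b c d. g a * h b c d)"
  by (simp add: D1_tens D4_def D3_scale)

lemmas D_simps = D1_mult D1_add D1_scale D1_diff D1_minus D1_power D2_mult D2_add D2_diff D2_scale D2_power
  D3_mult D3_add D3_diff D3_scale D4_mult D1_tens_D1 D1_tens_D2 D1_tens_D3

lemma D2_F:
  "D2 g * (F x i \<otimes>\<^sub>C 1) = (F x i \<otimes>\<^sub>C 1) * D2 (\<lambda>a b. g (sh a) b)"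
  "D2 g * (1 \<otimes>\<^sub>C F x i) = (1 \<otimes>\<^sub>C F x i) * D2 (\<lambda>a b. g a (sh b))"
  by (simp_all add: D2_def dg_F1 dg_tens_right D1_F)

lemma D3_F:
  "D3 g * (F x i \<otimes>\<^sub>C 1) = (F x i \<otimes>\<^sub>C 1) * D3 (\<lambda>a b c. g (sh a) b c)"
  "D3 g * (1 \<otimes>\<^sub>C F x i \<otimes>\<^sub>C 1) = (1 \<otimes>\<^sub>C F x i \<otimes>\<^sub>C 1) * D3 (\<lambda>a b c. g a (sh b) c)"
  "D3 g * (1 \<otimes>\<^sub>C 1 \<otimes>\<^sub>C F x i) = (1 \<otimes>\<^sub>C 1 \<otimes>\<^sub>C F x i) * D3 (\<lambda>a b c. g a b (sh c))"
  by (simp_all add: D3_def dg_F1 dg_tens_right D2_F)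

lemma D2_expand: "D2 g = (\<Sum>a\<in>UNIV. \<Sum>b\<in>UNIV. g a b *\<^sub>C (P a \<otimes>\<^sub>C P b))"
  by (simp add: D2_def D1_def dg_def tens_sum tens_scaleC_right)

lemma D3_expand: "D3 g = (\<Sum>a\<in>UNIV. \<Sum>b\<in>UNIV. \<Sum>c\<in>UNIV. g a b c *\<^sub>C (P a \<otimes>\<^sub>C P b \<otimes>\<^sub>C P c))"
  by (simp add: D3_def D2_expand dg_def tens_sum tens_scaleC_right)

lemma tflip_D2: "tflip (D2 g) = D2 (\<lambda>a b. g b a)"
  by (simp add: D2_expand linear_C_simps[OF algebra_homD(1)[OF algebra_hom_tflip]] tflip_tens) (rule sum.swap)

lemma tlift3_perm_D3:
  "tlift3 (\<lambda>x y z. z \<otimes>\<^sub>C x \<otimes>\<^sub>C y) (D3 g) = D3 (\<lambda>a b c. g b c a)"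
  "tlift3 (\<lambda>x y z. y \<otimes>\<^sub>C x \<otimes>\<^sub>C z) (D3 g) = D3 (\<lambda>a b c. g b a c)"
  "tlift3 (\<lambda>x y z. y \<otimes>\<^sub>C z \<otimes>\<^sub>C x) (D3 g) = D3 (\<lambda>a b c. g c a b)"
  "tlift3 (\<lambda>x y z. x \<otimes>\<^sub>C z \<otimes>\<^sub>C y) (D3 g) = D3 (\<lambda>a b c. g a c b)"
proof -
  note L = linear_C_simps[OF linear_C_tlift3[OF trilinear_C_perm(1)]] linear_C_simps[OF linear_C_tlift3[OF trilinear_C_perm(2)]]
    linear_C_simps[OF linear_C_tlift3[OF trilinear_C_perm(3)]] linear_C_simps[OF linear_C_tlift3[OF trilinear_C_perm(4)]]
  have s: "(\<Sum>a\<in>UNIV. \<Sum>b\<in>UNIV. \<Sum>c\<in>UNIV. f a b c) = (\<Sum>c\<in>UNIV. \<Sum>a\<in>UNIV. \<Sum>b\<in>UNIV. f a b c)"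
    for f :: "wt \<Rightarrow> wt \<Rightarrow> wt \<Rightarrow> 'n Q \<otimes>\<^sub>C 'n Q \<otimes>\<^sub>C 'n Q"
  proof -
    have "(\<Sum>a\<in>UNIV. \<Sum>b\<in>UNIV. \<Sum>c\<in>UNIV. f a b c) = (\<Sum>a\<in>UNIV. \<Sum>c\<in>UNIV. \<Sum>b\<in>UNIV. f a b c)"
      by (intro sum.cong refl sum.swap)
    also have "\<dots> = (\<Sum>c\<in>UNIV. \<Sum>a\<in>UNIV. \<Sum>b\<in>UNIV. f a b c)" by (rule sum.swap)
    finally show ?thesis .
  qed
  show "tlift3 (\<lambda>x y z. z \<otimes>\<^sub>C x \<otimes>\<^sub>C y) (D3 g) = D3 (\<lambda>a b c. g b c a)"
    unfolding D3_expand L tlift3_perm by (rule s)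
  show "tlift3 (\<lambda>x y z. y \<otimes>\<^sub>C x \<otimes>\<^sub>C z) (D3 g) = D3 (\<lambda>a b c. g b a c)"
    unfolding D3_expand L tlift3_perm by (rule sum.swap)
  show "tlift3 (\<lambda>x y z. y \<otimes>\<^sub>C z \<otimes>\<^sub>C x) (D3 g) = D3 (\<lambda>a b c. g c a b)"
    unfolding D3_expand L tlift3_perm by (rule s[symmetric])
  show "tlift3 (\<lambda>x y z. x \<otimes>\<^sub>C z \<otimes>\<^sub>C y) (D3 g) = D3 (\<lambda>a b c. g a c b)"
    unfolding D3_expand L tlift3_perm by (intro sum.cong refl sum.swap)
qed

lemma tlift_mid_D2: "tlift (\<lambda>x y. x \<otimes>\<^sub>C 1 \<otimes>\<^sub>C y) (D2 g) = D3 (\<lambda>a b c. g a c)"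
  unfolding D2_def D3_def dg_const
  by (simp add: dg_def linear_C_simps[OF linear_C_tlift[OF bilinear_C_mid]] tlift_mid)

lemma tmap_dg: "linear_C f \<Longrightarrow> tmap id f (dg G) = dg (\<lambda>a. f (G a))"
  by (simp add: dg_def linear_C_simps[OF linear_C_tmap[OF linear_C_id(1)]] tmap_tens linear_C_id)

lemma tassoc_dg_tens: "tassoc (dg G \<otimes>\<^sub>C y) = dg (\<lambda>a. G a \<otimes>\<^sub>C y)"
  by (simp add: dg_def tens_sum linear_C_simps[OF linear_C_tassoc] tassoc_tens)

text \<open>The projectors sum to 1, so an identity may be tested on each of them. There every
  function of \<open>K\<close> becomes a number and only words in the generators remain.\<close>

lemma wt_eqI1:
  assumes "\<And>a. x * P a = y * P a" shows "x = (y :: 'n Q)"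
proof -
  have "x * (\<Sum>a\<in>UNIV. P a) = y * (\<Sum>a\<in>UNIV. P a)" by (simp only: sum_distrib_left assms)
  then show ?thesis by (simp add: sum_P)
qed

lemma wt_eqI2:
  assumes "\<And>a b. x * (P a \<otimes>\<^sub>C P b) = y * (P a \<otimes>\<^sub>C P b)" shows "x = (y :: 'n Q \<otimes>\<^sub>C 'n Q)"
proof -
  have "x * D2 (\<lambda>a b. 1) = y * D2 (\<lambda>a b. 1)"
    by (simp only: D2_expand sum_distrib_left scaleC_mult_right assms)
  then show ?thesis by (simp add: one_D2[symmetric])
qed


section \<open>Structure functions on the group of weights\<close>

definition gm :: "bool \<Rightarrow> wt \<Rightarrow> wt \<Rightarrow> wt" where
  "gm od a b = (fst a \<noteq> fst b, (snd a \<noteq> snd b) \<noteq> (od \<and> fst a \<and> fst b))"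

text \<open>The inverse for the group law \<open>gm od\<close>. For \<open>od = False\<close> the
  group is \<open>\<int>_2 x \<int>_2\<close>; for \<open>od = True\<close> a weight of the sector
  \<open>e1\<close> squares to \<open>(False, True)\<close>, which gives
  \<open>\<int>_4\<close>.\<close>

definition st :: "bool \<Rightarrow> wt \<Rightarrow> wt" where
  "st od a = (fst a, snd a \<noteq> (od \<and> fst a))"

text \<open>Eigenvalues of \<open>omega_p\<close> for \<open>b = True\<close> and of
  \<open>omega_m\<close> for \<open>b = False\<close>; the latter is the bare parity.\<close>

definition w :: "bool \<Rightarrow> wt \<Rightarrow> complex" where
  "w b a = (if snd a then -1 else 1) * (if fst a \<and> b then -1 else 1)"

text \<open>The sign \<open>(-1)^N\<close> in the antipode of the generators exchanges the two
  elements omega when N is odd.\<close>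

definition u :: "bool \<Rightarrow> bool \<Rightarrow> wt \<Rightarrow> complex" where
  "u od b = w (b \<noteq> od)"

text \<open>In the next three definitions \<open>x\<close> stands for \<open>\<beta>\<^sup>2\<close>.\<close>

definition gam :: "bool \<Rightarrow> complex \<Rightarrow> wt \<Rightarrow> complex" where
  "gam od x a = (if fst a then (if od then - x else x) else 1) * (if od \<and> snd a then -1 else 1)"

definition phi :: "bool \<Rightarrow> complex \<Rightarrow> wt \<Rightarrow> wt \<Rightarrow> wt \<Rightarrow> complex" where
  "phi od x a b c = (if fst a \<and> fst b then gam od x c else 1)"

definition bet :: "bool \<Rightarrow> complex \<Rightarrow> wt \<Rightarrow> complex" where
  "bet od x a = (if fst a then gam od x a else 1)"

lemmas wt_defs = gm_def st_def w_def u_def gam_def phi_def bet_def chi_def sh_def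

lemma D1_cong: "(\<And>a. g a = h a) \<Longrightarrow> D1 g = D1 h"
  by presburger

lemma D2_cong: "(\<And>a b. g a b = h a b) \<Longrightarrow> D2 g = D2 h"
  by presburger

lemma D3_cong: "(\<And>a b c. g a b c = h a b c) \<Longrightarrow> D3 g = D3 h"
  by presburger

lemma D2_minus: "- D2 g = D2 (\<lambda>a b. - g a b)"
  using D2_scale[of "-1" g] by (simp add: complex_vector.scale_minus_left scaleC_one)

lemma e_D1: "e0 = D1 (\<lambda>a. if fst a then 0 else 1)" "e1 = D1 (\<lambda>a. if fst a then 1 else 0)"
  by (simp_all add: e0_def e0_of_def e1_def e1_of_def QK_D1 one_D1 D_simps)
     (rule D1_cong, simp add: chi_def power2_eq_square)+

lemma omega_D1: "omega_p = D1 (w True)" "omega_m = D1 (w False)"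
  by (simp_all add: omega_p_def omega_m_def QK_D1 e_D1 D_simps)
     (rule D1_cong, simp add: chi_def w_def)+

lemma D2_PP: "D2 g * (P a \<otimes>\<^sub>C P b) = g a b *\<^sub>C (P a \<otimes>\<^sub>C P b)"
  by (simp add: P_D1 D_simps) (rule D2_cong, simp)

lemma algebra_hom_wt_proj: "algebra_hom f \<Longrightarrow> f (wt_proj K a) = wt_proj (f K) a"
  by (simp add: wt_proj_def linear_C_simps[OF algebra_homD(1)] algebra_homD algebra_hom_power)

text \<open>The tensor product of two weight vectors is an eigenvector whose weight is
  \<open>m a b\<close>, so a spectral projector is the indicator of a fibre of
  \<open>m\<close>.\<close>

lemma wt_proj_D2:
  assumes "\<And>a b. k a b = chi (m a b)"
  shows "wt_proj (D2 k) c = D2 (\<lambda>a b. if m a b = c then 1 else 0)"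
proof (rule wt_eqI2)
  fix a b
  have "wt_proj (D2 k) c * (P a \<otimes>\<^sub>C P b) = (if c = m a b then P a \<otimes>\<^sub>C P b else 0)"
    by (rule wt_proj_mult_eigen) (simp add: D2_PP assms)
  then show "wt_proj (D2 k) c * (P a \<otimes>\<^sub>C P b) = D2 (\<lambda>a b. if m a b = c then 1 else 0) * (P a \<otimes>\<^sub>C P b)"
    by (auto simp: D2_PP scaleC_one complex_vector.scale_zero_left)
qed

lemma wt_proj_D1:
  assumes "\<And>a. k a = chi (m a)"
  shows "wt_proj (D1 k) c = D1 (\<lambda>a. if m a = c then 1 else 0)"
proof (rule wt_eqI1)
  fix a
  have D1P: "D1 g * P a = g a *\<^sub>C P a" for g :: "wt \<Rightarrow> complex"
    by (simp add: P_D1 D_simps) (rule D1_cong, simp)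
  have "wt_proj (D1 k) c * P a = (if c = m a then P a else 0)"
    by (rule wt_proj_mult_eigen) (simp add: D1P assms)
  then show "wt_proj (D1 k) c * P a = D1 (\<lambda>a. if m a = c then 1 else 0) * P a"
    by (auto simp: D1P scaleC_one complex_vector.scale_zero_left)
qed

section \<open>The comultiplication, counit and antipode\<close>

definition cm :: "'n::finite Q \<Rightarrow> 'n Q \<otimes>\<^sub>C 'n Q" where "cm = Q_hom_ext Q_comult_gen"
definition eps :: "'n Q \<Rightarrow> complex" where "eps = Q_hom_ext Q_counit_gen"
definition ant :: "'n::finite Q \<Rightarrow> 'n Q" where "ant = Q_antihom_ext Q_antipode_gen"

lemma tens_F_D2: "D1 g \<otimes>\<^sub>C F b i = (1 \<otimes>\<^sub>C F b i) * (D2 (\<lambda>a c. g a) :: 'n Q \<otimes>\<^sub>C 'n Q)"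
proof -
  have "D1 g \<otimes>\<^sub>C F b i = (1 \<otimes>\<^sub>C F b i) * (D1 g \<otimes>\<^sub>C (1 :: 'n Q) :: 'n Q \<otimes>\<^sub>C 'n Q)" by (simp add: tens_mult)
  moreover have "D1 g \<otimes>\<^sub>C 1 = (D2 (\<lambda>a c. g a) :: 'n Q \<otimes>\<^sub>C 'n Q)" unfolding one_D1 D1_tens_D1 by simp
  ultimately show ?thesis by simp
qed

lemma Q_comult_gen_eq:
  fixes i :: "'n::finite"
  shows "Q_comult_gen Letter_K = (D2 (\<lambda>a b. chi (gm (odd CARD('n)) a b)) :: 'n Q \<otimes>\<^sub>C 'n Q)"
    "Q_comult_gen (Letter_fp i) = F True i \<otimes>\<^sub>C 1 + (1 \<otimes>\<^sub>C F True i) * D2 (\<lambda>a c. w True a)"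
    "Q_comult_gen (Letter_fm i) = F False i \<otimes>\<^sub>C 1 + (1 \<otimes>\<^sub>C F False i) * D2 (\<lambda>a c. w False a)"
proof -
  have "(-1) ^ CARD('n) = (if odd CARD('n) then -1 else 1 :: complex)" by simp
  then show "Q_comult_gen Letter_K = (D2 (\<lambda>a b. chi (gm (odd CARD('n)) a b)) :: 'n Q \<otimes>\<^sub>C 'n Q)"
    unfolding Q_comult_gen.simps QK_D1 e_D1 D_simps
    by (intro D2_cong) (auto simp: chi_def gm_def)
qed (simp_all add: omega_D1 tens_F_D2[symmetric], simp_all add: F_def)

text \<open>The factor omega in the first leg anticommutes with generators, which cancels the mixed
  terms although generators in different legs commute. What is left is one anticommutator in each
  leg.\<close>

lemma comult_F_anticomm:
  fixes i j :: "'n::finite"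
  defines "DF \<equiv> \<lambda>b (i::'n). F b i \<otimes>\<^sub>C 1 + (1 \<otimes>\<^sub>C F b i) * D2 (\<lambda>a c. w b a)"
  shows "anticomm (DF b i) (D2 (\<lambda>a b. chi (gm od a b))) = 0"
    and "anticomm (DF b i) (DF c j) = (if i = j \<and> b \<noteq> c then e1_of (D2 (\<lambda>a b. chi (gm od a b))) else 0)"
proof -
  have s: "chi (gm od (sh a) d) = - chi (gm od a d)" "chi (gm od a (sh d)) = - chi (gm od a d)"
    "w b (sh a) = - w b a" for a d b
    by (auto simp: wt_defs)
  note mv = distrib_left distrib_right mult.assoc D2_F D2_mult D2_F[THEN trans[OF mult.assoc[symmetric] arg_cong[where f="\<lambda>x. x * _"]], unfolded mult.assoc]
  show "anticomm (DF b i) (D2 (\<lambda>a b. chi (gm od a b))) = 0"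
    unfolding anticomm_def DF_def
    by (simp add: mv s D2_minus[symmetric] mult.commute)
  let ?A = "\<lambda>b i. F b i \<otimes>\<^sub>C (1::'n Q)" and ?B = "\<lambda>b i. (1::'n Q) \<otimes>\<^sub>C F b i" and ?W = "\<lambda>b. D2 (\<lambda>a c. w b a) :: 'n Q \<otimes>\<^sub>C 'n Q"
  have c: "?B b i * ?A c j = ?A c j * ?B b i" for b c i j by (simp add: tens_mult)
  have WA: "?W b * ?A c j = - (?A c j * ?W b)" for b c j by (simp add: D2_F s D2_minus[symmetric])
  have WB: "?W b * ?B c j = ?B c j * ?W b" for b c j by (simp add: D2_F)
  have 1: "?A b i * (?B c j * ?W c) + (?B c j * ?W c) * ?A b i = 0" for b c i j
    by (simp add: mult.assoc WA) (simp add: mult.assoc[symmetric] c)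
  have 2: "(?B b i * ?W b) * (?B c j * ?W c) + (?B c j * ?W c) * (?B b i * ?W b)
      = (?B b i * ?B c j + ?B c j * ?B b i) * (?W b * ?W c)"
  proof -
    have "(?B b i * ?W b) * (?B c j * ?W c) = ?B b i * (?W b * ?B c j) * ?W c" for b c i j
      by (simp only: mult.assoc)
    then have "(?B b i * ?W b) * (?B c j * ?W c) = ?B b i * ?B c j * (?W b * ?W c)" for b c i j
      by (simp only: WB mult.assoc)
    moreover have "?W c * ?W b = ?W b * ?W c" by (simp add: D2_mult mult.commute)
    ultimately show ?thesis by (simp add: distrib_right)
  qed
  have "anticomm (DF b i) (DF c j) = (?A b i * ?A c j + ?A c j * ?A b i)
     + (?A b i * (?B c j * ?W c) + (?B c j * ?W c) * ?A b i) + (?A c j * (?B b i * ?W b) + (?B b i * ?W b) * ?A c j)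
     + ((?B b i * ?W b) * (?B c j * ?W c) + (?B c j * ?W c) * (?B b i * ?W b))"
    unfolding anticomm_def DF_def by (simp only: distrib_left distrib_right add_ac)
  also have "\<dots> = (F b i * F c j + F c j * F b i) \<otimes>\<^sub>C 1 + (1 \<otimes>\<^sub>C (F b i * F c j + F c j * F b i)) * (?W b * ?W c)"
    by (simp only: 1 2 add_0_right) (simp add: tens_mult tens_add_left tens_add_right)
  also have "\<dots> = (if i = j \<and> b \<noteq> c then e1_of (D2 (\<lambda>a b. chi (gm od a b))) else 0)"
  proof (cases "i = j \<and> b \<noteq> c")
    case True
    \<comment> \<open>For sectors s and t the eigenvalue is \<open>s + (-1)^s t\<close>, the
      indicator of \<open>s \<noteq> t\<close>, and this is the sector of the product
      weight.\<close>
    have "e1 \<otimes>\<^sub>C 1 + (1 \<otimes>\<^sub>C e1) * (?W b * ?W c) = e1_of (D2 (\<lambda>a b. chi (gm od a b)) :: 'n Q \<otimes>\<^sub>C 'n Q)"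
      unfolding e1_of_def e_D1 one_D1 D_simps one_D2
      using True by (intro D2_cong) (auto simp: wt_defs power2_eq_square)
    then show ?thesis using True by (simp add: F_anticomm)
  qed (auto simp: F_anticomm tens_zero)
  finally show "anticomm (DF b i) (DF c j) = (if i = j \<and> b \<noteq> c then e1_of (D2 (\<lambda>a b. chi (gm od a b))) else 0)" .
qed

lemma Q_rels_comult: "Q_rels (Q_comult_gen :: 'n::finite letter \<Rightarrow> _)"
  unfolding Q_rels_def Q_comult_gen_eq comult_F_anticomm(1) comult_F_anticomm(2)[where od="odd CARD('n)"] D2_power chi_simps one_D2 by simp

lemma algebra_hom_cm: "algebra_hom cm"
  unfolding cm_def by (rule algebra_hom_Q_hom_ext[OF Q_rels_comult])

lemma cm_F: "cm (F b i) = F b i \<otimes>\<^sub>C 1 + D1 (w b) \<otimes>\<^sub>C F b i"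
  by (simp add: F_def cm_def Q_ext_gens[OF Q_rels_comult] omega_D1)

lemma cm_P: "cm (P c :: 'n::finite Q) = D2 (\<lambda>a b. if gm (odd CARD('n)) a b = c then 1 else 0)"
  unfolding P_def algebra_hom_wt_proj[OF algebra_hom_cm]
  by (simp add: cm_def Q_ext_gens[OF Q_rels_comult] Q_comult_gen_eq wt_proj_D2 del: Q_comult_gen.simps)

lemma cm_D1: "cm (D1 g :: 'n::finite Q) = D2 (\<lambda>a b. g (gm (odd CARD('n)) a b))"
  by (simp add: D1_def linear_C_simps[OF algebra_homD(1)[OF algebra_hom_cm]] cm_P D2_scale D2_sum
      if_distrib[of "(*) _"] cong: if_cong)

lemma Q_rels_counit: "Q_rels Q_counit_gen"
  by (simp add: Q_rels_def anticomm_def e1_of_def scaleC_complex_def)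

lemma algebra_hom_eps: "algebra_hom eps"
  unfolding eps_def by (rule algebra_hom_Q_hom_ext[OF Q_rels_counit])

lemma eps_F: "eps (F b i) = 0"
  by (simp add: F_def eps_def Q_ext_gens[OF Q_rels_counit])

lemma eps_K: "eps QK = 1"
  by (simp add: eps_def Q_ext_gens[OF Q_rels_counit])

lemma eps_D1: "eps (D1 g :: 'n Q) = g (False, False)"
proof -
  have "wt_proj (1::complex) a * 1 = (if a = (False, False) then 1 else 0)" for a
    by (rule wt_proj_mult_eigen) (simp add: chi_def scaleC_complex_def)
  then have "eps (P a :: 'n Q) = (if a = (False, False) then 1 else 0)" for a
    unfolding P_def algebra_hom_wt_proj[OF algebra_hom_eps] by (simp add: eps_K)
  then show ?thesis
    by (simp add: D1_def linear_C_simps[OF algebra_homD(1)[OF algebra_hom_eps]] scaleC_complex_def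
        if_distrib[of "(*) _"] cong: if_cong)
qed

lemma QK_inverse: "inverse_el QK = D1 (\<lambda>a. cnj (chi a))"
  by (rule inverse_el_eq) (simp_all add: QK_D1 D1_mult one_D1 chi_simps)

lemma Q_antipode_gen_eq:
  fixes i :: "'n::finite"
  shows "Q_antipode_gen Letter_K = (D1 (\<lambda>a. chi (st (odd CARD('n)) a)) :: 'n Q)"
    "Q_antipode_gen (Letter_fp i) = F True i * D1 (u (odd CARD('n)) True)"
    "Q_antipode_gen (Letter_fm i) = F False i * D1 (u (odd CARD('n)) False)"
proof -
  show "Q_antipode_gen Letter_K = (D1 (\<lambda>a. chi (st (odd CARD('n)) a)) :: 'n Q)"
    by (simp add: QK_inverse) (auto intro!: D1_cong simp: QK_D1 chi_def st_def)
  have "(-1) ^ CARD('n) = (if odd CARD('n) then -1 else 1 :: complex)" by simp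
  note m = this
  show "Q_antipode_gen (Letter_fp i) = F True i * D1 (u (odd CARD('n)) True)"
    unfolding Q_antipode_gen.simps m QK_D1 e_D1 F_def if_True mult.assoc D_simps
    by (intro arg_cong[of _ _ "\<lambda>x. _ * x"] D1_cong) (auto simp: wt_defs)
  show "Q_antipode_gen (Letter_fm i) = F False i * D1 (u (odd CARD('n)) False)"
    unfolding Q_antipode_gen.simps m QK_D1 e_D1 F_def if_False mult.assoc D_simps
    by (intro arg_cong[of _ _ "\<lambda>x. _ * x"] D1_cong) (auto simp: wt_defs)
qed

lemma F_D1_F_D1: "(F b i * D1 g) * (F c j * D1 h) = F b i * F c j * D1 (\<lambda>a. g (sh a) * h a)"
proof -
  have "(F b i * D1 g) * (F c j * D1 h) = F b i * (D1 g * F c j) * D1 h" by (simp only: mult.assoc)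
  then show ?thesis by (simp only: D1_F mult.assoc D1_mult)
qed

text \<open>Moving \<open>u od b\<close> past a generator gives a minus sign, and the two choices of
  \<open>b\<close> multiply to -1 on the sector \<open>e1\<close>; the two signs cancel.\<close>

lemma antipode_F_anticomm:
  fixes i j :: 'n
  shows "anticomm (F b i * D1 (u od b)) (D1 (\<lambda>a. chi (st od a)) :: 'n Q) = 0"
    and "anticomm (F b i * D1 (u od b)) (F c j * D1 (u od c)) =
      (if i = j \<and> b \<noteq> c then e1_of (D1 (\<lambda>a. chi (st od a))) else 0)"
proof -
  have "F b i * D1 (u od b) * D1 (\<lambda>a. chi (st od a)) = F b i * D1 (\<lambda>a. u od b a * chi (st od a))"
    "D1 (\<lambda>a. chi (st od a)) * (F b i * D1 (u od b)) = F b i * D1 (\<lambda>a. chi (st od (sh a)) * u od b a)"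
    by (simp add: mult.assoc D1_mult) (simp add: mult.assoc[symmetric] D1_F, simp add: mult.assoc D1_mult)
  then have "anticomm (F b i * D1 (u od b)) (D1 (\<lambda>a. chi (st od a))) = F b i * D1 (\<lambda>a. 0)"
    unfolding anticomm_def
    by (simp add: distrib_left[symmetric] D1_add) (intro arg_cong[of _ _ "\<lambda>x. _ * x"] D1_cong, auto simp: wt_defs)
  then show "anticomm (F b i * D1 (u od b)) (D1 (\<lambda>a. chi (st od a)) :: 'n Q) = 0"
    by (simp add: zero_D1[symmetric])
  have s: "D1 (\<lambda>a. u od b (sh a) * u od c a) = D1 (\<lambda>a. - (u od b a * u od c a))" for b c
    by (rule D1_cong) (auto simp: wt_defs)
  have "anticomm (F b i * D1 (u od b)) (F c j * D1 (u od c)) =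
      (F b i * F c j + F c j * F b i) * D1 (\<lambda>a. - (u od b a * u od c a))"
    unfolding anticomm_def F_D1_F_D1 s by (simp add: distrib_right mult.commute)
  also have "\<dots> = (if i = j \<and> b \<noteq> c then e1_of (D1 (\<lambda>a. chi (st od a))) else 0)"
  proof (cases "i = j \<and> b \<noteq> c")
    case True
    have "e1 * D1 (\<lambda>a. - (u od b a * u od c a)) = e1_of (D1 (\<lambda>a. chi (st od a)) :: 'n Q)"
      unfolding e_D1 e1_of_def one_D1 D_simps
    proof (rule D1_cong)
      fix a :: wt
      show "(if fst a then 1 else 0) * - (u od b a * u od c a) = 1 / 2 * (1 - chi (st od a) ^ 2)"
        using True by (cases a; cases b; cases od) (auto simp: wt_defs power2_eq_square)
    qed
    then show ?thesis using True by (simp add: F_anticomm)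
  qed (auto simp: F_anticomm)
  finally show "anticomm (F b i * D1 (u od b)) (F c j * D1 (u od c)) =
      (if i = j \<and> b \<noteq> c then e1_of (D1 (\<lambda>a. chi (st od a))) else 0)" .
qed

lemma Q_rels_antipode: "Q_rels (Q_antipode_gen :: 'n::finite letter \<Rightarrow> _)"
  unfolding Q_rels_def Q_antipode_gen_eq antipode_F_anticomm D1_power chi_simps one_D1 by simp

lemma algebra_antihomD:
  assumes "algebra_antihom f"
  shows "linear_C f" "f 1 = 1" "f (x * y) = f y * f x"
  using assms by (simp_all add: algebra_antihom_def)

lemma algebra_antihom_power: "algebra_antihom f \<Longrightarrow> f (x ^ n) = f x ^ n"
  by (induction n) (simp_all add: algebra_antihomD power_commutes)

lemma algebra_antihom_ant: "algebra_antihom ant"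
  unfolding ant_def by (rule algebra_antihom_Q_antihom_ext[OF Q_rels_antipode])

lemmas ant_simps = algebra_antihomD[OF algebra_antihom_ant] linear_C_simps[OF algebra_antihomD(1)[OF algebra_antihom_ant]]

lemma ant_F: "ant (F b i :: 'n::finite Q) = F b i * D1 (u (odd CARD('n)) b)"
  using Q_ext_gens(5,6)[OF Q_rels_antipode, of i]
  by (cases b) (simp_all add: ant_def Q_antipode_gen_eq del: Q_antipode_gen.simps, simp_all add: F_def)

lemma st_st [simp]: "st od (st od a) = a"
  by (auto simp: st_def prod_eq_iff)

lemma ant_P: "ant (P a :: 'n::finite Q) = P (st (odd CARD('n)) a)"
proof -
  have "ant (P a :: 'n Q) = wt_proj (ant QK) a"
    by (simp add: P_def wt_proj_def ant_simps algebra_antihom_power[OF algebra_antihom_ant])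
  also have "\<dots> = D1 (\<lambda>b. if st (odd CARD('n)) b = a then 1 else 0)"
    by (simp add: ant_def Q_ext_gens[OF Q_rels_antipode] Q_antipode_gen_eq wt_proj_D1 del: Q_antipode_gen.simps)
  also have "\<dots> = P (st (odd CARD('n)) a)"
    unfolding P_D1 by (rule D1_cong) (metis st_st)
  finally show ?thesis .
qed

lemma ant_D1: "ant (D1 g :: 'n::finite Q) = D1 (\<lambda>a. g (st (odd CARD('n)) a))"
proof -
  have "ant (D1 g :: 'n Q) = (\<Sum>a\<in>UNIV. g a *\<^sub>C P (st (odd CARD('n)) a))"
    by (simp add: D1_def ant_simps ant_P)
  also have "\<dots> = (\<Sum>a\<in>UNIV. g (st (odd CARD('n)) a) *\<^sub>C P a)"
    by (rule sum.reindex_bij_witness[of _ "st (odd CARD('n))" "st (odd CARD('n))"]) simp_all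
  finally show ?thesis by (simp add: D1_def)
qed

lemma Q_induct_F [case_names one add scale D1 F]:
  fixes R :: "'n Q \<Rightarrow> bool"
  assumes one: "R 1" and add: "\<And>x y. R x \<Longrightarrow> R y \<Longrightarrow> R (x + y)" and scale: "\<And>c x. R x \<Longrightarrow> R (c *\<^sub>C x)"
    and D1: "\<And>g x. R x \<Longrightarrow> R (D1 g * x)" and F: "\<And>b i x. R x \<Longrightarrow> R (F b i * x)"
  shows "R x"
proof (induction x rule: Q_induct)
  case (fp i x) then show ?case using F[of x True i] by (simp add: F_def)
next
  case (fm i x) then show ?case using F[of x False i] by (simp add: F_def)
qed (auto simp: QK_D1 intro: one add scale D1)

text \<open>The square of the antipode fixes functions of \<open>K\<close> and multiplies a
  generator by a function of square 1. Its fourth power is therefore the identity, and its third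
  power is the inverse.\<close>

lemma bij_ant: "bij (ant :: 'n::finite Q \<Rightarrow> 'n Q)"
proof -
  let ?od = "odd CARD('n)" and ?S2 = "\<lambda>x::'n Q. ant (ant x)"
  let ?q = "\<lambda>b a. u ?od b (st ?od (sh a)) * u ?od b a"
  have S2: "?S2 (F b i) = F b i * D1 (?q b)" for b i
    by (simp add: ant_F ant_simps ant_D1 mult.assoc[symmetric] D1_F) (simp add: mult.assoc D1_mult)
  have q: "D1 (\<lambda>a. ?q b a * ?q b a) = (1 :: 'n Q)" for b
    unfolding one_D1 by (rule D1_cong) (auto simp: wt_defs)
  have "?S2 (?S2 x) = x" for x
  proof (induction x rule: Q_induct_F)
    case (F b i x)
    have "?S2 (?S2 (F b i)) = F b i * D1 (?q b) * D1 (?q b)"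
      by (simp add: S2) (simp add: ant_simps S2 ant_D1)
    then have "?S2 (?S2 (F b i)) = F b i" by (simp only: mult.assoc[where 'a="'n Q"] D1_mult q mult_1_right)
    then show ?case using F by (simp add: ant_simps)
  qed (simp_all add: ant_simps ant_D1)
  then show ?thesis by (intro bij_betw_byWitness[where f'="\<lambda>x. ant (ant (ant x))"]) auto
qed

lemma sh_w: "w b (sh a) = - w b a"
  by (auto simp: wt_defs)

section \<open>The antipode axioms\<close>

lemma bilinear_C_contract:
  fixes f g :: "'a::complex_algebra \<Rightarrow> 'b::complex_algebra"
  assumes "linear_C f" "linear_C g"
  shows "bilinear_C (\<lambda>x y. f x * c * g y)"
  using assms by (intro bilinear_CI linear_CI)
    (simp_all add: linear_C_simps distrib_left distrib_right scaleC_mult_left scaleC_mult_right mult.assoc)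

text \<open>The antipode reverses products, so the contraction of a product works from inside
  outwards: a scalar result of the inner factor can be pulled out. Generators therefore
  suffice.\<close>

lemma antipode_left: "tlift (\<lambda>x y. ant x * y) (cm a) = eps a *\<^sub>C (1 :: 'n::finite Q)"
proof -
  let ?k = "tlift (\<lambda>x y. ant x * y) :: 'n Q \<otimes>\<^sub>C 'n Q \<Rightarrow> 'n Q"
  have b: "bilinear_C (\<lambda>x y. ant x * y :: 'n Q)"
    using bilinear_C_contract[OF algebra_antihomD(1)[OF algebra_antihom_ant] linear_C_id(2), of 1] by simp
  note k = tlift_tens[OF b] tlift_add[OF b] tlift_scaleC[OF b] linear_C_simps[OF linear_C_tlift[OF b]]
  have step: "?k (t * v) = c *\<^sub>C ?k v" if "?k t = c *\<^sub>C 1" for t v c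
  proof (induction v rule: tensor_induct)
    case (tens x y)
    have "?k (t * (x \<otimes>\<^sub>C y)) = ant x * ?k t * y"
    proof (induction t rule: tensor_induct)
      case (tens a b)
      show ?case by (simp add: tens_mult k) (simp add: ant_simps mult.assoc)
    qed (simp add: k distrib_left distrib_right)
    then show ?case using that by (simp add: k scaleC_mult_left scaleC_mult_right)
  qed (simp add: k distrib_left scaleC_add_right)
  note cm = algebra_homD[OF algebra_hom_cm] linear_C_simps[OF algebra_homD(1)[OF algebra_hom_cm]]
  note eps = algebra_homD[OF algebra_hom_eps] linear_C_simps[OF algebra_homD(1)[OF algebra_hom_eps]]
  show ?thesis
  proof (induction a rule: Q_induct_F)
    case one
    show ?case by (simp add: cm eps tens_one[symmetric] k ant_simps scaleC_one)
  next
    case (D1 g x)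
    have "?k (cm (D1 g)) = (\<Sum>a\<in>UNIV. \<Sum>b\<in>UNIV. (if st (odd CARD('n)) a = b then
        g (gm (odd CARD('n)) a b) else 0) *\<^sub>C P b)"
      by (simp add: cm_D1 D2_expand k ant_P P_P if_distrib[of "scaleC _"] complex_vector.scale_zero_right
          if_distrib[of "\<lambda>x. x *\<^sub>C _"] complex_vector.scale_zero_left cong: if_cong)
    also have "\<dots> = g (False, False) *\<^sub>C (\<Sum>b\<in>UNIV. P b)"
      by (cases "odd CARD('n)") (simp_all add: sum_wt st_def gm_def complex_vector.scale_zero_left scaleC_add_right)
    finally have "?k (cm (D1 g)) = eps (D1 g :: 'n Q) *\<^sub>C 1" by (simp add: sum_P eps_D1)
    from step[OF this, of "cm x"] show ?case using D1 by (simp add: cm eps scaleC_scaleC)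
  next
    case (F b i x)
    have "?k (cm (F b i)) = F b i * (D1 (u (odd CARD('n)) b) + D1 (\<lambda>a. w b (st (odd CARD('n)) (sh a))))"
      by (simp add: cm_F k ant_F ant_simps ant_D1 D1_F distrib_left)
    also have "D1 (u (odd CARD('n)) b) + D1 (\<lambda>a. w b (st (odd CARD('n)) (sh a))) = (0 :: 'n Q)"
      unfolding D1_add zero_D1 by (rule D1_cong) (auto simp: wt_defs)
    finally have "?k (cm (F b i)) = 0 *\<^sub>C 1" by (simp add: complex_vector.scale_zero_left)
    from step[OF this, of "cm x"] show ?case by (simp add: cm eps eps_F complex_vector.scale_zero_left)
  qed (simp_all add: cm eps k scaleC_add_left scaleC_scaleC scaleC_complex_def)
qed

lemma antipode_right:
  "tlift (\<lambda>x y. x * D1 (bet (odd CARD('n)) z) * ant y) (cm a) = eps a *\<^sub>C (D1 (bet (odd CARD('n)) z) :: 'n::finite Q)"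
proof -
  let ?od = "odd CARD('n)"
  let ?b = "D1 (bet ?od z) :: 'n Q"
  let ?k = "tlift (\<lambda>x y. x * ?b * ant y)"
  have b: "bilinear_C (\<lambda>x y. x * c * ant y :: 'n Q)" for c
    by (rule bilinear_C_contract[OF linear_C_id(2) algebra_antihomD(1)[OF algebra_antihom_ant]])
  note k = tlift_tens[OF b] tlift_add[OF b] tlift_scaleC[OF b] linear_C_simps[OF linear_C_tlift[OF b]]
  \<comment> \<open>The antipode now sits on the second leg, so the innermost factor is the right
    one.\<close>
  have step: "?k (v * t) = c *\<^sub>C ?k v" if "?k t = c *\<^sub>C ?b" for t v c
  proof (induction v rule: tensor_induct)
    case (tens x y)
    have "?k ((x \<otimes>\<^sub>C y) * t) = x * ?k t * ant y"
    proof (induction t rule: tensor_induct)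
      case (tens a b)
      show ?case by (simp add: tens_mult k) (simp add: ant_simps mult.assoc)
    qed (simp add: k distrib_left distrib_right)
    then show ?case using that by (simp add: k scaleC_mult_left scaleC_mult_right)
  qed (simp add: k distrib_right scaleC_add_right)
  note cm = algebra_homD[OF algebra_hom_cm] linear_C_simps[OF algebra_homD(1)[OF algebra_hom_cm]]
  note eps = algebra_homD[OF algebra_hom_eps] linear_C_simps[OF algebra_homD(1)[OF algebra_hom_eps]]
  show ?thesis
  proof (induction a rule: Q_induct_F)
    case one
    show ?case by (simp add: cm eps tens_one[symmetric] k ant_simps scaleC_one)
  next
    case (D1 g x)
    have *: "P a * ?b * P c = (if a = c then bet ?od z c else 0) *\<^sub>C P c" for a c
      by (auto simp: P_D1 D_simps intro!: D1_cong)
    have "?k (cm (D1 g)) = (\<Sum>a\<in>UNIV. \<Sum>c\<in>UNIV. (if a = st ?od c then bet ?od z a * g (gm ?od a c) else 0) *\<^sub>C P a)"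
      by (auto simp add: cm_D1 D2_expand k ant_P * scaleC_scaleC mult.commute complex_vector.scale_zero_left intro!: sum.cong)
    also have "\<dots> = g (False, False) *\<^sub>C ?b"
      by (cases ?od) (simp_all add: D1_def sum_wt st_def gm_def complex_vector.scale_zero_left scaleC_add_right scaleC_scaleC mult.commute)
    finally have "?k (cm (D1 g)) = eps (D1 g :: 'n Q) *\<^sub>C ?b" by (simp add: eps_D1)
    note k1 = this
    have "?k (cm (D1 g * x)) = eps x *\<^sub>C ?k (cm (D1 g))" unfolding cm by (rule step[OF D1])
    also have "\<dots> = (eps x * eps (D1 g :: 'n Q)) *\<^sub>C ?b" by (simp only: k1 scaleC_scaleC)
    finally show ?case by (simp add: eps mult.commute)
  next
    case (F b i x)
    have "?k (cm (F b i)) = F b i * (?b + D1 (\<lambda>a. w b (sh a) * bet ?od z (sh a) * u ?od b a))"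
      by (simp add: cm_F k ant_F ant_simps D1_mult distrib_left)
         (simp add: mult.assoc[symmetric] D1_F, simp add: mult.assoc D1_mult)
    \<comment> \<open>For odd N, \<open>bet\<close> changes sign under \<open>sh\<close> on the
      sector \<open>e1\<close>, which cancels the sign between \<open>w b\<close> and
      \<open>u\<close>.\<close>
    also have "?b + D1 (\<lambda>a. w b (sh a) * bet ?od z (sh a) * u ?od b a) = 0"
      unfolding D1_add zero_D1 by (rule D1_cong) (auto simp: wt_defs)
    finally have "?k (cm (F b i)) = 0" by simp
    then show ?case using step[OF F] by (simp add: cm eps eps_F complex_vector.scale_zero_left complex_vector.scale_zero_right)
  qed (simp_all add: cm eps k scaleC_add_left scaleC_scaleC scaleC_complex_def)
qed


section \<open>The quasi-Hopf axioms\<close>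

text \<open>The elements that satisfy the conclusion form a subalgebra. Quasi-coassociativity, the
  exchange of the coproduct with its opposite by R, and centrality of the ribbon element are all of
  this form.\<close>

lemma algebra_hom_intertwine:
  fixes f g :: "'n Q \<Rightarrow> 'b::complex_algebra"
  assumes f: "algebra_hom f" and g: "algebra_hom g"
    and D1: "\<And>h. c * f (D1 h) = g (D1 h) * c" and F: "\<And>b i. c * f (F b i) = g (F b i) * c"
  shows "c * f x = g x * c"
proof -
  note fg = algebra_homD[OF f] algebra_homD[OF g] linear_C_simps[OF algebra_homD(1)[OF f]] linear_C_simps[OF algebra_homD(1)[OF g]]
  have step: "c * f (y * x) = g (y * x) * c" if "c * f y = g y * c" "c * f x = g x * c" for x y
  proof -
    have "c * f (y * x) = (c * f y) * f x" by (simp add: fg mult.assoc)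
    also have "\<dots> = g (y * x) * c" by (simp add: that fg mult.assoc)
    finally show ?thesis .
  qed
  show ?thesis
  proof (induction x rule: Q_induct_F)
    case (D1 h x)
    show ?case by (rule step[OF assms(3) D1])
  next
    case (F b i x)
    show ?case by (rule step[OF assms(4) F])
  qed (simp_all add: fg distrib_left distrib_right scaleC_mult_left scaleC_mult_right)
qed

lemma algebra_hom_eqI:
  fixes f g :: "'n Q \<Rightarrow> 'b::complex_algebra"
  assumes "algebra_hom f" "algebra_hom g" "\<And>h. f (D1 h) = g (D1 h)" "\<And>b i. f (F b i) = g (F b i)"
  shows "f x = g x"
  using algebra_hom_intertwine[OF assms(1,2), of 1] assms(3,4) by simp

lemma tmap_id_cm_D2:
  "tmap id cm (D2 g :: 'n::finite Q \<otimes>\<^sub>C 'n Q) = D3 (\<lambda>a b c. g a (gm (odd CARD('n)) b c))"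
  unfolding D2_def D3_def tmap_dg[OF algebra_homD(1)[OF algebra_hom_cm]] cm_D1 ..

lemma tmap_id_id_cm_D3:
  "tmap id (tmap id cm) (D3 g :: 'n::finite Q \<otimes>\<^sub>C 'n Q \<otimes>\<^sub>C 'n Q) = D4 (\<lambda>a b c d. g a b (gm (odd CARD('n)) c d))"
  unfolding D3_def[of g] D4_def tmap_dg[OF linear_C_tmap[OF linear_C_id(1) algebra_homD(1)[OF algebra_hom_cm]]] tmap_id_cm_D2 ..

lemma tassoc_D2_tens: "tassoc (D2 g \<otimes>\<^sub>C y) = dg (\<lambda>a. dg (\<lambda>b. g a b *\<^sub>C y))"
  unfolding D2_def tassoc_dg_tens D1_tens ..

text \<open>The coproduct of \<open>P c\<close> is the sum over all factorisations of the weight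
  \<open>c\<close>, so comultiplying a leg means substituting a product of weights into the
  function.\<close>

lemma tassoc_tmap_cm_dg:
  fixes G :: "wt \<Rightarrow> 'b::complex_vector"
  shows "tassoc (tmap cm id (dg G :: 'n::finite Q \<otimes>\<^sub>C 'b)) = dg (\<lambda>a. dg (\<lambda>b. G (gm (odd CARD('n)) a b)))"
proof -
  have "tassoc (tmap cm id (dg G :: 'n Q \<otimes>\<^sub>C 'b)) = (\<Sum>c\<in>UNIV. tassoc (cm (P c :: 'n Q) \<otimes>\<^sub>C G c))"
    by (simp add: dg_def linear_C_simps[OF linear_C_tassoc]
        linear_C_simps[OF linear_C_tmap[OF algebra_homD(1)[OF algebra_hom_cm] linear_C_id(1)]]
        tmap_tens[OF algebra_homD(1)[OF algebra_hom_cm] linear_C_id(1)])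
  then show ?thesis
    by (simp add: cm_P tassoc_D2_tens dg_sum sum_delta_scaleC)
qed

lemma tassoc_tmap_cm_D:
  fixes g3 :: "wt \<Rightarrow> wt \<Rightarrow> wt \<Rightarrow> complex"
  shows "tassoc (tmap cm id (D2 g2 :: 'n::finite Q \<otimes>\<^sub>C 'n Q)) = D3 (\<lambda>a b c. g2 (gm (odd CARD('n)) a b) c)"
    "tassoc (tmap cm id (D3 g3 :: 'n::finite Q \<otimes>\<^sub>C 'n Q \<otimes>\<^sub>C 'n Q)) = D4 (\<lambda>a b c d. g3 (gm (odd CARD('n)) a b) c d)"
  unfolding D2_def D3_def D4_def tassoc_tmap_cm_dg by simp_all

lemma linear_C_tassoc_tmap_cm: "linear_C (\<lambda>x. tassoc (tmap cm id x))"
  by (intro linear_C_comp[OF linear_C_tassoc] linear_C_tmap algebra_homD(1)[OF algebra_hom_cm] linear_C_id)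

lemma tmap_id_tassoc_tmap_cm_D3:
  "tmap id (\<lambda>x. tassoc (tmap cm id x)) (D3 g :: 'n::finite Q \<otimes>\<^sub>C 'n Q \<otimes>\<^sub>C 'n Q) = D4 (\<lambda>a b c d. g a (gm (odd CARD('n)) b c) d)"
  unfolding D3_def[of g] D4_def tmap_dg[OF linear_C_tassoc_tmap_cm] tassoc_tmap_cm_D ..

lemma tassoc_D2_one: "tassoc (D2 g \<otimes>\<^sub>C 1) = D3 (\<lambda>a b c. g a b)"
  unfolding tassoc_D2_tens D3_def by (simp add: D2_def one_D1 D1_scale)

lemma tens_one_D3: "1 \<otimes>\<^sub>C D3 g = D4 (\<lambda>a b c d. g b c d)"
  unfolding D4_def dg_const ..

lemma tens_one_D2: "1 \<otimes>\<^sub>C D2 g = D3 (\<lambda>a b c. g b c)"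
  unfolding D3_def dg_const ..

lemma tassoc_D3_one: "tmap id tassoc (tassoc (D3 g \<otimes>\<^sub>C 1)) = D4 (\<lambda>a b c d. g a b c)"
  unfolding D3_def[of g] tassoc_dg_tens tmap_dg[OF linear_C_tassoc] tassoc_D2_one D4_def ..

text \<open>\<open>gam\<close> records the eigenvalues of the third leg: at parity p,
  \<open>K^N\<close> gives \<open>(-1)^(p N)\<close> in the sector \<open>e0\<close>, and
  \<open>\<beta>^2 (\<i> K)^N\<close> gives \<open>\<beta>^2 (-1)^(N + p N)\<close> in the sector
  \<open>e1\<close>.\<close>

lemma Q_coassoc_D3: "Q_coassoc \<beta> = (D3 (phi (odd CARD('n)) (\<beta>\<^sup>2)) :: 'n::finite Q \<otimes>\<^sub>C 'n Q \<otimes>\<^sub>C 'n Q)"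
  unfolding Q_coassoc_def QK_D1 e_D1 one_D1 D_simps
proof (rule D3_cong)
  fix a b c :: wt
  show "1 * (1 * 1) + (if fst a then 1 else 0) * ((if fst b then 1 else 0) *
      ((chi c ^ CARD('n) - 1) * (if fst c then 0 else 1) +
       (\<beta>\<^sup>2 * (\<i> * chi c) ^ CARD('n) - 1) * (if fst c then 1 else 0))) = phi (odd CARD('n)) (\<beta>\<^sup>2) a b c"
    by (cases "odd CARD('n)"; cases c) (auto simp: wt_defs)
qed

lemma Q_beta_D1: "Q_beta \<beta> = (D1 (bet (odd CARD('n)) (\<beta>\<^sup>2)) :: 'n::finite Q)"
  unfolding Q_beta_def QK_D1 e_D1 one_D1 D_simps
proof (rule D1_cong)
  fix c :: wt
  show "(if fst c then 0 else 1) + \<beta>\<^sup>2 * (\<i> * chi c) ^ CARD('n) * (if fst c then 1 else 0) = bet (odd CARD('n)) (\<beta>\<^sup>2) c"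
    by (cases "odd CARD('n)"; cases c) (auto simp: wt_defs)
qed

lemma phi_nonzero: "x \<noteq> 0 \<Longrightarrow> phi od x a b c \<noteq> 0"
  by (simp add: phi_def gam_def)

lemma D3_inverse:
  assumes "\<And>a b c. g a b c \<noteq> 0"
  shows "D3 g * D3 (\<lambda>a b c. inverse (g a b c)) = 1" "D3 (\<lambda>a b c. inverse (g a b c)) * D3 g = 1"
  by (simp_all add: D3_mult one_D3 assms)

lemma Q_coassoc_inverse:
  assumes "\<beta> \<noteq> 0"
  shows "invertible_el (Q_coassoc \<beta> :: 'n::finite Q \<otimes>\<^sub>C 'n Q \<otimes>\<^sub>C 'n Q)"
    "inverse_el (Q_coassoc \<beta>) = (D3 (\<lambda>a b c. inverse (phi (odd CARD('n)) (\<beta>\<^sup>2) a b c)) :: 'n Q \<otimes>\<^sub>C 'n Q \<otimes>\<^sub>C 'n Q)"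
  unfolding Q_coassoc_D3 using assms
  by (auto intro!: invertible_elI inverse_el_eq D3_inverse simp: phi_nonzero)

text \<open>The 3-cocycle condition on the group of weights. The assumption is needed when all four
  weights lie in the sector \<open>e1\<close>: there \<open>x * x\<close> has to match the sign
  caused by the parity shift in \<open>gm od c d\<close>.\<close>

lemma pentagon_phi:
  assumes "x * x = (if od then -1 else 1)"
  shows "phi od x (gm od a b) c d * phi od x a b (gm od c d)
       = phi od x a b c * phi od x a (gm od b c) d * phi od x b c d"
proof -
  obtain a1 a2 b1 b2 c1 c2 d1 d2 where "a = (a1, a2)" "b = (b1, b2)" "c = (c1, c2)" "d = (d1, d2)"
    by (cases a; cases b; cases c; cases d)
  then show ?thesis
    using assms by (cases a1; cases b1; cases c1; cases d1; cases od) (auto simp: phi_def gam_def gm_def)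
qed

lemma tens_F_D3:
  "D1 g \<otimes>\<^sub>C F b i \<otimes>\<^sub>C 1 = (1 \<otimes>\<^sub>C F b i \<otimes>\<^sub>C 1) * (D3 (\<lambda>a c d. g a) :: 'n Q \<otimes>\<^sub>C 'n Q \<otimes>\<^sub>C 'n Q)"
  "D2' = D2 h \<Longrightarrow> tassoc (D2' \<otimes>\<^sub>C F b i) = (1 \<otimes>\<^sub>C 1 \<otimes>\<^sub>C F b i) * (D3 (\<lambda>a c d. h a c) :: 'n Q \<otimes>\<^sub>C 'n Q \<otimes>\<^sub>C 'n Q)"
  "D1 g \<otimes>\<^sub>C D1 k \<otimes>\<^sub>C F b i = (1 \<otimes>\<^sub>C 1 \<otimes>\<^sub>C F b i) * (D3 (\<lambda>a c d. g a * k c) :: 'n Q \<otimes>\<^sub>C 'n Q \<otimes>\<^sub>C 'n Q)"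
proof -
  have 1: "D3 (\<lambda>a c d. g a) = (D1 g \<otimes>\<^sub>C 1 \<otimes>\<^sub>C 1 :: 'n Q \<otimes>\<^sub>C 'n Q \<otimes>\<^sub>C 'n Q)"
    unfolding one_D1 D_simps by simp
  show "D1 g \<otimes>\<^sub>C F b i \<otimes>\<^sub>C 1 = (1 \<otimes>\<^sub>C F b i \<otimes>\<^sub>C 1) * (D3 (\<lambda>a c d. g a) :: 'n Q \<otimes>\<^sub>C 'n Q \<otimes>\<^sub>C 'n Q)"
    by (simp add: 1 tens_mult)
  have 2: "D3 (\<lambda>a c d. g a * k c) = (D1 g \<otimes>\<^sub>C D1 k \<otimes>\<^sub>C 1 :: 'n Q \<otimes>\<^sub>C 'n Q \<otimes>\<^sub>C 'n Q)"
    unfolding one_D1 D_simps by simp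
  show "D1 g \<otimes>\<^sub>C D1 k \<otimes>\<^sub>C F b i = (1 \<otimes>\<^sub>C 1 \<otimes>\<^sub>C F b i) * (D3 (\<lambda>a c d. g a * k c) :: 'n Q \<otimes>\<^sub>C 'n Q \<otimes>\<^sub>C 'n Q)"
    by (simp add: 2 tens_mult)
  have 3: "tassoc (t \<otimes>\<^sub>C y) = (1 \<otimes>\<^sub>C 1 \<otimes>\<^sub>C y) * tassoc (t \<otimes>\<^sub>C 1)" for t :: "'n Q \<otimes>\<^sub>C 'n Q" and y :: "'n Q"
    by (induction t rule: tensor_induct)
       (simp_all add: tassoc_tens tens_mult tens_add_left linear_C_add[OF linear_C_tassoc] distrib_left)
  show "tassoc (D2' \<otimes>\<^sub>C F b i) = (1 \<otimes>\<^sub>C 1 \<otimes>\<^sub>C F b i) * (D3 (\<lambda>a c d. h a c) :: 'n Q \<otimes>\<^sub>C 'n Q \<otimes>\<^sub>C 'n Q)"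
    if "D2' = D2 h"
    unfolding that 3[of _ "F b i"] tassoc_D2_one ..
qed

lemma quasi_coassoc_Q:
  fixes x :: "'n::finite Q"
  shows "D3 (phi (odd CARD('n)) z) * tmap id cm (cm x) = tassoc (tmap cm id (cm x)) * D3 (phi (odd CARD('n)) z)"
proof (rule algebra_hom_intertwine[where f="\<lambda>x. tmap id cm (cm x)" and g="\<lambda>x. tassoc (tmap cm id (cm x))"])
  let ?od = "odd CARD('n)"
  show "algebra_hom (\<lambda>x::'n Q. tmap id cm (cm x))"
    by (intro algebra_hom_comp[OF algebra_hom_tmap] algebra_hom_id algebra_hom_cm)
  show "algebra_hom (\<lambda>x::'n Q. tassoc (tmap cm id (cm x)))"
    by (intro algebra_hom_comp[OF algebra_hom_tassoc] algebra_hom_comp[OF algebra_hom_tmap] algebra_hom_id algebra_hom_cm)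
  have "gm ?od a (gm ?od b c) = gm ?od (gm ?od a b) c" for a b c
    by (auto simp: gm_def)
  then show "D3 (phi ?od z) * tmap id cm (cm (D1 h :: 'n Q)) = tassoc (tmap cm id (cm (D1 h))) * D3 (phi ?od z)" for h
    by (simp add: cm_D1 tmap_id_cm_D2 tassoc_tmap_cm_D D3_mult mult.commute)
  fix b and i :: 'n
  note l = algebra_homD(1)[OF algebra_hom_cm] linear_C_id(1)
  have L: "tmap id cm (cm (F b i)) = F b i \<otimes>\<^sub>C 1 + (1 \<otimes>\<^sub>C F b i \<otimes>\<^sub>C 1) * D3 (\<lambda>a c d. w b a)
      + (1 \<otimes>\<^sub>C 1 \<otimes>\<^sub>C F b i) * D3 (\<lambda>a c d. w b a * w b c)"
    by (simp add: cm_F linear_C_simps[OF linear_C_tmap[OF l(2,1)]] tmap_tens l algebra_homD[OF algebra_hom_cm]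
        tens_add_right tens_F_D3)
  have R: "tassoc (tmap cm id (cm (F b i))) = F b i \<otimes>\<^sub>C 1 + (1 \<otimes>\<^sub>C F b i \<otimes>\<^sub>C 1) * D3 (\<lambda>a c d. w b a)
      + (1 \<otimes>\<^sub>C 1 \<otimes>\<^sub>C F b i) * D3 (\<lambda>a c d. w b (gm ?od a c))"
    by (simp add: cm_F linear_C_simps[OF linear_C_tmap[OF l]] tmap_tens l tens_F_D3(2)[OF cm_D1]
        tens_add_left linear_C_simps[OF linear_C_tassoc] tassoc_tens tens_F_D3(1))
       (simp add: one_tensor_def)
  let ?p = "D3 (phi ?od z) :: 'n Q \<otimes>\<^sub>C 'n Q \<otimes>\<^sub>C 'n Q"
  have sp: "phi ?od z (sh a) c d = phi ?od z a c d" "phi ?od z a (sh c) d = phi ?od z a c d" for a c d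
    by (simp_all add: phi_def)
  have 1: "?p * (F b i \<otimes>\<^sub>C 1) = (F b i \<otimes>\<^sub>C 1) * ?p"
    by (simp add: D3_F sp)
  have 2: "?p * ((1 \<otimes>\<^sub>C F b i \<otimes>\<^sub>C 1) * D3 (\<lambda>a c d. w b a)) = (1 \<otimes>\<^sub>C F b i \<otimes>\<^sub>C 1) * D3 (\<lambda>a c d. w b a) * ?p"
    by (simp add: mult.assoc D3_mult) (simp add: mult.assoc[symmetric] D3_F, simp add: mult.assoc D3_mult sp mult.commute)
  have "?p * ((1 \<otimes>\<^sub>C 1 \<otimes>\<^sub>C F b i) * D3 (\<lambda>a c d. w b a * w b c))
      = (1 \<otimes>\<^sub>C 1 \<otimes>\<^sub>C F b i) * D3 (\<lambda>a c d. phi ?od z a c (sh d) * (w b a * w b c))"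
    by (simp only: mult.assoc[symmetric, where 'a="'n Q \<otimes>\<^sub>C 'n Q \<otimes>\<^sub>C 'n Q"] D3_F)
       (simp only: mult.assoc[where 'a="'n Q \<otimes>\<^sub>C 'n Q \<otimes>\<^sub>C 'n Q"] D3_mult)
  \<comment> \<open>For two weights in the sector \<open>e1\<close> and odd N, \<open>w b\<close> is
    multiplicative only up to -1. The function \<open>phi\<close> supplies this sign when the third
    weight is shifted.\<close>
  also have "D3 (\<lambda>a c d. phi ?od z a c (sh d) * (w b a * w b c)) = D3 (\<lambda>a c d. w b (gm ?od a c) * phi ?od z a c d)"
    by (rule D3_cong) (auto simp: wt_defs)
  also have "(1 \<otimes>\<^sub>C 1 \<otimes>\<^sub>C F b i) * \<dots> = (1 \<otimes>\<^sub>C 1 \<otimes>\<^sub>C F b i) * D3 (\<lambda>a c d. w b (gm ?od a c)) * ?p"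
    by (simp add: mult.assoc D3_mult)
  finally have 3: "?p * ((1 \<otimes>\<^sub>C 1 \<otimes>\<^sub>C F b i) * D3 (\<lambda>a c d. w b a * w b c)) =
    (1 \<otimes>\<^sub>C 1 \<otimes>\<^sub>C F b i) * D3 (\<lambda>a c d. w b (gm ?od a c)) * ?p" .
  show "D3 (phi ?od z) * tmap id cm (cm (F b i)) = tassoc (tmap cm id (cm (F b i))) * D3 (phi ?od z)"
    unfolding L R by (simp only: distrib_left distrib_right 1 2 3)
qed

lemma bilinear_C_counit: "bilinear_C (\<lambda>x y. eps x *\<^sub>C y)" "bilinear_C (\<lambda>x y. eps y *\<^sub>C x)"
  by (rule bilinear_CI; rule linear_CI; simp add: linear_C_simps[OF algebra_homD(1)[OF algebra_hom_eps]]
      scaleC_add_right scaleC_add_left scaleC_scaleC scaleC_complex_def mult.commute)+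

lemma gm_zero [simp]: "gm od (False, False) a = a" "gm od a (False, False) = a"
  by (auto simp: gm_def prod_eq_iff)

lemma counit_Q:
  "tlift (\<lambda>x y. eps x *\<^sub>C y) (cm a) = a" "tlift (\<lambda>x y. eps y *\<^sub>C x) (cm a) = (a :: 'n::finite Q)"
proof -
  have h: "algebra_hom (tlift (\<lambda>x y. eps x *\<^sub>C (y :: 'n Q)))" "algebra_hom (tlift (\<lambda>x y. eps y *\<^sub>C (x :: 'n Q)))"
    by (rule algebra_hom_tlift; simp add: bilinear_C_counit algebra_homD[OF algebra_hom_eps] scaleC_one
        scaleC_mult_left scaleC_mult_right scaleC_scaleC mult.commute)+
  note s = tlift_tens[OF bilinear_C_counit(1)] tlift_tens[OF bilinear_C_counit(2)]
    linear_C_simps[OF linear_C_tlift[OF bilinear_C_counit(1)]] linear_C_simps[OF linear_C_tlift[OF bilinear_C_counit(2)]]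
  have P: "eps (P a :: 'n Q) = (if a = (False, False) then 1 else 0)" for a
    unfolding P_D1 eps_D1 by auto
  have d: "tlift (\<lambda>x y. eps x *\<^sub>C y) (D2 g :: 'n Q \<otimes>\<^sub>C 'n Q) = D1 (g (False, False))"
    "tlift (\<lambda>x y. eps y *\<^sub>C x) (D2 g :: 'n Q \<otimes>\<^sub>C 'n Q) = D1 (\<lambda>a. g a (False, False))" for g
    by (simp_all add: D2_expand D1_def s P sum_wt complex_vector.scale_zero_left complex_vector.scale_zero_right scaleC_one)
  have F: "eps (F b i :: 'n Q) = 0" for b i by (rule eps_F)
  show "tlift (\<lambda>x y. eps x *\<^sub>C y) (cm a) = a"
    by (rule algebra_hom_eqI[OF algebra_hom_comp[OF h(1) algebra_hom_cm] algebra_hom_id, unfolded id_def])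
       (simp_all add: cm_D1 d cm_F s F algebra_homD[OF algebra_hom_eps] scaleC_one complex_vector.scale_zero_left eps_D1,
        simp_all add: w_def scaleC_one)
  show "tlift (\<lambda>x y. eps y *\<^sub>C x) (cm a) = a"
    by (rule algebra_hom_eqI[OF algebra_hom_comp[OF h(2) algebra_hom_cm] algebra_hom_id, unfolded id_def])
       (simp_all add: cm_D1 d cm_F s F algebra_homD[OF algebra_hom_eps] scaleC_one complex_vector.scale_zero_left eps_D1)
qed

lemma tlift3_D3: "trilinear_C h \<Longrightarrow>
  tlift3 h (D3 g) = (\<Sum>a\<in>UNIV. \<Sum>b\<in>UNIV. \<Sum>c\<in>UNIV. g a b c *\<^sub>C h (P a) (P b) (P c))"
  by (simp add: D3_expand linear_C_simps[OF linear_C_tlift3] tlift3_tens)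

lemma trilinear_C_counit: "trilinear_C (\<lambda>x y z. eps y *\<^sub>C (x \<otimes>\<^sub>C z))"
  by (rule trilinear_CI; rule linear_CI; simp add: linear_C_simps[OF algebra_homD(1)[OF algebra_hom_eps]]
      scaleC_add_right scaleC_add_left scaleC_scaleC scaleC_complex_def mult.commute
      tens_add_left tens_add_right tens_scaleC_left tens_scaleC_right)+

lemma coassoc_counit_Q: "tlift3 (\<lambda>x y z. eps y *\<^sub>C (x \<otimes>\<^sub>C z)) (D3 (phi od z) :: 'n Q \<otimes>\<^sub>C 'n Q \<otimes>\<^sub>C 'n Q) = 1"
proof -
  have P: "eps (P a :: 'n Q) = (if a = (False, False) then 1 else 0)" for a
    unfolding P_D1 eps_D1 by auto
  have "tlift3 (\<lambda>x y z. eps y *\<^sub>C (x \<otimes>\<^sub>C z)) (D3 (phi od z)) = (D2 (\<lambda>a c. phi od z a (False, False) c) :: 'n Q \<otimes>\<^sub>C 'n Q)"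
    unfolding tlift3_D3[OF trilinear_C_counit] D2_expand
    by (rule sum.cong[OF refl]) (simp add: P sum_wt complex_vector.scale_zero_left complex_vector.scale_zero_right scaleC_one)
  then show ?thesis by (simp add: phi_def one_D2)
qed

lemma trilinear_C_contract:
  fixes f g h :: "'a::complex_algebra \<Rightarrow> 'b::complex_algebra"
  assumes "linear_C f" "linear_C g" "linear_C h"
  shows "trilinear_C (\<lambda>x y z. f x * c * g y * d * h z)"
  using assms by (intro trilinear_CI linear_CI)
    (simp_all add: linear_C_simps distrib_left distrib_right scaleC_mult_left scaleC_mult_right)

lemma st_inj: "st od a = st od b \<longleftrightarrow> a = b"
  by (metis st_st)

text \<open>The projectors leave only the triples consisting of a weight, its inverse and the weight
  again. The function \<open>bet\<close> is the value of \<open>phi\<close> on such triples, which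
  settles the second identity; in the first one \<open>bet\<close> is taken at the inverse weight,
  and the product on the sector \<open>e1\<close> is \<open>x * x\<close> times
  \<open>(-1)^N\<close>.\<close>

lemma antipode_coassoc_Q:
  assumes "x * x = (if odd CARD('n) then -1 else 1)"
  shows "tlift3 (\<lambda>a b c. ant a * 1 * b * D1 (bet (odd CARD('n)) x) * ant c) (D3 (phi (odd CARD('n)) x)) = (1 :: 'n::finite Q)"
    "tlift3 (\<lambda>a b c. a * D1 (bet (odd CARD('n)) x) * ant b * 1 * c) (D3 (\<lambda>a b c. inverse (phi (odd CARD('n)) x a b c))) = (1 :: 'n::finite Q)"
proof -
  let ?od = "odd CARD('n)"
  let ?b = "D1 (bet ?od x) :: 'n Q"
  note l = algebra_antihomD(1)[OF algebra_antihom_ant] linear_C_id(2)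
  have x0: "x \<noteq> 0" using assms by (auto split: if_splits)
  have e: "(\<Sum>a\<in>UNIV. \<Sum>b\<in>UNIV. \<Sum>c\<in>UNIV. (if b = st ?od a \<and> a = c then g a b else (0::complex)) *\<^sub>C P c) = (D1 (\<lambda>a. g a (st ?od a)) :: 'n Q)"
    for g :: "wt \<Rightarrow> wt \<Rightarrow> complex"
  proof -
    have "(\<Sum>b\<in>UNIV. \<Sum>c\<in>UNIV. (if b = st ?od a \<and> a = c then g a b else (0::complex)) *\<^sub>C (P c :: 'n Q))
      = (\<Sum>b\<in>UNIV. if b = st ?od a then g a (st ?od a) *\<^sub>C P a else 0)" for a
      by (intro sum.cong refl)
         (auto simp: if_distrib[of "\<lambda>x. x *\<^sub>C _"] complex_vector.scale_zero_left cong: if_cong)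
    then show ?thesis
      by (simp only: D1_def) simp
  qed
  have "tlift3 (\<lambda>a b c. ant a * 1 * b * ?b * ant c) (D3 (phi ?od x)) =
     (\<Sum>a\<in>UNIV. \<Sum>b\<in>UNIV. \<Sum>c\<in>UNIV. (if b = st ?od a \<and> a = c then phi ?od x a b a * bet ?od x b else 0) *\<^sub>C P (st ?od c))"
    unfolding tlift3_D3[OF trilinear_C_contract[OF l l(1)]]
    by (intro sum.cong refl, simp only: ant_P mult_1_right, simp only: P_D1 D_simps, rule D1_cong) (auto simp: st_inj)
  also have "\<dots> = ant (\<Sum>a\<in>UNIV. \<Sum>b\<in>UNIV. \<Sum>c\<in>UNIV. (if b = st ?od a \<and> a = c then phi ?od x a b a * bet ?od x b else 0) *\<^sub>C P c)"
    by (simp only: ant_simps ant_P)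
  also have "\<dots> = 1"
    unfolding e ant_D1 one_D1 using assms by (intro D1_cong) (auto simp: wt_defs split: if_splits)
  finally show "tlift3 (\<lambda>a b c. ant a * 1 * b * ?b * ant c) (D3 (phi ?od x)) = 1" .
  have "tlift3 (\<lambda>a b c. a * ?b * ant b * 1 * c) (D3 (\<lambda>a b c. inverse (phi ?od x a b c))) =
     (\<Sum>a\<in>UNIV. \<Sum>b\<in>UNIV. \<Sum>c\<in>UNIV. (if b = st ?od a \<and> a = c then inverse (phi ?od x a b a) * bet ?od x a else 0) *\<^sub>C P c)"
    unfolding tlift3_D3[OF trilinear_C_contract[OF l(2,1,2)]]
    by (intro sum.cong refl, simp only: ant_P mult_1_right, simp only: P_D1 D_simps, rule D1_cong) (auto simp: st_inj)
  also have "\<dots> = 1"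
    unfolding e one_D1 using x0 by (intro D1_cong) (auto simp: wt_defs split: if_splits)
  finally show "tlift3 (\<lambda>a b c. a * ?b * ant b * 1 * c) (D3 (\<lambda>a b c. inverse (phi ?od x a b c))) = 1" .
qed

lemma Q_data_sel:
  "comult (Q_data \<beta>) = cm" "counit (Q_data \<beta>) = eps" "coassoc (Q_data \<beta>) = Q_coassoc \<beta>"
  "antipode (Q_data \<beta>) = ant" "alpha_el (Q_data \<beta>) = 1" "beta_el (Q_data \<beta>) = Q_beta \<beta>"
  "R_matrix (Q_data \<beta>) = Q_R \<beta>" "ribbon_el (Q_data \<beta>) = Q_ribbon \<beta>"
  by (simp_all add: Q_data_def cm_def eps_def ant_def)

lemma quasi_hopf_Q:
  assumes "\<beta> ^ 4 = (-1) ^ CARD('n::{finite,linorder})"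
  shows "quasi_hopf_algebra (Q_data \<beta> :: 'n Q ribbon_quasi_hopf)"
proof -
  have b: "\<beta>\<^sup>2 * \<beta>\<^sup>2 = (if odd CARD('n) then -1 else 1)"
    using assms by (simp add: power2_eq_square power4_eq_xxxx mult.assoc split: if_splits)
  have b0: "\<beta> \<noteq> 0" using b by (auto split: if_splits)
  note x = antipode_coassoc_Q[OF b]
  show ?thesis
    unfolding quasi_hopf_algebra_def Q_data_sel Q_coassoc_D3
    unfolding Q_coassoc_D3[symmetric] Q_coassoc_inverse(2)[OF b0]
    unfolding Q_coassoc_D3 Q_beta_D1
    using x quasi_coassoc_Q counit_Q coassoc_counit_Q antipode_left antipode_right Q_coassoc_inverse(1)[OF b0, unfolded Q_coassoc_D3]
    by (auto simp: algebra_hom_cm algebra_hom_eps algebra_antihom_ant bij_ant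
       tassoc_tmap_cm_D tmap_id_id_cm_D3 tassoc_D3_one tmap_id_tassoc_tmap_cm_D3 tens_one_D3 D4_mult pentagon_phi[OF b])
qed


section \<open>Ordered products\<close>

lemma prod_list_commute:
  fixes x :: "'b::monoid_mult"
  assumes "\<And>k. k \<in> set xs \<Longrightarrow> x * g k = g k * x"
  shows "x * prod_list (map g xs) = prod_list (map g xs) * x"
  using assms
proof (induction xs)
  case (Cons k ks)
  have "x * (g k * prod_list (map g ks)) = g k * (x * prod_list (map g ks))"
    by (simp add: mult.assoc[symmetric] Cons.prems)
  then show ?case using Cons by (simp add: mult.assoc)
qed simp

lemma prod_list_mult:
  fixes g h :: "'k \<Rightarrow> 'b::monoid_mult"
  assumes "distinct xs" "\<And>j k. j \<noteq> k \<Longrightarrow> g j * h k = h k * g j"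
  shows "prod_list (map g xs) * prod_list (map h xs) = prod_list (map (\<lambda>k. g k * h k) xs)"
  using assms(1)
proof (induction xs)
  case (Cons k ks)
  have "h k * prod_list (map g ks) = prod_list (map g ks) * h k"
    using Cons.prems by (intro prod_list_commute) (metis assms(2) distinct.simps(2))
  then have "g k * prod_list (map g ks) * (h k * prod_list (map h ks)) =
      g k * h k * (prod_list (map g ks) * prod_list (map h ks))"
    by (metis mult.assoc)
  then show ?case using Cons by (simp add: mult.assoc)
qed simp

text \<open>Only the factor with index \<open>j\<close> turns \<open>x\<close> into
  \<open>y\<close>, and the others commute with both, so its position in the list is irrelevant. In
  the applications \<open>x\<close> is built from a generator with index \<open>j\<close>.\<close>

lemma prod_list_intertwine:
  fixes g :: "'k \<Rightarrow> 'b::monoid_mult"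
  assumes "distinct xs" "j \<in> set xs" "g j * x = y * g j"
    and "\<And>k. k \<noteq> j \<Longrightarrow> g k * x = x * g k" "\<And>k. k \<noteq> j \<Longrightarrow> g k * y = y * g k"
  shows "prod_list (map g xs) * x = y * prod_list (map g xs)"
  using assms(1,2)
proof (induction xs)
  case (Cons k ks)
  show ?case
  proof (cases "k = j")
    case True
    then have "j \<notin> set ks" using Cons.prems by auto
    then have "x * prod_list (map g ks) = prod_list (map g ks) * x"
      by (intro prod_list_commute) (metis assms(4))
    then show ?thesis using True assms(3) by (simp add: mult.assoc) (metis mult.assoc)
  next
    case False
    then have "prod_list (map g ks) * x = y * prod_list (map g ks)" using Cons by simp
    then show ?thesis using assms(5)[OF False] by (simp add: mult.assoc) (metis mult.assoc)
  qed
qed simp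

lemma sorted_list_UNIV: "distinct (sorted_list_of_set (UNIV :: 'n::{finite,linorder} set))"
  "set (sorted_list_of_set (UNIV :: 'n set)) = UNIV"
  by simp_all
lemmas ordered_prod_mult = prod_list_mult[OF sorted_list_UNIV(1), folded ordered_prod_def]
lemmas ordered_prod_intertwine =
  prod_list_intertwine[OF sorted_list_UNIV(1), unfolded sorted_list_UNIV(2), OF UNIV_I, folded ordered_prod_def]

lemma ordered_prod_move:
  assumes "\<And>k. g k * x = x * h k"
  shows "ordered_prod g * x = x * ordered_prod h"
proof -
  have "prod_list (map g xs) * x = x * prod_list (map h xs)" for xs
    by (induction xs) (simp_all add: mult.assoc assms, simp add: mult.assoc[symmetric] assms)
  then show ?thesis by (simp add: ordered_prod_def)
qed

lemma ordered_prod_hom: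
  assumes "algebra_hom f" shows "f (ordered_prod g) = ordered_prod (\<lambda>k. f (g k))"
proof -
  have "f (prod_list (map g xs)) = prod_list (map (\<lambda>k. f (g k)) xs)" for xs
    by (induction xs) (simp_all add: algebra_homD[OF assms])
  then show ?thesis by (simp add: ordered_prod_def)
qed

lemma ordered_prod_invertible:
  assumes "\<And>k. invertible_el (g k)" shows "invertible_el (ordered_prod g)"
proof -
  have "invertible_el (prod_list (map g xs))" for xs
    by (induction xs) (auto simp: assms intro: invertible_el_mult invertible_elI[of 1 1])
  then show ?thesis by (simp add: ordered_prod_def)
qed


section \<open>Evaluation on weight vectors\<close>

lemma D1_F_mult: "D1 g * (F b i * x) = F b i * (D1 (\<lambda>a. g (sh a)) * x)"
  by (simp only: mult.assoc[symmetric] D1_F)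

lemma D1_P: "D1 g * P a = g a *\<^sub>C P a"
  by (simp add: P_D1 D_simps) (rule D1_cong, simp)

lemma e1_F: "e1 * F b i = F b i * e1"
  by (simp add: e_D1 D1_F)

lemma e1_F_mult: "e1 * (F b i * x) = F b i * (e1 * x)"
  by (simp only: mult.assoc[symmetric] e1_F)

lemma e1_P: "e1 * P a = (if fst a then P a else 0)"
  by (simp add: e_D1 D1_P scaleC_one complex_vector.scale_zero_left)

lemma F_F_mult: "F b i * (F b i * x) = 0"
  by (simp add: mult.assoc[symmetric] F_F_same)

lemma F_word: "F False i * F True i = e1 - F True i * F False i"
  using F_Not[of True i] by simp

lemma F_word_mult: "F False i * (F True i * x) = e1 * x - F True i * (F False i * x)"
  by (simp add: mult.assoc[symmetric] F_word left_diff_distrib)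

lemma F_swap_mult: "j \<noteq> k \<Longrightarrow> F b k * (F c j * x) = - (F c j * (F b k * x))"
  using F_swap[of k j b c] by (simp add: mult.assoc[symmetric])

lemma scaleC_numeral2: "2 *\<^sub>C x = x + x" "4 *\<^sub>C x = x + x + (x + x)"
proof -
  show t: "2 *\<^sub>C x = x + x" for x :: 'a
    using scaleC_add_left[of 1 1 x] by (simp only: scaleC_one one_add_one)
  show "4 *\<^sub>C x = x + x + (x + x)"
    using scaleC_scaleC[of 2 2 x] by (simp add: t)
qed

lemma tens_minus: "(- a) \<otimes>\<^sub>C b = - (a \<otimes>\<^sub>C b)" "a \<otimes>\<^sub>C (- b) = - (a \<otimes>\<^sub>C b)"
  using linear_C_minus[OF linear_C_tens(1)] linear_C_minus[OF linear_C_tens(2)] by blast+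

lemmas eval_simps = distrib_left distrib_right left_diff_distrib right_diff_distrib tens_mult mult.assoc
  tens_add_left tens_add_right tens_diff tens_zero tens_minus tens_scaleC_left tens_scaleC_right
  D1_F_mult D1_P e1_F_mult e1_P F_F_mult F_F_same F_word F_word_mult e1_F
  scaleC_mult_left scaleC_mult_right scaleC_scaleC scaleC_one
  complex_vector.scale_zero_left complex_vector.scale_zero_right complex_vector.scale_minus_left
  complex_vector.scale_minus_right scaleC_add_right complex_vector.scale_right_diff_distrib
  w_def sh_w sh_sh


section \<open>The R-matrix\<close>

definition rho :: "complex \<Rightarrow> wt \<Rightarrow> wt \<Rightarrow> complex" where
  "rho \<beta> a b = (if fst a \<and> fst b then \<beta> else 1) * (if snd a \<and> snd b \<noteq> fst b then -1 else 1)"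

definition ER :: "'n \<Rightarrow> 'n Q \<otimes>\<^sub>C 'n Q" where
  "ER k = 1 - 2 *\<^sub>C ((F False k * D1 (w False)) \<otimes>\<^sub>C F True k)"

text \<open>On a pair of weights the sums over p and q in \<open>Q_rho\<close> are a finite Fourier
  sum over \<open>\<int>_2 x \<int>_2\<close>, with the sign in \<open>rho\<close> as value.\<close>

lemma Q_R_eq: "(Q_R \<beta> :: 'n::{finite,linorder} Q \<otimes>\<^sub>C 'n Q) = D2 (rho \<beta>) * ordered_prod ER"
proof -
  have "(\<Sum>n\<in>{0,1}. \<Sum>m\<in>{0,1}. \<beta> ^ (n * m) *\<^sub>C (Q_rho n m * (idem n \<otimes>\<^sub>C idem m))) = (D2 (rho \<beta>) :: 'n Q \<otimes>\<^sub>C 'n Q)"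
    unfolding Q_rho_def idem_def QK_D1 e_D1
    by (simp add: one_D1 D_simps power_int_minus)
       (rule D2_cong, auto simp: rho_def chi_def algebra_simps)
  then show ?thesis
    unfolding Q_R_def ER_def[abs_def] by (simp add: omega_D1 F_def tens_one)
qed

lemma gm_sh: "gm od (sh a) (sh b) = gm od a b"
  by (auto simp: gm_def sh_def)

lemma gm_commute: "gm od a b = gm od b a"
  by (auto simp: gm_def)

lemma D2_F_mult:
  "D2 g * ((F x i \<otimes>\<^sub>C 1) * v) = (F x i \<otimes>\<^sub>C 1) * (D2 (\<lambda>a b. g (sh a) b) * v)"
  "D2 g * ((1 \<otimes>\<^sub>C F x i) * v) = (1 \<otimes>\<^sub>C F x i) * (D2 (\<lambda>a b. g a (sh b)) * v)"
  by (simp_all only: mult.assoc[symmetric] D2_F)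

lemma D3_F_mult:
  "D3 g * ((F x i \<otimes>\<^sub>C 1) * v) = (F x i \<otimes>\<^sub>C 1) * (D3 (\<lambda>a b c. g (sh a) b c) * v)"
  "D3 g * ((1 \<otimes>\<^sub>C F x i \<otimes>\<^sub>C 1) * v) = (1 \<otimes>\<^sub>C F x i \<otimes>\<^sub>C 1) * (D3 (\<lambda>a b c. g a (sh b) c) * v)"
  "D3 g * ((1 \<otimes>\<^sub>C 1 \<otimes>\<^sub>C F x i) * v) = (1 \<otimes>\<^sub>C 1 \<otimes>\<^sub>C F x i) * (D3 (\<lambda>a b c. g a b (sh c)) * v)"
  by (simp_all only: mult.assoc[symmetric] D3_F)

lemma pair_D2:
  "D2 g * ((F x i * D1 k) \<otimes>\<^sub>C (F y j * D1 l)) = (F x i \<otimes>\<^sub>C F y j) * D2 (\<lambda>a b. g (sh a) (sh b) * (k a * l b))"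
  "((F x i * D1 k) \<otimes>\<^sub>C (F y j * D1 l)) * D2 g = (F x i \<otimes>\<^sub>C F y j) * D2 (\<lambda>a b. (k a * l b) * g a b)"
proof -
  have 1: "(F x i * D1 k) \<otimes>\<^sub>C (F y j * D1 l) = (F x i \<otimes>\<^sub>C 1) * ((1 \<otimes>\<^sub>C F y j) * D2 (\<lambda>a b. k a * l b))"
    by (simp add: D1_tens_D1[symmetric] tens_mult)
  have 2: "F x i \<otimes>\<^sub>C F y j = (F x i \<otimes>\<^sub>C 1) * (1 \<otimes>\<^sub>C F y j)" by (simp add: tens_mult)
  show "D2 g * ((F x i * D1 k) \<otimes>\<^sub>C (F y j * D1 l)) = (F x i \<otimes>\<^sub>C F y j) * D2 (\<lambda>a b. g (sh a) (sh b) * (k a * l b))"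
    unfolding 1 2 by (simp only: mult.assoc D2_F_mult D2_mult)
  show "((F x i * D1 k) \<otimes>\<^sub>C (F y j * D1 l)) * D2 g = (F x i \<otimes>\<^sub>C F y j) * D2 (\<lambda>a b. (k a * l b) * g a b)"
    unfolding 1 2 by (simp only: mult.assoc D2_mult)
qed

lemma ER_D2:
  assumes "\<And>a b. g (sh a) (sh b) = g a b"
  shows "ER k * D2 g = D2 g * ER k"
  using pair_D2[where g=g and x=False and i=k and k="w False" and y=True and j=k and l="\<lambda>a. 1"]
  by (simp add: ER_def right_diff_distrib left_diff_distrib scaleC_mult_left scaleC_mult_right one_D1[symmetric] assms mult.commute)

text \<open>Halfway between the coproduct and its opposite: the factors \<open>ER\<close> carry
  \<open>cm (F b i)\<close> to \<open>cm' b i\<close>, and the weight part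
  \<open>D2 (rho \<beta>)\<close> carries this to the opposite coproduct.\<close>

definition cm' :: "bool \<Rightarrow> 'n \<Rightarrow> 'n Q \<otimes>\<^sub>C 'n Q" where
  "cm' b i = F b i \<otimes>\<^sub>C D1 (\<lambda>a. if fst a \<and> \<not> b then -1 else 1) + D1 (w False) \<otimes>\<^sub>C F b i"

lemma ER_cm_same: "ER k * cm (F b k) = cm' b k * (ER k :: 'n::finite Q \<otimes>\<^sub>C 'n Q)"
proof (rule wt_eqI2)
  fix a c
  show "ER k * cm (F b k) * (P a \<otimes>\<^sub>C P c) = cm' b k * ER k * (P a \<otimes>\<^sub>C P c)"
    unfolding ER_def cm'_def cm_F
    by (cases a; cases c; cases b; simp add: eval_simps scaleC_numeral2)
qed

lemma ER_cm_other:
  assumes "k \<noteq> j"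
  shows "ER k * cm (F b j) = cm (F b j) * (ER k :: 'n::finite Q \<otimes>\<^sub>C 'n Q)"
    "ER k * cm' b j = cm' b j * (ER k :: 'n::finite Q \<otimes>\<^sub>C 'n Q)"
proof -
  note s = F_swap_mult[OF assms]
  show "ER k * cm (F b j) = cm (F b j) * ER k"
  proof (rule wt_eqI2)
    fix a c
    show "ER k * cm (F b j) * (P a \<otimes>\<^sub>C P c) = cm (F b j) * ER k * (P a \<otimes>\<^sub>C P c)"
      unfolding ER_def cm_F by (cases a; cases c; cases b; simp add: eval_simps s scaleC_numeral2)
  qed
  show "ER k * cm' b j = cm' b j * ER k"
  proof (rule wt_eqI2)
    fix a c
    show "ER k * cm' b j * (P a \<otimes>\<^sub>C P c) = cm' b j * ER k * (P a \<otimes>\<^sub>C P c)"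
      unfolding ER_def cm'_def by (cases a; cases c; cases b; simp add: eval_simps s scaleC_numeral2)
  qed
qed

lemma F_tens_D1: "F b i \<otimes>\<^sub>C D1 g = (F b i \<otimes>\<^sub>C 1) * (D2 (\<lambda>a c. g c) :: 'n Q \<otimes>\<^sub>C 'n Q)"
  "D1 g \<otimes>\<^sub>C F b i = (1 \<otimes>\<^sub>C F b i) * (D2 (\<lambda>a c. g a) :: 'n Q \<otimes>\<^sub>C 'n Q)"
proof -
  have "D2 (\<lambda>a c. g c) = (1 \<otimes>\<^sub>C D1 g :: 'n Q \<otimes>\<^sub>C 'n Q)" by (simp add: one_D1 D1_tens_D1)
  then show "F b i \<otimes>\<^sub>C D1 g = (F b i \<otimes>\<^sub>C 1) * (D2 (\<lambda>a c. g c) :: 'n Q \<otimes>\<^sub>C 'n Q)"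
    by (simp add: tens_mult)
qed (rule tens_F_D2)

lemma R_comult_Q:
  "Q_R \<beta> * cm x = tflip (cm x) * (Q_R \<beta> :: 'n::{finite,linorder} Q \<otimes>\<^sub>C 'n Q)"
proof (rule algebra_hom_intertwine[where f=cm and g="\<lambda>x. tflip (cm x)"])
  show "algebra_hom (cm :: 'n Q \<Rightarrow> _)" by (rule algebra_hom_cm)
  show "algebra_hom (\<lambda>x :: 'n Q. tflip (cm x))" by (intro algebra_hom_comp[OF algebra_hom_tflip] algebra_hom_cm)
  let ?D = "D2 (rho \<beta>) :: 'n Q \<otimes>\<^sub>C 'n Q"
  let ?od = "odd CARD('n)"
  fix h
  have "ordered_prod ER * cm (D1 h) = cm (D1 h) * (ordered_prod ER :: 'n Q \<otimes>\<^sub>C 'n Q)"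
    by (rule ordered_prod_move) (simp add: cm_D1 ER_D2 gm_sh)
  then have "Q_R \<beta> * cm (D1 h :: 'n Q) = (?D * cm (D1 h)) * ordered_prod ER"
    by (simp only: Q_R_eq mult.assoc)
  also have "?D * cm (D1 h) = cm (D1 h) * ?D" by (simp add: cm_D1 D2_mult mult.commute)
  also have "cm (D1 h) * ?D * ordered_prod ER = tflip (cm (D1 h)) * Q_R \<beta>"
    by (simp add: cm_D1 tflip_D2 gm_commute Q_R_eq mult.assoc)
  finally show "Q_R \<beta> * cm (D1 h :: 'n Q) = tflip (cm (D1 h)) * Q_R \<beta>" .
next
  let ?D = "D2 (rho \<beta>) :: 'n Q \<otimes>\<^sub>C 'n Q"
  fix b and i :: 'n
  have "Q_R \<beta> * cm (F b i) = ?D * (ordered_prod ER * cm (F b i))" by (simp only: Q_R_eq mult.assoc)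
  also have "ordered_prod ER * cm (F b i) = cm' b i * ordered_prod ER"
    by (rule ordered_prod_intertwine[where j=i]) (simp_all add: ER_cm_same ER_cm_other)
  also have "?D * (cm' b i * ordered_prod ER) = (?D * cm' b i) * ordered_prod ER" by (simp only: mult.assoc)
  also have "?D * cm' b i = tflip (cm (F b i)) * ?D"
  proof -
    have "?D * cm' b i = (F b i \<otimes>\<^sub>C 1) * D2 (\<lambda>a c. rho \<beta> (sh a) c * (if fst c \<and> \<not> b then -1 else 1))
        + (1 \<otimes>\<^sub>C F b i) * D2 (\<lambda>a c. rho \<beta> a (sh c) * w False a)"
      unfolding cm'_def F_tens_D1 distrib_left
      by (simp only: mult.assoc[symmetric] D2_F) (simp only: mult.assoc D2_mult)
    \<comment> \<open>Flipping the parity of the first weight multiplies \<open>rho\<close> by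
      \<open>w True\<close> of the second; flipping that of the second multiplies it by
      \<open>w False\<close> of the first.\<close>
    also have "D2 (\<lambda>a c. rho \<beta> (sh a) c * (if fst c \<and> \<not> b then -1 else 1)) = D2 (\<lambda>a c. w b c * rho \<beta> a c)"
      by (rule D2_cong) (auto simp: rho_def wt_defs)
    also have "D2 (\<lambda>a c. rho \<beta> a (sh c) * w False a) = D2 (rho \<beta>)"
      by (rule D2_cong) (auto simp: rho_def wt_defs)
    also have "(F b i \<otimes>\<^sub>C 1) * D2 (\<lambda>a c. w b c * rho \<beta> a c) + (1 \<otimes>\<^sub>C F b i) * ?D = tflip (cm (F b i)) * ?D"
      by (simp add: cm_F linear_C_simps[OF algebra_homD(1)[OF algebra_hom_tflip]] tflip_tens)
         (simp add: F_tens_D1 distrib_right mult.assoc D2_mult)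
    finally show ?thesis .
  qed
  finally show "Q_R \<beta> * cm (F b i) = tflip (cm (F b i)) * Q_R \<beta>" by (simp only: Q_R_eq mult.assoc)
qed

lemma D3_minus: "- D3 g = D3 (\<lambda>a b c. - g a b c)"
  using D3_scale[of "-1" g] by (simp add: complex_vector.scale_minus_left scaleC_one)

lemma ER_invertible: "invertible_el (ER k)"
proof (rule invertible_elI)
  let ?y = "(F False k * D1 (w False)) \<otimes>\<^sub>C F True k"
  have "?y * ?y = 0" by (simp add: tens_mult F_F_same tens_zero)
  then show "ER k * (1 + 2 *\<^sub>C ?y) = 1" "(1 + 2 *\<^sub>C ?y) * ER k = 1"
    by (simp_all add: ER_def distrib_left distrib_right left_diff_distrib right_diff_distrib
        scaleC_mult_left scaleC_mult_right complex_vector.scale_zero_right)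
qed

lemma rho_nonzero: "\<beta> \<noteq> 0 \<Longrightarrow> rho \<beta> a b \<noteq> 0"
  by (simp add: rho_def)

lemma R_invertible_Q:
  assumes "\<beta> \<noteq> 0" shows "invertible_el (Q_R \<beta> :: 'n::{finite,linorder} Q \<otimes>\<^sub>C 'n Q)"
  unfolding Q_R_eq
proof (intro invertible_el_mult ordered_prod_invertible ER_invertible)
  show "invertible_el (D2 (rho \<beta>))"
    by (rule invertible_elI[of _ "D2 (\<lambda>a b. inverse (rho \<beta> a b))"]) (simp_all add: D2_mult rho_nonzero[OF assms] one_D2)
qed

section \<open>The hexagons\<close>

definition F1 :: "bool \<Rightarrow> 'n \<Rightarrow> 'n Q \<otimes>\<^sub>C 'n Q \<otimes>\<^sub>C 'n Q" where "F1 b i = F b i \<otimes>\<^sub>C 1"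
definition F2 :: "bool \<Rightarrow> 'n \<Rightarrow> 'n Q \<otimes>\<^sub>C 'n Q \<otimes>\<^sub>C 'n Q" where "F2 b i = 1 \<otimes>\<^sub>C F b i \<otimes>\<^sub>C 1"
definition F3 :: "bool \<Rightarrow> 'n \<Rightarrow> 'n Q \<otimes>\<^sub>C 'n Q \<otimes>\<^sub>C 'n Q" where "F3 b i = 1 \<otimes>\<^sub>C 1 \<otimes>\<^sub>C F b i"

lemmas D3_Fs = D3_F[folded F1_def F2_def F3_def] D3_F_mult[folded F1_def F2_def F3_def]

lemma F123_commute:
  "F3 x i * (F2 y j * v) = F2 y j * (F3 x i * v)" "F3 x i * (F1 y j * v) = F1 y j * (F3 x i * v)"
  "F2 x i * (F1 y j * v) = F1 y j * (F2 x i * v)"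
  unfolding F1_def F2_def F3_def one_tensor_def by (simp_all add: mult.assoc[symmetric] tens_mult)

lemma F123_same: "F1 x i * (F1 x i * v) = 0" "F3 x i * (F3 x i * v) = 0"
  unfolding F1_def F2_def F3_def by (simp_all add: mult.assoc[symmetric] tens_mult F_F_same tens_zero)

lemma F123_swap:
  assumes "i \<noteq> j"
  shows "F1 x i * (F1 y j * v) = - (F1 y j * (F1 x i * v))" "F3 x i * (F3 y j * v) = - (F3 y j * (F3 x i * v))"
  unfolding F1_def F2_def F3_def using F_swap[of i j x y] assms
  by (simp_all add: mult.assoc[symmetric] tens_mult tens_minus)

text \<open>A factor of R in two of three legs. The function \<open>h\<close> holds the eigenvalue
  of omega together with all signs that the factor collects from other weight functions, so these
  products are closed under moving such functions past them.\<close>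

definition ERs :: "(bool \<Rightarrow> 'n \<Rightarrow> 'n Q \<otimes>\<^sub>C 'n Q \<otimes>\<^sub>C 'n Q) \<Rightarrow> (bool \<Rightarrow> 'n \<Rightarrow> 'n Q \<otimes>\<^sub>C 'n Q \<otimes>\<^sub>C 'n Q) \<Rightarrow>
    (wt \<Rightarrow> wt \<Rightarrow> wt \<Rightarrow> complex) \<Rightarrow> 'n \<Rightarrow> 'n Q \<otimes>\<^sub>C 'n Q \<otimes>\<^sub>C 'n Q" where
  "ERs s s' h k = 1 - 2 *\<^sub>C (s False k * (s' True k * D3 h))"

lemma ERs_D3:
  "(\<And>a b c. h a b c * g a b c = g (sh a) (sh b) c * h' a b c) \<Longrightarrow> ERs F1 F2 h k * D3 g = D3 g * ERs F1 F2 h' k"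
  "(\<And>a b c. h a b c * g a b c = g (sh a) b (sh c) * h' a b c) \<Longrightarrow> ERs F1 F3 h k * D3 g = D3 g * ERs F1 F3 h' k"
  "(\<And>a b c. h a b c * g a b c = g a (sh b) (sh c) * h' a b c) \<Longrightarrow> ERs F2 F3 h k * D3 g = D3 g * ERs F2 F3 h' k"
  by (simp_all add: ERs_def left_diff_distrib right_diff_distrib scaleC_mult_left scaleC_mult_right mult.assoc D3_Fs D3_mult)

text \<open>In the product of the two nilpotent parts the same generator occurs twice in the shared
  leg, so it vanishes.\<close>

lemma ERs_mult:
  "ERs F1 F3 h k * ERs F1 F2 h' k = 1 - 2 *\<^sub>C (F1 False k * (F2 True k * D3 h')) - 2 *\<^sub>C (F1 False k * (F3 True k * D3 h))"
  "ERs F1 F3 h k * ERs F2 F3 h' k = 1 - 2 *\<^sub>C (F2 False k * (F3 True k * D3 h')) - 2 *\<^sub>C (F1 False k * (F3 True k * D3 h))"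
  by (simp_all add: ERs_def left_diff_distrib right_diff_distrib scaleC_mult_left scaleC_mult_right mult.assoc D3_Fs D3_mult
      F123_commute F123_same complex_vector.scale_zero_right)

text \<open>Exchanging the two generators in the shared leg gives a minus sign, and the assumption
  on \<open>h\<close> and \<open>h'\<close> provides a second one.\<close>

lemma ERs_commute:
  assumes "j \<noteq> k"
  shows "(\<And>a b c. h (sh a) (sh b) c * h' a b c = - (h' (sh a) b (sh c) * h a b c)) \<Longrightarrow>
      ERs F1 F3 h j * ERs F1 F2 h' k = ERs F1 F2 h' k * ERs F1 F3 h j"
    and "(\<And>a b c. h a (sh b) (sh c) * h' a b c = - (h' (sh a) b (sh c) * h a b c)) \<Longrightarrow>
      ERs F1 F3 h j * ERs F2 F3 h' k = ERs F2 F3 h' k * ERs F1 F3 h j"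
  using F123_swap[OF assms]
  by (simp_all add: ERs_def left_diff_distrib right_diff_distrib scaleC_mult_left scaleC_mult_right mult.assoc D3_Fs D3_mult
      F123_commute)
     (simp_all add: D3_minus[symmetric] scaleC_add_right complex_vector.scale_right_diff_distrib
      complex_vector.scale_minus_right algebra_simps)

lemma D2_D3: "D1 g \<otimes>\<^sub>C 1 = (D3 (\<lambda>a b c. g a) :: 'n Q \<otimes>\<^sub>C 'n Q \<otimes>\<^sub>C 'n Q)"
  "1 \<otimes>\<^sub>C D1 g \<otimes>\<^sub>C 1 = (D3 (\<lambda>a b c. g b) :: 'n Q \<otimes>\<^sub>C 'n Q \<otimes>\<^sub>C 'n Q)"
  unfolding one_tensor_def one_D1 D_simps by simp_all

text \<open>Comultiplying a generator gives two summands. By \<open>ERs_mult\<close> they can be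
  separated into a product of two factors, which is what allows the ordered product to be split
  later.\<close>

lemma tmap_cm_ER:
  fixes k :: "'n::finite"
  shows "tmap id cm (ER k) = ERs F1 F3 (\<lambda>a b c. w False a * w True b) k * ERs F1 F2 (\<lambda>a b c. w False a) k"
    "tassoc (tmap cm id (ER k)) = ERs F1 F3 (\<lambda>a b c. w False (gm (odd CARD('n)) a b)) k
       * ERs F2 F3 (\<lambda>a b c. w False a * w False (gm (odd CARD('n)) a b)) k"
    "tlift (\<lambda>x y. x \<otimes>\<^sub>C 1 \<otimes>\<^sub>C y) (ER k) = ERs F1 F3 (\<lambda>a b c. w False a) k"
    "tassoc (ER k \<otimes>\<^sub>C 1) = ERs F1 F2 (\<lambda>a b c. w False a) k"
    "1 \<otimes>\<^sub>C ER k = ERs F2 F3 (\<lambda>a b c. w False b) k"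
proof -
  note l = algebra_homD(1)[OF algebra_hom_cm] linear_C_id(1)
  note c = algebra_homD[OF algebra_hom_cm]
  let ?od = "odd CARD('n)"
  have 1: "(F False k * D1 (w False)) \<otimes>\<^sub>C F True k \<otimes>\<^sub>C 1 = F1 False k * (F2 True k * D3 (\<lambda>a b c. w False a))"
    unfolding F1_def F2_def D2_D3[symmetric] by (simp add: tens_mult one_tensor_def[where 'a="'n Q" and 'b="'n Q"])
  have 2: "(F False k * D1 (w False)) \<otimes>\<^sub>C D1 h \<otimes>\<^sub>C F True k = F1 False k * (F3 True k * D3 (\<lambda>a b c. w False a * h b))" for h
  proof -
    have "D3 (\<lambda>a b c. w False a * h b) = (D1 (w False) \<otimes>\<^sub>C D1 h \<otimes>\<^sub>C 1 :: 'n Q \<otimes>\<^sub>C 'n Q \<otimes>\<^sub>C 'n Q)"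
      unfolding one_D1 D_simps by simp
    then show ?thesis unfolding F1_def F3_def by (simp add: tens_mult one_tensor_def[where 'a="'n Q" and 'b="'n Q"])
  qed
  have mid: "(F False k * D1 (w False)) \<otimes>\<^sub>C 1 \<otimes>\<^sub>C F True k = F1 False k * (F3 True k * D3 (\<lambda>a b c. w False a))"
    using 2[of "\<lambda>a. 1"] by (simp add: one_D1)
  have 3: "1 \<otimes>\<^sub>C (F False k * D1 (w False)) \<otimes>\<^sub>C F True k = F2 False k * (F3 True k * D3 (\<lambda>a b c. w False b))"
    unfolding F2_def F3_def D2_D3[symmetric] by (simp add: tens_mult one_tensor_def[where 'a="'n Q" and 'b="'n Q"])
  show "tmap id cm (ER k) = ERs F1 F3 (\<lambda>a b c. w False a * w True b) k * ERs F1 F2 (\<lambda>a b c. w False a) k"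
    unfolding ERs_mult ER_def
    by (simp add: linear_C_simps[OF linear_C_tmap[OF l(2,1)]] algebra_homD(2)[OF algebra_hom_tmap[OF algebra_hom_id algebra_hom_cm]]
       tmap_tens l cm_F tens_add_right 1 2 scaleC_add_right)
  show "tlift (\<lambda>x y. x \<otimes>\<^sub>C 1 \<otimes>\<^sub>C y) (ER k) = ERs F1 F3 (\<lambda>a b c. w False a) k"
    unfolding ERs_def ER_def
    by (simp add: linear_C_simps[OF algebra_homD(1)[OF algebra_hom_mid]] algebra_homD(2)[OF algebra_hom_mid] tlift_mid mid)
  show "tassoc (ER k \<otimes>\<^sub>C 1) = ERs F1 F2 (\<lambda>a b c. w False a) k"
    unfolding ERs_def ER_def
    by (simp add: linear_C_simps[OF linear_C_tassoc] tens_diff tens_scaleC_left tassoc_tens 1 tens_one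
        algebra_homD(2)[OF algebra_hom_tassoc])
  show "1 \<otimes>\<^sub>C ER k = ERs F2 F3 (\<lambda>a b c. w False b) k"
    unfolding ERs_def ER_def by (simp add: tens_diff tens_scaleC_right 3 tens_one)
  have 4: "tassoc (t \<otimes>\<^sub>C y) = tassoc (t \<otimes>\<^sub>C 1) * (1 \<otimes>\<^sub>C 1 \<otimes>\<^sub>C y)" for t :: "'n Q \<otimes>\<^sub>C 'n Q" and y :: "'n Q"
    by (induction t rule: tensor_induct)
       (simp_all add: tassoc_tens tens_mult tens_add_left linear_C_add[OF linear_C_tassoc] distrib_right)
  have 5: "tassoc ((s * t) \<otimes>\<^sub>C 1) = tassoc (s \<otimes>\<^sub>C 1) * tassoc (t \<otimes>\<^sub>C 1)" for s t :: "'n Q \<otimes>\<^sub>C 'n Q"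
    by (simp add: algebra_homD(3)[OF algebra_hom_tassoc, symmetric] tens_mult)
  have "tassoc (cm (F False k * D1 (w False)) \<otimes>\<^sub>C F True k) =
      (F1 False k + F2 False k * D3 (\<lambda>a b c. w False a)) * D3 (\<lambda>a b c. w False (gm ?od a b)) * F3 True k"
    unfolding 4[of _ "F True k"] c 5
    by (simp add: cm_F cm_D1 tens_F_D2 tens_add_left linear_C_simps[OF linear_C_tassoc] 5 tassoc_D2_one tassoc_tens F1_def F2_def F3_def
       one_tensor_def[where 'a="'n Q" and 'b="'n Q"])
  also have "\<dots> = F1 False k * (F3 True k * D3 (\<lambda>a b c. w False (gm ?od a b)))
     + F2 False k * (F3 True k * D3 (\<lambda>a b c. w False a * w False (gm ?od a b)))"
    by (simp add: distrib_right mult.assoc D3_Fs D3_mult)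
  finally show "tassoc (tmap cm id (ER k)) = ERs F1 F3 (\<lambda>a b c. w False (gm ?od a b)) k
       * ERs F2 F3 (\<lambda>a b c. w False a * w False (gm ?od a b)) k"
    unfolding ERs_mult ER_def
    by (simp add: linear_C_simps[OF linear_C_tmap[OF l]] algebra_homD(2)[OF algebra_hom_tmap[OF algebra_hom_cm algebra_hom_id]]
       tmap_tens l scaleC_add_right linear_C_simps[OF linear_C_tassoc] algebra_homD(2)[OF algebra_hom_tassoc])
qed

lemma algebra_hom_tassoc_one: "algebra_hom (\<lambda>t. tassoc (t \<otimes>\<^sub>C 1))"
  by (intro algebra_hom_comp[OF algebra_hom_tassoc] algebra_hom_tens)

lemma Q_R_maps:
  fixes \<beta> :: complex
  defines "R \<equiv> Q_R \<beta> :: 'n::{finite,linorder} Q \<otimes>\<^sub>C 'n Q" and "od \<equiv> odd CARD('n)"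
  shows "tmap id cm R = D3 (\<lambda>a b c. rho \<beta> a (gm od b c)) * (ordered_prod (ERs F1 F3 (\<lambda>a b c. w False a * w True b))
       * ordered_prod (ERs F1 F2 (\<lambda>a b c. w False a)))"
    "tassoc (tmap cm id R) = D3 (\<lambda>a b c. rho \<beta> (gm od a b) c) * (ordered_prod (ERs F1 F3 (\<lambda>a b c. w False (gm od a b)))
       * ordered_prod (ERs F2 F3 (\<lambda>a b c. w False a * w False (gm od a b))))"
    "tlift (\<lambda>x y. x \<otimes>\<^sub>C 1 \<otimes>\<^sub>C y) R = D3 (\<lambda>a b c. rho \<beta> a c) * ordered_prod (ERs F1 F3 (\<lambda>a b c. w False a))"
    "tassoc (R \<otimes>\<^sub>C 1) = D3 (\<lambda>a b c. rho \<beta> a b) * ordered_prod (ERs F1 F2 (\<lambda>a b c. w False a))"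
    "1 \<otimes>\<^sub>C R = D3 (\<lambda>a b c. rho \<beta> b c) * ordered_prod (ERs F2 F3 (\<lambda>a b c. w False b))"
proof -
  note h = algebra_hom_tmap[OF algebra_hom_id algebra_hom_cm]
    algebra_hom_comp[OF algebra_hom_tassoc algebra_hom_tmap[OF algebra_hom_cm algebra_hom_id]]
    algebra_hom_mid algebra_hom_tassoc_one algebra_hom_tens(2)
  have p: "ordered_prod (ERs F1 F3 (\<lambda>a b c. w False a * w True b)) * ordered_prod (ERs F1 F2 (\<lambda>a b c. w False a))
     = ordered_prod (\<lambda>k::'n. ERs F1 F3 (\<lambda>a b c. w False a * w True b) k * ERs F1 F2 (\<lambda>a b c. w False a) k)"
    "ordered_prod (ERs F1 F3 (\<lambda>a b c. w False (gm od a b))) * ordered_prod (ERs F2 F3 (\<lambda>a b c. w False a * w False (gm od a b)))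
     = ordered_prod (\<lambda>k::'n. ERs F1 F3 (\<lambda>a b c. w False (gm od a b)) k * ERs F2 F3 (\<lambda>a b c. w False a * w False (gm od a b)) k)"
    by (rule ordered_prod_mult; rule ERs_commute; auto simp: wt_defs)+
  show "tmap id cm R = D3 (\<lambda>a b c. rho \<beta> a (gm od b c)) * (ordered_prod (ERs F1 F3 (\<lambda>a b c. w False a * w True b))
       * ordered_prod (ERs F1 F2 (\<lambda>a b c. w False a)))"
    unfolding p(1) unfolding R_def od_def Q_R_eq algebra_homD(3)[OF h(1)] ordered_prod_hom[OF h(1)] tmap_cm_ER tmap_id_cm_D2 ..
  show "tassoc (tmap cm id R) = D3 (\<lambda>a b c. rho \<beta> (gm od a b) c) * (ordered_prod (ERs F1 F3 (\<lambda>a b c. w False (gm od a b)))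
       * ordered_prod (ERs F2 F3 (\<lambda>a b c. w False a * w False (gm od a b))))"
    unfolding p(2) unfolding R_def od_def Q_R_eq algebra_homD(3)[OF h(2)] ordered_prod_hom[OF h(2)] tmap_cm_ER tassoc_tmap_cm_D ..
  show "tlift (\<lambda>x y. x \<otimes>\<^sub>C 1 \<otimes>\<^sub>C y) R = D3 (\<lambda>a b c. rho \<beta> a c) * ordered_prod (ERs F1 F3 (\<lambda>a b c. w False a))"
    unfolding R_def Q_R_eq algebra_homD(3)[OF h(3)] ordered_prod_hom[OF h(3)] tmap_cm_ER tlift_mid_D2 ..
  show "tassoc (R \<otimes>\<^sub>C 1) = D3 (\<lambda>a b c. rho \<beta> a b) * ordered_prod (ERs F1 F2 (\<lambda>a b c. w False a))"
    unfolding R_def Q_R_eq algebra_homD(3)[OF h(4)] ordered_prod_hom[OF h(4)] tmap_cm_ER tassoc_D2_one ..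
  show "1 \<otimes>\<^sub>C R = D3 (\<lambda>a b c. rho \<beta> b c) * ordered_prod (ERs F2 F3 (\<lambda>a b c. w False b))"
    unfolding R_def Q_R_eq algebra_homD(3)[OF h(5)] ordered_prod_hom[OF h(5)] tmap_cm_ER tens_one_D2 ..
qed

text \<open>All weight functions are moved to the left. The products of factors \<open>ERs\<close>
  then agree on both sides, and what remains is an identity between scalar functions of three
  weights, where the assumption on \<open>\<beta>\<close> enters.\<close>

lemma hexagon_right_Q:
  fixes \<beta> :: complex
  assumes b: "\<beta>\<^sup>2 * \<beta>\<^sup>2 = (if odd CARD('n) then -1 else 1)"
  defines "R \<equiv> Q_R \<beta> :: 'n::{finite,linorder} Q \<otimes>\<^sub>C 'n Q" and "p \<equiv> phi (odd CARD('n)) (\<beta>\<^sup>2)"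
  shows "tmap id cm R = D3 (\<lambda>a b c. p b c a) * tlift (\<lambda>x y. x \<otimes>\<^sub>C 1 \<otimes>\<^sub>C y) R
      * D3 (\<lambda>a b c. inverse (p b a c)) * tassoc (R \<otimes>\<^sub>C 1) * D3 p"
proof -
  let ?od = "odd CARD('n)"
  have b0: "\<beta> \<noteq> 0" using b by (auto split: if_splits)
  let ?A = "ordered_prod (ERs F1 F2 (\<lambda>a b c. w False a)) :: 'n Q \<otimes>\<^sub>C 'n Q \<otimes>\<^sub>C 'n Q"
  let ?B = "ordered_prod (ERs F1 F3 (\<lambda>a b c. w False a)) :: 'n Q \<otimes>\<^sub>C 'n Q \<otimes>\<^sub>C 'n Q"
  let ?B' = "ordered_prod (ERs F1 F3 (\<lambda>a b c. w False a * w True b)) :: 'n Q \<otimes>\<^sub>C 'n Q \<otimes>\<^sub>C 'n Q"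
  \<comment> \<open>Everything that stands between the product \<open>?B\<close> and the product
    \<open>?A\<close> once \<open>D3 p\<close> has passed \<open>?A\<close>.\<close>
  define y where "y = (\<lambda>a b c. inverse (p b a c) * rho \<beta> a b * p a b c)"
  have 1: "?A * D3 p = D3 p * ?A"
    by (rule ordered_prod_move, rule ERs_D3) (auto simp: p_def phi_def)
  have 2: "?B * D3 y = D3 y * ?B'"
    by (rule ordered_prod_move, rule ERs_D3) (use b0 in \<open>auto simp: y_def p_def rho_def wt_defs\<close>)
  have yy: "D3 (\<lambda>a b c. inverse (p b a c)) * D3 (\<lambda>a b c. rho \<beta> a b) * D3 p = (D3 y :: 'n Q \<otimes>\<^sub>C 'n Q \<otimes>\<^sub>C 'n Q)"
    by (simp only: D3_mult y_def)
  have 3: "(\<lambda>a b c. p b c a * rho \<beta> a c * y a b c) = (\<lambda>a b c. rho \<beta> a (gm ?od b c))"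
  proof (intro ext)
    fix a b' c :: wt
    obtain a1 a2 b1 b2 c1 c2 where "a = (a1, a2)" "b' = (b1, b2)" "c = (c1, c2)" by (cases a; cases b'; cases c)
    then show "p b' c a * rho \<beta> a c * y a b' c = rho \<beta> a (gm ?od b' c)"
      using b b0 by (cases a1; cases b1; cases c1; cases ?od)
        (auto simp: y_def p_def rho_def phi_def gam_def gm_def field_simps power2_eq_square)
  qed
  have "D3 (\<lambda>a b c. p b c a) * (D3 (\<lambda>a b c. rho \<beta> a c) * ?B) * D3 (\<lambda>a b c. inverse (p b a c))
      * (D3 (\<lambda>a b c. rho \<beta> a b) * ?A) * D3 p
    = D3 (\<lambda>a b c. p b c a) * D3 (\<lambda>a b c. rho \<beta> a c) * (?B * D3 (\<lambda>a b c. inverse (p b a c))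
      * D3 (\<lambda>a b c. rho \<beta> a b) * (?A * D3 p))"
    by (simp only: mult.assoc)
  also have "\<dots> = D3 (\<lambda>a b c. p b c a) * D3 (\<lambda>a b c. rho \<beta> a c) * (?B * D3 y * ?A)"
    unfolding 1 yy[symmetric] by (simp only: mult.assoc)
  also have "\<dots> = D3 (\<lambda>a b c. p b c a * rho \<beta> a c * y a b c) * (?B' * ?A)"
    unfolding 2 by (simp only: mult.assoc[where 'a="'n Q \<otimes>\<^sub>C 'n Q \<otimes>\<^sub>C 'n Q", symmetric] D3_mult)
  finally show ?thesis unfolding 3 R_def Q_R_maps by simp
qed

lemma hexagon_left_Q:
  fixes \<beta> :: complex
  assumes b: "\<beta>\<^sup>2 * \<beta>\<^sup>2 = (if odd CARD('n) then -1 else 1)"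
  defines "R \<equiv> Q_R \<beta> :: 'n::{finite,linorder} Q \<otimes>\<^sub>C 'n Q" and "p \<equiv> phi (odd CARD('n)) (\<beta>\<^sup>2)"
  shows "tassoc (tmap cm id R) = D3 (\<lambda>a b c. inverse (p c a b)) * tlift (\<lambda>x y. x \<otimes>\<^sub>C 1 \<otimes>\<^sub>C y) R
      * D3 (\<lambda>a b c. p a c b) * (1 \<otimes>\<^sub>C R) * D3 (\<lambda>a b c. inverse (p a b c))"
proof -
  let ?od = "odd CARD('n)"
  have b0: "\<beta> \<noteq> 0" using b by (auto split: if_splits)
  let ?A = "ordered_prod (ERs F2 F3 (\<lambda>a b c. w False b)) :: 'n Q \<otimes>\<^sub>C 'n Q \<otimes>\<^sub>C 'n Q"
  let ?A' = "ordered_prod (ERs F2 F3 (\<lambda>a b c. w False a * w False (gm ?od a b))) :: 'n Q \<otimes>\<^sub>C 'n Q \<otimes>\<^sub>C 'n Q"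
  let ?B = "ordered_prod (ERs F1 F3 (\<lambda>a b c. w False a)) :: 'n Q \<otimes>\<^sub>C 'n Q \<otimes>\<^sub>C 'n Q"
  let ?B' = "ordered_prod (ERs F1 F3 (\<lambda>a b c. w False (gm ?od a b))) :: 'n Q \<otimes>\<^sub>C 'n Q \<otimes>\<^sub>C 'n Q"
  let ?q = "\<lambda>a b c. inverse (p a b c)"
  define y where "y = (\<lambda>a b c. p a c b * rho \<beta> b c * inverse (p a b c))"
  \<comment> \<open>Unlike in the other hexagon, the inner product changes as well: the shift of the
    third weight alters the inverse coassociator by a sign when N is odd.\<close>
  have 1: "?A * D3 ?q = D3 ?q * ?A'"
    by (rule ordered_prod_move, rule ERs_D3) (use b0 in \<open>auto simp: p_def wt_defs\<close>)
  have 2: "?B * D3 y = D3 y * ?B'"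
    by (rule ordered_prod_move, rule ERs_D3) (use b0 in \<open>auto simp: y_def p_def rho_def wt_defs\<close>)
  have yy: "D3 (\<lambda>a b c. p a c b) * D3 (\<lambda>a b c. rho \<beta> b c) * D3 ?q = (D3 y :: 'n Q \<otimes>\<^sub>C 'n Q \<otimes>\<^sub>C 'n Q)"
    by (simp only: D3_mult y_def)
  have 3: "(\<lambda>a b c. ?q c a b * rho \<beta> a c * y a b c) = (\<lambda>a b c. rho \<beta> (gm ?od a b) c)"
  proof (intro ext)
    fix a b' c :: wt
    obtain a1 a2 b1 b2 c1 c2 where "a = (a1, a2)" "b' = (b1, b2)" "c = (c1, c2)" by (cases a; cases b'; cases c)
    then show "?q c a b' * rho \<beta> a c * y a b' c = rho \<beta> (gm ?od a b') c"
      using b b0 by (cases a1; cases b1; cases c1; cases ?od)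
        (auto simp: y_def p_def rho_def phi_def gam_def gm_def field_simps power2_eq_square)
  qed
  have "D3 (\<lambda>a b c. ?q c a b) * (D3 (\<lambda>a b c. rho \<beta> a c) * ?B) * D3 (\<lambda>a b c. p a c b)
      * (D3 (\<lambda>a b c. rho \<beta> b c) * ?A) * D3 ?q
    = D3 (\<lambda>a b c. ?q c a b) * D3 (\<lambda>a b c. rho \<beta> a c) * (?B * D3 (\<lambda>a b c. p a c b)
      * D3 (\<lambda>a b c. rho \<beta> b c) * (?A * D3 ?q))"
    by (simp only: mult.assoc)
  also have "\<dots> = D3 (\<lambda>a b c. ?q c a b) * D3 (\<lambda>a b c. rho \<beta> a c) * (?B * D3 y * ?A')"
    unfolding 1 yy[symmetric] by (simp only: mult.assoc)
  also have "\<dots> = D3 (\<lambda>a b c. ?q c a b * rho \<beta> a c * y a b c) * (?B' * ?A')"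
    unfolding 2 by (simp only: mult.assoc[where 'a="'n Q \<otimes>\<^sub>C 'n Q \<otimes>\<^sub>C 'n Q", symmetric] D3_mult)
  finally show ?thesis unfolding 3 R_def Q_R_maps by simp
qed


lemma quasi_triangular_Q:
  assumes "\<beta> ^ 4 = (-1) ^ CARD('n::{finite,linorder})"
  shows "quasi_triangular_quasi_hopf_algebra (Q_data \<beta> :: 'n Q ribbon_quasi_hopf)"
proof -
  have b: "\<beta>\<^sup>2 * \<beta>\<^sup>2 = (if odd CARD('n) then -1 else 1)"
    using assms by (simp add: power2_eq_square power4_eq_xxxx mult.assoc split: if_splits)
  have b0: "\<beta> \<noteq> 0" using b by (auto split: if_splits)
  interpret quasi_hopf_algebra "Q_data \<beta> :: 'n Q ribbon_quasi_hopf"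
    by (rule quasi_hopf_Q[OF assms])
  show ?thesis
  proof (unfold_locales, unfold Q_data_sel Q_coassoc_D3 Q_coassoc_inverse(2)[OF b0, unfolded Q_coassoc_D3] tlift3_perm_D3)
    show "invertible_el (Q_R \<beta> :: 'n Q \<otimes>\<^sub>C 'n Q)" by (rule R_invertible_Q[OF b0])
    show "Q_R \<beta> * cm a = tflip (cm a) * Q_R \<beta>" for a :: "'n Q" by (rule R_comult_Q)
  qed (rule hexagon_right_Q[OF b] hexagon_left_Q[OF b])+
qed


section \<open>The ribbon element\<close>

definition VR :: "'n \<Rightarrow> 'n Q" where
  "VR k = 1 - 2 *\<^sub>C (F True k * F False k)"

definition nu :: "complex \<Rightarrow> wt \<Rightarrow> complex" where
  "nu \<beta> a = (if fst a then \<beta> * (if snd a then -1 else 1) else 1)"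

text \<open>The eigenvalues of \<open>K^2\<close>.\<close>

definition zs :: "wt \<Rightarrow> complex" where
  "zs a = (if fst a then -1 else 1)"

lemma Q_ribbon_eq: "Q_ribbon \<beta> = (D1 (nu \<beta>) * ordered_prod VR :: 'n::{finite,linorder} Q)"
proof -
  have "e0 - (\<beta> * \<i>) *\<^sub>C (QK * e1) = (D1 (nu \<beta>) :: 'n Q)"
    unfolding e_D1 QK_D1 D_simps by (rule D1_cong) (auto simp: nu_def chi_def mult.assoc)
  then show ?thesis unfolding Q_ribbon_def VR_def[abs_def] by (simp add: F_def)
qed

lemma VR_D1: "VR k * D1 g = D1 g * VR k"
  by (simp add: VR_def left_diff_distrib right_diff_distrib scaleC_mult_left scaleC_mult_right mult.assoc D1_F D1_F_mult)

lemma commute_mult_right: "x * y = y * x \<Longrightarrow> x * z = z * x \<Longrightarrow> x * (y * z) = y * z * x"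
  for x :: "'b::semigroup_mult"
  by (metis mult.assoc)

lemma commute_mult_left: "x * z = z * x \<Longrightarrow> y * z = z * y \<Longrightarrow> x * y * z = z * (x * y)"
  for x :: "'b::semigroup_mult"
  by (metis mult.assoc)

text \<open>In the sector \<open>e1\<close> the element \<open>f_k^+ f_k^-\<close> is idempotent and
  \<open>VR k\<close> is a sign operator that anticommutes with \<open>f_k^\<plusminus>\<close>; in
  the sector \<open>e0\<close> both orders of the product reduce to the generator itself.\<close>

lemma VR_F_same: "VR k * F b k = (D1 zs * F b k) * VR k"
proof (rule wt_eqI1)
  fix a
  show "VR k * F b k * P a = D1 zs * F b k * VR k * P a"
    unfolding VR_def by (cases a; cases b; simp add: eval_simps zs_def scaleC_numeral2)
qed

lemma VR_F_other:
  assumes "k \<noteq> j"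
  shows "VR k * F b j = F b j * VR k"
proof (rule wt_eqI1)
  fix a
  show "VR k * F b j * P a = F b j * VR k * P a"
    unfolding VR_def by (cases b; simp add: eval_simps F_swap_mult[OF assms])
qed

lemma VR_commute: "VR k * VR j = VR j * VR k"
proof (cases "k = j")
  case False
  have "VR k * (F True j * F False j) = (F True j * F False j) * VR k"
    by (intro commute_mult_right VR_F_other False)
  then show ?thesis
    by (simp add: VR_def[of j] left_diff_distrib right_diff_distrib scaleC_mult_left scaleC_mult_right)
qed simp

lemma ribbon_central_Q: "Q_ribbon \<beta> * x = x * (Q_ribbon \<beta> :: 'n::{finite,linorder} Q)"
proof (rule algebra_hom_intertwine[where f=id and g=id, unfolded id_apply])
  show "Q_ribbon \<beta> * D1 h = D1 h * (Q_ribbon \<beta> :: 'n Q)" for h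
  proof -
    have "ordered_prod VR * D1 h = D1 h * (ordered_prod VR :: 'n Q)"
      by (rule ordered_prod_move) (rule VR_D1)
    then show ?thesis by (simp add: Q_ribbon_eq mult.assoc) (simp add: mult.assoc[symmetric] D1_mult mult.commute)
  qed
  fix b and i :: 'n
  have "VR k * (D1 zs * F b i) = D1 zs * F b i * VR k" if "k \<noteq> i" for k
    by (intro commute_mult_right VR_D1 VR_F_other that)
  then have "ordered_prod VR * F b i = (D1 zs * F b i) * ordered_prod VR"
    by (intro ordered_prod_intertwine[where j=i] VR_F_same VR_F_other)
  then have "Q_ribbon \<beta> * F b i = (D1 (nu \<beta>) * (D1 zs * F b i)) * ordered_prod VR"
    by (simp only: Q_ribbon_eq mult.assoc)
  also have "D1 (nu \<beta>) * (D1 zs * F b i) = F b i * D1 (nu \<beta>)"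
  proof -
    have "D1 (nu \<beta>) * (D1 zs * F b i) = F b i * D1 (\<lambda>a. nu \<beta> (sh a) * zs (sh a))"
      by (simp only: mult.assoc[symmetric, where 'a="'n Q"] D1_mult) (simp only: D1_F)
    \<comment> \<open>The sign from \<open>VR\<close> in the sector \<open>e1\<close> cancels
      against the parity sign of \<open>nu\<close>.\<close>
    also have "D1 (\<lambda>a. nu \<beta> (sh a) * zs (sh a)) = (D1 (nu \<beta>) :: 'n Q)"
      by (rule D1_cong) (auto simp: nu_def zs_def sh_def)
    finally show ?thesis .
  qed
  finally show "Q_ribbon \<beta> * F b i = F b i * (Q_ribbon \<beta> :: 'n Q)"
    by (simp only: Q_ribbon_eq mult.assoc)
qed (rule algebra_hom_id[unfolded id_def])+

lemma VR_invertible: "invertible_el (VR k)"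
proof (rule invertible_elI)
  let ?y = "1 + 2 *\<^sub>C (F True k * F False k * D1 zs)"
  show "VR k * ?y = 1"
  proof (rule wt_eqI1)
    show "VR k * ?y * P a = 1 * P a" for a
      unfolding VR_def by (cases a; simp add: eval_simps zs_def scaleC_numeral2)
  qed
  show "?y * VR k = 1"
  proof (rule wt_eqI1)
    show "?y * VR k * P a = 1 * P a" for a
      unfolding VR_def by (cases a; simp add: eval_simps zs_def scaleC_numeral2)
  qed
qed

lemma ribbon_invertible_Q:
  assumes "\<beta> \<noteq> 0" shows "invertible_el (Q_ribbon \<beta> :: 'n::{finite,linorder} Q)"
  unfolding Q_ribbon_eq
proof (intro invertible_el_mult ordered_prod_invertible VR_invertible)
  show "invertible_el (D1 (nu \<beta>))"
    using assms by (intro invertible_elI[of _ "D1 (\<lambda>a. inverse (nu \<beta> a))"])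
      (auto simp: D1_mult one_D1 nu_def intro!: D1_cong)
qed

lemma ant_VR: "ant (VR k) = D1 zs * (VR k :: 'n::finite Q)"
proof (rule wt_eqI1)
  fix a
  have "ant (VR k) = 1 - 2 *\<^sub>C ((F False k * D1 (u (odd CARD('n)) False)) * (F True k * D1 (u (odd CARD('n)) True)) :: 'n Q)"
    by (simp add: VR_def ant_simps ant_F)
  then show "ant (VR k) * P a = D1 zs * (VR k :: 'n Q) * P a"
    unfolding VR_def by (cases a; cases "odd CARD('n)"; simp add: eval_simps zs_def u_def scaleC_numeral2)
qed

lemma prod_list_rev:
  fixes g :: "'k \<Rightarrow> 'b::monoid_mult"
  assumes "\<And>j k. g j * g k = g k * g j"
  shows "prod_list (map g (rev xs)) = prod_list (map g xs)"
proof (induction xs)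
  case (Cons x xs)
  have "g x * prod_list (map g xs) = prod_list (map g xs) * g x" by (rule prod_list_commute) (rule assms)
  then show ?case using Cons by (simp add: rev_map)
qed simp

text \<open>The factors commute, so reversing their order is harmless. Each of the N factors
  contributes \<open>K^2\<close>, and the resulting sign \<open>zs^N\<close> undoes the effect of
  \<open>st\<close> on \<open>nu\<close>, which is a parity shift in \<open>e1\<close> for odd
  N.\<close>

lemma ribbon_antipode_Q: "ant (Q_ribbon \<beta>) = (Q_ribbon \<beta> :: 'n::{finite,linorder} Q)"
proof -
  let ?od = "odd CARD('n)"
  have anti: "ant (prod_list (map VR xs)) = prod_list (map (\<lambda>k. ant (VR k)) (rev xs))" for xs :: "'n list"
    by (induction xs) (simp_all add: ant_simps)
  have pow: "prod_list (map (\<lambda>k. D1 zs * VR k) xs) = D1 (\<lambda>a. zs a ^ length xs) * prod_list (map VR xs)" for xs :: "'n list"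
  proof (induction xs)
    case (Cons k xs)
    have "D1 zs * VR k * (D1 (\<lambda>a. zs a ^ length xs) * prod_list (map VR xs)) =
       D1 zs * (VR k * D1 (\<lambda>a. zs a ^ length xs)) * prod_list (map VR xs)" by (simp only: mult.assoc)
    then show ?case by (simp only: VR_D1 Cons list.map prod_list.Cons list.size)
       (simp add: mult.assoc[symmetric] D1_mult)
  qed (simp add: one_D1 D1_mult)
  have "ant (ordered_prod VR) = (D1 (\<lambda>a. zs a ^ CARD('n)) * ordered_prod VR :: 'n Q)"
    unfolding ordered_prod_def anti ant_VR pow by (simp add: prod_list_rev[of VR, OF VR_commute])
  then have "ant (Q_ribbon \<beta> :: 'n Q) = D1 (\<lambda>a. zs a ^ CARD('n)) * (ordered_prod VR * D1 (\<lambda>a. nu \<beta> (st ?od a)))"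
    by (simp add: Q_ribbon_eq ant_simps ant_D1 mult.assoc)
  also have "ordered_prod VR * D1 (\<lambda>a. nu \<beta> (st ?od a)) = D1 (\<lambda>a. nu \<beta> (st ?od a)) * (ordered_prod VR :: 'n Q)"
    by (rule ordered_prod_move) (rule VR_D1)
  also have "D1 (\<lambda>a. zs a ^ CARD('n)) * (D1 (\<lambda>a. nu \<beta> (st ?od a)) * ordered_prod VR) = (Q_ribbon \<beta> :: 'n Q)"
    unfolding mult.assoc[symmetric] D1_mult Q_ribbon_eq
    by (intro arg_cong[of _ _ "\<lambda>x. x * _"] D1_cong) (auto simp: zs_def nu_def st_def)
  finally show ?thesis .
qed

section \<open>The double braiding and the coproduct of the ribbon element\<close>

definition GR :: "'n \<Rightarrow> 'n Q \<otimes>\<^sub>C 'n Q" where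
  "GR k = 1 + 2 *\<^sub>C ((F True k * D1 (w False)) \<otimes>\<^sub>C (F False k * D1 zs))"

lemma tflip_ER: "tflip (ER k) = 1 - 2 *\<^sub>C (F True k \<otimes>\<^sub>C (F False k * D1 (w False)))"
  by (simp add: ER_def linear_C_simps[OF algebra_homD(1)[OF algebra_hom_tflip]] algebra_homD(2)[OF algebra_hom_tflip] tflip_tens)

text \<open>\<open>GR k\<close> is the flipped factor of R with \<open>rho\<close> moved to its
  left, so that in the double braiding all weight functions stand in front of a product with one
  factor for each index.\<close>

lemma tflip_ER_rho: "tflip (ER k) * D2 (rho \<beta>) = D2 (rho \<beta>) * GR k"
proof -
  have "F True k \<otimes>\<^sub>C (F False k * D1 (w False)) * D2 (rho \<beta>) = (F True k \<otimes>\<^sub>C F False k) * D2 (\<lambda>a b. w False b * rho \<beta> a b)"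
    using pair_D2(2)[where g="rho \<beta>" and x=True and i=k and k="\<lambda>a. 1" and y=False and j=k and l="w False"]
    by (simp add: one_D1[symmetric])
  also have "D2 (\<lambda>a b. w False b * rho \<beta> a b) = - D2 (\<lambda>a b. rho \<beta> (sh a) (sh b) * (w False a * zs b))"
    unfolding D2_minus by (rule D2_cong) (auto simp: rho_def wt_defs zs_def)
  also have "(F True k \<otimes>\<^sub>C F False k) * - D2 (\<lambda>a b. rho \<beta> (sh a) (sh b) * (w False a * zs b))
     = - (D2 (rho \<beta>) * ((F True k * D1 (w False)) \<otimes>\<^sub>C (F False k * D1 zs)))"
    by (simp add: pair_D2)
  finally show ?thesis
    by (simp add: tflip_ER GR_def distrib_left left_diff_distrib scaleC_mult_left scaleC_mult_right
        complex_vector.scale_minus_right)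
qed

lemma GR_D2:
  assumes "\<And>a b. g (sh a) (sh b) = g a b"
  shows "GR k * D2 g = D2 g * GR k"
  by (simp add: GR_def distrib_left distrib_right scaleC_mult_left scaleC_mult_right pair_D2 assms mult.commute)

lemma monodromy_Q:
  "tflip (Q_R \<beta>) * Q_R \<beta> = D2 (\<lambda>a b. rho \<beta> b a * rho \<beta> a b) * ordered_prod (\<lambda>k. GR k * (ER k :: 'n::{finite,linorder} Q \<otimes>\<^sub>C 'n Q))"
proof -
  have c: "GR j * ER k = ER k * (GR j :: 'n Q \<otimes>\<^sub>C 'n Q)" if "j \<noteq> k" for j k
  proof (rule wt_eqI2)
    fix a c
    show "GR j * ER k * (P a \<otimes>\<^sub>C P c) = ER k * GR j * (P a \<otimes>\<^sub>C P c :: 'n Q \<otimes>\<^sub>C 'n Q)"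
      unfolding ER_def GR_def
      by (cases a; cases c; simp add: eval_simps F_swap_mult[OF that] zs_def scaleC_numeral2)
  qed
  have "tflip (Q_R \<beta>) = D2 (\<lambda>a b. rho \<beta> b a) * ordered_prod (\<lambda>k. tflip (ER k :: 'n Q \<otimes>\<^sub>C 'n Q))"
    by (simp add: Q_R_eq algebra_homD[OF algebra_hom_tflip] tflip_D2 ordered_prod_hom[OF algebra_hom_tflip])
  then have "tflip (Q_R \<beta>) * Q_R \<beta> = D2 (\<lambda>a b. rho \<beta> b a) * (ordered_prod (\<lambda>k. tflip (ER k)) * D2 (rho \<beta>)) * (ordered_prod ER :: 'n Q \<otimes>\<^sub>C 'n Q)"
    by (simp only: Q_R_eq mult.assoc)
  also have "ordered_prod (\<lambda>k. tflip (ER k)) * D2 (rho \<beta>) = D2 (rho \<beta>) * (ordered_prod GR :: 'n Q \<otimes>\<^sub>C 'n Q)"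
    by (rule ordered_prod_move) (rule tflip_ER_rho)
  also have "D2 (\<lambda>a b. rho \<beta> b a) * (D2 (rho \<beta>) * ordered_prod GR) * ordered_prod ER
     = (D2 (\<lambda>a b. rho \<beta> b a) * D2 (rho \<beta>)) * (ordered_prod GR * (ordered_prod ER :: 'n Q \<otimes>\<^sub>C 'n Q))"
    by (simp only: mult.assoc)
  also have "ordered_prod GR * ordered_prod ER = ordered_prod (\<lambda>k. GR k * (ER k :: 'n Q \<otimes>\<^sub>C 'n Q))"
    by (rule ordered_prod_mult) (rule c)
  finally show ?thesis by (simp only: D2_mult)
qed

lemma cm_F_F: "cm (F True k) * cm (F False k) = (F True k * F False k) \<otimes>\<^sub>C 1
    + (F True k * D1 (w False)) \<otimes>\<^sub>C F False k - (F False k * D1 (w True)) \<otimes>\<^sub>C F True k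
    + D1 zs \<otimes>\<^sub>C (F True k * (F False k :: 'n::finite Q))"
proof (rule wt_eqI2)
  fix a c
  show "cm (F True k) * cm (F False k) * (P a \<otimes>\<^sub>C P c) = ((F True k * F False k) \<otimes>\<^sub>C 1
    + (F True k * D1 (w False)) \<otimes>\<^sub>C F False k - (F False k * D1 (w True)) \<otimes>\<^sub>C F True k
    + D1 zs \<otimes>\<^sub>C (F True k * (F False k :: 'n::finite Q))) * (P a \<otimes>\<^sub>C P c)"
    unfolding cm_F by (cases a; simp add: eval_simps zs_def)
qed

lemma ER_cm_VR: "ER k * cm (VR k) = VR k \<otimes>\<^sub>C VR k - 2 *\<^sub>C ((F True k * D1 (w False)) \<otimes>\<^sub>C (F False k :: 'n::finite Q))"
proof (rule wt_eqI2)
  fix a c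
  have "cm (VR k) = 1 - 2 *\<^sub>C (cm (F True k) * cm (F False k))"
    by (simp add: VR_def algebra_homD[OF algebra_hom_cm] linear_C_simps[OF algebra_homD(1)[OF algebra_hom_cm]])
  then show "ER k * cm (VR k) * (P a \<otimes>\<^sub>C P c) = (VR k \<otimes>\<^sub>C VR k - 2 *\<^sub>C ((F True k * D1 (w False)) \<otimes>\<^sub>C F False k)) * (P a \<otimes>\<^sub>C P c)"
    unfolding cm_F_F ER_def VR_def
    by (cases a; simp add: eval_simps zs_def scaleC_numeral2)
qed

text \<open>The ribbon identity for a single pair of generators, with the weight parts stripped
  off.\<close>

lemma ribbon_local: "GR k * ER k * cm (VR k) = VR k \<otimes>\<^sub>C (VR k :: 'n::finite Q)"
proof (rule wt_eqI2)
  fix a c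
  have "GR k * (VR k \<otimes>\<^sub>C VR k - 2 *\<^sub>C ((F True k * D1 (w False)) \<otimes>\<^sub>C F False k)) * (P a \<otimes>\<^sub>C P c) = (VR k \<otimes>\<^sub>C VR k) * (P a \<otimes>\<^sub>C P c)"
    unfolding GR_def VR_def
    by (cases a; cases c; simp add: eval_simps zs_def scaleC_numeral2)
  then show "GR k * ER k * cm (VR k) * (P a \<otimes>\<^sub>C P c) = (VR k \<otimes>\<^sub>C VR k) * (P a \<otimes>\<^sub>C P c)"
    unfolding ER_cm_VR[symmetric] by (simp only: mult.assoc)
qed

lemma ribbon_comult_Q:
  "tflip (Q_R \<beta>) * Q_R \<beta> * cm (Q_ribbon \<beta>) = Q_ribbon \<beta> \<otimes>\<^sub>C (Q_ribbon \<beta> :: 'n::{finite,linorder} Q)"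
proof -
  let ?od = "odd CARD('n)" and ?r = "\<lambda>a b. rho \<beta> b a * rho \<beta> a b" and ?n = "\<lambda>a b. nu \<beta> (gm (odd CARD('n)) a b)"
  let ?GE = "ordered_prod (\<lambda>k. GR k * (ER k :: 'n Q \<otimes>\<^sub>C 'n Q))" and ?V = "ordered_prod (\<lambda>k. cm (VR k :: 'n Q))"
  have D: "?GE * D2 ?n = D2 ?n * ?GE"
  proof (rule ordered_prod_move)
    fix k :: 'n
    have "GR k * ER k * D2 ?n = GR k * (D2 ?n * ER k)" by (simp only: mult.assoc ER_D2 gm_sh)
    then show "GR k * ER k * D2 ?n = D2 ?n * (GR k * ER k)"
      by (simp only: mult.assoc[symmetric] GR_D2 gm_sh)
  qed
  have c: "GR j * ER j * cm (VR k) = cm (VR k) * (GR j * (ER j :: 'n Q \<otimes>\<^sub>C 'n Q))" if "j \<noteq> k" for j k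
  proof -
    have G: "GR j * cm (F b k) = cm (F b k) * (GR j :: 'n Q \<otimes>\<^sub>C 'n Q)" for b
    proof (rule wt_eqI2)
      fix a c
      show "GR j * cm (F b k) * (P a \<otimes>\<^sub>C P c) = cm (F b k) * GR j * (P a \<otimes>\<^sub>C P c)"
        unfolding GR_def cm_F
        by (cases a; cases c; cases b; simp add: eval_simps F_swap_mult[OF that] zs_def scaleC_numeral2)
    qed
    have GE: "GR j * ER j * cm (F b k) = cm (F b k) * (GR j * (ER j :: 'n Q \<otimes>\<^sub>C 'n Q))" for b
      by (rule commute_mult_left[OF G ER_cm_other(1)[OF that]])
    have "GR j * ER j * (cm (F True k) * cm (F False k)) = cm (F True k) * cm (F False k) * (GR j * (ER j :: 'n Q \<otimes>\<^sub>C 'n Q))"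
      by (rule commute_mult_right[OF GE GE])
    then show ?thesis
      by (simp add: VR_def algebra_homD[OF algebra_hom_cm] linear_C_simps[OF algebra_homD(1)[OF algebra_hom_cm]]
          left_diff_distrib right_diff_distrib scaleC_mult_left scaleC_mult_right)
  qed
  have V: "ordered_prod (\<lambda>k. VR k \<otimes>\<^sub>C VR k) = ordered_prod VR \<otimes>\<^sub>C (ordered_prod VR :: 'n Q)"
  proof -
    have "ordered_prod VR \<otimes>\<^sub>C (ordered_prod VR :: 'n Q) = (ordered_prod VR \<otimes>\<^sub>C 1) * (1 \<otimes>\<^sub>C ordered_prod VR)"
      by (simp add: tens_mult)
    also have "\<dots> = ordered_prod (\<lambda>k. (VR k \<otimes>\<^sub>C 1) * (1 \<otimes>\<^sub>C VR k))"
      unfolding ordered_prod_hom[OF algebra_hom_tens(1)] ordered_prod_hom[OF algebra_hom_tens(2)]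
      by (rule ordered_prod_mult) (simp add: tens_mult)
    finally show ?thesis by (simp add: tens_mult)
  qed
  have "cm (Q_ribbon \<beta> :: 'n Q) = D2 ?n * ?V"
    by (simp add: Q_ribbon_eq algebra_homD[OF algebra_hom_cm] cm_D1 ordered_prod_hom[OF algebra_hom_cm])
  then have "tflip (Q_R \<beta>) * Q_R \<beta> * cm (Q_ribbon \<beta> :: 'n Q) = D2 ?r * (?GE * D2 ?n) * ?V"
    by (simp only: monodromy_Q mult.assoc)
  also have "\<dots> = (D2 ?r * D2 ?n) * (?GE * ?V)" unfolding D by (simp only: mult.assoc)
  also have "?GE * ?V = ordered_prod (\<lambda>k. GR k * ER k * cm (VR k))"
    by (rule ordered_prod_mult) (rule c)
  also have "\<dots> = ordered_prod VR \<otimes>\<^sub>C ordered_prod VR"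
    by (simp only: ribbon_local V)
  \<comment> \<open>\<open>nu\<close> is a quadratic function on the group of weights, and the
    weight part of the double braiding is its polarisation.\<close>
  also have "D2 ?r * D2 ?n = (D2 (\<lambda>a b. nu \<beta> a * nu \<beta> b) :: 'n Q \<otimes>\<^sub>C 'n Q)"
    unfolding D2_mult by (rule D2_cong) (auto simp: rho_def nu_def gm_def)
  also have "D2 (\<lambda>a b. nu \<beta> a * nu \<beta> b) * (ordered_prod VR \<otimes>\<^sub>C ordered_prod VR) = Q_ribbon \<beta> \<otimes>\<^sub>C (Q_ribbon \<beta> :: 'n Q)"
    by (simp add: D1_tens_D1[symmetric] tens_mult Q_ribbon_eq)
  finally show ?thesis .
qed

lemma ribbon_Q:
  assumes "\<beta> ^ 4 = (-1) ^ CARD('n::{finite,linorder})"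
  shows "ribbon_quasi_hopf_algebra (Q_data \<beta> :: 'n Q ribbon_quasi_hopf)"
proof -
  have b0: "\<beta> \<noteq> 0" using assms by (auto simp: zero_power)
  interpret quasi_triangular_quasi_hopf_algebra "Q_data \<beta> :: 'n Q ribbon_quasi_hopf"
    by (rule quasi_triangular_Q[OF assms])
  show ?thesis
    by (unfold_locales, unfold Q_data_sel)
       (rule ribbon_central_Q ribbon_invertible_Q[OF b0] ribbon_comult_Q ribbon_antipode_Q)+
qed


section \<open>A Fock representation\<close>

text \<open>The target of \<open>Q_hom_ext\<close> has to be a type of class
  \<open>complex_algebra\<close>, so linear endomorphisms are made into a type.\<close>

typedef (overloaded) 'a endo = "{f :: 'a::complex_vector \<Rightarrow> 'a. linear_C f}" morphisms app Endo
  by (rule exI[of _ id]) (simp add: linear_C_id)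

setup_lifting type_definition_endo

instantiation endo :: (complex_vector) complex_algebra
begin
lift_definition zero_endo :: "'a endo" is "\<lambda>x. 0"
  by (simp add: linear_C_def complex_vector.scale_zero_right)
lift_definition one_endo :: "'a endo" is "\<lambda>x. x"
  by (simp add: linear_C_def)
lift_definition plus_endo :: "'a endo \<Rightarrow> 'a endo \<Rightarrow> 'a endo" is "\<lambda>f g x. f x + g x"
  by (simp add: linear_C_def scaleC_add_right)
lift_definition minus_endo :: "'a endo \<Rightarrow> 'a endo \<Rightarrow> 'a endo" is "\<lambda>f g x. f x - g x"
  by (simp add: linear_C_def complex_vector.scale_right_diff_distrib)
lift_definition uminus_endo :: "'a endo \<Rightarrow> 'a endo" is "\<lambda>f x. - f x"
  by (simp add: linear_C_def complex_vector.scale_minus_right)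
lift_definition times_endo :: "'a endo \<Rightarrow> 'a endo \<Rightarrow> 'a endo" is "\<lambda>f g x. f (g x)"
  by (simp add: linear_C_def)
lift_definition scaleC_endo :: "complex \<Rightarrow> 'a endo \<Rightarrow> 'a endo" is "\<lambda>c f x. c *\<^sub>C f x"
  by (simp add: linear_C_def scaleC_add_right scaleC_scaleC mult.commute)
instance
  by standard (transfer, simp add: linear_C_def fun_eq_iff algebra_simps scaleC_add_right scaleC_add_left
      scaleC_scaleC scaleC_one complex_vector.scale_zero_left)+
end

lemmas app_simps = zero_endo.rep_eq one_endo.rep_eq plus_endo.rep_eq minus_endo.rep_eq uminus_endo.rep_eq
  times_endo.rep_eq scaleC_endo.rep_eq

lemma linear_C_app: "linear_C (app f)"
  using app[of f] by simp

type_synonym 'n fock = "(('n \<times> bool) set \<times> wt) \<Rightarrow>\<^sub>0 complex"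

definition ket :: "('n \<times> bool) set \<Rightarrow> wt \<Rightarrow> 'n fock" where
  "ket S a = Poly_Mapping.single (S, a) 1"

definition ext_endo :: "(('n \<times> bool) set \<Rightarrow> wt \<Rightarrow> 'n fock) \<Rightarrow> 'n fock endo" where
  "ext_endo g = Endo (linear_ext (\<lambda>(S, a). g S a))"

lemma ext_endo_ket [simp]: "app (ext_endo g) (ket S a) = g S a"
proof -
  have "linear_C (linear_ext (\<lambda>(S, a). g S a))"
    by (simp add: linear_C_def linear_ext_add linear_ext_scaleC)
  then show ?thesis by (simp add: ext_endo_def Endo_inverse ket_def scaleC_one)
qed

lemma endo_eqI:
  assumes "\<And>S a. app f (ket S a) = app g (ket S a)"
  shows "f = (g :: 'n fock endo)"
proof -
  have "app f v = app g v" for v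
  proof (induction v rule: poly_mapping_induct)
    case (single k c)
    have "Poly_Mapping.single k c = c *\<^sub>C ket (fst k) (snd k)"
      by (rule poly_mapping_eqI) (simp add: ket_def lookup_scaleC lookup_single when_def scaleC_complex_def)
    then show ?case by (simp add: linear_C_scale[OF linear_C_app] assms)
  qed (simp add: linear_C_add[OF linear_C_app])
  then show ?thesis by (simp add: app_inject[symmetric] fun_eq_iff)
qed

text \<open>Jordan--Wigner signs, which make the operators \<open>cre\<close> and \<open>ann\<close> below anticommute.\<close>

definition sg :: "'x::countable \<Rightarrow> 'x \<Rightarrow> complex" where
  "sg x y = (if to_nat y < to_nat x then -1 else 1)"

definition jw :: "'x::{countable,finite} \<Rightarrow> 'x set \<Rightarrow> complex" where
  "jw x S = (\<Prod>y\<in>S. sg x y)"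

lemma sg_simps [simp]: "sg x x = 1" "sg x y * sg x y = 1" "sg x y * (sg x y * c) = c" "sg x y \<noteq> 0"
  by (simp_all add: sg_def)

lemma sg_anti: "x \<noteq> y \<Longrightarrow> sg y x = - sg x y"
  using inj_eq[OF inj_to_nat, of x y] by (auto simp: sg_def)

lemma jw_insert: "y \<notin> S \<Longrightarrow> jw x (insert y S) = sg x y * jw x S"
  by (simp add: jw_def)

lemma jw_remove: "y \<in> S \<Longrightarrow> jw x (S - {y}) = sg x y * jw x S"
  unfolding jw_def by (simp add: prod.remove[of S y] mult.assoc[symmetric])

lemma jw_simps [simp]: "jw x S * jw x S = 1" "jw x S * (jw x S * c) = c" "jw x S \<noteq> 0"
proof -
  show "jw x S * jw x S = 1" unfolding jw_def prod.distrib[symmetric] by simp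
  then show "jw x S * (jw x S * c) = c" "jw x S \<noteq> 0" by (auto simp: mult.assoc[symmetric])
qed

definition cre :: "'n::finite \<times> bool \<Rightarrow> 'n fock endo" where
  "cre x = ext_endo (\<lambda>S a. if x \<in> S then 0 else jw x S *\<^sub>C ket (insert x S) a)"

definition ann :: "'n::finite \<times> bool \<Rightarrow> 'n fock endo" where
  "ann x = ext_endo (\<lambda>S a. if x \<in> S \<and> fst a then jw x S *\<^sub>C ket (S - {x}) a else 0)"

definition dia :: "(('n::finite \<times> bool) set \<Rightarrow> wt \<Rightarrow> complex) \<Rightarrow> 'n fock endo" where
  "dia g = ext_endo (\<lambda>S a. g S a *\<^sub>C ket S a)"

lemma cre_ket: "app (cre x) (ket S a) = (if x \<in> S then 0 else jw x S *\<^sub>C ket (insert x S) a)"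
  and ann_ket: "app (ann x) (ket S a) = (if x \<in> S \<and> fst a then jw x S *\<^sub>C ket (S - {x}) a else 0)"
  and dia_ket: "app (dia g) (ket S a) = g S a *\<^sub>C ket S a"
  by (simp_all add: cre_def ann_def dia_def)

lemmas ket_simps = cre_ket ann_ket dia_ket app_simps linear_C_simps[OF linear_C_app] scaleC_scaleC scaleC_one
  complex_vector.scale_zero_right complex_vector.scale_zero_left complex_vector.scale_minus_left
  complex_vector.scale_minus_right

lemma cre_cre: "cre x * cre y + cre y * cre x = 0"
proof (cases "x = y")
  case True
  then show ?thesis by (intro endo_eqI) (simp add: ket_simps)
next
  case False
  then show ?thesis
    by (intro endo_eqI) (auto simp: ket_simps jw_insert sg_anti[OF False] insert_commute mult.commute mult.left_commute)
qed

lemma ann_ann: "ann x * ann y + ann y * ann x = 0"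
proof (cases "x = y")
  case True
  then show ?thesis by (intro endo_eqI) (simp add: ket_simps)
next
  case False
  have "S - {x} - {y} = S - {y} - {x}" for S by auto
  with False show ?thesis
    by (intro endo_eqI) (auto simp: ket_simps jw_remove sg_anti[OF False] mult.commute mult.left_commute)
qed

lemma ann_cre: "ann x * cre y + cre y * ann x = (if x = y then dia (\<lambda>S a. if fst a then 1 else 0) else 0)"
proof (cases "x = y")
  case True
  then show ?thesis
    by (intro endo_eqI) (auto simp: ket_simps jw_insert jw_remove insert_absorb)
next
  case False
  have "x \<in> S \<Longrightarrow> insert y S - {x} = insert y (S - {x})" for S using False by auto
  with False show ?thesis
    by (intro endo_eqI) (auto simp: ket_simps jw_insert jw_remove sg_anti[OF False] mult.commute mult.left_commute)
qed

text \<open>There are two modes for each index. The annihilator of \<open>(k, True)\<close> is cut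
  off outside the sector \<open>e1\<close>, so \<open>f_k^+\<close> and \<open>f_k^-\<close> satisfy
  Clifford relations there and exterior relations in \<open>e0\<close>. The second label of a basis
  vector is the weight of its vacuum, which leaves one basis vector for each PBW monomial with a
  weight projector.\<close>

fun fock_gen :: "'n::finite letter \<Rightarrow> 'n fock endo" where
  "fock_gen Letter_K = dia (\<lambda>S a. chi a * (-1) ^ card S)"
| "fock_gen (Letter_fp k) = cre (k, True)"
| "fock_gen (Letter_fm k) = cre (k, False) + ann (k, True)"

lemma one_dia: "1 = dia (\<lambda>S a. 1)"
  by (rule endo_eqI) (simp add: ket_simps)

lemma dia_simps: "dia g * dia h = dia (\<lambda>S a. g S a * h S a)" "dia g - dia h = dia (\<lambda>S a. g S a - h S a)"
  "c *\<^sub>C dia g = dia (\<lambda>S a. c * g S a)"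
  by (intro endo_eqI, simp add: ket_simps mult.commute complex_vector.scale_left_diff_distrib)+

lemma dia_power: "dia g ^ n = dia (\<lambda>S a. g S a ^ n)"
  by (induction n) (simp_all add: dia_simps one_dia)

lemma Q_rels_fock: "Q_rels (fock_gen :: 'n::finite letter \<Rightarrow> _)"
proof -
  let ?K = "dia (\<lambda>S a. chi a * (-1) ^ card S) :: 'n fock endo"
  have c: "cre x * ?K + ?K * cre x = 0" for x
    by (intro endo_eqI) (auto simp: ket_simps mult_ac scaleC_add_left[symmetric])
  have p: "(-1) ^ (card S - Suc 0) = (- ((-1) ^ card S) :: complex)" if "x \<in> S" for S and x :: "'n \<times> bool"
    using card_Suc_Diff1[OF finite that] by (cases "card S") auto
  have a: "ann x * ?K + ?K * ann x = 0" for x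
    by (intro endo_eqI) (auto simp: ket_simps mult_ac scaleC_add_left[symmetric] p)
  have sq: "((-1) ^ n) ^ 2 = (1::complex)" for n by (simp add: power_mult[symmetric] mult.commute)
  have e: "e1_of ?K = dia (\<lambda>S a. if fst a then 1 else 0)"
    unfolding e1_of_def dia_power one_dia dia_simps power_mult_distrib sq
    by (intro arg_cong[of _ _ dia] ext) (auto simp: chi_def power_mult_distrib)
  have k: "?K ^ 4 = 1"
    using power_mult[of "(-1)::complex" _ 4]
    unfolding dia_power one_dia power_mult_distrib chi_simps by (simp add: mult.commute)
  have ca: "cre x * ann y + ann y * cre x = (if x = y then dia (\<lambda>S a. if fst a then 1 else 0) else 0)" for x y :: "'n \<times> bool"
    using ann_cre[of y x] by (simp add: add.commute eq_commute)
  have s: "a * (b + c) + (b + c) * a = (a * b + b * a) + (a * c + c * a)" for a b c :: "'n fock endo"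
    by (simp add: algebra_simps)
  have s': "(b + c) * a + a * (b + c) = (b * a + a * b) + (c * a + a * c)" for a b c :: "'n fock endo"
    by (simp add: algebra_simps)
  show ?thesis
    unfolding Q_rels_def anticomm_def fock_gen.simps k e s s' c a cre_cre ca ann_ann ann_cre by auto
qed

definition fock :: "'n::finite Q \<Rightarrow> 'n fock endo" where
  "fock = Q_hom_ext fock_gen"

lemma algebra_hom_fock: "algebra_hom fock"
  unfolding fock_def by (rule algebra_hom_Q_hom_ext[OF Q_rels_fock])

lemma fock_F: "fock (F True k) = cre (k, True)" "fock (F False k) = cre (k, False) + ann (k, True)"
  by (simp_all add: fock_def F_def Q_ext_gens[OF Q_rels_fock])

lemma fock_P_vacuum: "app (fock (P a)) (ket {} c) = (if a = c then ket {} c else 0)"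
proof -
  \<comment> \<open>\<open>wt_proj_mult_eigen\<close> concerns elements of an algebra, so the vacuum
    vector is replaced by the rank one projector onto it.\<close>
  let ?v = "dia (\<lambda>S b. if S = {} \<and> b = c then 1 else 0) :: 'a fock endo"
  have "fock QK * ?v = chi c *\<^sub>C ?v"
    by (intro endo_eqI) (simp add: fock_def Q_ext_gens[OF Q_rels_fock] ket_simps)
  then have "fock (P a) * ?v = (if a = c then ?v else 0)"
    unfolding P_def algebra_hom_wt_proj[OF algebra_hom_fock] by (rule wt_proj_mult_eigen)
  then have "app (fock (P a) * ?v) (ket {} c) = app (if a = c then ?v else 0) (ket {} c)" by (rule arg_cong)
  then show ?thesis by (simp add: ket_simps split: if_splits)
qed

section \<open>The Poincare-Birkhoff-Witt basis\<close>

text \<open>The flag \<open>b\<close> fixes the order of the two generators and \<open>t\<close>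
  tells which of them occur. Flipping \<open>b\<close> exchanges + and -, so the same
  \<open>t\<close> labels both legs of a term of the double braiding.\<close>

definition lw :: "bool \<Rightarrow> 'n \<Rightarrow> bool \<times> bool \<Rightarrow> 'n Q" where
  "lw b k t = (if fst t then F b k else 1) * (if snd t then F (\<not> b) k else 1)"

fun Lw :: "bool \<Rightarrow> 'n list \<Rightarrow> (bool \<times> bool) list \<Rightarrow> 'n Q" where
  "Lw b (k # ks) (t # ts) = lw b k t * Lw b ks ts"
| "Lw b _ _ = 1"

fun par :: "(bool \<times> bool) list \<Rightarrow> bool" where
  "par [] = False"
| "par (t # ts) = ((fst t \<noteq> snd t) \<noteq> par ts)"

definition shp :: "bool \<Rightarrow> wt \<Rightarrow> wt" where
  "shp p a = (if p then sh a else a)"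

lemma shp_simps [simp]: "shp p (shp p a) = a" "shp False a = a" "shp True a = sh a" "fst (shp p a) = fst a"
  by (simp_all add: shp_def)

lemma shp_comp: "shp p (shp q a) = shp (p \<noteq> q) a"
  by (simp add: shp_def)

lemma D1_lw: "D1 g * lw b k t = lw b k t * D1 (\<lambda>a. g (shp (fst t \<noteq> snd t) a))"
  by (cases t) (auto simp: lw_def shp_def D1_F D1_F_mult mult.assoc)

lemma D1_Lw:
  assumes "length s = length xs"
  shows "D1 g * Lw b xs s = Lw b xs s * D1 (\<lambda>a. g (shp (par s) a))"
  using assms
proof (induction xs s arbitrary: g rule: list_induct2')
  case (4 k ks t ts)
  have "D1 g * Lw b (k # ks) (t # ts) = lw b k t * (D1 (\<lambda>a. g (shp (fst t \<noteq> snd t) a)) * Lw b ks ts)"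
    by (simp only: Lw.simps mult.assoc[symmetric] D1_lw)
  also have "\<dots> = Lw b (k # ks) (t # ts) * D1 (\<lambda>a. g (shp (fst t \<noteq> snd t) (shp (par ts) a)))"
    using 4 by (simp add: mult.assoc)
  finally show ?case by (simp only: shp_comp par.simps)
qed simp_all

definition pbw_span :: "bool \<Rightarrow> 'n list \<Rightarrow> 'n Q set" where
  "pbw_span b xs = complex_vector.span {Lw b xs s * P a | s a. length s = length xs}"

lemma span_image_linear:
  assumes "linear_C f" "x \<in> complex_vector.span S" "\<And>y. y \<in> S \<Longrightarrow> f y \<in> complex_vector.span W"
  shows "f x \<in> complex_vector.span W"
  using assms(2)
proof (induction rule: complex_vector.span_induct_alt)
  case (step c x y)
  then show ?case
    by (simp add: linear_C_simps[OF assms(1)] complex_vector.span_add complex_vector.span_scale assms(3))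
qed (simp add: linear_C_zero[OF assms(1)] complex_vector.span_zero)

text \<open>Squares of generators vanish and reordering costs at most one \<open>e1\<close>, which
  becomes a number as soon as a weight projector stands on the right.\<close>

lemma F_lw_same: "\<exists>x y t1 t2. F c k * lw b k t = x *\<^sub>C lw b k t1 + y *\<^sub>C (e1 * lw b k t2)"
proof (cases "c = b")
  case True
  have "F c k * lw b k t = (if fst t then 0 else 1) *\<^sub>C lw b k (True, snd t) + 0 *\<^sub>C (e1 * lw b k t)"
    using True by (simp add: lw_def mult.assoc[symmetric] F_F_same complex_vector.scale_zero_left scaleC_one)
  then show ?thesis by blast
next
  case False
  then have c: "c = (\<not> b)" by simp
  have m: "F (\<not> b) k * (F (\<not> b) k * z) = 0" "F (\<not> b) k * (F b k * z) = e1 * z - F b k * (F (\<not> b) k * z)" for z :: "'a Q"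
    by (simp_all add: mult.assoc[symmetric] F_F_same F_Not left_diff_distrib)
  have "F c k * lw b k t =
      (if fst t then (if snd t then 0 else -1) else (if snd t then 0 else 1)) *\<^sub>C lw b k (fst t, True)
      + (if fst t then 1 else 0) *\<^sub>C (e1 * lw b k (False, snd t))"
    by (cases t)
      (auto simp: lw_def c m F_F_same F_Not complex_vector.scale_zero_left complex_vector.scale_minus_left scaleC_one)
  then show ?thesis by blast
qed

lemma F_lw_other:
  assumes "j \<noteq> k"
  shows "F c j * lw b k t = (if fst t \<noteq> snd t then -1 else 1) *\<^sub>C (lw b k t * F c j)"
  using F_swap[of j k c] F_swap_mult[OF assms[symmetric]] assms
  by (cases t) (auto simp: lw_def mult.assoc complex_vector.scale_minus_left scaleC_one)

lemma F_Lw_pbw: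
  assumes "distinct xs" "j \<in> set xs" "length s = length xs"
  shows "F c j * (Lw b xs s * P a) \<in> pbw_span b xs"
  using assms
proof (induction xs arbitrary: s)
  case (Cons k ks)
  then obtain t ts where s: "s = t # ts" by (cases s) auto
  with Cons have len: "length ts = length ks" by simp
  have base: "lw b k t' * (Lw b ks ts' * P a') \<in> pbw_span b (k # ks)" if "length ts' = length ks" for t' ts' a'
    unfolding pbw_span_def
    by (intro complex_vector.span_base CollectI exI[of _ "t' # ts'"] exI[of _ a'])
      (simp add: mult.assoc that)
  show ?case
  proof (cases "j = k")
    case True
    obtain x y t1 t2 where f: "F c j * lw b k t = x *\<^sub>C lw b k t1 + y *\<^sub>C (e1 * lw b k t2)"
      using F_lw_same[of c k b t] True by auto
    have e: "e1 * (lw b k t2 * (Lw b ks ts * P a)) = (if fst a then 1 else 0) *\<^sub>C (lw b k t2 * (Lw b ks ts * P a))"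
    proof -
      have "e1 * (lw b k t2 * (Lw b ks ts * P a)) = (D1 (\<lambda>a. if fst a then 1 else 0) * Lw b (k # ks) (t2 # ts)) * P a"
        by (simp add: e_D1 mult.assoc)
      also have "\<dots> = Lw b (k # ks) (t2 # ts) * (D1 (\<lambda>a. if fst a then 1 else 0) * P a)"
        using D1_Lw[of "t2 # ts" "k # ks"] len by (simp add: mult.assoc del: Lw.simps)
      finally show ?thesis by (simp add: D1_P scaleC_mult_right mult.assoc)
    qed
    have "F c j * (Lw b (k # ks) s * P a) = (F c j * lw b k t) * (Lw b ks ts * P a)"
      by (simp add: s mult.assoc)
    also have "\<dots> = x *\<^sub>C (lw b k t1 * (Lw b ks ts * P a)) + (y * (if fst a then 1 else 0)) *\<^sub>C (lw b k t2 * (Lw b ks ts * P a))"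
      by (simp only: f distrib_right scaleC_mult_left mult.assoc e scaleC_scaleC)
    also have "\<dots> \<in> pbw_span b (k # ks)"
      using base[OF len, of t1 a] base[OF len, of t2 a]
      by (simp only: pbw_span_def complex_vector.span_add complex_vector.span_scale)
    finally show ?thesis .
  next
    case False
    then have "F c j * (Lw b ks ts * P a) \<in> pbw_span b ks"
      using Cons len by auto
    then have "lw b k t * (F c j * (Lw b ks ts * P a)) \<in> pbw_span b (k # ks)"
      unfolding pbw_span_def
      by (rule span_image_linear[OF linear_C_mult(2)]) (use base[unfolded pbw_span_def] in blast)
    moreover have "F c j * (Lw b (k # ks) s * P a) = (F c j * lw b k t) * (Lw b ks ts * P a)"
      by (simp add: s mult.assoc)
    ultimately show ?thesis
      unfolding F_lw_other[OF False] by (simp only: scaleC_mult_left mult.assoc pbw_span_def complex_vector.span_scale)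
  qed
qed simp

text \<open>The span contains 1 as the sum of the weight projectors and is stable under left
  multiplication by generators.\<close>

lemma pbw_spans:
  assumes "distinct xs" "set xs = UNIV"
  shows "x \<in> pbw_span b xs"
proof (induction x rule: Q_induct_F)
  case one
  have "Lw b ks (map (\<lambda>_. (False, False)) ks) = 1" for ks :: "'a list"
    by (induction ks) (simp_all add: lw_def)
  then have "P a \<in> pbw_span b xs" for a :: wt
    unfolding pbw_span_def
    by (intro complex_vector.span_base CollectI exI[of _ "map (\<lambda>_. (False, False)) xs"] exI[of _ a]) simp
  then have "(\<Sum>a\<in>UNIV. P a) \<in> pbw_span b xs"
    unfolding pbw_span_def by (intro complex_vector.span_sum)
  then show ?case by (simp add: sum_P)
next
  case (add x y) then show ?case unfolding pbw_span_def by (rule complex_vector.span_add)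
next
  case (scale c x) then show ?case unfolding pbw_span_def by (rule complex_vector.span_scale)
next
  case (D1 g x)
  then show ?case
    unfolding pbw_span_def
  proof (rule span_image_linear[OF linear_C_mult(2)])
    fix y assume m: "y \<in> {Lw b xs s * P a |s a. length s = length xs}"
    then obtain s a where y: "y = Lw b xs s * P a" "length s = length xs" by blast
    have "D1 g * y = (D1 g * Lw b xs s) * P a" unfolding y by (simp only: mult.assoc)
    also have "\<dots> = g (shp (par s) a) *\<^sub>C y"
      unfolding D1_Lw[OF y(2)] by (simp only: y mult.assoc D1_P scaleC_mult_right)
    finally show "D1 g * y \<in> complex_vector.span {Lw b xs s * P a |s a. length s = length xs}"
      using m by (simp only: complex_vector.span_scale complex_vector.span_base)
  qed
next
  case (F c j x)
  then show ?case
    unfolding pbw_span_def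
    by (rule span_image_linear[OF linear_C_mult(2)])
       (use F_Lw_pbw[OF assms(1), of j _ c b, unfolded assms(2) pbw_span_def] in blast)
qed

text \<open>The modes that the monomial fills when it acts on a vacuum.\<close>

fun occ :: "'n list \<Rightarrow> (bool \<times> bool) list \<Rightarrow> ('n \<times> bool) set" where
  "occ (k # ks) (t # ts) = (if fst t then {(k, True)} else {}) \<union> (if snd t then {(k, False)} else {}) \<union> occ ks ts"
| "occ _ _ = {}"

lemma occ_subset: "(k, b) \<in> occ ks ts \<Longrightarrow> k \<in> set ks"
  by (induction ks ts rule: occ.induct) (auto split: if_splits)

lemma occ_inj:
  assumes "distinct ks" "length ts = length ks" "length ts' = length ks" "occ ks ts = occ ks ts'"
  shows "ts = ts'"
  using assms
proof (induction ks arbitrary: ts ts')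
  case (Cons k ks)
  then obtain t us t' us' where t: "ts = t # us" "ts' = t' # us'" by (metis length_Suc_conv length_Cons)
  have n: "(k, b) \<notin> occ ks vs" for b vs using Cons.prems(1) occ_subset[of k b ks vs] by auto
  have m: "(k, True) \<in> occ (k # ks) (t # us) \<longleftrightarrow> fst t" "(k, False) \<in> occ (k # ks) (t # us) \<longleftrightarrow> snd t" for t us
    using n by simp_all
  have "t = t'"
    using m[of t us] m[of t' us'] Cons.prems(4) unfolding t by (simp only: prod_eq_iff)
  have r: "occ ks us = occ (k # ks) (t # us) - {k} \<times> UNIV" for us using n by auto
  have "occ ks us = occ ks us'" using Cons.prems(4) unfolding t r[of us] r[of us'] by (simp only: \<open>t = t'\<close>)
  then show ?case using Cons \<open>t = t'\<close> by (simp add: t)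
qed simp

text \<open>In the order \<open>f_k^+ f_k^-\<close> the operator of \<open>f_k^-\<close> acts first,
  on a state in which the mode \<open>(k, True)\<close> is empty. Its annihilation part therefore
  contributes nothing, and modes are only filled.\<close>

lemma fock_Lw:
  assumes "distinct xs" "length s = length xs"
  shows "\<exists>c. c \<noteq> 0 \<and> app (fock (Lw True xs s)) (ket {} a) = c *\<^sub>C ket (occ xs s) a"
  using assms
proof (induction xs arbitrary: s)
  case Nil
  show ?case by (rule exI[of _ 1]) (simp add: algebra_homD[OF algebra_hom_fock] app_simps scaleC_one)
next
  case (Cons k ks)
  then obtain t ts where s: "s = t # ts" by (cases s) auto
  with Cons obtain c where c: "c \<noteq> 0" "app (fock (Lw True ks ts)) (ket {} a) = c *\<^sub>C ket (occ ks ts) a" by auto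
  have n: "(k, b) \<notin> occ ks ts" for b using Cons.prems(1) occ_subset[of k b ks ts] by auto
  define d where "d = (if fst t then jw (k, True) (if snd t then insert (k, False) (occ ks ts) else occ ks ts) else 1)
    * (if snd t then jw (k, False) (occ ks ts) else 1)"
  have d: "d \<noteq> 0" "app (fock (lw True k t)) (ket (occ ks ts) a) = d *\<^sub>C ket (occ (k # ks) s) a"
    by (cases t; auto simp: d_def s lw_def algebra_homD[OF algebra_hom_fock] fock_F ket_simps n insert_commute mult.commute)+
  show ?case
    by (rule exI[of _ "c * d"])
      (simp add: c d(1) d(2)[unfolded s] s algebra_homD[OF algebra_hom_fock] ket_simps del: occ.simps)
qed

text \<open>On the vacua, different basis elements give non-zero multiples of different Fock vectors
  or zero, so the coordinates can be read off as Fock coefficients.\<close>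

lemma pbw_coordinates:
  assumes "distinct (xs :: 'n::finite list)"
  shows "\<exists>co. (\<forall>s a. linear_C (co s a :: 'n Q \<Rightarrow> complex)) \<and>
    (\<forall>s a s' a'. length s = length xs \<longrightarrow> length s' = length xs \<longrightarrow>
      co s a (Lw True xs s' * P a') = (if s = s' \<and> a = a' then 1 else 0))"
proof -
  have "\<forall>p. \<exists>c. length (fst p) = length xs \<longrightarrow> c \<noteq> 0 \<and>
      app (fock (Lw True xs (fst p))) (ket {} (snd p)) = c *\<^sub>C ket (occ xs (fst p)) (snd p)"
    using fock_Lw[OF assms] by blast
  from choice[OF this] obtain c where c0: "\<forall>p. length (fst p) = length xs \<longrightarrow> c p \<noteq> 0 \<and>
      app (fock (Lw True xs (fst p))) (ket {} (snd p)) = c p *\<^sub>C ket (occ xs (fst p)) (snd p)" ..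
  have c: "c (s, a) \<noteq> 0" "app (fock (Lw True xs s)) (ket {} a) = c (s, a) *\<^sub>C ket (occ xs s) a"
    if "length s = length xs" for s a
    using c0[rule_format, of "(s, a)"] that by simp_all
  let ?co = "\<lambda>s a x. inverse (c (s, a)) * Poly_Mapping.lookup (app (fock x) (ket {} a)) (occ xs s, a)"
  have "linear_C (?co s a)" for s a
    by (rule linear_CI) (simp_all add: linear_C_simps[OF algebra_homD(1)[OF algebra_hom_fock]] app_simps
        lookup_add lookup_scaleC scaleC_complex_def algebra_simps)
  moreover have "?co s a (Lw True xs s' * P a') = (if s = s' \<and> a = a' then 1 else 0)"
    if "length s = length xs" "length s' = length xs" for s a s' a'
  proof -
    have k: "Poly_Mapping.lookup (ket S b) (T, b') = (if S = T \<and> b = b' then 1 else 0)" for S T :: "('n \<times> bool) set" and b b'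
      by (auto simp: ket_def lookup_single when_def)
    show ?thesis
      using c(1)[OF that(1), of a] c(2)[OF that(2), of a] occ_inj[OF assms that]
      by (auto simp: algebra_homD[OF algebra_hom_fock] app_simps fock_P_vacuum linear_C_zero[OF linear_C_app]
          lookup_scaleC scaleC_complex_def k)
  qed
  ultimately show ?thesis by (intro exI[of _ ?co]) blast
qed


section \<open>Expansion of the double braiding\<close>

definition lists_of :: "nat \<Rightarrow> (bool \<times> bool) list set" where
  "lists_of n = {s. length s = n}"

lemma lists_of_Suc: "lists_of (Suc n) = (\<lambda>(t, ts). t # ts) ` (UNIV \<times> lists_of n)"
  by (auto simp: lists_of_def length_Suc_conv image_iff)

lemma finite_lists_of: "finite (lists_of n)"
  by (induction n) (simp_all add: lists_of_Suc, simp add: lists_of_def)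

lemma sum_lists_of_Suc: "(\<Sum>s\<in>lists_of (Suc n). f s) = (\<Sum>t\<in>UNIV. \<Sum>ts\<in>lists_of n. f (t # ts))"
  unfolding lists_of_Suc by (subst sum.reindex) (auto simp: inj_on_def sum.cartesian_product split_def)

text \<open>The constants come from expanding
  \<open>(1 + 2 f_k^+ \<otimes> f_k^-) (1 - 2 f_k^- \<otimes> f_k^+)\<close> with its weight
  functions; in the quadratic term -4 becomes 4 when \<open>omega_m\<close> passes a
  generator.\<close>

definition px :: "bool \<times> bool \<Rightarrow> wt \<Rightarrow> complex" where
  "px t a = (if fst t = snd t then if fst t then 4 else 1 else (if fst t then 2 else -2) * w False a)"

definition py :: "bool \<times> bool \<Rightarrow> wt \<Rightarrow> complex" where
  "py t a = (if fst t then zs a else 1)"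

text \<open>The weight function of a factor is moved to the right past the later monomials, hence
  the shift by their parity.\<close>

fun px_list py_list :: "(bool \<times> bool) list \<Rightarrow> wt \<Rightarrow> complex" where
  "px_list [] a = 1"
| "px_list (t # ts) a = px t (shp (par ts) a) * px_list ts a"
| "py_list [] a = 1"
| "py_list (t # ts) a = py t (shp (par ts) a) * py_list ts a"

lemma px_nonzero: "px_list s a \<noteq> 0" "py_list s a \<noteq> 0"
  by (induction s) (auto simp: px_def py_def zs_def w_def)

lemma GR_ER: "GR k * ER k = (\<Sum>t\<in>UNIV. (lw True k t * D1 (px t)) \<otimes>\<^sub>C (lw False k t * D1 (py t)))"
proof (rule wt_eqI2)
  fix a b
  show "GR k * ER k * (P a \<otimes>\<^sub>C P b)
     = (\<Sum>t\<in>UNIV. (lw True k t * D1 (px t)) \<otimes>\<^sub>C (lw False k t * D1 (py t))) * (P a \<otimes>\<^sub>C P b)"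
    unfolding sum_wt GR_def ER_def lw_def
    by (simp add: eval_simps px_def py_def sh_w zs_def w_def)
qed

lemma GR_ER_prod:
  "prod_list (map (\<lambda>k. GR k * ER k) xs) = (\<Sum>s\<in>lists_of (length xs).
     (Lw True xs s * D1 (px_list s)) \<otimes>\<^sub>C (Lw False xs s * D1 (py_list s)))"
proof (induction xs)
  case Nil
  have "lists_of 0 = {[]}" by (auto simp: lists_of_def)
  then show ?case by (simp add: one_D1[symmetric] tens_one)
next
  case (Cons k ks)
  have m: "(lw b k t * D1 f) * (Lw b ks ts * D1 g) = Lw b (k # ks) (t # ts) * D1 (\<lambda>a. f (shp (par ts) a) * g a)"
    if "ts \<in> lists_of (length ks)" for b t ts f g
  proof -
    have l: "length ts = length ks" using that by (simp add: lists_of_def)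
    have "(lw b k t * D1 f) * (Lw b ks ts * D1 g) = lw b k t * (D1 f * Lw b ks ts) * D1 g"
      by (simp only: mult.assoc)
    then show ?thesis unfolding D1_Lw[OF l] by (simp add: mult.assoc D1_mult)
  qed
  have fs: "px_list (t # ts) = (\<lambda>a. px t (shp (par ts) a) * px_list ts a)"
    "py_list (t # ts) = (\<lambda>a. py t (shp (par ts) a) * py_list ts a)" for t ts
    by (simp_all add: fun_eq_iff)
  show ?case
    unfolding list.map prod_list.Cons Cons list.size(4) add_0_right add_Suc_right sum_lists_of_Suc
    unfolding GR_ER sum_product tens_mult
    by (intro sum.cong refl) (simp only: m fs)
qed

lemma D2_eigen:
  assumes "\<And>h. D1 h * x = h a *\<^sub>C x" "\<And>h. D1 h * y = h b *\<^sub>C (y :: 'n Q)"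
  shows "D2 g * (x \<otimes>\<^sub>C y) = g a b *\<^sub>C (x \<otimes>\<^sub>C y)"
proof -
  have p: "P a' * x = (if a' = a then x else 0)" "P b' * y = (if b' = b then y else 0)" for a' b'
    by (simp_all add: P_D1 assms scaleC_one complex_vector.scale_zero_left eq_commute)
  have "D2 g * (x \<otimes>\<^sub>C y) = (\<Sum>a'\<in>UNIV. \<Sum>b'\<in>UNIV. if b' = b then if a' = a then g a b *\<^sub>C (x \<otimes>\<^sub>C y) else 0 else 0)"
    unfolding D2_expand sum_distrib_right scaleC_mult_left tens_mult p
    by (intro sum.cong refl) (simp add: tens_zero complex_vector.scale_zero_right)
  then show ?thesis by simp
qed

lemma D1_Lw_P: "length s = length xs \<Longrightarrow> D1 h * (Lw b xs s * P a) = h (shp (par s) a) *\<^sub>C (Lw b xs s * P a)"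
  by (simp only: mult.assoc[symmetric] D1_Lw) (simp add: mult.assoc D1_P scaleC_mult_right)

text \<open>The weight part of the double braiding stands to the left of the monomials and sees
  weights shifted by the parity of \<open>s\<close>; the coefficients of the expansion stand to the
  right and see \<open>a\<close> and \<open>b\<close>.\<close>

definition mono_coeff :: "complex \<Rightarrow> (bool \<times> bool) list \<Rightarrow> wt \<Rightarrow> wt \<Rightarrow> complex" where
  "mono_coeff \<beta> s a b = rho \<beta> (shp (par s) b) (shp (par s) a) * rho \<beta> (shp (par s) a) (shp (par s) b) * (px_list s a * py_list s b)"

lemma monodromy_expand:
  defines "xs \<equiv> sorted_list_of_set (UNIV :: 'n::{finite,linorder} set)"
  shows "tflip (Q_R \<beta>) * Q_R \<beta> = (\<Sum>s\<in>lists_of CARD('n). \<Sum>a\<in>UNIV. \<Sum>b\<in>UNIV.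
    mono_coeff \<beta> s a b *\<^sub>C ((Lw True xs s * P a) \<otimes>\<^sub>C (Lw False xs s * P b :: 'n Q)))"
proof -
  have len: "length xs = CARD('n)" by (simp add: xs_def)
  have e: "(x * D1 f) \<otimes>\<^sub>C (y * D1 g) = (\<Sum>a\<in>UNIV. \<Sum>b\<in>UNIV. (f a * g b) *\<^sub>C ((x * P a) \<otimes>\<^sub>C (y * P b :: 'n Q)))"
    for x y :: "'n Q" and f g
    unfolding D1_def sum_distrib_left scaleC_mult_right tens_sum(1) unfolding tens_sum(2)
    by (simp only: tens_scaleC_left tens_scaleC_right scaleC_scaleC mult.commute[of "g _"])
  have "tflip (Q_R \<beta>) * Q_R \<beta> = D2 (\<lambda>a b. rho \<beta> b a * rho \<beta> a b) *
      prod_list (map (\<lambda>k. GR k * (ER k :: 'n Q \<otimes>\<^sub>C 'n Q)) xs)"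
    by (simp only: monodromy_Q ordered_prod_def xs_def)
  also have "\<dots> = (\<Sum>s\<in>lists_of CARD('n). \<Sum>a\<in>UNIV. \<Sum>b\<in>UNIV. (px_list s a * py_list s b) *\<^sub>C
      (D2 (\<lambda>a b. rho \<beta> b a * rho \<beta> a b) * ((Lw True xs s * P a) \<otimes>\<^sub>C (Lw False xs s * P b))))"
    by (simp only: GR_ER_prod e sum_distrib_left scaleC_mult_right len)
  also have "\<dots> = (\<Sum>s\<in>lists_of CARD('n). \<Sum>a\<in>UNIV. \<Sum>b\<in>UNIV.
    mono_coeff \<beta> s a b *\<^sub>C ((Lw True xs s * P a) \<otimes>\<^sub>C (Lw False xs s * P b :: 'n Q)))"
  proof (intro sum.cong refl)
    fix s a b assume "s \<in> lists_of CARD('n)"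
    then have l: "length s = length xs" by (simp add: lists_of_def len)
    show "(px_list s a * py_list s b) *\<^sub>C
      (D2 (\<lambda>a b. rho \<beta> b a * rho \<beta> a b) * ((Lw True xs s * P a) \<otimes>\<^sub>C (Lw False xs s * P b)))
      = mono_coeff \<beta> s a b *\<^sub>C ((Lw True xs s * P a) \<otimes>\<^sub>C (Lw False xs s * P b :: 'n Q))"
      unfolding D2_eigen[OF D1_Lw_P[OF l] D1_Lw_P[OF l]] by (simp add: mono_coeff_def scaleC_scaleC mult_ac)
  qed
  finally show ?thesis .
qed

text \<open>The matrix of the double braiding on weights is the character table of \<open>\<int>\<^sub>2 \<times> \<int>\<^sub>2\<close> with the entries
  between two weights of the sector \<open>e\<^sub>1\<close> multiplied by \<open>\<beta>\<^sup>2\<close>.\<close>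

definition rho_inv :: "complex \<Rightarrow> wt \<Rightarrow> wt \<Rightarrow> complex" where
  "rho_inv \<beta> b a = (if fst b then (if snd a then -1 else 1) else 1) * (if fst a then (if snd b then -1 else 1) else 1)
     * (if fst a \<and> fst b then inverse (\<beta>\<^sup>2) else 1) / 4"

text \<open>Summing over the parity of \<open>a\<close> forces equal sectors of \<open>b\<close> and
  \<open>b'\<close>, whereupon the powers of \<open>\<beta>\<close> cancel. Summing over the sector
  of \<open>a\<close> then forces equal parities.\<close>

lemma sum_rho_inv:
  assumes "\<beta> \<noteq> 0"
  shows "(\<Sum>a\<in>UNIV. rho_inv \<beta> b a * (rho \<beta> b' a * rho \<beta> a b')) = (if b = b' then 1 else 0)"
proof -
  have "\<beta> * (\<beta> * (inverse \<beta> * inverse \<beta>)) = 1" using assms by (simp add: field_simps)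
  then show ?thesis
    using assms unfolding sum_wt rho_inv_def rho_def
    by (cases b; cases b') (auto simp: power2_eq_square)
qed


section \<open>Factorisability of \<open>Q\<close>\<close>

context quasi_hopf_algebra
begin

definition ladj :: "'a \<Rightarrow> 'a \<otimes>\<^sub>C 'a \<Rightarrow> 'a \<otimes>\<^sub>C 'a" where
  "ladj h = tmap (adj h) id"

definition radj :: "'a \<Rightarrow> 'a \<otimes>\<^sub>C 'a \<Rightarrow> 'a \<otimes>\<^sub>C 'a" where
  "radj h = tmap id (adj h)"

lemma ladj_tens: "ladj h (x \<otimes>\<^sub>C y) = adj h x \<otimes>\<^sub>C y" and radj_tens: "radj h (x \<otimes>\<^sub>C y) = x \<otimes>\<^sub>C adj h y"
  unfolding ladj_def radj_def tmap_tens[OF linear_C_adj(1) linear_C_id(1)] tmap_tens[OF linear_C_id(1) linear_C_adj(1)] id_apply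
  by (rule refl)+

lemma linear_C_ladj: "linear_C (ladj h)" and linear_C_radj: "linear_C (radj h)"
  unfolding ladj_def radj_def
  by (rule linear_C_tmap[OF linear_C_adj(1) linear_C_id(1)], rule linear_C_tmap[OF linear_C_id(1) linear_C_adj(1)])

lemma linear_C_ladj2: "linear_C (\<lambda>h. ladj h t)"
proof (induction t rule: tensor_induct)
  case (tens x y)
  show ?case unfolding ladj_tens by (rule linear_C_comp[OF linear_C_tens(1) linear_C_adj(2)])
next
  case (add s t)
  then show ?case unfolding linear_C_add[OF linear_C_ladj] by (simp add: linear_C_def scaleC_add_right)
qed

lemma linear_C_radj2: "linear_C (\<lambda>h. radj h t)"
proof (induction t rule: tensor_induct)
  case (tens x y)
  show ?case unfolding radj_tens by (rule linear_C_comp[OF linear_C_tens(2) linear_C_adj(2)])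
next
  case (add s t)
  then show ?case unfolding linear_C_add[OF linear_C_radj] by (simp add: linear_C_def scaleC_add_right)
qed

lemma ladj_mult: "ladj (h * k) t = ladj k (ladj h t)" and radj_mult: "radj (h * k) t = radj k (radj h t)"
  and ladj_radj: "ladj h (radj k t) = radj k (ladj h t)" and ladj_one: "ladj 1 t = t" and radj_one: "radj 1 t = t"
  and ad2_tens: "ad2 (h \<otimes>\<^sub>C k) t = ladj h (radj k t)"
proof -
  show "ladj (h * k) t = ladj k (ladj h t)" "radj (h * k) t = radj k (radj h t)"
    "ladj h (radj k t) = radj k (ladj h t)" "ladj 1 t = t" "radj 1 t = t"
    by (induction t rule: tensor_induct)
      (simp_all add: ladj_tens radj_tens adj_mult adj_one linear_C_add[OF linear_C_ladj] linear_C_add[OF linear_C_radj])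
  show "ad2 (h \<otimes>\<^sub>C k) t = ladj h (radj k t)"
    unfolding ad2_def tlift_tens[OF bilinear_C_ad2]
    by (induction t rule: tensor_induct)
      (simp_all add: ladj_tens radj_tens tmap_tens linear_C_adj linear_C_add[OF linear_C_ladj]
        linear_C_add[OF linear_C_radj] linear_C_add[OF linear_C_tmap])
qed

lemma linear_C_ad2: "linear_C (\<lambda>s. ad2 s t)"
  unfolding ad2_def by (rule linear_C_tlift[OF bilinear_C_ad2])

lemma ad2_mult_tens: "ad2 (s * (h \<otimes>\<^sub>C k)) t = ladj h (radj k (ad2 s t))"
proof (rule tensor_linear_eq[where f="\<lambda>s. ad2 (s * (h \<otimes>\<^sub>C k)) t"])
  show "linear_C (\<lambda>s. ad2 (s * (h \<otimes>\<^sub>C k)) t)" by (rule linear_C_comp[OF linear_C_ad2 linear_C_mult(3)])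
  show "linear_C (\<lambda>s. ladj h (radj k (ad2 s t)))"
    by (rule linear_C_comp[OF linear_C_ladj linear_C_comp[OF linear_C_radj linear_C_ad2]])
qed (simp add: tens_mult ad2_tens ladj_mult radj_mult ladj_radj)

end

locale Q_parameter =
  fixes \<beta> :: complex and ty :: "'n::{finite,linorder} itself"
  assumes param: "\<beta> ^ 4 = (-1) ^ CARD('n)"

sublocale Q_parameter \<subseteq> quasi_triangular_quasi_hopf_algebra "Q_data \<beta> :: 'n Q ribbon_quasi_hopf"
  by (rule quasi_triangular_Q[OF param])

context Q_parameter
begin

lemma beta_nonzero: "\<beta> \<noteq> 0"
  using param by auto

lemma contract_tens_Q: "contract (x \<otimes>\<^sub>C y) a = ant x * a * y"
  using contract_tens[of x y a] by (simp only: Q_data_sel)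

lemma adj_Q: "adj h = contract (cm h)"
  unfolding adj_def Q_data_sel ..

lemma gm_eq_zero_iff: "gm z a b = (False, False) \<longleftrightarrow> b = st z a"
  by (cases a; cases b) (auto simp: gm_def st_def)

text \<open>By invariance only the components of trivial total weight survive, and in these the two
  weights are inverse to each other.\<close>

lemma ladj_P_radj_P:
  assumes "b \<noteq> st (odd CARD('n)) a" shows "ladj (P a) (radj (P b) pairing_el) = 0"
proof -
  let ?c = "gm (odd CARD('n)) a b"
  have e: "eps (P ?c :: 'n Q) = 0"
    using assms by (simp add: P_D1 eps_D1 gm_eq_zero_iff[symmetric] eq_commute)
  have "ladj (P a) (radj (P b) pairing_el) = ad2 (cm (P ?c) * (P a \<otimes>\<^sub>C P b)) pairing_el"
    by (simp add: cm_P D2_PP scaleC_one ad2_tens)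
  also have "\<dots> = ladj (P a) (radj (P b) (ad2 (cm (P ?c)) pairing_el))" by (rule ad2_mult_tens)
  also have "ad2 (cm (P ?c)) pairing_el = 0"
    using pairing_el_invariant[of "P ?c"] by (simp add: Q_data_sel e complex_vector.scale_zero_left)
  finally show ?thesis by (simp add: linear_C_zero[OF linear_C_ladj] linear_C_zero[OF linear_C_radj])
qed

lemma ladj_P: "ladj (P a) pairing_el = radj (ant (P a)) pairing_el"
proof -
  have "ladj (P a) pairing_el = ladj (P a) (radj (\<Sum>b\<in>UNIV. P b) pairing_el)" by (simp add: sum_P radj_one)
  also have "\<dots> = (\<Sum>b\<in>UNIV. if b = st (odd CARD('n)) a then ladj (P a) (radj (P b) pairing_el) else 0)"
    unfolding linear_C_sum[OF linear_C_radj2] linear_C_sum[OF linear_C_ladj] by (intro sum.cong refl) (auto simp: ladj_P_radj_P)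
  finally have 1: "ladj (P a) pairing_el = ladj (P a) (radj (P (st (odd CARD('n)) a)) pairing_el)" by simp
  have "radj (P (st (odd CARD('n)) a)) pairing_el = ladj (\<Sum>b\<in>UNIV. P b) (radj (P (st (odd CARD('n)) a)) pairing_el)" by (simp add: sum_P ladj_one)
  also have "\<dots> = (\<Sum>b\<in>UNIV. if b = a then ladj (P b) (radj (P (st (odd CARD('n)) a)) pairing_el) else 0)"
    unfolding linear_C_sum[OF linear_C_ladj2]
  proof (intro sum.cong refl)
    fix b
    have "st (odd CARD('n)) a = st (odd CARD('n)) b \<Longrightarrow> b = a" by (metis st_st)
    then show "ladj (P b) (radj (P (st (odd CARD('n)) a)) pairing_el) = (if b = a then ladj (P b) (radj (P (st (odd CARD('n)) a)) pairing_el) else 0)"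
      using ladj_P_radj_P[of "st (odd CARD('n)) a" b] by auto
  qed
  finally have 2: "radj (P (st (odd CARD('n)) a)) pairing_el = ladj (P a) (radj (P (st (odd CARD('n)) a)) pairing_el)" by simp
  show ?thesis unfolding ant_P using 1 2 by simp
qed

lemma ladj_D1: "ladj (D1 g) pairing_el = radj (ant (D1 g)) pairing_el"
  by (simp only: D1_def linear_C_simps[OF linear_C_ladj2] linear_C_simps[OF linear_C_radj2] ant_simps ladj_P)

text \<open>Invariance under \<open>f \<otimes> 1 + omega \<otimes> f\<close> expresses the action
  of \<open>f\<close> on the first leg through omega on the first and \<open>f\<close> on the
  second. Moving omega over by \<open>ladj_D1\<close> leaves \<open>- S(omega) f = S(f)\<close> on
  the second leg.\<close>

lemma ladj_F: "ladj (F b i) pairing_el = radj (ant (F b i)) pairing_el"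
proof -
  have a: "ant (F b i) = - (ant (D1 (w b)) * (F b i :: 'n Q))"
  proof -
    have "D1 (u (odd CARD('n)) b) = (- D1 (\<lambda>a. w b (st (odd CARD('n)) (sh a))) :: 'n Q)"
      unfolding D1_minus by (rule D1_cong) (auto simp: wt_defs)
    then show ?thesis by (simp add: ant_F ant_D1 D1_F)
  qed
  have "ad2 (cm (F b i)) pairing_el = 0"
    using pairing_el_invariant[of "F b i"] by (simp add: Q_data_sel eps_F complex_vector.scale_zero_left)
  then have "ladj (F b i) pairing_el + ladj (D1 (w b)) (radj (F b i) pairing_el) = 0"
    by (simp add: cm_F linear_C_add[OF linear_C_ad2] ad2_tens radj_one)
  then have "ladj (F b i) pairing_el = - radj (ant (D1 (w b)) * F b i) pairing_el"
    by (simp add: ladj_radj ladj_D1 radj_mult eq_neg_iff_add_eq_0)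
  then show ?thesis by (simp add: a linear_C_minus[OF linear_C_radj2])
qed

text \<open>The two leg actions commute and the antipode reverses products, so the property passes
  from generators to products.\<close>

lemma ladj_pairing_el: "ladj h pairing_el = radj (ant h) pairing_el"
proof (induction h rule: Q_induct_F)
  case one
  show ?case by (simp add: ant_simps ladj_one radj_one)
next
  case (add x y)
  then show ?case by (simp only: ant_simps linear_C_add[OF linear_C_ladj2] linear_C_add[OF linear_C_radj2])
next
  case (scale c x)
  then show ?case by (simp only: ant_simps linear_C_scale[OF linear_C_ladj2] linear_C_scale[OF linear_C_radj2])
next
  case (D1 g x)
  then show ?case by (simp only: ant_simps ladj_mult radj_mult ladj_D1 ladj_radj)
next
  case (F b i x)
  then show ?case by (simp only: ant_simps ladj_mult radj_mult ladj_F ladj_radj)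
qed

text \<open>The contribution of a term \<open>m \<otimes> n\<close> of the double braiding to the
  pairing element. The second summand stems from the inverse coassociator applied before the
  braidings.\<close>

definition kap :: "'n Q \<Rightarrow> 'n Q \<Rightarrow> 'n Q \<otimes>\<^sub>C 'n Q" where
  "kap m n = m \<otimes>\<^sub>C ant n + (m * e1) \<otimes>\<^sub>C adj (D1 (\<lambda>a. inverse (gam (odd CARD('n)) (\<beta>\<^sup>2) a) - 1)) (ant n)"

lemma bilinear_kap: "bilinear_C kap"
  unfolding kap_def
  by (intro bilinear_CI linear_CI)
    (simp_all add: ant_simps linear_C_simps[OF linear_C_adj(1)] distrib_right scaleC_mult_left tens_add_left tens_add_right
      tens_scaleC_left tens_scaleC_right scaleC_add_right)

lemma Q_coassoc_form:
  "Q_coassoc \<beta> = (1 + e1 \<otimes>\<^sub>C e1 \<otimes>\<^sub>C D1 (\<lambda>a. gam (odd CARD('n)) (\<beta>\<^sup>2) a - 1) :: 'n Q \<otimes>\<^sub>C 'n Q \<otimes>\<^sub>C 'n Q)"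
  "inverse_el (Q_coassoc \<beta>) = (1 + e1 \<otimes>\<^sub>C e1 \<otimes>\<^sub>C D1 (\<lambda>a. inverse (gam (odd CARD('n)) (\<beta>\<^sup>2) a) - 1) :: 'n Q \<otimes>\<^sub>C 'n Q \<otimes>\<^sub>C 'n Q)"
  unfolding Q_coassoc_inverse(2)[OF beta_nonzero] unfolding Q_coassoc_D3 e_D1 one_D3 D_simps
  by (rule D3_cong, simp add: phi_def)+

lemma e1_central: "e1 * x = x * (e1 :: 'n Q)"
proof (rule algebra_hom_intertwine[OF algebra_hom_id algebra_hom_id, unfolded id_apply])
  show "e1 * D1 h = D1 h * (e1 :: 'n Q)" for h by (simp add: e_D1 D1_mult mult.commute)
  show "e1 * F b i = F b i * (e1 :: 'n Q)" for b i by (rule e1_F)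
qed

text \<open>The first two legs of the coassociator consist of the central elements 1 and
  \<open>e1\<close>.\<close>

lemma coassoc_monodromy: "tassoc (M \<otimes>\<^sub>C 1) * Q_coassoc \<beta> = Q_coassoc \<beta> * tassoc (M \<otimes>\<^sub>C (1 :: 'n Q))" for M :: "'n Q \<otimes>\<^sub>C 'n Q"
proof (rule tensor_linear_eq[where f="\<lambda>M. tassoc (M \<otimes>\<^sub>C 1) * Q_coassoc \<beta>"])
  show "linear_C (\<lambda>M. tassoc (M \<otimes>\<^sub>C 1) * (Q_coassoc \<beta> :: 'n Q \<otimes>\<^sub>C 'n Q \<otimes>\<^sub>C 'n Q))"
    "linear_C (\<lambda>M. (Q_coassoc \<beta> :: 'n Q \<otimes>\<^sub>C 'n Q \<otimes>\<^sub>C 'n Q) * tassoc (M \<otimes>\<^sub>C 1))"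
    by (rule linear_C_comp[OF linear_C_mult(3)] linear_C_comp[OF linear_C_mult(2)], rule linear_C_comp[OF linear_C_tassoc linear_C_tens(1)])+
  show "tassoc ((x \<otimes>\<^sub>C y) \<otimes>\<^sub>C 1) * Q_coassoc \<beta> = Q_coassoc \<beta> * tassoc ((x \<otimes>\<^sub>C y) \<otimes>\<^sub>C (1 :: 'n Q))" for x y :: "'n Q"
    unfolding Q_coassoc_form tassoc_tens by (simp add: distrib_left distrib_right tens_mult e1_central[of x] e1_central[of y])
qed

lemma trace2_tunassoc: "trace2 (tunassoc (x \<otimes>\<^sub>C y \<otimes>\<^sub>C Z)) = (ant x * y) \<otimes>\<^sub>C contract Z 1"
  unfolding tunassoc_def tlift3_tens[OF trilinear_C_tunassoc] trace2_tens Q_data_sel by (simp add: contract_tens_Q)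

lemma cocycle4_tens: "cocycle4 (x \<otimes>\<^sub>C y \<otimes>\<^sub>C z) = x \<otimes>\<^sub>C y \<otimes>\<^sub>C cm z"
  unfolding cocycle4_def Q_data_sel tmap_tens[OF linear_C_id(1) linear_C_tmap[OF linear_C_id(1) algebra_homD(1)[OF algebra_hom_cm]]]
    tmap_tens[OF linear_C_id(1) algebra_homD(1)[OF algebra_hom_cm]] id_apply ..

text \<open>The inner coassociators cancel by \<open>coassoc_monodromy\<close>. The non-trivial part
  of the left outer one has the coproduct of \<open>gam - 1\<close> in its last legs; contraction
  turns this into a counit, which is 0 because \<open>gam\<close> is 1 at the trivial
  weight.\<close>

lemma pairing_el_kap: "pairing_el = tlift kap (tflip (Q_R \<beta>) * Q_R \<beta>)"
proof -
  let ?\<Phi> = "Q_coassoc \<beta> :: 'n Q \<otimes>\<^sub>C 'n Q \<otimes>\<^sub>C 'n Q" and ?M = "tflip (Q_R \<beta>) * Q_R \<beta> :: 'n Q \<otimes>\<^sub>C 'n Q"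
  let ?g = "D1 (\<lambda>a. gam (odd CARD('n)) (\<beta>\<^sup>2) a - 1) :: 'n Q" and ?i = "D1 (\<lambda>a. inverse (gam (odd CARD('n)) (\<beta>\<^sup>2) a) - 1) :: 'n Q"
  have i: "inverse_el ?\<Phi> * ?\<Phi> = 1" using invertible_el_inverse[OF Q_coassoc_inverse(1)[OF beta_nonzero]] by blast
  have "(1 \<otimes>\<^sub>C inverse_el ?\<Phi>) * (1 \<otimes>\<^sub>C tassoc (?M \<otimes>\<^sub>C 1)) * (1 \<otimes>\<^sub>C ?\<Phi>) = (1 :: 'n Q) \<otimes>\<^sub>C (inverse_el ?\<Phi> * ?\<Phi> * tassoc (?M \<otimes>\<^sub>C 1))"
    by (simp only: tens_mult mult_1_left mult.assoc coassoc_monodromy)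
  then have d: "dbp_el = cocycle4 ?\<Phi> * (1 \<otimes>\<^sub>C tassoc (?M \<otimes>\<^sub>C 1)) * cocycle4 (inverse_el ?\<Phi>)"
    unfolding dbp_el_def Q_data_sel i by (simp add: mult.assoc)
  have cz: "contract (cm ?g * Z) 1 = 0" for Z
    using contract_comult_left[of ?g Z] by (simp add: Q_data_sel eps_D1 gam_def complex_vector.scale_zero_left)
  have cg: "contract (cm ?g) 1 = 0" using cz[of 1] by simp
  have "trace2 (tunassoc (cocycle4 ?\<Phi> * (1 \<otimes>\<^sub>C tassoc (M \<otimes>\<^sub>C 1)) * cocycle4 (inverse_el ?\<Phi>))) = tlift kap M" for M
  proof (rule tensor_linear_eq[where f="\<lambda>M. trace2 (tunassoc (cocycle4 ?\<Phi> * (1 \<otimes>\<^sub>C tassoc (M \<otimes>\<^sub>C 1)) * cocycle4 (inverse_el ?\<Phi>)))"])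
    show "linear_C (\<lambda>M. trace2 (tunassoc (cocycle4 ?\<Phi> * (1 \<otimes>\<^sub>C tassoc (M \<otimes>\<^sub>C 1)) * cocycle4 (inverse_el ?\<Phi>))))"
      by (rule linear_C_comp[OF linear_C_trace2 linear_C_comp[OF algebra_homD(1)[OF algebra_hom_tunassoc]
          linear_C_comp[OF linear_C_mult(1) linear_C_comp[OF linear_C_tens(2) linear_C_comp[OF linear_C_tassoc linear_C_tens(1)]]]]])
    show "linear_C (tlift kap)" by (rule linear_C_tlift[OF bilinear_kap])
    fix m n :: "'n Q"
    have c: "cocycle4 (1 + e1 \<otimes>\<^sub>C e1 \<otimes>\<^sub>C z) = 1 \<otimes>\<^sub>C 1 \<otimes>\<^sub>C 1 + e1 \<otimes>\<^sub>C e1 \<otimes>\<^sub>C cm z" for z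
      by (simp add: linear_C_add[OF algebra_homD(1)[OF algebra_hom_cocycle4]] algebra_homD(2)[OF algebra_hom_cocycle4] cocycle4_tens tens_one)
    have e: "ant e1 = (e1 :: 'n Q)" unfolding e_D1 ant_D1 by (rule D1_cong) (simp add: st_def)
    have ee: "e1 * e1 = (e1 :: 'n Q)" unfolding e_D1 D1_mult by (rule D1_cong) simp
    have t: "e1 * (m * e1) = m * e1"
      unfolding mult.assoc[symmetric] e1_central[of m] unfolding mult.assoc ee ..
    have n1: "contract (n \<otimes>\<^sub>C 1) 1 = ant n" by (simp add: contract_tens_Q)
    show "trace2 (tunassoc (cocycle4 ?\<Phi> * (1 \<otimes>\<^sub>C tassoc ((m \<otimes>\<^sub>C n) \<otimes>\<^sub>C 1)) * cocycle4 (inverse_el ?\<Phi>))) = tlift kap (m \<otimes>\<^sub>C n)"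
      unfolding Q_coassoc_form(2) unfolding tlift_tens[OF bilinear_kap] kap_def tassoc_tens Q_coassoc_form(1) c distrib_left distrib_right tens_mult
        linear_C_add[OF algebra_homD(1)[OF algebra_hom_tunassoc]] linear_C_add[OF linear_C_trace2] trace2_tunassoc
      by (simp add: mult.assoc cg linear_C_zero[OF linear_C_contract2] tens_zero contract_mult n1 adj_Q e t ant_simps)
  qed
  then show ?thesis unfolding pairing_el_def d .
qed

lemma shp_eq_iff: "shp p a = b \<longleftrightarrow> a = shp p b"
  by (metis shp_simps(1))

text \<open>An element of parity \<open>p\<close> couples each weight to its inverse shifted by
  \<open>p\<close>, and the product of the two is always \<open>(False, p)\<close>.\<close>

lemma adj_D1_homogeneous:
  assumes "\<And>h. D1 h * y = y * D1 (\<lambda>a. h (shp p a))"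
  shows "adj (D1 g) y = g (False, p) *\<^sub>C (y :: 'n Q)"
proof -
  have "adj (D1 g) y = (\<Sum>a\<in>UNIV. \<Sum>b\<in>UNIV. g (gm (odd CARD('n)) a b) *\<^sub>C (P (st (odd CARD('n)) a) * y * P b))"
    by (simp add: adj_Q cm_D1 D2_expand linear_C_simps[OF linear_C_contract] contract_tens_Q ant_P)
  also have "\<dots> = (\<Sum>a\<in>UNIV. \<Sum>b\<in>UNIV. if b = shp p (st (odd CARD('n)) a) then g (False, p) *\<^sub>C (y * P b) else 0)"
  proof (intro sum.cong refl)
    fix a b
    have "P (st (odd CARD('n)) a) * y = y * P (shp p (st (odd CARD('n)) a))"
      unfolding P_D1 assms by (intro arg_cong[of _ _ "\<lambda>z. y * z"] D1_cong) (simp add: shp_eq_iff)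
    moreover have "gm (odd CARD('n)) a (shp p (st (odd CARD('n)) a)) = (False, p)" by (cases a; cases p) (auto simp: gm_def st_def shp_def sh_def)
    ultimately show "g (gm (odd CARD('n)) a b) *\<^sub>C (P (st (odd CARD('n)) a) * y * P b) = (if b = shp p (st (odd CARD('n)) a) then g (False, p) *\<^sub>C (y * P b) else 0)"
      by (auto simp: mult.assoc P_P complex_vector.scale_zero_right)
  qed
  also have "\<dots> = (\<Sum>a\<in>UNIV. g (False, p) *\<^sub>C (y * P (shp p (st (odd CARD('n)) a))))" by simp
  also have "\<dots> = (\<Sum>a\<in>UNIV. g (False, p) *\<^sub>C (y * P a))"
    by (rule sum.reindex_bij_betw[where h="\<lambda>a. shp p (st (odd CARD('n)) a)"]) (rule bij_betwI[of _ _ _ "\<lambda>a. st (odd CARD('n)) (shp p a)"], auto)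
  also have "\<dots> = g (False, p) *\<^sub>C y"
    by (simp add: complex_vector.scale_sum_right[symmetric] sum_distrib_left[symmetric] sum_P)
  finally show ?thesis .
qed

section \<open>Non-degeneracy in the PBW basis\<close>

definition xs :: "'n list" where
  "xs = sorted_list_of_set UNIV"

lemma xs_enum: "distinct xs" "set xs = UNIV" "length xs = CARD('n)"
  by (simp_all add: xs_def)

definition kfac :: "(bool \<times> bool) list \<Rightarrow> wt \<Rightarrow> complex" where
  "kfac s a = (if fst a then inverse (gam (odd CARD('n)) (\<beta>\<^sup>2) (False, par s)) else 1)"

definition dual_pbw :: "(bool \<times> bool) list \<Rightarrow> wt \<Rightarrow> 'n Q" where
  "dual_pbw s a = (\<Sum>b\<in>UNIV. (kfac s a * mono_coeff \<beta> s a b) *\<^sub>C ant (Lw False xs s * P b))"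

text \<open>The image of a monomial under the antipode is homogeneous, so the adjoint action in
  \<open>kap\<close> is a scalar and the associator mixes no monomials.\<close>

lemma kap_pbw:
  assumes l: "length s = length xs"
  shows "kap (Lw True xs s * P a) (Lw False xs s * P b) = kfac s a *\<^sub>C ((Lw True xs s * P a) \<otimes>\<^sub>C ant (Lw False xs s * P b))"
proof -
  let ?z = "Lw False xs s * P b" and ?p = "par s"
  have z: "D1 h * ?z = ?z * D1 (\<lambda>a. h (shp ?p a))" for h
    using D1_Lw_P[OF l, of h False b] D1_mult
    by (simp add: mult.assoc) (simp add: P_D1 D1_mult D1_scale scaleC_mult_right[symmetric], intro arg_cong[of _ _ "\<lambda>z. _ * z"] D1_cong, auto)
  have "D1 h * ant ?z = ant ?z * D1 (\<lambda>a. h (shp ?p a))" for h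
  proof -
    let ?h = "\<lambda>a. h (st (odd CARD('n)) (shp ?p a))"
    have "ant (?z * D1 (\<lambda>a. ?h (shp ?p a))) = ant (D1 ?h * ?z)" by (simp only: z)
    moreover have "(\<lambda>a. ?h (st (odd CARD('n)) a)) = (\<lambda>a. h (shp ?p a))" by (rule ext, rule arg_cong[of _ _ h]) (auto simp: st_def shp_def sh_def)
    moreover have "(\<lambda>a. ?h (shp ?p (st (odd CARD('n)) a))) = h" by (rule ext) simp
    ultimately show ?thesis by (simp only: ant_simps(3)[of ?z] ant_simps(3)[of "D1 ?h"] ant_D1)
  qed
  note adj_D1_homogeneous[OF this]
  moreover have "Lw True xs s * P a * e1 = (if fst a then 1 else 0) *\<^sub>C (Lw True xs s * P a)"
    by (simp add: mult.assoc e1_central[of "P a", symmetric] e1_P scaleC_one complex_vector.scale_zero_left)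
  ultimately show ?thesis
    unfolding kap_def kfac_def
    by (simp add: tens_scaleC_left tens_scaleC_right tens_diff complex_vector.scale_left_diff_distrib scaleC_one
        complex_vector.scale_zero_left tens_zero)
qed

lemma pairing_el_pbw:
  "pairing_el = (\<Sum>s\<in>lists_of CARD('n). \<Sum>a\<in>UNIV. (Lw True xs s * P a) \<otimes>\<^sub>C dual_pbw s a)"
  unfolding pairing_el_kap monodromy_expand xs_def[symmetric] linear_C_simps[OF linear_C_tlift[OF bilinear_kap]]
proof (intro sum.cong refl)
  fix s a assume "s \<in> lists_of CARD('n)"
  then have l: "length s = length xs" by (simp add: lists_of_def xs_enum)
  show "(\<Sum>b\<in>UNIV. mono_coeff \<beta> s a b *\<^sub>C tlift kap ((Lw True xs s * P a) \<otimes>\<^sub>C (Lw False xs s * P b)))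
    = (Lw True xs s * P a) \<otimes>\<^sub>C dual_pbw s a"
    unfolding tlift_tens[OF bilinear_kap] kap_pbw[OF l] dual_pbw_def
    by (simp add: tens_sum tens_scaleC_right scaleC_scaleC mult.commute)
qed

text \<open>For fixed \<open>s\<close> the passage to \<open>dual_pbw s\<close> is a matrix on the
  four weights: the weight part of the double braiding at shifted arguments, multiplied by
  invertible diagonal matrices on both sides.\<close>

lemma ant_pbw_span:
  assumes "length s = length xs"
  shows "ant (Lw False xs s * P b) \<in> complex_vector.span (range (dual_pbw s))"
proof -
  let ?S = "shp (par s)" and ?A = "\<lambda>b. ant (Lw False xs s * P b)"
  \<comment> \<open>The row \<open>b\<close> of the inverse matrix: \<open>rho_inv\<close> at the
    shifted weights, divided by the diagonal factors.\<close>
  let ?c = "\<lambda>a. rho_inv \<beta> (?S b) (?S a) / (kfac s a * px_list s a * py_list s b)"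
  have k: "kfac s a \<noteq> 0" for a using beta_nonzero by (simp add: kfac_def gam_def)
  have "(\<Sum>a\<in>UNIV. ?c a *\<^sub>C dual_pbw s a) = (\<Sum>b'\<in>UNIV. (\<Sum>a\<in>UNIV. ?c a * (kfac s a * mono_coeff \<beta> s a b')) *\<^sub>C ?A b')"
    by (simp add: dual_pbw_def complex_vector.scale_sum_right complex_vector.scale_sum_left scaleC_scaleC) (rule sum.swap)
  also have "\<dots> = (\<Sum>b'\<in>UNIV. (if b' = b then 1 else 0) *\<^sub>C ?A b')"
  proof (intro sum.cong refl arg_cong[of _ _ "\<lambda>c. c *\<^sub>C _"])
    fix b'
    let ?r = "\<lambda>a. rho_inv \<beta> (?S b) a * (rho \<beta> (?S b') a * rho \<beta> a (?S b'))"
    have "(\<Sum>a\<in>UNIV. ?c a * (kfac s a * mono_coeff \<beta> s a b')) = (\<Sum>a\<in>UNIV. ?r (?S a) * (py_list s b' / py_list s b))"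
      by (intro sum.cong refl) (simp add: mono_coeff_def k px_nonzero)
    also have "\<dots> = (\<Sum>a\<in>UNIV. ?r (?S a)) * (py_list s b' / py_list s b)" by (rule sum_distrib_right[symmetric])
    also have "(\<Sum>a\<in>UNIV. ?r (?S a)) = (\<Sum>a\<in>UNIV. ?r a)"
      by (rule sum.reindex_bij_betw[where g="?r" and h="?S"]) (rule bij_betwI[of _ _ _ ?S], auto)
    also have "\<dots> = (if ?S b = ?S b' then 1 else 0)" by (rule sum_rho_inv[OF beta_nonzero])
    also have "?S b = ?S b' \<longleftrightarrow> b' = b" by (auto simp: shp_def split: if_splits)
    finally show "(\<Sum>a\<in>UNIV. ?c a * (kfac s a * mono_coeff \<beta> s a b')) = (if b' = b then 1 else 0)"
      by (simp add: px_nonzero split: if_splits)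
  qed
  also have "\<dots> = ?A b" by (simp add: sum_delta_scaleC)
  finally have "?A b = (\<Sum>a\<in>UNIV. ?c a *\<^sub>C dual_pbw s a)" ..
  then show ?thesis
    by (simp only:) (intro complex_vector.span_sum complex_vector.span_scale complex_vector.span_base, simp)
qed

text \<open>The antipode is bijective and carries the spanning monomials of the order
  \<open>b = False\<close> to a spanning family, whose members \<open>ant_pbw_span\<close> recovers
  from the elements \<open>dual_pbw\<close>.\<close>

lemma dual_pbw_spans: "x \<in> complex_vector.span ((\<lambda>(s, a). dual_pbw s a) ` (lists_of CARD('n) \<times> UNIV))"
proof -
  let ?W = "(\<lambda>(s, a). dual_pbw s a) ` (lists_of CARD('n) \<times> UNIV)"
  obtain z where z: "x = ant z" using bij_ant by (metis bij_pointE)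
  have "z \<in> pbw_span False xs" by (rule pbw_spans[OF xs_enum(1,2)])
  then show ?thesis
    unfolding z pbw_span_def
  proof (rule span_image_linear[OF ant_simps(1)])
    fix y assume "y \<in> {Lw False xs s * P a | s a. length s = length xs}"
    then obtain s a where y: "y = Lw False xs s * P a" "length s = length xs" by blast
    have "range (dual_pbw s) \<subseteq> ?W" using y(2) by (auto simp: lists_of_def xs_enum)
    then show "ant y \<in> complex_vector.span ?W"
      using complex_vector.span_mono ant_pbw_span[OF y(2), of a] unfolding y(1) by blast
  qed
qed

end

lemma span_indexed:
  assumes "x \<in> complex_vector.span (f ` {..<d::nat})"
  shows "\<exists>c. x = (\<Sum>i<d. c i *\<^sub>C f i)"
  using assms
proof (induction rule: complex_vector.span_induct_alt)
  case base
  show ?case by (rule exI[of _ "\<lambda>_. 0"]) (simp add: complex_vector.scale_zero_left)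
next
  case (step k x y)
  then obtain j c where j: "j < d" "x = f j" and c: "y = (\<Sum>i<d. c i *\<^sub>C f i)" by auto
  have "(\<Sum>i<d. ((if i = j then k else 0) + c i) *\<^sub>C f i) = k *\<^sub>C x + y"
    using j by (simp add: scaleC_add_left sum.distrib c if_distrib[of "\<lambda>c. c *\<^sub>C _"] complex_vector.scale_zero_left cong: if_cong)
  then show ?case by (intro exI[of _ "\<lambda>i. (if i = j then k else 0) + c i"]) simp
qed

lemma (in Q_parameter) factorisable_Q: "factorisable (Q_data \<beta> :: 'n Q ribbon_quasi_hopf)"
proof -
  let ?J = "lists_of CARD('n) \<times> (UNIV :: wt set)"
  \<comment> \<open>\<open>h\<close> numbers the labels of the PBW basis, since
    \<open>factorisability_data\<close> indexes its basis by natural numbers.\<close>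
  obtain h where h: "bij_betw h {0..<card ?J} ?J"
    using ex_bij_betw_nat_finite[of ?J] finite_lists_of by auto
  define d where "d = card ?J"
  have h: "bij_betw h {..<d} ?J" using h by (simp add: d_def atLeast0LessThan)
  obtain cf where cf: "\<And>s a. linear_C (cf s a :: 'n Q \<Rightarrow> complex)"
    "\<And>s a s' a'. length s = length xs \<Longrightarrow> length s' = length xs \<Longrightarrow>
      cf s a (Lw True xs s' * P a') = (if s = s' \<and> a = a' then 1 else 0)"
    using pbw_coordinates[OF xs_enum(1)] by blast
  define bs where "bs i = Lw True xs (fst (h i)) * P (snd (h i))" for i
  define ds where "ds i = dual_pbw (fst (h i)) (snd (h i))" for i
  define co where "co i = cf (fst (h i)) (snd (h i))" for i
  have hJ: "length (fst (h i)) = length xs" if "i < d" for i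
    using bspec[OF bij_betwE[OF h], of i] that by (simp add: mem_Times_iff lists_of_def xs_enum)
  have cl: "linear_C (co i)" for i unfolding co_def by (rule cf(1))
  have co_bs: "co i (bs j) = (if i = j then 1 else 0)" if "i < d" "j < d" for i j
    using cf(2)[OF hJ hJ] that bij_betw_imp_inj_on[OF h] by (auto simp: co_def bs_def prod_eq_iff inj_on_def)
  have expand: "a = (\<Sum>i<d. co i a *\<^sub>C bs i)" for a
  proof -
    have "{Lw True xs s * P a | s a. length s = length xs} \<subseteq> bs ` {..<d}"
    proof clarify
      fix s :: "(bool \<times> bool) list" and a1 a2 :: bool assume "length s = length xs"
      then have "(s, (a1, a2)) \<in> h ` {..<d}" using bij_betw_imp_surj_on[OF h] by (simp add: lists_of_def xs_enum)
      then obtain i where "(s, (a1, a2)) = h i" "i \<in> {..<d}" by (rule imageE)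
      then show "Lw True xs s * P (a1, a2) \<in> bs ` {..<d}" by (intro image_eqI[of _ _ i]) (simp_all add: bs_def flip: \<open>(s, (a1, a2)) = h i\<close>)
    qed
    then have "a \<in> complex_vector.span (bs ` {..<d})"
      using pbw_spans[OF xs_enum(1,2), of a True] complex_vector.span_mono unfolding pbw_span_def by blast
    then obtain c where c: "a = (\<Sum>i<d. c i *\<^sub>C bs i)" using span_indexed by blast
    have "co j a = c j" if "j < d" for j
    proof -
      have "co j a = (\<Sum>i<d. if i = j then c i else 0)"
        unfolding c linear_C_sum[OF cl] linear_C_scale[OF cl] using that
        by (intro sum.cong refl) (simp add: co_bs scaleC_complex_def)
      then show ?thesis using that by simp
    qed
    then show ?thesis using c by simp
  qed
  interpret factorisability_data "Q_data \<beta> :: 'n Q ribbon_quasi_hopf" d bs co ds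
  proof (unfold_locales, unfold Q_data_sel)
    show "1 = (1 :: 'n Q)" ..
    show "linear_C (co i)" for i by (rule cl)
    show "co i (bs j) = (if i = j then 1 else 0)" if "i < d" "j < d" for i j by (rule co_bs[OF that])
    show "a = (\<Sum>i<d. co i a *\<^sub>C bs i)" for a by (rule expand)
    show "tmap (adj h) id pairing_el = tmap id (adj (ant h)) pairing_el" for h
      using ladj_pairing_el[of h] unfolding ladj_def radj_def .
    show "pairing_el = (\<Sum>i<d. bs i \<otimes>\<^sub>C ds i)"
      unfolding pairing_el_pbw bs_def ds_def sum.cartesian_product split_def
      by (rule sum.reindex_bij_betw[OF h, symmetric])
    fix a
    have "a \<in> complex_vector.span ((\<lambda>(s, a). dual_pbw s a) ` ?J)" by (rule dual_pbw_spans)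
    also have "(\<lambda>(s, a). dual_pbw s a) ` ?J = ds ` {..<d}"
      unfolding bij_betw_imp_surj_on[OF h, symmetric] ds_def by (auto simp: image_image split_def)
    finally show "\<exists>c. a = (\<Sum>i<d. c i *\<^sub>C ds i)" by (rule span_indexed)
  qed
  show ?thesis by (rule factorisable_H)
qed

theorem corollary3p8:
  fixes N :: nat and \<beta> :: complex
  assumes "CARD('n::{finite,linorder}) = N"
    and "N \<ge> 1"
    and "\<beta> ^ 4 = (-1) ^ N"
  shows "ribbon_quasi_hopf_algebra (Q_data \<beta> :: 'n Q ribbon_quasi_hopf)
       \<and> factorisable (Q_data \<beta> :: 'n Q ribbon_quasi_hopf)"
proof -
  have "\<beta> ^ 4 = (-1) ^ CARD('n)" using assms by simp
  then show ?thesis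
    using ribbon_Q Q_parameter.factorisable_Q[of \<beta>, OF Q_parameter.intro] by blast
qed

end
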